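(* Let $\mathcal B$ be a category. The forgetful 2-functors $$U\colon \mathit{BI\text{-}IND}(\mathcal B)\to {}_{\mathrm{left}}\mathit{OPIND}(\mathcal B)\qquad\text{and}\qquad V\colon \mathit{BI\text{-}IND}(\mathcal B)\to {}_{\mathrm{right}}\mathit{IND}(\mathcal B)$$ are 2-equivalences. The Grothendieck construction $\mathcal G$ and the Grothendieck op-construction $\mathcal G_{op}$ restrict to 2-equivalences $$\mathcal G\colon {}_{\mathrm{right}}\mathit{IND}(\mathcal B)\xrightarrow{\sim}\mathit{BIFIB}(\mathcal B),\qquad \mathcal G_{op}\colon {}_{\mathrm{left}}\mathit{OPIND}(\mathcal B)\xrightarrow{\sim}\mathit{BIFIB}(\mathcal B),$$ and there is a 2-natural isomorphism $\mathcal G\circ V\cong \mathcal G_{op}\circ U$ of 2-functors $\mathit{BI\text{-}IND}(\mathcal B)\to\mathit{BIFIB}(\mathcal B)$.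
   Context: Size conventions: $\mathit{CAT}$ is the 2-category of possibly large categories; all 2-categories below live in a set theory where such collections make sense, and choice (including choice of cleavages) is assumed available. **Fibrations.** A bifibration over $\mathcal B$ is a functor $\mathcal E\to\mathcal B$ that is both a Grothendieck fibration and a Grothendieck opfibration. $\mathit{BIFIB}(\mathcal B)$ is the 2-category of bifibrations over $\mathcal B$, all functors over $\mathcal B$ (commuting strictly with the projections; no Cartesianness required) and natural transformations over $\mathcal B$ (all components vertical). **Indexed categories.** $\mathit{IND}(\mathcal B)$ is the 2-category of pseudo-functors $\Phi\colon\mathcal B^{op}\to\mathit{CAT}$ (write $f^*=\Phi(f)$, with structure isomorphisms $\gamma_{f,g}\colon f^*g^*\Rightarrow (g f)^*$, $\delta_A\colon \mathrm{Id}\Rightarrow 1_A^*$), oplax natural transformations (components $\tau_A\colon\Phi(A)\to\Psi(A)$, 2-cells $\tau_A\circ\Phi(f)\Rightarrow\Psi(f)\circ\tau_B$ for $f\colon A\to B$) and modifications. $\mathit{OPIND}(\mathcal B)$ is the 2-category of pseudo-functors $\mathcal B\to\mathit{CAT}$ (write $f_*$ for the image of $f$), lax natural transformations (2-cells $\Psi(f)\circ\tau_A\Rightarrow\tau_B\circ\Phi(f)$) and modifications. ${}_{\mathrm{right}}\mathit{IND}(\mathcal B)$ is the full sub-2-category of $\mathit{IND}(\mathcal B)$ on those $\Phi$ all of whose functors $f^*$ are right adjoints; ${}_{\mathrm{left}}\mathit{OPIND}(\mathcal B)$ is the full sub-2-category of $\mathit{OPIND}(\mathcal B)$ on those all of whose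 functors $f_*$ are left adjoints. **Grothendieck (op-)construction.** $\mathcal G(\Phi)$ is the projection to $\mathcal B$ of the category with objects pairs $(B,E)$, $B\in\mathcal B$, $E\in\Phi(B)$, and arrows $(f,h)\colon(A,D)\to(B,E)$ with $f\colon A\to B$ and $h\colon D\to f^*E$ in $\Phi(A)$, composition and identities being defined with $\gamma$ and $\delta$ in the usual way. $\mathcal G_{op}(\Phi)$ is analogous with $h\colon f_*D\to E$ in $\Phi(B)$. Both extend in the usual way to 2-functors into fibrations, resp. opfibrations, over $\mathcal B$. **The double category $\mathfrak{ADJ}$.** Objects: categories. Vertical arrows: functors. Horizontal arrows $\mathcal A\to\mathcal B$: adjunctions $F\dashv G$ with left adjoint $F\colon\mathcal A\to\mathcal B$. Cells with top $F\dashv G\colon\mathcal A\to\mathcal B$, bottom $F'\dashv G'\colon\mathcal A'\to\mathcal B'$, left $H\colon\mathcal A\to\mathcal A'$ and right $K\colon\mathcal B\to\mathcal B'$: mate pairs $(\xi,\zeta)$, i.e. natural transformations $\xi\colon F'H\Rightarrow KF$, $\zeta\colon HG\Rightarrow G'K$ such that for every $f\colon F(A)\to B$ with transpose $g\colon A\to G(B)$, the transpose under $F'\dashv G'$ of $K(f)\circ\xi_A$ is $\zeta_B\circ H(g)$. Vertical and horizontal compositions of cells are componentwise pasting in $\mathit{CAT}$. **Double functors.** View $\mathcal B$ as a 2-category with only identity 2-cells; $\mathfrak H\mathcal B$ is the double category with the objects of $\mathcal B$, horizontal arrows the arrows of $\mathcal B$, only identity vertical arrows, and only identity cells. A lax double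 functor $\Omega\colon\mathfrak A\to\mathfrak D$ strictly preserves the vertical structure and preserves horizontal composition and identities up to given comparison cells with identity vertical sides, $\delta_A$ (from $1^h_{\Omega A}$ on top to $\Omega(1^h_A)$ at the bottom) and $\gamma_{f,g}$ (from $\Omega g\circ\Omega f$ on top to $\Omega(g\circ f)$ at the bottom), subject to the usual naturality and coherence axioms; it is a pseudo double functor if these cells are invertible for vertical composition. A vertical transformation $\tau\colon\Omega\Rightarrow\Omega'$ consists of a vertical arrow $\tau_A\colon\Omega A\to\Omega'A$ for each object $A$ and, for each horizontal $f\colon A\to B$, a cell $\tau_f$ with top $\Omega f$, bottom $\Omega' f$, left $\tau_A$, right $\tau_B$, subject to the usual naturality axioms and coherence with $\delta$ and $\gamma$. A modification $\Xi\colon\sigma\Rrightarrow\tau$ consists of a cell $\Xi_A$ for each object $A$, with left $\sigma_A$, right $\tau_A$ and identity horizontal arrows as top and bottom, such that for each horizontal $f\colon A\to B$ the horizontal composite of $\Xi_A$ followed by $\tau_f$ equals that of $\sigma_f$ followed by $\Xi_B$, and the analogous compatibility holds for vertical arrows. $\mathit{BI\text{-}IND}(\mathcal B)$, the 2-category of bi-indexed categories over $\mathcal B$, is the 2-category of pseudo double functors $\mathfrak H\mathcal B\to\mathfrak{ADJ}$, vertical transformations and modifications. Such an $\Omega$ gives for each $f\colon A\to B$ an adjunction $\Omega(f)_*\dashv\Omega(f)^*$ and structure cells $\delta_A=(\delta_{A*},\delta_A^* )$, $\gamma_{f,g}=(\gamma_{f,g*},\gamma_{f,g}^* )$. **$U$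 and $V$.** $U(\Omega)\colon\mathcal B\to\mathit{CAT}$ is the pseudo-functor $A\mapsto\Omega(A)$, $f\mapsto\Omega(f)_*$ with structure isomorphisms $\delta_{A*}^{-1}$, $\gamma_{f,g*}^{-1}$; $U(\tau)$ has components $\tau_A$ and 2-cells the left-adjoint members $(\tau_f)_*$ of the mate pairs $\tau_f$; $U$ sends a modification $\Xi$ to its components (the two members of each $\Xi_A$ are equal). $V$ is defined similarly by selecting the right adjoints $\Omega(f)^*$, the structure isomorphisms $\delta_A^*,\gamma_{f,g}^*$ and the right-adjoint members of mate pairs. *)

theory Defs
  imports Main "HOL-Library.FuncSet"
begin

section \<open>Categories, functors, natural transformations\<close>

text \<open>
  Categories have explicit carriers; the operations of a category are unconstrained outside the
  carriers. Functors and natural transformations, in contrast, carry their source and target and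
  are extensional functions (undefined outside the carriers), so that equality in HOL is the
  intended equality of 1-cells and 2-cells. The same convention is used below for all other
  1-cells and 2-cells.
\<close>

record ('o, 'm) cat =
  Obj :: "'o set"
  Arr :: "'m set"
  Dom :: "'m \<Rightarrow> 'o"
  Cod :: "'m \<Rightarrow> 'o"
  Id :: "'o \<Rightarrow> 'm"
  Comp :: "'m \<Rightarrow> 'm \<Rightarrow> 'm"  \<comment> \<open>\<open>Comp C g f\<close> is \<open>g\<close> after \<open>f\<close>\<close>

definition hom :: "('o, 'm) cat \<Rightarrow> 'o \<Rightarrow> 'o \<Rightarrow> 'm set" where
  "hom C a b = {f \<in> Arr C. Dom C f = a \<and> Cod C f = b}"

definition category :: "('o, 'm) cat \<Rightarrow> bool" where
  "category C \<longleftrightarrow>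
     (\<forall>f\<in>Arr C. Dom C f \<in> Obj C \<and> Cod C f \<in> Obj C) \<and>
     (\<forall>a\<in>Obj C. Id C a \<in> hom C a a) \<and>
     (\<forall>f\<in>Arr C. \<forall>g\<in>Arr C. Dom C g = Cod C f \<longrightarrow> Comp C g f \<in> hom C (Dom C f) (Cod C g)) \<and>
     (\<forall>f\<in>Arr C. Comp C f (Id C (Dom C f)) = f \<and> Comp C (Id C (Cod C f)) f = f) \<and>
     (\<forall>f\<in>Arr C. \<forall>g\<in>Arr C. \<forall>h\<in>Arr C. Dom C g = Cod C f \<longrightarrow> Dom C h = Cod C g \<longrightarrow>
        Comp C h (Comp C g f) = Comp C (Comp C h g) f)"

definition op_cat :: "('o, 'm) cat \<Rightarrow> ('o, 'm) cat" where
  "op_cat C = \<lparr>Obj = Obj C, Arr = Arr C, Dom = Cod C, Cod = Dom C, Id = Id C,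
           Comp = (\<lambda>g f. Comp C f g)\<rparr>"

text \<open>The discrete category on a set; its only arrow at \<open>a\<close> is \<open>a\<close> itself.\<close>

definition discrete :: "'o set \<Rightarrow> ('o, 'o) cat" where
  "discrete S = \<lparr>Obj = S, Arr = S, Dom = (\<lambda>a. a), Cod = (\<lambda>a. a), Id = (\<lambda>a. a),
                 Comp = (\<lambda>g f. f)\<rparr>"

definition inverse_arrows :: "('o, 'm) cat \<Rightarrow> 'm \<Rightarrow> 'm \<Rightarrow> bool" where
  "inverse_arrows C f g \<longleftrightarrow> f \<in> Arr C \<and> g \<in> hom C (Cod C f) (Dom C f) \<and>
     Comp C g f = Id C (Dom C f) \<and> Comp C f g = Id C (Cod C f)"

definition iso_arrow :: "('o, 'm) cat \<Rightarrow> 'm \<Rightarrow> bool" where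
  "iso_arrow C f \<longleftrightarrow> (\<exists>g. inverse_arrows C f g)"

definition inv_arrow :: "('o, 'm) cat \<Rightarrow> 'm \<Rightarrow> 'm" where
  "inv_arrow C f = (THE g. inverse_arrows C f g)"

definition preserves_cat ::
  "('o, 'm) cat \<Rightarrow> ('p, 'n) cat \<Rightarrow> ('o \<Rightarrow> 'p) \<Rightarrow> ('m \<Rightarrow> 'n) \<Rightarrow> bool" where
  "preserves_cat C D fo fm \<longleftrightarrow>
     (\<forall>a\<in>Obj C. fo a \<in> Obj D) \<and>
     (\<forall>f\<in>Arr C. fm f \<in> hom D (fo (Dom C f)) (fo (Cod C f))) \<and>
     (\<forall>a\<in>Obj C. fm (Id C a) = Id D (fo a)) \<and>
     (\<forall>f\<in>Arr C. \<forall>g\<in>Arr C. Dom C g = Cod C f \<longrightarrow> fm (Comp C g f) = Comp D (fm g) (fm f))"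

record ('o, 'm, 'p, 'n) ftor =
  FDom :: "('o, 'm) cat"
  FCod :: "('p, 'n) cat"
  FO :: "'o \<Rightarrow> 'p"
  FM :: "'m \<Rightarrow> 'n"

definition is_functor :: "('o, 'm, 'p, 'n) ftor \<Rightarrow> bool" where
  "is_functor F \<longleftrightarrow> category (FDom F) \<and> category (FCod F) \<and>
     FO F \<in> extensional (Obj (FDom F)) \<and> FM F \<in> extensional (Arr (FDom F)) \<and>
     preserves_cat (FDom F) (FCod F) (FO F) (FM F)"

definition ftid :: "('o, 'm) cat \<Rightarrow> ('o, 'm, 'o, 'm) ftor" where
  "ftid C = \<lparr>FDom = C, FCod = C, FO = (\<lambda>a\<in>Obj C. a), FM = (\<lambda>f\<in>Arr C. f)\<rparr>"

definition ftcomp ::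
  "('p, 'n, 'q, 'k) ftor \<Rightarrow> ('o, 'm, 'p, 'n) ftor \<Rightarrow> ('o, 'm, 'q, 'k) ftor" where
  "ftcomp G F = \<lparr>FDom = FDom F, FCod = FCod G,
     FO = compose (Obj (FDom F)) (FO G) (FO F), FM = compose (Arr (FDom F)) (FM G) (FM F)\<rparr>"

definition op_ftor :: "('o, 'm, 'p, 'n) ftor \<Rightarrow> ('o, 'm, 'p, 'n) ftor" where
  "op_ftor F = \<lparr>FDom = op_cat (FDom F), FCod = op_cat (FCod F), FO = FO F, FM = FM F\<rparr>"

record ('o, 'm, 'p, 'n) nt =
  NSrc :: "('o, 'm, 'p, 'n) ftor"
  NTgt :: "('o, 'm, 'p, 'n) ftor"
  NMap :: "'o \<Rightarrow> 'n"

definition is_nt :: "('o, 'm, 'p, 'n) nt \<Rightarrow> bool" where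
  "is_nt \<alpha> \<longleftrightarrow> is_functor (NSrc \<alpha>) \<and> is_functor (NTgt \<alpha>) \<and>
     FDom (NSrc \<alpha>) = FDom (NTgt \<alpha>) \<and> FCod (NSrc \<alpha>) = FCod (NTgt \<alpha>) \<and>
     NMap \<alpha> \<in> extensional (Obj (FDom (NSrc \<alpha>))) \<and>
     (\<forall>a\<in>Obj (FDom (NSrc \<alpha>)). NMap \<alpha> a \<in> hom (FCod (NSrc \<alpha>)) (FO (NSrc \<alpha>) a) (FO (NTgt \<alpha>) a)) \<and>
     (\<forall>f\<in>Arr (FDom (NSrc \<alpha>)).
        Comp (FCod (NSrc \<alpha>)) (NMap \<alpha> (Cod (FDom (NSrc \<alpha>)) f)) (FM (NSrc \<alpha>) f) =
        Comp (FCod (NSrc \<alpha>)) (FM (NTgt \<alpha>) f) (NMap \<alpha> (Dom (FDom (NSrc \<alpha>)) f)))"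

definition is_nt_between ::
  "('o, 'm, 'p, 'n) ftor \<Rightarrow> ('o, 'm, 'p, 'n) ftor \<Rightarrow> ('o, 'm, 'p, 'n) nt \<Rightarrow> bool" where
  "is_nt_between F G \<alpha> \<longleftrightarrow> is_nt \<alpha> \<and> NSrc \<alpha> = F \<and> NTgt \<alpha> = G"

definition is_nat_iso_between ::
  "('o, 'm, 'p, 'n) ftor \<Rightarrow> ('o, 'm, 'p, 'n) ftor \<Rightarrow> ('o, 'm, 'p, 'n) nt \<Rightarrow> bool" where
  "is_nat_iso_between F G \<alpha> \<longleftrightarrow> is_nt_between F G \<alpha> \<and>
     (\<forall>a\<in>Obj (FDom F). iso_arrow (FCod F) (NMap \<alpha> a))"

definition nid :: "('o, 'm, 'p, 'n) ftor \<Rightarrow> ('o, 'm, 'p, 'n) nt" where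
  "nid F = \<lparr>NSrc = F, NTgt = F, NMap = (\<lambda>a\<in>Obj (FDom F). Id (FCod F) (FO F a))\<rparr>"

definition ncomp :: "('o, 'm, 'p, 'n) nt \<Rightarrow> ('o, 'm, 'p, 'n) nt \<Rightarrow> ('o, 'm, 'p, 'n) nt" where
  "ncomp \<beta> \<alpha> = \<lparr>NSrc = NSrc \<alpha>, NTgt = NTgt \<beta>,
     NMap = (\<lambda>a\<in>Obj (FDom (NSrc \<alpha>)). Comp (FCod (NSrc \<alpha>)) (NMap \<beta> a) (NMap \<alpha> a))\<rparr>"

definition ninv :: "('o, 'm, 'p, 'n) nt \<Rightarrow> ('o, 'm, 'p, 'n) nt" where
  "ninv \<alpha> = \<lparr>NSrc = NTgt \<alpha>, NTgt = NSrc \<alpha>,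
     NMap = (\<lambda>a\<in>Obj (FDom (NSrc \<alpha>)). inv_arrow (FCod (NSrc \<alpha>)) (NMap \<alpha> a))\<rparr>"

text \<open>Whiskering \<open>K \<alpha>\<close> and \<open>\<alpha> H\<close>, and horizontal composition.\<close>

definition whisker_left ::
  "('p, 'n, 'q, 'k) ftor \<Rightarrow> ('o, 'm, 'p, 'n) nt \<Rightarrow> ('o, 'm, 'q, 'k) nt" where
  "whisker_left K \<alpha> = \<lparr>NSrc = ftcomp K (NSrc \<alpha>), NTgt = ftcomp K (NTgt \<alpha>),
     NMap = (\<lambda>a\<in>Obj (FDom (NSrc \<alpha>)). FM K (NMap \<alpha> a))\<rparr>"

definition whisker_right ::
  "('p, 'n, 'q, 'k) nt \<Rightarrow> ('o, 'm, 'p, 'n) ftor \<Rightarrow> ('o, 'm, 'q, 'k) nt" where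
  "whisker_right \<alpha> H = \<lparr>NSrc = ftcomp (NSrc \<alpha>) H, NTgt = ftcomp (NTgt \<alpha>) H,
     NMap = (\<lambda>a\<in>Obj (FDom H). NMap \<alpha> (FO H a))\<rparr>"

definition hcomp ::
  "('p, 'n, 'q, 'k) nt \<Rightarrow> ('o, 'm, 'p, 'n) nt \<Rightarrow> ('o, 'm, 'q, 'k) nt" where
  "hcomp \<beta> \<alpha> = ncomp (whisker_right \<beta> (NTgt \<alpha>)) (whisker_left (NSrc \<beta>) \<alpha>)"


section \<open>2-categories\<close>

text \<open>
  A (strict) 2-category is given by its category of objects and 1-cells, its category of 1-cells
  and 2-cells (under vertical composition) and horizontal composition of 2-cells.
\<close>

record ('x, 'f, 'c) two_cat =
  C1 :: "('x, 'f) cat"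
  C2 :: "('f, 'c) cat"
  HComp :: "'c \<Rightarrow> 'c \<Rightarrow> 'c"

definition src0 :: "('x, 'f, 'c) two_cat \<Rightarrow> 'c \<Rightarrow> 'x" where
  "src0 K \<alpha> = Dom (C1 K) (Dom (C2 K) \<alpha>)"

definition tgt0 :: "('x, 'f, 'c) two_cat \<Rightarrow> 'c \<Rightarrow> 'x" where
  "tgt0 K \<alpha> = Cod (C1 K) (Dom (C2 K) \<alpha>)"

definition two_category :: "('x, 'f, 'c) two_cat \<Rightarrow> bool" where
  "two_category K \<longleftrightarrow>
     category (C1 K) \<and> category (C2 K) \<and> Obj (C2 K) = Arr (C1 K) \<and>
     (\<forall>\<alpha>\<in>Arr (C2 K). Dom (C1 K) (Cod (C2 K) \<alpha>) = src0 K \<alpha> \<and> Cod (C1 K) (Cod (C2 K) \<alpha>) = tgt0 K \<alpha>) \<and>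
     (\<forall>\<alpha>\<in>Arr (C2 K). \<forall>\<beta>\<in>Arr (C2 K). src0 K \<beta> = tgt0 K \<alpha> \<longrightarrow>
        HComp K \<beta> \<alpha> \<in> hom (C2 K) (Comp (C1 K) (Dom (C2 K) \<beta>) (Dom (C2 K) \<alpha>))
                                 (Comp (C1 K) (Cod (C2 K) \<beta>) (Cod (C2 K) \<alpha>))) \<and>
     (\<forall>f\<in>Arr (C1 K). \<forall>g\<in>Arr (C1 K). Dom (C1 K) g = Cod (C1 K) f \<longrightarrow>
        HComp K (Id (C2 K) g) (Id (C2 K) f) = Id (C2 K) (Comp (C1 K) g f)) \<and>
     (\<forall>\<alpha>\<in>Arr (C2 K). \<forall>\<alpha>'\<in>Arr (C2 K). \<forall>\<beta>\<in>Arr (C2 K). \<forall>\<beta>'\<in>Arr (C2 K).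
        Dom (C2 K) \<alpha>' = Cod (C2 K) \<alpha> \<longrightarrow> Dom (C2 K) \<beta>' = Cod (C2 K) \<beta> \<longrightarrow>
        src0 K \<beta> = tgt0 K \<alpha> \<longrightarrow>
        HComp K (Comp (C2 K) \<beta>' \<beta>) (Comp (C2 K) \<alpha>' \<alpha>) =
        Comp (C2 K) (HComp K \<beta>' \<alpha>') (HComp K \<beta> \<alpha>)) \<and>
     (\<forall>\<alpha>\<in>Arr (C2 K). \<forall>\<beta>\<in>Arr (C2 K). \<forall>\<gamma>\<in>Arr (C2 K).
        src0 K \<beta> = tgt0 K \<alpha> \<longrightarrow> src0 K \<gamma> = tgt0 K \<beta> \<longrightarrow>
        HComp K \<gamma> (HComp K \<beta> \<alpha>) = HComp K (HComp K \<gamma> \<beta>) \<alpha>) \<and>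
     (\<forall>\<alpha>\<in>Arr (C2 K). HComp K \<alpha> (Id (C2 K) (Id (C1 K) (src0 K \<alpha>))) = \<alpha> \<and>
                      HComp K (Id (C2 K) (Id (C1 K) (tgt0 K \<alpha>))) \<alpha> = \<alpha>)"

definition full_sub :: "('x, 'f, 'c) two_cat \<Rightarrow> ('x \<Rightarrow> bool) \<Rightarrow> ('x, 'f, 'c) two_cat" where
  "full_sub K P = K
     \<lparr>C1 := (C1 K)\<lparr>Obj := {x \<in> Obj (C1 K). P x},
                   Arr := {f \<in> Arr (C1 K). P (Dom (C1 K) f) \<and> P (Cod (C1 K) f)}\<rparr>,
      C2 := (C2 K)\<lparr>Obj := {f \<in> Obj (C2 K). P (Dom (C1 K) f) \<and> P (Cod (C1 K) f)},
                   Arr := {\<alpha> \<in> Arr (C2 K). P (src0 K \<alpha>) \<and> P (tgt0 K \<alpha>)}\<rparr>\<rparr>"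

record ('x, 'f, 'c, 'y, 'g, 'd) two_ftor =
  F0 :: "'x \<Rightarrow> 'y"
  F1 :: "'f \<Rightarrow> 'g"
  F2 :: "'c \<Rightarrow> 'd"

definition two_functor ::
  "('x, 'f, 'c) two_cat \<Rightarrow> ('y, 'g, 'd) two_cat \<Rightarrow> ('x, 'f, 'c, 'y, 'g, 'd) two_ftor \<Rightarrow> bool" where
  "two_functor K L F \<longleftrightarrow> two_category K \<and> two_category L \<and>
     preserves_cat (C1 K) (C1 L) (F0 F) (F1 F) \<and>
     preserves_cat (C2 K) (C2 L) (F1 F) (F2 F) \<and>
     (\<forall>\<alpha>\<in>Arr (C2 K). \<forall>\<beta>\<in>Arr (C2 K). src0 K \<beta> = tgt0 K \<alpha> \<longrightarrow>
        F2 F (HComp K \<beta> \<alpha>) = HComp L (F2 F \<beta>) (F2 F \<alpha>))"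

definition two_id :: "('x, 'f, 'c, 'x, 'f, 'c) two_ftor" where
  "two_id = \<lparr>F0 = id, F1 = id, F2 = id\<rparr>"

definition two_comp ::
  "('y, 'g, 'd, 'z, 'h, 'e) two_ftor \<Rightarrow> ('x, 'f, 'c, 'y, 'g, 'd) two_ftor
    \<Rightarrow> ('x, 'f, 'c, 'z, 'h, 'e) two_ftor" where
  "two_comp G F = \<lparr>F0 = F0 G \<circ> F0 F, F1 = F1 G \<circ> F1 F, F2 = F2 G \<circ> F2 F\<rparr>"

definition two_natural ::
  "('x, 'f, 'c) two_cat \<Rightarrow> ('y, 'g, 'd) two_cat \<Rightarrow> ('x, 'f, 'c, 'y, 'g, 'd) two_ftor
    \<Rightarrow> ('x, 'f, 'c, 'y, 'g, 'd) two_ftor \<Rightarrow> ('x \<Rightarrow> 'g) \<Rightarrow> bool" where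
  "two_natural K L F G t \<longleftrightarrow>
     (\<forall>x\<in>Obj (C1 K). t x \<in> hom (C1 L) (F0 F x) (F0 G x)) \<and>
     (\<forall>f\<in>Arr (C1 K). Comp (C1 L) (t (Cod (C1 K) f)) (F1 F f) =
                      Comp (C1 L) (F1 G f) (t (Dom (C1 K) f))) \<and>
     (\<forall>\<alpha>\<in>Arr (C2 K). HComp L (Id (C2 L) (t (tgt0 K \<alpha>))) (F2 F \<alpha>) =
                      HComp L (F2 G \<alpha>) (Id (C2 L) (t (src0 K \<alpha>))))"

definition two_naturally_isomorphic ::
  "('x, 'f, 'c) two_cat \<Rightarrow> ('y, 'g, 'd) two_cat \<Rightarrow> ('x, 'f, 'c, 'y, 'g, 'd) two_ftor
    \<Rightarrow> ('x, 'f, 'c, 'y, 'g, 'd) two_ftor \<Rightarrow> bool" where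
  "two_naturally_isomorphic K L F G \<longleftrightarrow> two_functor K L F \<and> two_functor K L G \<and>
     (\<exists>t. two_natural K L F G t \<and> (\<forall>x\<in>Obj (C1 K). iso_arrow (C1 L) (t x)))"

definition two_equivalence ::
  "('x, 'f, 'c) two_cat \<Rightarrow> ('y, 'g, 'd) two_cat \<Rightarrow> ('x, 'f, 'c, 'y, 'g, 'd) two_ftor \<Rightarrow> bool" where
  "two_equivalence K L F \<longleftrightarrow> two_functor K L F \<and>
     (\<exists>G. two_functor L K G \<and>
        two_naturally_isomorphic K K two_id (two_comp G F) \<and>
        two_naturally_isomorphic L L (two_comp F G) two_id)"


section \<open>Bifibrations\<close>

definition cartesian :: "('e, 'h, 'o, 'm) ftor \<Rightarrow> 'h \<Rightarrow> bool" where
  "cartesian p \<phi> \<longleftrightarrow> \<phi> \<in> Arr (FDom p) \<and>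
     (\<forall>\<psi>\<in>Arr (FDom p). \<forall>g\<in>hom (FCod p) (FO p (Dom (FDom p) \<psi>)) (FO p (Dom (FDom p) \<phi>)).
        Cod (FDom p) \<psi> = Cod (FDom p) \<phi> \<longrightarrow> FM p \<psi> = Comp (FCod p) (FM p \<phi>) g \<longrightarrow>
        (\<exists>!\<chi>. \<chi> \<in> hom (FDom p) (Dom (FDom p) \<psi>) (Dom (FDom p) \<phi>) \<and>
              FM p \<chi> = g \<and> Comp (FDom p) \<phi> \<chi> = \<psi>))"

definition fibration :: "('e, 'h, 'o, 'm) ftor \<Rightarrow> bool" where
  "fibration p \<longleftrightarrow> is_functor p \<and>
     (\<forall>e\<in>Obj (FDom p). \<forall>f\<in>Arr (FCod p). Cod (FCod p) f = FO p e \<longrightarrow>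
        (\<exists>\<phi>. cartesian p \<phi> \<and> Cod (FDom p) \<phi> = e \<and> FM p \<phi> = f))"

definition opfibration :: "('e, 'h, 'o, 'm) ftor \<Rightarrow> bool" where
  "opfibration p \<longleftrightarrow> fibration (op_ftor p)"

definition bifibration :: "('e, 'h, 'o, 'm) ftor \<Rightarrow> bool" where
  "bifibration p \<longleftrightarrow> fibration p \<and> opfibration p"

text \<open>
  The 2-category of functors into \<open>B\<close>, functors over \<open>B\<close> and natural transformations over \<open>B\<close>.
  1-cells and 2-cells are tagged with the functors into \<open>B\<close> that form their source and target.
\<close>

type_synonym ('e, 'h, 'o, 'm) over1 =
  "('e, 'h, 'o, 'm) ftor \<times> ('e, 'h, 'e, 'h) ftor \<times> ('e, 'h, 'o, 'm) ftor"

type_synonym ('e, 'h, 'o, 'm) over2 =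
  "('e, 'h, 'o, 'm) ftor \<times> ('e, 'h, 'e, 'h) nt \<times> ('e, 'h, 'o, 'm) ftor"

definition object_over :: "('o, 'm) cat \<Rightarrow> ('e, 'h, 'o, 'm) ftor \<Rightarrow> bool" where
  "object_over B p \<longleftrightarrow> is_functor p \<and> FCod p = B"

definition functor_over :: "('o, 'm) cat \<Rightarrow> ('e, 'h, 'o, 'm) over1 \<Rightarrow> bool" where
  "functor_over B = (\<lambda>(p, H, q). object_over B p \<and> object_over B q \<and>
     is_functor H \<and> FDom H = FDom p \<and> FCod H = FDom q \<and> ftcomp q H = p)"

definition transformation_over :: "('o, 'm) cat \<Rightarrow> ('e, 'h, 'o, 'm) over2 \<Rightarrow> bool" where
  "transformation_over B = (\<lambda>(p, \<alpha>, q). is_nt \<alpha> \<and>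
     functor_over B (p, NSrc \<alpha>, q) \<and> functor_over B (p, NTgt \<alpha>, q) \<and>
     (\<forall>e\<in>Obj (FDom p). FM q (NMap \<alpha> e) = Id B (FO p e)))"

definition CAT_over ::
  "('o, 'm) cat \<Rightarrow>
    (('e, 'h, 'o, 'm) ftor, ('e, 'h, 'o, 'm) over1, ('e, 'h, 'o, 'm) over2) two_cat" where
  "CAT_over B =
     \<lparr>C1 = \<lparr>Obj = {p. object_over B p}, Arr = {H. functor_over B H},
            Dom = (\<lambda>(p, H, q). p), Cod = (\<lambda>(p, H, q). q),
            Id = (\<lambda>p. (p, ftid (FDom p), p)),
            Comp = (\<lambda>(q, K, r) (p, H, q'). (p, ftcomp K H, r))\<rparr>,
      C2 = \<lparr>Obj = {H. functor_over B H}, Arr = {\<alpha>. transformation_over B \<alpha>},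
            Dom = (\<lambda>(p, \<alpha>, q). (p, NSrc \<alpha>, q)), Cod = (\<lambda>(p, \<alpha>, q). (p, NTgt \<alpha>, q)),
            Id = (\<lambda>(p, H, q). (p, nid H, q)),
            Comp = (\<lambda>(p', \<beta>, q') (p, \<alpha>, q). (p, ncomp \<beta> \<alpha>, q))\<rparr>,
      HComp = (\<lambda>(q, \<beta>, r) (p, \<alpha>, q'). (p, hcomp \<beta> \<alpha>, r))\<rparr>"

definition BIFIB ::
  "('o, 'm) cat \<Rightarrow>
    (('e, 'h, 'o, 'm) ftor, ('e, 'h, 'o, 'm) over1, ('e, 'h, 'o, 'm) over2) two_cat" where
  "BIFIB B = full_sub (CAT_over B) bifibration"


section \<open>Adjunctions\<close>

record ('o, 'm, 'p, 'n) adj =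
  ALeft :: "('o, 'm, 'p, 'n) ftor"
  ARight :: "('p, 'n, 'o, 'm) ftor"
  AUnit :: "('o, 'm, 'o, 'm) nt"
  ACounit :: "('p, 'n, 'p, 'n) nt"

abbreviation ASrc :: "('o, 'm, 'p, 'n) adj \<Rightarrow> ('o, 'm) cat" where
  "ASrc a \<equiv> FDom (ALeft a)"

abbreviation ATgt :: "('o, 'm, 'p, 'n) adj \<Rightarrow> ('p, 'n) cat" where
  "ATgt a \<equiv> FCod (ALeft a)"

definition adjunction :: "('o, 'm, 'p, 'n) adj \<Rightarrow> bool" where
  "adjunction a \<longleftrightarrow> is_functor (ALeft a) \<and> is_functor (ARight a) \<and>
     FDom (ARight a) = ATgt a \<and> FCod (ARight a) = ASrc a \<and>
     is_nt_between (ftid (ASrc a)) (ftcomp (ARight a) (ALeft a)) (AUnit a) \<and>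
     is_nt_between (ftcomp (ALeft a) (ARight a)) (ftid (ATgt a)) (ACounit a) \<and>
     (\<forall>x\<in>Obj (ASrc a). Comp (ATgt a) (NMap (ACounit a) (FO (ALeft a) x)) (FM (ALeft a) (NMap (AUnit a) x))
                        = Id (ATgt a) (FO (ALeft a) x)) \<and>
     (\<forall>y\<in>Obj (ATgt a). Comp (ASrc a) (FM (ARight a) (NMap (ACounit a) y)) (NMap (AUnit a) (FO (ARight a) y))
                        = Id (ASrc a) (FO (ARight a) y))"

definition is_left_adjoint :: "('o, 'm, 'p, 'n) ftor \<Rightarrow> bool" where
  "is_left_adjoint F \<longleftrightarrow> (\<exists>a. adjunction a \<and> ALeft a = F)"

definition is_right_adjoint :: "('p, 'n, 'o, 'm) ftor \<Rightarrow> bool" where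
  "is_right_adjoint G \<longleftrightarrow> (\<exists>a. adjunction a \<and> ARight a = G)"

text \<open>The transpose \<open>x \<rightarrow> G y\<close> of an arrow \<open>f : F x \<rightarrow> y\<close>.\<close>

definition adj_transpose :: "('o, 'm, 'p, 'n) adj \<Rightarrow> 'o \<Rightarrow> 'n \<Rightarrow> 'm" where
  "adj_transpose a x f = Comp (ASrc a) (FM (ARight a) f) (NMap (AUnit a) x)"

definition adj_id :: "('o, 'm) cat \<Rightarrow> ('o, 'm, 'o, 'm) adj" where
  "adj_id C = \<lparr>ALeft = ftid C, ARight = ftid C, AUnit = nid (ftid C), ACounit = nid (ftid C)\<rparr>"

definition adj_comp ::
  "('p, 'n, 'q, 'k) adj \<Rightarrow> ('o, 'm, 'p, 'n) adj \<Rightarrow> ('o, 'm, 'q, 'k) adj" where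
  "adj_comp b a =
     \<lparr>ALeft = ftcomp (ALeft b) (ALeft a), ARight = ftcomp (ARight a) (ARight b),
      AUnit = ncomp (whisker_left (ARight a) (whisker_right (AUnit b) (ALeft a))) (AUnit a),
      ACounit = ncomp (ACounit b) (whisker_left (ALeft b) (whisker_right (ACounit a) (ARight b)))\<rparr>"


section \<open>Double categories\<close>

text \<open>
  A (strict) double category is given by the categories of vertical and of horizontal arrows and
  by the vertical and the horizontal composition of cells. In \<open>CV\<close> the source and target of a cell
  are its top and bottom, in \<open>CH\<close> they are its left and right side.
\<close>

record ('o, 'v, 'h, 'c) dbl =
  Vert :: "('o, 'v) cat"
  Horz :: "('o, 'h) cat"
  CV :: "('h, 'c) cat"
  CH :: "('v, 'c) cat"

abbreviation "top_side D \<equiv> Dom (CV D)"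
abbreviation "bottom_side D \<equiv> Cod (CV D)"
abbreviation "left_side D \<equiv> Dom (CH D)"
abbreviation "right_side D \<equiv> Cod (CH D)"

definition double_category :: "('o, 'v, 'h, 'c) dbl \<Rightarrow> bool" where
  "double_category D \<longleftrightarrow>
     category (Vert D) \<and> category (Horz D) \<and> category (CV D) \<and> category (CH D) \<and>
     Obj (Vert D) = Obj (Horz D) \<and> Obj (CV D) = Arr (Horz D) \<and> Obj (CH D) = Arr (Vert D) \<and>
     Arr (CV D) = Arr (CH D) \<and>
     (\<forall>c\<in>Arr (CV D).
        Dom (Vert D) (left_side D c) = Dom (Horz D) (top_side D c) \<and>
        Cod (Vert D) (left_side D c) = Dom (Horz D) (bottom_side D c) \<and>
        Dom (Vert D) (right_side D c) = Cod (Horz D) (top_side D c) \<and>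
        Cod (Vert D) (right_side D c) = Cod (Horz D) (bottom_side D c)) \<and>
     (\<forall>h\<in>Arr (Horz D). left_side D (Id (CV D) h) = Id (Vert D) (Dom (Horz D) h) \<and>
                        right_side D (Id (CV D) h) = Id (Vert D) (Cod (Horz D) h)) \<and>
     (\<forall>v\<in>Arr (Vert D). top_side D (Id (CH D) v) = Id (Horz D) (Dom (Vert D) v) \<and>
                        bottom_side D (Id (CH D) v) = Id (Horz D) (Cod (Vert D) v)) \<and>
     (\<forall>c\<in>Arr (CV D). \<forall>d\<in>Arr (CV D). top_side D d = bottom_side D c \<longrightarrow>
        left_side D (Comp (CV D) d c) = Comp (Vert D) (left_side D d) (left_side D c) \<and>
        right_side D (Comp (CV D) d c) = Comp (Vert D) (right_side D d) (right_side D c)) \<and>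
     (\<forall>c\<in>Arr (CV D). \<forall>d\<in>Arr (CV D). left_side D d = right_side D c \<longrightarrow>
        top_side D (Comp (CH D) d c) = Comp (Horz D) (top_side D d) (top_side D c) \<and>
        bottom_side D (Comp (CH D) d c) = Comp (Horz D) (bottom_side D d) (bottom_side D c)) \<and>
     (\<forall>a\<in>Obj (Vert D). Id (CV D) (Id (Horz D) a) = Id (CH D) (Id (Vert D) a)) \<and>
     (\<forall>f\<in>Arr (Horz D). \<forall>g\<in>Arr (Horz D). Dom (Horz D) g = Cod (Horz D) f \<longrightarrow>
        Id (CV D) (Comp (Horz D) g f) = Comp (CH D) (Id (CV D) g) (Id (CV D) f)) \<and>
     (\<forall>v\<in>Arr (Vert D). \<forall>w\<in>Arr (Vert D). Dom (Vert D) w = Cod (Vert D) v \<longrightarrow>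
        Id (CH D) (Comp (Vert D) w v) = Comp (CV D) (Id (CH D) w) (Id (CH D) v)) \<and>
     (\<forall>c\<in>Arr (CV D). \<forall>d\<in>Arr (CV D). \<forall>c'\<in>Arr (CV D). \<forall>d'\<in>Arr (CV D).
        left_side D d = right_side D c \<longrightarrow> left_side D d' = right_side D c' \<longrightarrow>
        top_side D c' = bottom_side D c \<longrightarrow> top_side D d' = bottom_side D d \<longrightarrow>
        Comp (CV D) (Comp (CH D) d' c') (Comp (CH D) d c) =
        Comp (CH D) (Comp (CV D) d' d) (Comp (CV D) c' c))"

text \<open>
  Besides the objects and arrows of \<open>B\<close> the double category \<open>HH B\<close> has only identities: the identity
  vertical arrow at \<open>a\<close> is represented by \<open>a\<close>, the identity cell at \<open>f\<close> is represented by \<open>f\<close>.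
\<close>

definition HH :: "('o, 'm) cat \<Rightarrow> ('o, 'o, 'm, 'm) dbl" where
  "HH B = \<lparr>Vert = discrete (Obj B), Horz = B, CV = discrete (Arr B), CH = B\<rparr>"

text \<open>
  In a cell of \<open>ADJ\<close> with top \<open>F \<stileturn> G\<close>, bottom \<open>F' \<stileturn> G'\<close>, left \<open>H\<close> and right \<open>K\<close>, the members of the
  mate pair are \<open>SXi : F' H \<Rightarrow> K F\<close> and \<open>SZeta : H G \<Rightarrow> G' K\<close>.
\<close>

record ('o, 'm) square =
  STop :: "('o, 'm, 'o, 'm) adj"
  SBot :: "('o, 'm, 'o, 'm) adj"
  SLeft :: "('o, 'm, 'o, 'm) ftor"
  SRight :: "('o, 'm, 'o, 'm) ftor"
  SXi :: "('o, 'm, 'o, 'm) nt"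
  SZeta :: "('o, 'm, 'o, 'm) nt"

definition is_square :: "('o, 'm) square \<Rightarrow> bool" where
  "is_square s \<longleftrightarrow>
     adjunction (STop s) \<and> adjunction (SBot s) \<and> is_functor (SLeft s) \<and> is_functor (SRight s) \<and>
     FDom (SLeft s) = ASrc (STop s) \<and> FCod (SLeft s) = ASrc (SBot s) \<and>
     FDom (SRight s) = ATgt (STop s) \<and> FCod (SRight s) = ATgt (SBot s) \<and>
     is_nt_between (ftcomp (ALeft (SBot s)) (SLeft s)) (ftcomp (SRight s) (ALeft (STop s))) (SXi s) \<and>
     is_nt_between (ftcomp (SLeft s) (ARight (STop s))) (ftcomp (ARight (SBot s)) (SRight s)) (SZeta s) \<and>
     (\<forall>x\<in>Obj (ASrc (STop s)). \<forall>y\<in>Obj (ATgt (STop s)).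
        \<forall>f\<in>hom (ATgt (STop s)) (FO (ALeft (STop s)) x) y.
          adj_transpose (SBot s) (FO (SLeft s) x) (Comp (ATgt (SBot s)) (FM (SRight s) f) (NMap (SXi s) x)) =
          Comp (ASrc (SBot s)) (NMap (SZeta s) y) (FM (SLeft s) (adj_transpose (STop s) x f)))"

definition ADJ :: "(('o, 'm) cat, ('o, 'm, 'o, 'm) ftor, ('o, 'm, 'o, 'm) adj, ('o, 'm) square) dbl" where
  "ADJ =
     \<lparr>Vert = \<lparr>Obj = {C. category C}, Arr = {F. is_functor F}, Dom = FDom, Cod = FCod,
              Id = ftid, Comp = ftcomp\<rparr>,
      Horz = \<lparr>Obj = {C. category C}, Arr = {a. adjunction a}, Dom = (\<lambda>a. ASrc a), Cod = (\<lambda>a. ATgt a),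
              Id = adj_id, Comp = adj_comp\<rparr>,
      CV = \<lparr>Obj = {a. adjunction a}, Arr = {s. is_square s}, Dom = STop, Cod = SBot,
            Id = (\<lambda>a. \<lparr>STop = a, SBot = a, SLeft = ftid (ASrc a), SRight = ftid (ATgt a),
                       SXi = nid (ALeft a), SZeta = nid (ARight a)\<rparr>),
            Comp = (\<lambda>d c. \<lparr>STop = STop c, SBot = SBot d,
                           SLeft = ftcomp (SLeft d) (SLeft c), SRight = ftcomp (SRight d) (SRight c),
                           SXi = ncomp (whisker_left (SRight d) (SXi c)) (whisker_right (SXi d) (SLeft c)),
                           SZeta = ncomp (whisker_right (SZeta d) (SRight c)) (whisker_left (SLeft d) (SZeta c))\<rparr>)\<rparr>,
      CH = \<lparr>Obj = {F. is_functor F}, Arr = {s. is_square s}, Dom = SLeft, Cod = SRight,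
            Id = (\<lambda>F. \<lparr>STop = adj_id (FDom F), SBot = adj_id (FCod F), SLeft = F, SRight = F,
                       SXi = nid F, SZeta = nid F\<rparr>),
            Comp = (\<lambda>d c. \<lparr>STop = adj_comp (STop d) (STop c), SBot = adj_comp (SBot d) (SBot c),
                           SLeft = SLeft c, SRight = SRight d,
                           SXi = ncomp (whisker_right (SXi d) (ALeft (STop c))) (whisker_left (ALeft (SBot d)) (SXi c)),
                           SZeta = ncomp (whisker_left (ARight (SBot c)) (SZeta d)) (whisker_right (SZeta c) (ARight (STop d)))\<rparr>)\<rparr>\<rparr>"


section \<open>Double functors and bi-indexed categories\<close>

text \<open>In \<open>Dgamma \<Omega> f g\<close> the arrow \<open>f\<close> comes first: it goes from \<open>\<Omega> g \<circ> \<Omega> f\<close> to \<open>\<Omega> (g \<circ> f)\<close>.\<close>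

record ('o, 'v, 'h, 'c, 'p, 'w, 'k, 'd) dftor =
  DO :: "'o \<Rightarrow> 'p"
  DV :: "'v \<Rightarrow> 'w"
  DH :: "'h \<Rightarrow> 'k"
  DC :: "'c \<Rightarrow> 'd"
  Ddelta :: "'o \<Rightarrow> 'd"
  Dgamma :: "'h \<Rightarrow> 'h \<Rightarrow> 'd"

definition lax_double_functor ::
  "('o, 'v, 'h, 'c) dbl \<Rightarrow> ('p, 'w, 'k, 'd) dbl \<Rightarrow> ('o, 'v, 'h, 'c, 'p, 'w, 'k, 'd) dftor \<Rightarrow> bool" where
  "lax_double_functor A D \<Omega> \<longleftrightarrow>
     preserves_cat (Vert A) (Vert D) (DO \<Omega>) (DV \<Omega>) \<and>
     preserves_cat (CV A) (CV D) (DH \<Omega>) (DC \<Omega>) \<and>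
     (\<forall>h\<in>Arr (Horz A). DH \<Omega> h \<in> hom (Horz D) (DO \<Omega> (Dom (Horz A) h)) (DO \<Omega> (Cod (Horz A) h))) \<and>
     (\<forall>c\<in>Arr (CV A). left_side D (DC \<Omega> c) = DV \<Omega> (left_side A c) \<and>
                      right_side D (DC \<Omega> c) = DV \<Omega> (right_side A c)) \<and>
     \<comment> \<open>boundaries of the comparison cells\<close>
     (\<forall>a\<in>Obj (Horz A). Ddelta \<Omega> a \<in> hom (CV D) (Id (Horz D) (DO \<Omega> a)) (DH \<Omega> (Id (Horz A) a)) \<and>
                        Ddelta \<Omega> a \<in> hom (CH D) (Id (Vert D) (DO \<Omega> a)) (Id (Vert D) (DO \<Omega> a))) \<and>
     (\<forall>f\<in>Arr (Horz A). \<forall>g\<in>Arr (Horz A). Dom (Horz A) g = Cod (Horz A) f \<longrightarrow>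
        Dgamma \<Omega> f g \<in> hom (CV D) (Comp (Horz D) (DH \<Omega> g) (DH \<Omega> f)) (DH \<Omega> (Comp (Horz A) g f)) \<and>
        Dgamma \<Omega> f g \<in> hom (CH D) (Id (Vert D) (DO \<Omega> (Dom (Horz A) f))) (Id (Vert D) (DO \<Omega> (Cod (Horz A) g)))) \<and>
     \<comment> \<open>naturality of the comparison cells\<close>
     (\<forall>v\<in>Arr (Vert A). Comp (CV D) (DC \<Omega> (Id (CH A) v)) (Ddelta \<Omega> (Dom (Vert A) v)) =
                        Comp (CV D) (Ddelta \<Omega> (Cod (Vert A) v)) (Id (CH D) (DV \<Omega> v))) \<and>
     (\<forall>c\<in>Arr (CH A). \<forall>d\<in>Arr (CH A). left_side A d = right_side A c \<longrightarrow>
        Comp (CV D) (DC \<Omega> (Comp (CH A) d c)) (Dgamma \<Omega> (top_side A c) (top_side A d)) =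
        Comp (CV D) (Dgamma \<Omega> (bottom_side A c) (bottom_side A d)) (Comp (CH D) (DC \<Omega> d) (DC \<Omega> c))) \<and>
     \<comment> \<open>coherence\<close>
     (\<forall>f\<in>Arr (Horz A).
        Comp (CV D) (Dgamma \<Omega> (Id (Horz A) (Dom (Horz A) f)) f)
                    (Comp (CH D) (Id (CV D) (DH \<Omega> f)) (Ddelta \<Omega> (Dom (Horz A) f))) =
        Id (CV D) (DH \<Omega> f) \<and>
        Comp (CV D) (Dgamma \<Omega> f (Id (Horz A) (Cod (Horz A) f)))
                    (Comp (CH D) (Ddelta \<Omega> (Cod (Horz A) f)) (Id (CV D) (DH \<Omega> f))) =
        Id (CV D) (DH \<Omega> f)) \<and>
     (\<forall>f\<in>Arr (Horz A). \<forall>g\<in>Arr (Horz A). \<forall>h\<in>Arr (Horz A).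
        Dom (Horz A) g = Cod (Horz A) f \<longrightarrow> Dom (Horz A) h = Cod (Horz A) g \<longrightarrow>
        Comp (CV D) (Dgamma \<Omega> (Comp (Horz A) g f) h) (Comp (CH D) (Id (CV D) (DH \<Omega> h)) (Dgamma \<Omega> f g)) =
        Comp (CV D) (Dgamma \<Omega> f (Comp (Horz A) h g)) (Comp (CH D) (Dgamma \<Omega> g h) (Id (CV D) (DH \<Omega> f))))"

definition pseudo_double_functor ::
  "('o, 'v, 'h, 'c) dbl \<Rightarrow> ('p, 'w, 'k, 'd) dbl \<Rightarrow> ('o, 'v, 'h, 'c, 'p, 'w, 'k, 'd) dftor \<Rightarrow> bool" where
  "pseudo_double_functor A D \<Omega> \<longleftrightarrow> lax_double_functor A D \<Omega> \<and>
     (\<forall>a\<in>Obj (Horz A). iso_arrow (CV D) (Ddelta \<Omega> a)) \<and>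
     (\<forall>f\<in>Arr (Horz A). \<forall>g\<in>Arr (Horz A). Dom (Horz A) g = Cod (Horz A) f \<longrightarrow>
        iso_arrow (CV D) (Dgamma \<Omega> f g))"

record ('o, 'v, 'h, 'c, 'p, 'w, 'k, 'd) vtrans =
  VSrc :: "('o, 'v, 'h, 'c, 'p, 'w, 'k, 'd) dftor"
  VTgt :: "('o, 'v, 'h, 'c, 'p, 'w, 'k, 'd) dftor"
  VO :: "'o \<Rightarrow> 'w"
  VH :: "'h \<Rightarrow> 'd"

definition vertical_transformation ::
  "('o, 'v, 'h, 'c) dbl \<Rightarrow> ('p, 'w, 'k, 'd) dbl \<Rightarrow> ('o, 'v, 'h, 'c, 'p, 'w, 'k, 'd) vtrans \<Rightarrow> bool" where
  "vertical_transformation A D \<tau> \<longleftrightarrow>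
     pseudo_double_functor A D (VSrc \<tau>) \<and> pseudo_double_functor A D (VTgt \<tau>) \<and>
     VO \<tau> \<in> extensional (Obj (Horz A)) \<and> VH \<tau> \<in> extensional (Arr (Horz A)) \<and>
     (\<forall>a\<in>Obj (Horz A). VO \<tau> a \<in> hom (Vert D) (DO (VSrc \<tau>) a) (DO (VTgt \<tau>) a)) \<and>
     (\<forall>f\<in>Arr (Horz A). VH \<tau> f \<in> hom (CV D) (DH (VSrc \<tau>) f) (DH (VTgt \<tau>) f) \<and>
                        VH \<tau> f \<in> hom (CH D) (VO \<tau> (Dom (Horz A) f)) (VO \<tau> (Cod (Horz A) f))) \<and>
     \<comment> \<open>naturality\<close>
     (\<forall>v\<in>Arr (Vert A). Comp (Vert D) (VO \<tau> (Cod (Vert A) v)) (DV (VSrc \<tau>) v) =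
                        Comp (Vert D) (DV (VTgt \<tau>) v) (VO \<tau> (Dom (Vert A) v))) \<and>
     (\<forall>c\<in>Arr (CV A). Comp (CV D) (VH \<tau> (bottom_side A c)) (DC (VSrc \<tau>) c) =
                      Comp (CV D) (DC (VTgt \<tau>) c) (VH \<tau> (top_side A c))) \<and>
     \<comment> \<open>coherence\<close>
     (\<forall>a\<in>Obj (Horz A). Comp (CV D) (VH \<tau> (Id (Horz A) a)) (Ddelta (VSrc \<tau>) a) =
                        Comp (CV D) (Ddelta (VTgt \<tau>) a) (Id (CH D) (VO \<tau> a))) \<and>
     (\<forall>f\<in>Arr (Horz A). \<forall>g\<in>Arr (Horz A). Dom (Horz A) g = Cod (Horz A) f \<longrightarrow>
        Comp (CV D) (VH \<tau> (Comp (Horz A) g f)) (Dgamma (VSrc \<tau>) f g) =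
        Comp (CV D) (Dgamma (VTgt \<tau>) f g) (Comp (CH D) (VH \<tau> g) (VH \<tau> f)))"

record ('o, 'v, 'h, 'c, 'p, 'w, 'k, 'd) vmod =
  VMSrc :: "('o, 'v, 'h, 'c, 'p, 'w, 'k, 'd) vtrans"
  VMTgt :: "('o, 'v, 'h, 'c, 'p, 'w, 'k, 'd) vtrans"
  VMC :: "'o \<Rightarrow> 'd"

definition double_modification ::
  "('o, 'v, 'h, 'c) dbl \<Rightarrow> ('p, 'w, 'k, 'd) dbl \<Rightarrow> ('o, 'v, 'h, 'c, 'p, 'w, 'k, 'd) vmod \<Rightarrow> bool" where
  "double_modification A D \<Xi> \<longleftrightarrow>
     vertical_transformation A D (VMSrc \<Xi>) \<and> vertical_transformation A D (VMTgt \<Xi>) \<and>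
     VSrc (VMSrc \<Xi>) = VSrc (VMTgt \<Xi>) \<and> VTgt (VMSrc \<Xi>) = VTgt (VMTgt \<Xi>) \<and>
     VMC \<Xi> \<in> extensional (Obj (Horz A)) \<and>
     (\<forall>a\<in>Obj (Horz A).
        VMC \<Xi> a \<in> hom (CH D) (VO (VMSrc \<Xi>) a) (VO (VMTgt \<Xi>) a) \<and>
        VMC \<Xi> a \<in> hom (CV D) (Id (Horz D) (DO (VSrc (VMSrc \<Xi>)) a)) (Id (Horz D) (DO (VTgt (VMSrc \<Xi>)) a))) \<and>
     (\<forall>f\<in>Arr (Horz A). Comp (CH D) (VH (VMTgt \<Xi>) f) (VMC \<Xi> (Dom (Horz A) f)) =
                        Comp (CH D) (VMC \<Xi> (Cod (Horz A) f)) (VH (VMSrc \<Xi>) f)) \<and>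
     (\<forall>v\<in>Arr (Vert A).
        Comp (CV D) (VMC \<Xi> (Cod (Vert A) v)) (Id (CH D) (DV (VSrc (VMSrc \<Xi>)) v)) =
        Comp (CV D) (Id (CH D) (DV (VTgt (VMSrc \<Xi>)) v)) (VMC \<Xi> (Dom (Vert A) v)))"

definition vt_id ::
  "('o, 'v, 'h, 'c) dbl \<Rightarrow> ('p, 'w, 'k, 'd) dbl \<Rightarrow> ('o, 'v, 'h, 'c, 'p, 'w, 'k, 'd) dftor
    \<Rightarrow> ('o, 'v, 'h, 'c, 'p, 'w, 'k, 'd) vtrans" where
  "vt_id A D \<Omega> = \<lparr>VSrc = \<Omega>, VTgt = \<Omega>,
     VO = (\<lambda>a\<in>Obj (Horz A). Id (Vert D) (DO \<Omega> a)),
     VH = (\<lambda>f\<in>Arr (Horz A). Id (CV D) (DH \<Omega> f))\<rparr>"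

definition vt_comp ::
  "('o, 'v, 'h, 'c) dbl \<Rightarrow> ('p, 'w, 'k, 'd) dbl \<Rightarrow> ('o, 'v, 'h, 'c, 'p, 'w, 'k, 'd) vtrans
    \<Rightarrow> ('o, 'v, 'h, 'c, 'p, 'w, 'k, 'd) vtrans \<Rightarrow> ('o, 'v, 'h, 'c, 'p, 'w, 'k, 'd) vtrans" where
  "vt_comp A D \<sigma> \<tau> = \<lparr>VSrc = VSrc \<tau>, VTgt = VTgt \<sigma>,
     VO = (\<lambda>a\<in>Obj (Horz A). Comp (Vert D) (VO \<sigma> a) (VO \<tau> a)),
     VH = (\<lambda>f\<in>Arr (Horz A). Comp (CV D) (VH \<sigma> f) (VH \<tau> f))\<rparr>"

text \<open>
  Modifications are composed vertically, as 2-cells, by horizontal pasting of their components and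
  horizontally by vertical pasting.
\<close>

definition pseudo_double_functors ::
  "('o, 'v, 'h, 'c) dbl \<Rightarrow> ('p, 'w, 'k, 'd) dbl \<Rightarrow>
    (('o, 'v, 'h, 'c, 'p, 'w, 'k, 'd) dftor, ('o, 'v, 'h, 'c, 'p, 'w, 'k, 'd) vtrans,
     ('o, 'v, 'h, 'c, 'p, 'w, 'k, 'd) vmod) two_cat" where
  "pseudo_double_functors A D =
     \<lparr>C1 = \<lparr>Obj = {\<Omega>. pseudo_double_functor A D \<Omega>}, Arr = {\<tau>. vertical_transformation A D \<tau>},
            Dom = VSrc, Cod = VTgt, Id = vt_id A D, Comp = vt_comp A D\<rparr>,
      C2 = \<lparr>Obj = {\<tau>. vertical_transformation A D \<tau>}, Arr = {\<Xi>. double_modification A D \<Xi>},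
            Dom = VMSrc, Cod = VMTgt,
            Id = (\<lambda>\<tau>. \<lparr>VMSrc = \<tau>, VMTgt = \<tau>, VMC = (\<lambda>a\<in>Obj (Horz A). Id (CH D) (VO \<tau> a))\<rparr>),
            Comp = (\<lambda>\<Theta> \<Xi>. \<lparr>VMSrc = VMSrc \<Xi>, VMTgt = VMTgt \<Theta>,
                           VMC = (\<lambda>a\<in>Obj (Horz A). Comp (CH D) (VMC \<Theta> a) (VMC \<Xi> a))\<rparr>)\<rparr>,
      HComp = (\<lambda>\<Theta> \<Xi>. \<lparr>VMSrc = vt_comp A D (VMSrc \<Theta>) (VMSrc \<Xi>),
                       VMTgt = vt_comp A D (VMTgt \<Theta>) (VMTgt \<Xi>),
                       VMC = (\<lambda>a\<in>Obj (Horz A). Comp (CV D) (VMC \<Theta> a) (VMC \<Xi> a))\<rparr>)\<rparr>"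

type_synonym ('o, 'm, 'u) bi_indexed =
  "('o, 'o, 'm, 'm, ('u, 'u) cat, ('u, 'u, 'u, 'u) ftor, ('u, 'u, 'u, 'u) adj, ('u, 'u) square) dftor"

type_synonym ('o, 'm, 'u) bi_indexed1 =
  "('o, 'o, 'm, 'm, ('u, 'u) cat, ('u, 'u, 'u, 'u) ftor, ('u, 'u, 'u, 'u) adj, ('u, 'u) square) vtrans"

type_synonym ('o, 'm, 'u) bi_indexed2 =
  "('o, 'o, 'm, 'm, ('u, 'u) cat, ('u, 'u, 'u, 'u) ftor, ('u, 'u, 'u, 'u) adj, ('u, 'u) square) vmod"

definition BI_IND ::
  "('o, 'm) cat \<Rightarrow>
    (('o, 'm, 'u) bi_indexed, ('o, 'm, 'u) bi_indexed1, ('o, 'm, 'u) bi_indexed2) two_cat" where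
  "BI_IND B = pseudo_double_functors (HH B) ADJ"


section \<open>Indexed and opindexed categories\<close>

text \<open>
  Pseudo-functors from a category \<open>C\<close> to the 2-category of categories with objects and arrows in
  \<open>'u\<close>. The structure isomorphisms are \<open>Pdelta a : Id \<Rightarrow> P 1\<^sub>a\<close> and, for composable \<open>f\<close> and \<open>g\<close>,
  \<open>Pgamma g f : P g \<circ> P f \<Rightarrow> P (g \<circ> f)\<close>. For \<open>C = op_cat B\<close> and \<open>f : A \<rightarrow> B\<close>, \<open>g : B \<rightarrow> C\<close> in \<open>B\<close> this
  means \<open>Pgamma f g : f\<^sup>* g\<^sup>* \<Rightarrow> (g f)\<^sup>*\<close>.
\<close>

record ('o, 'm, 'u) psftor =
  PO :: "'o \<Rightarrow> ('u, 'u) cat"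
  PM :: "'m \<Rightarrow> ('u, 'u, 'u, 'u) ftor"
  Pdelta :: "'o \<Rightarrow> ('u, 'u, 'u, 'u) nt"
  Pgamma :: "'m \<Rightarrow> 'm \<Rightarrow> ('u, 'u, 'u, 'u) nt"

definition pseudo_functor :: "('o, 'm) cat \<Rightarrow> ('o, 'm, 'u) psftor \<Rightarrow> bool" where
  "pseudo_functor C \<Phi> \<longleftrightarrow>
     (\<forall>a\<in>Obj C. category (PO \<Phi> a)) \<and>
     (\<forall>f\<in>Arr C. is_functor (PM \<Phi> f) \<and> FDom (PM \<Phi> f) = PO \<Phi> (Dom C f) \<and> FCod (PM \<Phi> f) = PO \<Phi> (Cod C f)) \<and>
     (\<forall>a\<in>Obj C. is_nat_iso_between (ftid (PO \<Phi> a)) (PM \<Phi> (Id C a)) (Pdelta \<Phi> a)) \<and>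
     (\<forall>f\<in>Arr C. \<forall>g\<in>Arr C. Dom C g = Cod C f \<longrightarrow>
        is_nat_iso_between (ftcomp (PM \<Phi> g) (PM \<Phi> f)) (PM \<Phi> (Comp C g f)) (Pgamma \<Phi> g f)) \<and>
     (\<forall>f\<in>Arr C. \<forall>x\<in>Obj (PO \<Phi> (Dom C f)).
        Comp (PO \<Phi> (Cod C f)) (NMap (Pgamma \<Phi> f (Id C (Dom C f))) x)
                              (FM (PM \<Phi> f) (NMap (Pdelta \<Phi> (Dom C f)) x)) =
        Id (PO \<Phi> (Cod C f)) (FO (PM \<Phi> f) x) \<and>
        Comp (PO \<Phi> (Cod C f)) (NMap (Pgamma \<Phi> (Id C (Cod C f)) f) x)
                              (NMap (Pdelta \<Phi> (Cod C f)) (FO (PM \<Phi> f) x)) =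
        Id (PO \<Phi> (Cod C f)) (FO (PM \<Phi> f) x)) \<and>
     (\<forall>f\<in>Arr C. \<forall>g\<in>Arr C. \<forall>h\<in>Arr C. Dom C g = Cod C f \<longrightarrow> Dom C h = Cod C g \<longrightarrow>
        (\<forall>x\<in>Obj (PO \<Phi> (Dom C f)).
          Comp (PO \<Phi> (Cod C h)) (NMap (Pgamma \<Phi> h (Comp C g f)) x) (FM (PM \<Phi> h) (NMap (Pgamma \<Phi> g f) x)) =
          Comp (PO \<Phi> (Cod C h)) (NMap (Pgamma \<Phi> (Comp C h g) f) x) (NMap (Pgamma \<Phi> h g) (FO (PM \<Phi> f) x))))"

text \<open>
  The data of lax and of oplax transformations \<open>\<Phi> \<Rightarrow> \<Psi>\<close>: functors \<open>TO a : \<Phi> a \<rightarrow> \<Psi> a\<close> and, for \<open>f : a \<rightarrow> b\<close>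
  in \<open>C\<close>, 2-cells \<open>TM f : \<Psi> f \<circ> TO a \<Rightarrow> TO b \<circ> \<Phi> f\<close> (lax) or \<open>TM f : TO b \<circ> \<Phi> f \<Rightarrow> \<Psi> f \<circ> TO a\<close> (oplax).
\<close>

record ('o, 'm, 'u) ptrans =
  TSrc :: "('o, 'm, 'u) psftor"
  TTgt :: "('o, 'm, 'u) psftor"
  TO :: "'o \<Rightarrow> ('u, 'u, 'u, 'u) ftor"
  TM :: "'m \<Rightarrow> ('u, 'u, 'u, 'u) nt"

definition ptrans_frame :: "('o, 'm) cat \<Rightarrow> ('o, 'm, 'u) ptrans \<Rightarrow> bool" where
  "ptrans_frame C \<tau> \<longleftrightarrow>
     pseudo_functor C (TSrc \<tau>) \<and> pseudo_functor C (TTgt \<tau>) \<and>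
     TO \<tau> \<in> extensional (Obj C) \<and> TM \<tau> \<in> extensional (Arr C) \<and>
     (\<forall>a\<in>Obj C. is_functor (TO \<tau> a) \<and> FDom (TO \<tau> a) = PO (TSrc \<tau>) a \<and> FCod (TO \<tau> a) = PO (TTgt \<tau>) a)"

definition lax_transformation :: "('o, 'm) cat \<Rightarrow> ('o, 'm, 'u) ptrans \<Rightarrow> bool" where
  "lax_transformation C \<tau> \<longleftrightarrow> ptrans_frame C \<tau> \<and>
     (\<forall>f\<in>Arr C. is_nt_between (ftcomp (PM (TTgt \<tau>) f) (TO \<tau> (Dom C f)))
                               (ftcomp (TO \<tau> (Cod C f)) (PM (TSrc \<tau>) f)) (TM \<tau> f)) \<and>
     (\<forall>a\<in>Obj C. \<forall>x\<in>Obj (PO (TSrc \<tau>) a).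
        Comp (PO (TTgt \<tau>) a) (NMap (TM \<tau> (Id C a)) x) (NMap (Pdelta (TTgt \<tau>) a) (FO (TO \<tau> a) x)) =
        FM (TO \<tau> a) (NMap (Pdelta (TSrc \<tau>) a) x)) \<and>
     (\<forall>f\<in>Arr C. \<forall>g\<in>Arr C. Dom C g = Cod C f \<longrightarrow>
        (\<forall>x\<in>Obj (PO (TSrc \<tau>) (Dom C f)).
          Comp (PO (TTgt \<tau>) (Cod C g))
               (NMap (TM \<tau> (Comp C g f)) x)
               (NMap (Pgamma (TTgt \<tau>) g f) (FO (TO \<tau> (Dom C f)) x)) =
          Comp (PO (TTgt \<tau>) (Cod C g))
               (FM (TO \<tau> (Cod C g)) (NMap (Pgamma (TSrc \<tau>) g f) x))
               (Comp (PO (TTgt \<tau>) (Cod C g))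
                     (NMap (TM \<tau> g) (FO (PM (TSrc \<tau>) f) x))
                     (FM (PM (TTgt \<tau>) g) (NMap (TM \<tau> f) x)))))"

definition oplax_transformation :: "('o, 'm) cat \<Rightarrow> ('o, 'm, 'u) ptrans \<Rightarrow> bool" where
  "oplax_transformation C \<tau> \<longleftrightarrow> ptrans_frame C \<tau> \<and>
     (\<forall>f\<in>Arr C. is_nt_between (ftcomp (TO \<tau> (Cod C f)) (PM (TSrc \<tau>) f))
                               (ftcomp (PM (TTgt \<tau>) f) (TO \<tau> (Dom C f))) (TM \<tau> f)) \<and>
     (\<forall>a\<in>Obj C. \<forall>x\<in>Obj (PO (TSrc \<tau>) a).
        Comp (PO (TTgt \<tau>) a) (NMap (TM \<tau> (Id C a)) x) (FM (TO \<tau> a) (NMap (Pdelta (TSrc \<tau>) a) x)) =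
        NMap (Pdelta (TTgt \<tau>) a) (FO (TO \<tau> a) x)) \<and>
     (\<forall>f\<in>Arr C. \<forall>g\<in>Arr C. Dom C g = Cod C f \<longrightarrow>
        (\<forall>x\<in>Obj (PO (TSrc \<tau>) (Dom C f)).
          Comp (PO (TTgt \<tau>) (Cod C g))
               (NMap (TM \<tau> (Comp C g f)) x)
               (FM (TO \<tau> (Cod C g)) (NMap (Pgamma (TSrc \<tau>) g f) x)) =
          Comp (PO (TTgt \<tau>) (Cod C g))
               (NMap (Pgamma (TTgt \<tau>) g f) (FO (TO \<tau> (Dom C f)) x))
               (Comp (PO (TTgt \<tau>) (Cod C g))
                     (FM (PM (TTgt \<tau>) g) (NMap (TM \<tau> f) x))
                     (NMap (TM \<tau> g) (FO (PM (TSrc \<tau>) f) x)))))"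

record ('o, 'm, 'u) pmod =
  MSrc :: "('o, 'm, 'u) ptrans"
  MTgt :: "('o, 'm, 'u) ptrans"
  MO :: "'o \<Rightarrow> ('u, 'u, 'u, 'u) nt"

definition pmod_frame :: "('o, 'm) cat \<Rightarrow> ('o, 'm, 'u) pmod \<Rightarrow> bool" where
  "pmod_frame C \<Xi> \<longleftrightarrow>
     TSrc (MSrc \<Xi>) = TSrc (MTgt \<Xi>) \<and> TTgt (MSrc \<Xi>) = TTgt (MTgt \<Xi>) \<and>
     MO \<Xi> \<in> extensional (Obj C) \<and>
     (\<forall>a\<in>Obj C. is_nt_between (TO (MSrc \<Xi>) a) (TO (MTgt \<Xi>) a) (MO \<Xi> a))"

definition lax_modification :: "('o, 'm) cat \<Rightarrow> ('o, 'm, 'u) pmod \<Rightarrow> bool" where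
  "lax_modification C \<Xi> \<longleftrightarrow>
     lax_transformation C (MSrc \<Xi>) \<and> lax_transformation C (MTgt \<Xi>) \<and> pmod_frame C \<Xi> \<and>
     (\<forall>f\<in>Arr C. \<forall>x\<in>Obj (PO (TSrc (MSrc \<Xi>)) (Dom C f)).
        Comp (PO (TTgt (MSrc \<Xi>)) (Cod C f))
             (NMap (TM (MTgt \<Xi>) f) x) (FM (PM (TTgt (MSrc \<Xi>)) f) (NMap (MO \<Xi> (Dom C f)) x)) =
        Comp (PO (TTgt (MSrc \<Xi>)) (Cod C f))
             (NMap (MO \<Xi> (Cod C f)) (FO (PM (TSrc (MSrc \<Xi>)) f) x)) (NMap (TM (MSrc \<Xi>) f) x))"

definition oplax_modification :: "('o, 'm) cat \<Rightarrow> ('o, 'm, 'u) pmod \<Rightarrow> bool" where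
  "oplax_modification C \<Xi> \<longleftrightarrow>
     oplax_transformation C (MSrc \<Xi>) \<and> oplax_transformation C (MTgt \<Xi>) \<and> pmod_frame C \<Xi> \<and>
     (\<forall>f\<in>Arr C. \<forall>x\<in>Obj (PO (TSrc (MSrc \<Xi>)) (Dom C f)).
        Comp (PO (TTgt (MSrc \<Xi>)) (Cod C f))
             (NMap (TM (MTgt \<Xi>) f) x) (NMap (MO \<Xi> (Cod C f)) (FO (PM (TSrc (MSrc \<Xi>)) f) x)) =
        Comp (PO (TTgt (MSrc \<Xi>)) (Cod C f))
             (FM (PM (TTgt (MSrc \<Xi>)) f) (NMap (MO \<Xi> (Dom C f)) x)) (NMap (TM (MSrc \<Xi>) f) x))"

definition lax_id :: "('o, 'm) cat \<Rightarrow> ('o, 'm, 'u) psftor \<Rightarrow> ('o, 'm, 'u) ptrans" where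
  "lax_id C \<Phi> = \<lparr>TSrc = \<Phi>, TTgt = \<Phi>,
     TO = (\<lambda>a\<in>Obj C. ftid (PO \<Phi> a)), TM = (\<lambda>f\<in>Arr C. nid (PM \<Phi> f))\<rparr>"

definition lax_comp ::
  "('o, 'm) cat \<Rightarrow> ('o, 'm, 'u) ptrans \<Rightarrow> ('o, 'm, 'u) ptrans \<Rightarrow> ('o, 'm, 'u) ptrans" where
  "lax_comp C \<sigma> \<tau> = \<lparr>TSrc = TSrc \<tau>, TTgt = TTgt \<sigma>,
     TO = (\<lambda>a\<in>Obj C. ftcomp (TO \<sigma> a) (TO \<tau> a)),
     TM = (\<lambda>f\<in>Arr C. ncomp (whisker_left (TO \<sigma> (Cod C f)) (TM \<tau> f))
                            (whisker_right (TM \<sigma> f) (TO \<tau> (Dom C f))))\<rparr>"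

definition oplax_comp ::
  "('o, 'm) cat \<Rightarrow> ('o, 'm, 'u) ptrans \<Rightarrow> ('o, 'm, 'u) ptrans \<Rightarrow> ('o, 'm, 'u) ptrans" where
  "oplax_comp C \<sigma> \<tau> = \<lparr>TSrc = TSrc \<tau>, TTgt = TTgt \<sigma>,
     TO = (\<lambda>a\<in>Obj C. ftcomp (TO \<sigma> a) (TO \<tau> a)),
     TM = (\<lambda>f\<in>Arr C. ncomp (whisker_right (TM \<sigma> f) (TO \<tau> (Dom C f)))
                            (whisker_left (TO \<sigma> (Cod C f)) (TM \<tau> f)))\<rparr>"

definition pmod_id :: "('o, 'm) cat \<Rightarrow> ('o, 'm, 'u) ptrans \<Rightarrow> ('o, 'm, 'u) pmod" where
  "pmod_id C \<tau> = \<lparr>MSrc = \<tau>, MTgt = \<tau>, MO = (\<lambda>a\<in>Obj C. nid (TO \<tau> a))\<rparr>"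

definition pmod_comp ::
  "('o, 'm) cat \<Rightarrow> ('o, 'm, 'u) pmod \<Rightarrow> ('o, 'm, 'u) pmod \<Rightarrow> ('o, 'm, 'u) pmod" where
  "pmod_comp C \<Theta> \<Xi> = \<lparr>MSrc = MSrc \<Xi>, MTgt = MTgt \<Theta>,
     MO = (\<lambda>a\<in>Obj C. ncomp (MO \<Theta> a) (MO \<Xi> a))\<rparr>"

type_synonym ('o, 'm, 'u) ps_two_cat =
  "(('o, 'm, 'u) psftor, ('o, 'm, 'u) ptrans, ('o, 'm, 'u) pmod) two_cat"

definition OPIND :: "('o, 'm) cat \<Rightarrow> ('o, 'm, 'u) ps_two_cat" where
  "OPIND B =
     \<lparr>C1 = \<lparr>Obj = {\<Phi>. pseudo_functor B \<Phi>}, Arr = {\<tau>. lax_transformation B \<tau>},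
            Dom = TSrc, Cod = TTgt, Id = lax_id B, Comp = lax_comp B\<rparr>,
      C2 = \<lparr>Obj = {\<tau>. lax_transformation B \<tau>}, Arr = {\<Xi>. lax_modification B \<Xi>},
            Dom = MSrc, Cod = MTgt, Id = pmod_id B, Comp = pmod_comp B\<rparr>,
      HComp = (\<lambda>\<Theta> \<Xi>. \<lparr>MSrc = lax_comp B (MSrc \<Theta>) (MSrc \<Xi>), MTgt = lax_comp B (MTgt \<Theta>) (MTgt \<Xi>),
                       MO = (\<lambda>a\<in>Obj B. hcomp (MO \<Theta> a) (MO \<Xi> a))\<rparr>)\<rparr>"

text \<open>The identity 2-cells in \<open>lax_id\<close> serve for lax and for oplax transformations.\<close>

definition IND :: "('o, 'm) cat \<Rightarrow> ('o, 'm, 'u) ps_two_cat" where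
  "IND B = (let C = op_cat B in
     \<lparr>C1 = \<lparr>Obj = {\<Phi>. pseudo_functor C \<Phi>}, Arr = {\<tau>. oplax_transformation C \<tau>},
            Dom = TSrc, Cod = TTgt, Id = lax_id C, Comp = oplax_comp C\<rparr>,
      C2 = \<lparr>Obj = {\<tau>. oplax_transformation C \<tau>}, Arr = {\<Xi>. oplax_modification C \<Xi>},
            Dom = MSrc, Cod = MTgt, Id = pmod_id C, Comp = pmod_comp C\<rparr>,
      HComp = (\<lambda>\<Theta> \<Xi>. \<lparr>MSrc = oplax_comp C (MSrc \<Theta>) (MSrc \<Xi>), MTgt = oplax_comp C (MTgt \<Theta>) (MTgt \<Xi>),
                       MO = (\<lambda>a\<in>Obj C. hcomp (MO \<Theta> a) (MO \<Xi> a))\<rparr>)\<rparr>)"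

definition left_OPIND :: "('o, 'm) cat \<Rightarrow> ('o, 'm, 'u) ps_two_cat" where
  "left_OPIND B = full_sub (OPIND B) (\<lambda>\<Phi>. \<forall>f\<in>Arr B. is_left_adjoint (PM \<Phi> f))"

definition right_IND :: "('o, 'm) cat \<Rightarrow> ('o, 'm, 'u) ps_two_cat" where
  "right_IND B = full_sub (IND B) (\<lambda>\<Phi>. \<forall>f\<in>Arr B. is_right_adjoint (PM \<Phi> f))"


section \<open>The forgetful 2-functors\<close>

type_synonym ('o, 'm, 'u) forget_two_ftor =
  "(('o, 'm, 'u) bi_indexed, ('o, 'm, 'u) bi_indexed1, ('o, 'm, 'u) bi_indexed2,
    ('o, 'm, 'u) psftor, ('o, 'm, 'u) ptrans, ('o, 'm, 'u) pmod) two_ftor"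

text \<open>
  The left-adjoint members of the comparison cells have the directions \<open>\<Omega>(1)\<^sub>* \<Rightarrow> Id\<close> and
  \<open>\<Omega>(g f)\<^sub>* \<Rightarrow> \<Omega>(g)\<^sub>* \<Omega>(f)\<^sub>*\<close>; hence the inverses in \<open>UU\<close>. The right-adjoint members are used as they
  are in \<open>VV\<close>.
\<close>

definition UU :: "('o, 'm) cat \<Rightarrow> ('o, 'm, 'u) forget_two_ftor" where
  "UU B =
     (let u0 = (\<lambda>\<Omega>. \<lparr>PO = DO \<Omega>, PM = (\<lambda>f. ALeft (DH \<Omega> f)),
                      Pdelta = (\<lambda>a. ninv (SXi (Ddelta \<Omega> a))),
                      Pgamma = (\<lambda>g f. ninv (SXi (Dgamma \<Omega> f g)))\<rparr>);
          u1 = (\<lambda>\<tau>. \<lparr>TSrc = u0 (VSrc \<tau>), TTgt = u0 (VTgt \<tau>), TO = VO \<tau>,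
                      TM = (\<lambda>f\<in>Arr B. SXi (VH \<tau> f))\<rparr>)
      in \<lparr>F0 = u0, F1 = u1,
          F2 = (\<lambda>\<Xi>. \<lparr>MSrc = u1 (VMSrc \<Xi>), MTgt = u1 (VMTgt \<Xi>),
                      MO = (\<lambda>a\<in>Obj B. SXi (VMC \<Xi> a))\<rparr>)\<rparr>)"

definition VV :: "('o, 'm) cat \<Rightarrow> ('o, 'm, 'u) forget_two_ftor" where
  "VV B =
     (let v0 = (\<lambda>\<Omega>. \<lparr>PO = DO \<Omega>, PM = (\<lambda>f. ARight (DH \<Omega> f)),
                      Pdelta = (\<lambda>a. SZeta (Ddelta \<Omega> a)),
                      Pgamma = (\<lambda>f g. SZeta (Dgamma \<Omega> f g))\<rparr>);
          v1 = (\<lambda>\<tau>. \<lparr>TSrc = v0 (VSrc \<tau>), TTgt = v0 (VTgt \<tau>), TO = VO \<tau>,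
                      TM = (\<lambda>f\<in>Arr B. SZeta (VH \<tau> f))\<rparr>)
      in \<lparr>F0 = v0, F1 = v1,
          F2 = (\<lambda>\<Xi>. \<lparr>MSrc = v1 (VMSrc \<Xi>), MTgt = v1 (VMTgt \<Xi>),
                      MO = (\<lambda>a\<in>Obj B. SZeta (VMC \<Xi> a))\<rparr>)\<rparr>)"


section \<open>The Grothendieck constructions\<close>

text \<open>
  The elements from which objects and arrows of categories are taken. This universe has to contain
  the total categories of pseudo-functors on \<open>B\<close> whose values live in it: \<open>GO b e\<close> is the
  object \<open>(b, e)\<close>, and \<open>GA d f h e\<close> is the arrow \<open>(f, h) : (a, d) \<rightarrow> (b, e)\<close> with \<open>f : a \<rightarrow> b\<close>.
  The type \<open>'a\<close> of atoms is arbitrary.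
\<close>

datatype ('o, 'm, 'a) univ =
    Atom 'a
  | GO (ob_base: 'o) (ob_fibre: "('o, 'm, 'a) univ")
  | GA (ar_src: "('o, 'm, 'a) univ") (ar_base: 'm) (ar_fibre: "('o, 'm, 'a) univ")
       (ar_tgt: "('o, 'm, 'a) univ")

definition total_cat ::
  "('o, 'm) cat \<Rightarrow> ('o, 'm, ('o, 'm, 'a) univ) psftor
    \<Rightarrow> (('o, 'm, 'a) univ, ('o, 'm, 'a) univ) cat" where
  "total_cat B \<Phi> =
     \<lparr>Obj = {GO b e | b e. b \<in> Obj B \<and> e \<in> Obj (PO \<Phi> b)},
      Arr = {GA d f h e | d f h e. f \<in> Arr B \<and> d \<in> Obj (PO \<Phi> (Dom B f)) \<and> e \<in> Obj (PO \<Phi> (Cod B f)) \<and>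
                                   h \<in> hom (PO \<Phi> (Dom B f)) d (FO (PM \<Phi> f) e)},
      Dom = (\<lambda>x. GO (Dom B (ar_base x)) (ar_src x)),
      Cod = (\<lambda>x. GO (Cod B (ar_base x)) (ar_tgt x)),
      Id = (\<lambda>x. GA (ob_fibre x) (Id B (ob_base x)) (NMap (Pdelta \<Phi> (ob_base x)) (ob_fibre x)) (ob_fibre x)),
      Comp = (\<lambda>y x. let f = ar_base x; g = ar_base y; K = PO \<Phi> (Dom B f) in
        GA (ar_src x) (Comp B g f)
           (Comp K (NMap (Pgamma \<Phi> f g) (ar_tgt y)) (Comp K (FM (PM \<Phi> f) (ar_fibre y)) (ar_fibre x)))
           (ar_tgt y))\<rparr>"

definition total_cat_op ::
  "('o, 'm) cat \<Rightarrow> ('o, 'm, ('o, 'm, 'a) univ) psftor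
    \<Rightarrow> (('o, 'm, 'a) univ, ('o, 'm, 'a) univ) cat" where
  "total_cat_op B \<Phi> =
     \<lparr>Obj = {GO b e | b e. b \<in> Obj B \<and> e \<in> Obj (PO \<Phi> b)},
      Arr = {GA d f h e | d f h e. f \<in> Arr B \<and> d \<in> Obj (PO \<Phi> (Dom B f)) \<and> e \<in> Obj (PO \<Phi> (Cod B f)) \<and>
                                   h \<in> hom (PO \<Phi> (Cod B f)) (FO (PM \<Phi> f) d) e},
      Dom = (\<lambda>x. GO (Dom B (ar_base x)) (ar_src x)),
      Cod = (\<lambda>x. GO (Cod B (ar_base x)) (ar_tgt x)),
      Id = (\<lambda>x. GA (ob_fibre x) (Id B (ob_base x))
                    (inv_arrow (PO \<Phi> (ob_base x)) (NMap (Pdelta \<Phi> (ob_base x)) (ob_fibre x))) (ob_fibre x)),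
      Comp = (\<lambda>y x. let f = ar_base x; g = ar_base y; K = PO \<Phi> (Cod B g) in
        GA (ar_src x) (Comp B g f)
           (Comp K (ar_fibre y)
                   (Comp K (FM (PM \<Phi> g) (ar_fibre x)) (inv_arrow K (NMap (Pgamma \<Phi> g f) (ar_src x)))))
           (ar_tgt y))\<rparr>"

definition total_proj ::
  "('o, 'm) cat \<Rightarrow> (('o, 'm, 'a) univ, ('o, 'm, 'a) univ) cat
    \<Rightarrow> (('o, 'm, 'a) univ, ('o, 'm, 'a) univ, 'o, 'm) ftor" where
  "total_proj B E = \<lparr>FDom = E, FCod = B, FO = (\<lambda>x\<in>Obj E. ob_base x), FM = (\<lambda>x\<in>Arr E. ar_base x)\<rparr>"

type_synonym ('o, 'm, 'u) groth_two_ftor =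
  "(('o, 'm, 'u) psftor, ('o, 'm, 'u) ptrans, ('o, 'm, 'u) pmod,
    ('u, 'u, 'o, 'm) ftor, ('u, 'u, 'o, 'm) over1, ('u, 'u, 'o, 'm) over2) two_ftor"

text \<open>
  On 1-cells: \<open>(b, e) \<mapsto> (b, \<tau>\<^sub>b e)\<close> and \<open>(f, h) \<mapsto> (f, \<tau>\<^sub>f \<circ> \<tau>\<^sub>a h)\<close>, respectively \<open>(f, \<tau>\<^sub>b h \<circ> \<tau>\<^sub>f)\<close>,
  for \<open>f : a \<rightarrow> b\<close>. On 2-cells: the component at \<open>(b, e)\<close> is the vertical arrow that corresponds to
  the arrow \<open>\<Xi>\<^sub>b\<close> at \<open>e\<close> of the fibre over \<open>b\<close>.
\<close>

definition Groth :: "('o, 'm) cat \<Rightarrow> ('o, 'm, ('o, 'm, 'a) univ) groth_two_ftor" where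
  "Groth B =
     (let p = (\<lambda>\<Phi>. total_proj B (total_cat B \<Phi>));
          H = (\<lambda>\<tau>. let E = total_cat B (TSrc \<tau>) in
                 \<lparr>FDom = E, FCod = total_cat B (TTgt \<tau>),
                  FO = (\<lambda>x\<in>Obj E. GO (ob_base x) (FO (TO \<tau> (ob_base x)) (ob_fibre x))),
                  FM = (\<lambda>x\<in>Arr E. let f = ar_base x; a = Dom B f; b = Cod B f in
                          GA (FO (TO \<tau> a) (ar_src x)) f
                             (Comp (PO (TTgt \<tau>) a) (NMap (TM \<tau> f) (ar_tgt x)) (FM (TO \<tau> a) (ar_fibre x)))
                             (FO (TO \<tau> b) (ar_tgt x)))\<rparr>)
      in \<lparr>F0 = p,
          F1 = (\<lambda>\<tau>. (p (TSrc \<tau>), H \<tau>, p (TTgt \<tau>))),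
          F2 = (\<lambda>\<Xi>. let \<sigma> = MSrc \<Xi>; \<tau> = MTgt \<Xi>; \<Psi> = TTgt \<sigma> in
                  (p (TSrc \<sigma>),
                   \<lparr>NSrc = H \<sigma>, NTgt = H \<tau>,
                    NMap = (\<lambda>x\<in>Obj (total_cat B (TSrc \<sigma>)). let b = ob_base x; e = ob_fibre x in
                              GA (FO (TO \<sigma> b) e) (Id B b)
                                 (Comp (PO \<Psi> b) (NMap (Pdelta \<Psi> b) (FO (TO \<tau> b) e)) (NMap (MO \<Xi> b) e))
                                 (FO (TO \<tau> b) e))\<rparr>,
                   p \<Psi>))\<rparr>)"

definition Groth_op :: "('o, 'm) cat \<Rightarrow> ('o, 'm, ('o, 'm, 'a) univ) groth_two_ftor" where
  "Groth_op B =
     (let p = (\<lambda>\<Phi>. total_proj B (total_cat_op B \<Phi>));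
          H = (\<lambda>\<tau>. let E = total_cat_op B (TSrc \<tau>) in
                 \<lparr>FDom = E, FCod = total_cat_op B (TTgt \<tau>),
                  FO = (\<lambda>x\<in>Obj E. GO (ob_base x) (FO (TO \<tau> (ob_base x)) (ob_fibre x))),
                  FM = (\<lambda>x\<in>Arr E. let f = ar_base x; a = Dom B f; b = Cod B f in
                          GA (FO (TO \<tau> a) (ar_src x)) f
                             (Comp (PO (TTgt \<tau>) b) (FM (TO \<tau> b) (ar_fibre x)) (NMap (TM \<tau> f) (ar_src x)))
                             (FO (TO \<tau> b) (ar_tgt x)))\<rparr>)
      in \<lparr>F0 = p,
          F1 = (\<lambda>\<tau>. (p (TSrc \<tau>), H \<tau>, p (TTgt \<tau>))),
          F2 = (\<lambda>\<Xi>. let \<sigma> = MSrc \<Xi>; \<tau> = MTgt \<Xi>; \<Psi> = TTgt \<sigma> in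
                  (p (TSrc \<sigma>),
                   \<lparr>NSrc = H \<sigma>, NTgt = H \<tau>,
                    NMap = (\<lambda>x\<in>Obj (total_cat_op B (TSrc \<sigma>)). let b = ob_base x; e = ob_fibre x in
                              GA (FO (TO \<sigma> b) e) (Id B b)
                                 (Comp (PO \<Psi> b) (NMap (MO \<Xi> b) e)
                                    (inv_arrow (PO \<Psi> b) (NMap (Pdelta \<Psi> b) (FO (TO \<sigma> b) e))))
                                 (FO (TO \<tau> b) e))\<rparr>,
                   p \<Psi>))\<rparr>)"

end

theory Submission
 imports Defs
begin

text \<open>
 An adjunction is determined up to unique isomorphism by either of its functors, and a mate pair is
 determined by either of its members. For this reason \<open>U\<close> and \<open>V\<close> are bijective on 1-cells and
 2-cells with given ends. A missing member is the mate of the given one (\<open>square_mate\<close>,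
 \<open>square_comate\<close>). The equations between cells that make up the coherence of a bi-indexed category,
 a vertical transformation or a modification can be tested on either kind of member
 (\<open>square_eq_zeta\<close>, \<open>square_eq_xi\<close>), where they become the equations of a pseudo-functor, of an oplax or
 lax transformation and of a modification (\<open>pseudo_functor_VV\<close>, \<open>oplax_transformation_VV\<close>,
 \<open>oplax_modification_VV\<close> and their counterparts for \<open>U\<close>). By the same principle a pseudo-functor
 whose members have adjoints extends to a bi-indexed category. So \<open>U\<close> and \<open>V\<close> are isomorphisms on
 hom-categories and essentially surjective, and \<open>two_equivalence_criterion\<close> applies.

 An arrow of the total category of an indexed category is a vertical arrow followed by a Cartesian
 lift. A functor over \<open>B\<close> between total categories is therefore given by its restrictions to the
 fibres together with the images of the lifts, and the relations between vertical arrows and lifts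
 turn into the equations of an oplax transformation; likewise for 2-cells (\<open>Groth_embedding\<close>). A
 fibration with a cleavage is isomorphic to the total category of its fibres
 (\<open>fibration_is_total\<close>). Finally, an arrow of a total category is opcartesian iff its fibre part is a
 universal arrow to the reindexing functor; so the projection is a bifibration iff all reindexing
 functors are right adjoints (\<open>bifibration_total_iff\<close>). This gives \<open>Groth_equivalence\<close>.

 The op-construction is reduced to these results. Sending \<open>h : f\<^sub>* d \<rightarrow> e\<close> to its transpose
 \<open>d \<rightarrow> f\<^sup>* e\<close> is an isomorphism over \<open>B\<close> from the op-construction of the left adjoints of a bi-indexed
 category to the total category of its right adjoints. It preserves identities and composition
 because the comparison cells are mate pairs (\<open>transposition_preserves\<close>), and it is 2-natural because
 the cells of transformations and modifications are mate pairs (\<open>gop1_conjugate\<close>,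
 \<open>gop2_conjugate\<close>). Since \<open>U\<close> and the Grothendieck construction after \<open>V\<close> are 2-equivalences, so is
 the op-construction (\<open>two_equivalence_cancel\<close>).

 The laws of a 2-category are checked by hand only for categories over \<open>B\<close>. The other 2-categories
 inherit them along injective maps that preserve the operations (\<open>two_category_reflect\<close>).
\<close>

section \<open>Calculating in categories and 2-categories\<close>

abbreviation comp_in :: "'m => ('o, 'm) cat => 'm => 'm"  ("_ *[_] _" [66, 0, 65] 65) where
 "g *[C] f \<equiv> Comp C g f"

abbreviation hcomp_in :: "'c => ('x, 'f, 'c) two_cat => 'c => 'c"  ("_ \<star>[_] _" [66, 0, 65] 65) where
 "v \<star>[K] u \<equiv> HComp K v u"

lemma category_Arr [simp]:
 assumes "category C" "f \<in> Arr C"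
 shows "Dom C f \<in> Obj C" "Cod C f \<in> Obj C"
 using assms unfolding category_def by blast+

lemma category_Id [simp]:
 assumes "category C" "a \<in> Obj C"
 shows "Id C a \<in> Arr C" "Dom C (Id C a) = a" "Cod C (Id C a) = a"
 using assms unfolding category_def hom_def by blast+

lemma category_Comp [simp]:
 assumes "category C" "f \<in> Arr C" "g \<in> Arr C" "Dom C g = Cod C f"
 shows "g *[C] f \<in> Arr C" "Dom C (g *[C] f) = Dom C f" "Cod C (g *[C] f) = Cod C g"
 using assms unfolding category_def hom_def by blast+

lemma category_Id_right [simp]: "category C ==> f \<in> Arr C ==> Dom C f = a ==> f *[C] Id C a = f"
 unfolding category_def by blast

lemma category_Id_left [simp]: "category C ==> f \<in> Arr C ==> Cod C f = a ==> Id C a *[C] f = f"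
 unfolding category_def by blast

lemma category_assoc [simp]:
 "category C ==> f \<in> Arr C ==> g \<in> Arr C ==> h \<in> Arr C ==> Dom C g = Cod C f ==> Dom C h = Cod C g ==>
  (h *[C] g) *[C] f = h *[C] (g *[C] f)"
 by (rule sym) (unfold category_def, blast)

lemma categoryI:
 assumes "\<And>f. f \<in> Arr C ==> Dom C f \<in> Obj C" "\<And>f. f \<in> Arr C ==> Cod C f \<in> Obj C"
  and "\<And>a. a \<in> Obj C ==> Id C a \<in> hom C a a"
  and "\<And>f g. f \<in> Arr C ==> g \<in> Arr C ==> Dom C g = Cod C f ==> g *[C] f \<in> hom C (Dom C f) (Cod C g)"
  and "\<And>f. f \<in> Arr C ==> f *[C] Id C (Dom C f) = f" "\<And>f. f \<in> Arr C ==> Id C (Cod C f) *[C] f = f"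
  and "\<And>f g h. f \<in> Arr C ==> g \<in> Arr C ==> h \<in> Arr C ==> Dom C g = Cod C f ==> Dom C h = Cod C g ==>
   h *[C] (g *[C] f) = (h *[C] g) *[C] f"
 shows "category C"
 using assms unfolding category_def by blast

text \<open>
 Composites are kept associated to the right. An equation between composites therefore has to be
 available with an arbitrary further arrow on the right.
\<close>

lemma comp_comp_eq:
 assumes "category C" "g *[C] f = k" "f \<in> Arr C" "g \<in> Arr C" "Dom C g = Cod C f"
  "x \<in> Arr C" "Cod C x = Dom C f"
 shows "g *[C] (f *[C] x) = k *[C] x"
 using assms category_assoc[OF assms(1,6,3,4)] by simp

lemma comp_eq_comp:
 assumes "category C" "g *[C] f = k *[C] h" "f \<in> Arr C" "g \<in> Arr C" "Dom C g = Cod C f"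
  "h \<in> Arr C" "k \<in> Arr C" "Dom C k = Cod C h" "x \<in> Arr C" "Cod C x = Dom C f"
 shows "g *[C] (f *[C] x) = k *[C] (h *[C] x)"
 using assms category_assoc[OF assms(1,9,3,4)] category_assoc[OF assms(1,9,6,7)]
  category_Comp(2)[OF assms(1,3,4,5)] category_Comp(2)[OF assms(1,6,7,8)] by simp

lemma inverse_arrowsD:
 assumes "inverse_arrows C f g"
 shows "f \<in> Arr C" "g \<in> Arr C" "Dom C g = Cod C f" "Cod C g = Dom C f"
  "g *[C] f = Id C (Dom C f)" "f *[C] g = Id C (Cod C f)"
 using assms by (simp_all add: inverse_arrows_def hom_def)

lemma inverse_arrowsI:
 assumes "f \<in> Arr C" "g \<in> Arr C" "Dom C g = Cod C f" "Cod C g = Dom C f"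
  "g *[C] f = Id C (Dom C f)" "f *[C] g = Id C (Cod C f)"
 shows "inverse_arrows C f g"
 using assms by (simp add: inverse_arrows_def hom_def)

lemma inverse_arrows_sym: "inverse_arrows C f g ==> inverse_arrows C g f"
 by (simp add: inverse_arrows_def hom_def)

lemma inverse_arrows_unique:
 assumes C: "category C" and g: "inverse_arrows C f g" and h: "inverse_arrows C f h"
 shows "g = h"
proof -
 note [simp] = inverse_arrowsD[OF g] inverse_arrowsD[OF h] C
 have "g = (h *[C] f) *[C] g" by simp
 also have "\<dots> = h" by (subst category_assoc) simp_all
 finally show ?thesis .
qed

lemma inv_arrow_eq: "category C ==> inverse_arrows C f g ==> inv_arrow C f = g"
 unfolding inv_arrow_def using inverse_arrows_unique by (metis the_equality)

lemma inverse_inv_arrow: "category C ==> iso_arrow C f ==> inverse_arrows C f (inv_arrow C f)"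
 by (auto simp: iso_arrow_def inv_arrow_eq)

lemma inv_arrow [simp]:
 assumes "category C" "iso_arrow C f"
 shows "inv_arrow C f \<in> Arr C" "Dom C (inv_arrow C f) = Cod C f" "Cod C (inv_arrow C f) = Dom C f"
  "inv_arrow C f *[C] f = Id C (Dom C f)" "f *[C] inv_arrow C f = Id C (Cod C f)"
  "iso_arrow C (inv_arrow C f)"
 using inverse_arrowsD[OF inverse_inv_arrow[OF assms]] inverse_arrows_sym[OF inverse_inv_arrow[OF assms]]
 by (auto simp: iso_arrow_def)

lemma inv_arrow_inv_arrow: "category C ==> iso_arrow C f ==> inv_arrow C (inv_arrow C f) = f"
 by (meson inv_arrow_eq inverse_arrows_sym inverse_inv_arrow)

lemma iso_cancel_left:
 assumes "category C" "iso_arrow C i" "i \<in> Arr C" "f \<in> Arr C" "g \<in> Arr C" "Cod C f = Dom C i" "Cod C g = Dom C i"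
  and eq: "i *[C] f = i *[C] g"
 shows "f = g"
proof -
 have "(inv_arrow C i *[C] i) *[C] f = (inv_arrow C i *[C] i) *[C] g"
  by (subst (1 2) category_assoc) (use assms in simp_all)
 then show ?thesis using assms by simp
qed

lemma iso_Id [simp]: "category C ==> a \<in> Obj C ==> iso_arrow C (Id C a)"
 unfolding iso_arrow_def by (rule exI[of _ "Id C a"], rule inverse_arrowsI) simp_all

lemma inverse_arrows_Comp:
 assumes C: "category C" and f: "inverse_arrows C f f'" and g: "inverse_arrows C g g'" and gf: "Dom C g = Cod C f"
 shows "inverse_arrows C (g *[C] f) (f' *[C] g')"
proof -
 note [simp] = inverse_arrowsD[OF f] inverse_arrowsD[OF g] C gf
 have "g' *[C] (g *[C] f) = Id C (Cod C f) *[C] f" by (rule comp_comp_eq) simp_all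
 moreover have "f *[C] (f' *[C] g') = Id C (Dom C g) *[C] g'" by (rule comp_comp_eq) simp_all
 ultimately show ?thesis by (intro inverse_arrowsI) simp_all
qed

lemma iso_Comp [simp]:
 "category C ==> iso_arrow C f ==> iso_arrow C g ==> Dom C g = Cod C f ==> iso_arrow C (g *[C] f)"
 by (meson iso_arrow_def inverse_arrows_Comp)

lemma iso_arrow_Arr: "iso_arrow C f ==> f \<in> Arr C"
 by (auto simp: iso_arrow_def inverse_arrows_def)

lemma homD: assumes "f \<in> hom C a b" shows "f \<in> Arr C" "Dom C f = a" "Cod C f = b"
 using assms by (simp_all add: hom_def)

lemma homI: "f \<in> Arr C ==> Dom C f = a ==> Cod C f = b ==> f \<in> hom C a b"
 by (simp add: hom_def)

lemma preserves_catD: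
 assumes "preserves_cat C D fo fm"
 shows "a \<in> Obj C ==> fo a \<in> Obj D" "f \<in> Arr C ==> fm f \<in> Arr D"
  "f \<in> Arr C ==> Dom D (fm f) = fo (Dom C f)" "f \<in> Arr C ==> Cod D (fm f) = fo (Cod C f)"
  "a \<in> Obj C ==> fm (Id C a) = Id D (fo a)"
  "f \<in> Arr C ==> g \<in> Arr C ==> Dom C g = Cod C f ==> fm (g *[C] f) = fm g *[D] fm f"
 using assms by (simp_all add: preserves_cat_def hom_def)

lemma preserves_catI:
 assumes "\<And>a. a \<in> Obj C ==> fo a \<in> Obj D" "\<And>f. f \<in> Arr C ==> fm f \<in> hom D (fo (Dom C f)) (fo (Cod C f))"
  "\<And>a. a \<in> Obj C ==> fm (Id C a) = Id D (fo a)"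
  "\<And>f g. f \<in> Arr C ==> g \<in> Arr C ==> Dom C g = Cod C f ==> fm (g *[C] f) = fm g *[D] fm f"
 shows "preserves_cat C D fo fm"
 using assms by (simp add: preserves_cat_def)

lemma preserves_inverse:
 assumes "preserves_cat C D fo fm" "category C" "inverse_arrows C f g"
 shows "inverse_arrows D (fm f) (fm g)"
proof -
 note [simp] = preserves_catD[OF assms(1)] inverse_arrowsD[OF assms(3)] assms(2)
 have "fm g *[D] fm f = fm (g *[C] f)" "fm f *[D] fm g = fm (f *[C] g)"
  by (simp_all del: inverse_arrowsD(5,6)[OF assms(3)])
 then show ?thesis by (intro inverse_arrowsI) simp_all
qed

lemma preserves_iso: "preserves_cat C D fo fm ==> category C ==> iso_arrow C f ==> iso_arrow D (fm f)"
 by (meson iso_arrow_def preserves_inverse)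

subsection \<open>2-categories\<close>

lemma two_category_cats [simp]:
 assumes "two_category K"
 shows "category (C1 K)" "category (C2 K)" "Obj (C2 K) = Arr (C1 K)"
 using assms unfolding two_category_def by blast+

lemma two_category_sides [simp]:
 assumes "two_category K" "u \<in> Arr (C2 K)"
 shows "Dom (C2 K) u \<in> Arr (C1 K)" "Cod (C2 K) u \<in> Arr (C1 K)"
  "src0 K u \<in> Obj (C1 K)" "tgt0 K u \<in> Obj (C1 K)"
  "Dom (C1 K) (Dom (C2 K) u) = src0 K u" "Cod (C1 K) (Dom (C2 K) u) = tgt0 K u"
  "Dom (C1 K) (Cod (C2 K) u) = src0 K u" "Cod (C1 K) (Cod (C2 K) u) = tgt0 K u"
proof -
 show 1: "Dom (C2 K) u \<in> Arr (C1 K)" and "Cod (C2 K) u \<in> Arr (C1 K)"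
  using assms category_Arr[of "C2 K" u] by simp_all
 show "src0 K u \<in> Obj (C1 K)" "tgt0 K u \<in> Obj (C1 K)" using 1 assms by (simp_all add: src0_def tgt0_def)
qed (use assms in "unfold two_category_def src0_def tgt0_def, blast+")

lemma two_category_HComp [simp]:
 assumes "two_category K" "u \<in> Arr (C2 K)" "v \<in> Arr (C2 K)" "src0 K v = tgt0 K u"
 shows "v \<star>[K] u \<in> Arr (C2 K)" "Dom (C2 K) (v \<star>[K] u) = Dom (C2 K) v *[C1 K] Dom (C2 K) u"
  "Cod (C2 K) (v \<star>[K] u) = Cod (C2 K) v *[C1 K] Cod (C2 K) u"
  "src0 K (v \<star>[K] u) = src0 K u" "tgt0 K (v \<star>[K] u) = tgt0 K v"
proof -
 show "v \<star>[K] u \<in> Arr (C2 K)" and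
  1: "Dom (C2 K) (v \<star>[K] u) = Dom (C2 K) v *[C1 K] Dom (C2 K) u"
  "Cod (C2 K) (v \<star>[K] u) = Cod (C2 K) v *[C1 K] Cod (C2 K) u"
  using assms unfolding two_category_def hom_def by blast+
 show "src0 K (v \<star>[K] u) = src0 K u" "tgt0 K (v \<star>[K] u) = tgt0 K v"
  using assms unfolding src0_def[of K "v \<star>[K] u"] tgt0_def[of K "v \<star>[K] u"] 1 by simp_all
qed

lemma two_category_Id2 [simp]:
 assumes "two_category K" "f \<in> Arr (C1 K)"
 shows "src0 K (Id (C2 K) f) = Dom (C1 K) f" "tgt0 K (Id (C2 K) f) = Cod (C1 K) f"
 unfolding src0_def tgt0_def using assms by (simp_all only: two_category_cats category_Id)

lemma two_category_Comp2 [simp]: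
 assumes "two_category K" "u \<in> Arr (C2 K)" "v \<in> Arr (C2 K)" "Dom (C2 K) v = Cod (C2 K) u"
 shows "src0 K (v *[C2 K] u) = src0 K u" "tgt0 K (v *[C2 K] u) = tgt0 K u"
 unfolding src0_def tgt0_def using assms by (simp_all only: two_category_cats category_Comp)

lemma two_category_HComp_Id [simp]:
 assumes "two_category K" "f \<in> Arr (C1 K)" "g \<in> Arr (C1 K)" "Dom (C1 K) g = Cod (C1 K) f"
 shows "Id (C2 K) g \<star>[K] Id (C2 K) f = Id (C2 K) (g *[C1 K] f)"
 using assms unfolding two_category_def by blast

lemma two_category_unit [simp]:
 assumes "two_category K" "u \<in> Arr (C2 K)"
 shows "src0 K u = x ==> u \<star>[K] Id (C2 K) (Id (C1 K) x) = u"
  "tgt0 K u = x ==> Id (C2 K) (Id (C1 K) x) \<star>[K] u = u"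
 using assms unfolding two_category_def by blast+

lemma two_category_assoc [simp]:
 assumes "two_category K" "u \<in> Arr (C2 K)" "v \<in> Arr (C2 K)" "\<gamma> \<in> Arr (C2 K)"
  "src0 K v = tgt0 K u" "src0 K \<gamma> = tgt0 K v"
 shows "(\<gamma> \<star>[K] v) \<star>[K] u = \<gamma> \<star>[K] (v \<star>[K] u)"
 by (rule sym) (use assms in "unfold two_category_def, blast")

lemma two_category_interchange:
 assumes "two_category K" "u \<in> Arr (C2 K)" "u' \<in> Arr (C2 K)" "v \<in> Arr (C2 K)" "v' \<in> Arr (C2 K)"
  "Dom (C2 K) u' = Cod (C2 K) u" "Dom (C2 K) v' = Cod (C2 K) v" "src0 K v = tgt0 K u"
 shows "(v' *[C2 K] v) \<star>[K] (u' *[C2 K] u) = (v' \<star>[K] u') *[C2 K] (v \<star>[K] u)"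
 using assms unfolding two_category_def by blast

lemma two_category_HComp_eq:
 assumes "two_category K" "\<gamma> \<star>[K] v = \<delta>" "v \<in> Arr (C2 K)" "\<gamma> \<in> Arr (C2 K)" "src0 K \<gamma> = tgt0 K v"
  "u \<in> Arr (C2 K)" "src0 K v = tgt0 K u"
 shows "\<gamma> \<star>[K] (v \<star>[K] u) = \<delta> \<star>[K] u"
 using assms two_category_assoc[OF assms(1,6,3,4)] by simp

lemma two_functorD:
 assumes "two_functor K L F"
 shows "two_category K" "two_category L"
  "preserves_cat (C1 K) (C1 L) (F0 F) (F1 F)" "preserves_cat (C2 K) (C2 L) (F1 F) (F2 F)"
  "u \<in> Arr (C2 K) ==> src0 L (F2 F u) = F0 F (src0 K u)"
  "u \<in> Arr (C2 K) ==> tgt0 L (F2 F u) = F0 F (tgt0 K u)"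
  "u \<in> Arr (C2 K) ==> v \<in> Arr (C2 K) ==> src0 K v = tgt0 K u ==> F2 F (v \<star>[K] u) = F2 F v \<star>[L] F2 F u"
proof -
 show 1: "two_category K" "two_category L" and
  2: "preserves_cat (C1 K) (C1 L) (F0 F) (F1 F)" "preserves_cat (C2 K) (C2 L) (F1 F) (F2 F)"
  using assms by (simp_all add: two_functor_def)
 show "u \<in> Arr (C2 K) ==> src0 L (F2 F u) = F0 F (src0 K u)"
  "u \<in> Arr (C2 K) ==> tgt0 L (F2 F u) = F0 F (tgt0 K u)"
  unfolding src0_def tgt0_def using 1 preserves_catD[OF 2(1)] preserves_catD[OF 2(2)]
   two_category_sides(1) by fastforce+
qed (use assms in "simp add: two_functor_def")

lemmas two_functor1 = preserves_catD[OF two_functorD(3)]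
lemmas two_functor2 = preserves_catD[OF two_functorD(4)]
lemmas two_functor_simps = two_functor1 two_functor2[unfolded two_category_cats(3)[OF two_functorD(1)]] two_functorD

lemma two_category_whisker [simp]:
 assumes "two_category K" "u \<in> Arr (C2 K)" "v \<in> Arr (C2 K)" "Dom (C2 K) v = Cod (C2 K) u" "f \<in> Arr (C1 K)"
 shows "Dom (C1 K) f = tgt0 K u ==>
   Id (C2 K) f \<star>[K] (v *[C2 K] u) = (Id (C2 K) f \<star>[K] v) *[C2 K] (Id (C2 K) f \<star>[K] u)"
  "Cod (C1 K) f = src0 K u ==>
   (v *[C2 K] u) \<star>[K] Id (C2 K) f = (v \<star>[K] Id (C2 K) f) *[C2 K] (u \<star>[K] Id (C2 K) f)"
 using two_category_interchange[of K u v "Id (C2 K) f" "Id (C2 K) f"]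
  two_category_interchange[of K "Id (C2 K) f" "Id (C2 K) f" u v] assms by simp_all

lemma two_category_sides_eq:
 assumes "two_category K" "u \<in> Arr (C2 K)" "v \<in> Arr (C2 K)" "Dom (C2 K) v = Cod (C2 K) u"
 shows "src0 K v = src0 K u" "tgt0 K v = tgt0 K u"
 using two_category_sides(5,6)[OF assms(1,3)] assms by simp_all

lemma two_functorI:
 assumes "two_category K" "two_category L"
  "preserves_cat (C1 K) (C1 L) (F0 F) (F1 F)" "preserves_cat (C2 K) (C2 L) (F1 F) (F2 F)"
  "\<And>u v. u \<in> Arr (C2 K) ==> v \<in> Arr (C2 K) ==> src0 K v = tgt0 K u ==>
   F2 F (v \<star>[K] u) = F2 F v \<star>[L] F2 F u"
 shows "two_functor K L F"
 using assms by (simp add: two_functor_def)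

text \<open>
 A 2-functor can be conjugated by any family of invertible 1-cells; the family then becomes a
 2-natural isomorphism.
\<close>

lemma two_functor_conjugate:
 assumes W: "two_functor M L W"
  and s: "\<And>x. x \<in> Obj (C1 M) ==> inverse_arrows (C1 L) (s x) (s' x)"
  and P0: "\<And>x. x \<in> Obj (C1 M) ==> s x \<in> hom (C1 L) (F0 P x) (F0 W x)"
  and P1: "\<And>f. f \<in> Arr (C1 M) ==> F1 P f = s' (Cod (C1 M) f) *[C1 L] (F1 W f *[C1 L] s (Dom (C1 M) f))"
  and P2: "\<And>u. u \<in> Arr (C2 M) ==>
   F2 P u = Id (C2 L) (s' (tgt0 M u)) \<star>[L] (F2 W u \<star>[L] Id (C2 L) (s (src0 M u)))"
 shows "two_naturally_isomorphic M L P W"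
proof -
 note [simp] = two_functor_simps[OF W] P1 P2
 have [simp]: "s x \<in> Arr (C1 L)" "s' x \<in> Arr (C1 L)" "Dom (C1 L) (s x) = F0 P x" "Cod (C1 L) (s x) = F0 W x"
  "Dom (C1 L) (s' x) = F0 W x" "Cod (C1 L) (s' x) = F0 P x" "F0 P x \<in> Obj (C1 L)"
  "s' x *[C1 L] s x = Id (C1 L) (F0 P x)" "s x *[C1 L] s' x = Id (C1 L) (F0 W x)"
  if "x \<in> Obj (C1 M)" for x
  using inverse_arrowsD[OF s[OF that]] homD[OF P0[OF that]] category_Arr(1)[of "C1 L" "s x"] by simp_all
 have [simp]: "s x *[C1 L] (s' x *[C1 L] y) = y" if "x \<in> Obj (C1 M)" "y \<in> Arr (C1 L)" "Cod (C1 L) y = F0 W x" for x y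
  using comp_comp_eq[of "C1 L" "s x" "s' x"] that by simp
 have [simp]: "Id (C2 L) (s x) \<star>[L] (Id (C2 L) (s' x) \<star>[L] v) = v"
  if "x \<in> Obj (C1 M)" "v \<in> Arr (C2 L)" "tgt0 L v = F0 W x" for x v
  using two_category_HComp_eq[of L "Id (C2 L) (s x)" "Id (C2 L) (s' x)"] that by simp
 have "two_functor M L P"
 proof (rule two_functorI)
  show "preserves_cat (C1 M) (C1 L) (F0 P) (F1 P)"
   by (rule preserves_catI) (simp_all add: hom_def)
  show "preserves_cat (C2 M) (C2 L) (F1 P) (F2 P)"
  proof (rule preserves_catI)
   show "f \<in> Obj (C2 M) ==> F1 P f \<in> Obj (C2 L)" for f by simp
   show "f \<in> Obj (C2 M) ==> F2 P (Id (C2 M) f) = Id (C2 L) (F1 P f)" for f by simp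
   show "u \<in> Arr (C2 M) ==> F2 P u \<in> hom (C2 L) (F1 P (Dom (C2 M) u)) (F1 P (Cod (C2 M) u))" for u
    by (simp add: hom_def)
   show "F2 P (v *[C2 M] u) = F2 P v *[C2 L] F2 P u"
    if "u \<in> Arr (C2 M)" "v \<in> Arr (C2 M)" "Dom (C2 M) v = Cod (C2 M) u" for u v
    using that two_category_sides_eq[OF _ that] by simp
  qed
 qed simp_all
 moreover have "two_natural M L P W s"
  unfolding two_natural_def by (simp add: hom_def)
 ultimately show ?thesis
  unfolding two_naturally_isomorphic_def using W s by (auto simp: iso_arrow_def)
qed

lemma two_naturally_isomorphicI:
 assumes "two_functor K L F" "two_functor K L G" "two_natural K L F G t" "\<And>x. x \<in> Obj (C1 K) ==> iso_arrow (C1 L) (t x)"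
 shows "two_naturally_isomorphic K L F G"
 using assms by (auto simp: two_naturally_isomorphic_def)

lemma two_naturalD:
 assumes "two_natural K L F G t"
 shows "x \<in> Obj (C1 K) ==> t x \<in> Arr (C1 L)" "x \<in> Obj (C1 K) ==> Dom (C1 L) (t x) = F0 F x"
  "x \<in> Obj (C1 K) ==> Cod (C1 L) (t x) = F0 G x"
  "f \<in> Arr (C1 K) ==> t (Cod (C1 K) f) *[C1 L] F1 F f = F1 G f *[C1 L] t (Dom (C1 K) f)"
  "u \<in> Arr (C2 K) ==>
   Id (C2 L) (t (tgt0 K u)) \<star>[L] F2 F u = F2 G u \<star>[L] Id (C2 L) (t (src0 K u))"
 using assms by (simp_all add: two_natural_def hom_def)

lemma two_naturally_isomorphic_sym:
 assumes "two_naturally_isomorphic K L F G"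
 shows "two_naturally_isomorphic K L G F"
proof -
 obtain t where F: "two_functor K L F" and G: "two_functor K L G" and t: "two_natural K L F G t"
  and iso: "\<And>x. x \<in> Obj (C1 K) ==> iso_arrow (C1 L) (t x)"
  using assms by (auto simp: two_naturally_isomorphic_def)
 note [simp] = two_functor_simps[OF F] two_functor_simps[OF G] two_naturalD(1-3)[OF t] iso
 define s where "s x = inv_arrow (C1 L) (t x)" for x
 have [simp]: "s x \<in> Arr (C1 L)" "Dom (C1 L) (s x) = F0 G x" "Cod (C1 L) (s x) = F0 F x" "iso_arrow (C1 L) (s x)"
  "s x *[C1 L] t x = Id (C1 L) (F0 F x)" "t x *[C1 L] s x = Id (C1 L) (F0 G x)"
  if "x \<in> Obj (C1 K)" for x
  using that by (simp_all add: s_def)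
 have "two_natural K L G F s"
  unfolding two_natural_def
 proof (intro conjI ballI)
  fix f assume [simp]: "f \<in> Arr (C1 K)"
  let ?a = "Dom (C1 K) f" and ?b = "Cod (C1 K) f"
  have "s ?b *[C1 L] F1 G f = s ?b *[C1 L] ((F1 G f *[C1 L] t ?a) *[C1 L] s ?a)" by simp
  also have "\<dots> = (s ?b *[C1 L] t ?b) *[C1 L] (F1 F f *[C1 L] s ?a)"
   by (subst two_naturalD(4)[OF t, symmetric], simp, subst (1 2) category_assoc) simp_all
  also have "\<dots> = F1 F f *[C1 L] s ?a" by simp
  finally show "s ?b *[C1 L] F1 G f = F1 F f *[C1 L] s ?a" .
 next
  fix u assume [simp]: "u \<in> Arr (C2 K)"
  let ?S = "\<lambda>x. Id (C2 L) (s x)" and ?T = "\<lambda>x. Id (C2 L) (t x)" and ?a = "src0 K u" and ?b = "tgt0 K u"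
  have "?S ?b \<star>[L] F2 G u = ?S ?b \<star>[L] ((F2 G u \<star>[L] ?T ?a) \<star>[L] ?S ?a)" by simp
  also have "\<dots> = (?S ?b \<star>[L] ?T ?b) \<star>[L] (F2 F u \<star>[L] ?S ?a)"
   by (subst two_naturalD(5)[OF t, symmetric], simp, subst (1 2) two_category_assoc) simp_all
  also have "\<dots> = F2 F u \<star>[L] ?S ?a" by simp
  finally show "?S ?b \<star>[L] F2 G u = F2 F u \<star>[L] ?S ?a" .
 qed (simp add: hom_def)
 then show ?thesis by (rule two_naturally_isomorphicI[OF G F]) simp
qed

lemma two_naturally_isomorphic_trans [trans]:
 assumes "two_naturally_isomorphic K L F G" "two_naturally_isomorphic K L G H"
 shows "two_naturally_isomorphic K L F H"
proof -
 obtain t s where F: "two_functor K L F" and G: "two_functor K L G" and H: "two_functor K L H"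
  and t: "two_natural K L F G t" and s: "two_natural K L G H s"
  and [simp]: "\<And>x. x \<in> Obj (C1 K) ==> iso_arrow (C1 L) (t x)" "\<And>x. x \<in> Obj (C1 K) ==> iso_arrow (C1 L) (s x)"
  using assms by (auto simp: two_naturally_isomorphic_def)
 note [simp] = two_functor_simps[OF F] two_functor_simps[OF G] two_functor_simps[OF H]
  two_naturalD(1-3)[OF t] two_naturalD(1-3)[OF s]
 define r where "r x = s x *[C1 L] t x" for x
 have "two_natural K L F H r"
  unfolding two_natural_def r_def
 proof (intro conjI ballI)
  fix f assume [simp]: "f \<in> Arr (C1 K)"
  let ?a = "Dom (C1 K) f" and ?b = "Cod (C1 K) f"
  have "(s ?b *[C1 L] t ?b) *[C1 L] F1 F f = (s ?b *[C1 L] F1 G f) *[C1 L] t ?a"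
   using two_naturalD(4)[OF t] by simp
  then show "(s ?b *[C1 L] t ?b) *[C1 L] F1 F f = F1 H f *[C1 L] (s ?a *[C1 L] t ?a)"
   by (simp only: two_naturalD(4)[OF s \<open>f \<in> Arr (C1 K)\<close>]) simp
 next
  fix u assume [simp]: "u \<in> Arr (C2 K)"
  let ?S = "\<lambda>x. Id (C2 L) (s x)" and ?T = "\<lambda>x. Id (C2 L) (t x)" and ?a = "src0 K u" and ?b = "tgt0 K u"
  have "(?S ?b \<star>[L] ?T ?b) \<star>[L] F2 F u = (?S ?b \<star>[L] F2 G u) \<star>[L] ?T ?a"
   using two_naturalD(5)[OF t] by (simp del: two_category_HComp_Id)
  also have "\<dots> = F2 H u \<star>[L] (?S ?a \<star>[L] ?T ?a)"
   by (simp only: two_naturalD(5)[OF s \<open>u \<in> Arr (C2 K)\<close>]) (simp del: two_category_HComp_Id)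
  finally show "Id (C2 L) (s ?b *[C1 L] t ?b) \<star>[L] F2 F u = F2 H u \<star>[L] Id (C2 L) (s ?a *[C1 L] t ?a)"
   by simp
 qed (simp add: hom_def)
 then show ?thesis by (rule two_naturally_isomorphicI[OF F H]) (simp add: r_def)
qed

lemma two_functor_id: "two_category K ==> two_functor K K two_id"
 by (rule two_functorI) (simp_all add: two_id_def preserves_cat_def hom_def)

lemma two_functor_comp:
 assumes F: "two_functor K L F" and G: "two_functor L M G"
 shows "two_functor K M (two_comp G F)"
proof -
 note [simp] = two_functor_simps[OF F] two_functor_simps[OF G]
 show ?thesis
  by (rule two_functorI) (simp_all add: two_comp_def preserves_cat_def hom_def)
qed

lemma two_comp_id [simp]: "two_comp F two_id = F" "two_comp two_id F = F"
 by (simp_all add: two_comp_def two_id_def)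

lemma two_comp_assoc: "two_comp H (two_comp G F) = two_comp (two_comp H G) F"
 by (simp add: two_comp_def o_assoc)

lemma two_naturally_isomorphic_comp_right:
 assumes "two_naturally_isomorphic L M G H" "two_functor K L F"
 shows "two_naturally_isomorphic K M (two_comp G F) (two_comp H F)"
proof -
 obtain t where G: "two_functor L M G" and H: "two_functor L M H" and t: "two_natural L M G H t"
  and iso: "\<And>x. x \<in> Obj (C1 L) ==> iso_arrow (C1 M) (t x)"
  using assms(1) by (auto simp: two_naturally_isomorphic_def)
 note [simp] = two_functor_simps[OF G] two_functor_simps[OF H] two_functor_simps[OF assms(2)] iso two_naturalD(1-3)[OF t]
 have "two_natural K M (two_comp G F) (two_comp H F) (\<lambda>x. t (F0 F x))"
  unfolding two_natural_def two_comp_def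
 proof (intro conjI ballI)
  fix f assume [simp]: "f \<in> Arr (C1 K)"
  show "t (F0 F (Cod (C1 K) f)) *[C1 M] F1 \<lparr>F0 = F0 G \<circ> F0 F, F1 = F1 G \<circ> F1 F, F2 = F2 G \<circ> F2 F\<rparr> f =
   F1 \<lparr>F0 = F0 H \<circ> F0 F, F1 = F1 H \<circ> F1 F, F2 = F2 H \<circ> F2 F\<rparr> f *[C1 M] t (F0 F (Dom (C1 K) f))"
   using two_naturalD(4)[OF t, of "F1 F f"] by simp
 next
  fix u assume [simp]: "u \<in> Arr (C2 K)"
  show "Id (C2 M) (t (F0 F (tgt0 K u))) \<star>[M] F2 \<lparr>F0 = F0 G \<circ> F0 F, F1 = F1 G \<circ> F1 F, F2 = F2 G \<circ> F2 F\<rparr> u =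
   F2 \<lparr>F0 = F0 H \<circ> F0 F, F1 = F1 H \<circ> F1 F, F2 = F2 H \<circ> F2 F\<rparr> u \<star>[M] Id (C2 M) (t (F0 F (src0 K u)))"
   using two_naturalD(5)[OF t, of "F2 F u"] by simp
 qed (simp add: hom_def)
 then show ?thesis
  by (rule two_naturally_isomorphicI[rotated 2]) (simp_all add: two_functor_comp[OF assms(2)] G H)
qed

lemma two_naturally_isomorphic_comp_left:
 assumes "two_naturally_isomorphic K L F G" "two_functor L M H"
 shows "two_naturally_isomorphic K M (two_comp H F) (two_comp H G)"
proof -
 obtain t where F: "two_functor K L F" and G: "two_functor K L G" and t: "two_natural K L F G t"
  and iso: "\<And>x. x \<in> Obj (C1 K) ==> iso_arrow (C1 L) (t x)"
  using assms(1) by (auto simp: two_naturally_isomorphic_def)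
 note [simp] = two_functor_simps[OF F] two_functor_simps[OF G] iso two_naturalD(1-3)[OF t]
 note H = two_functor_simps[OF assms(2)]
 have "two_natural K M (two_comp H F) (two_comp H G) (\<lambda>x. F1 H (t x))"
  unfolding two_natural_def two_comp_def o_def select_convs two_ftor.select_convs
 proof (intro conjI ballI)
  fix f assume [simp]: "f \<in> Arr (C1 K)"
  have "F1 H (t (Cod (C1 K) f) *[C1 L] F1 F f) = F1 H (F1 G f *[C1 L] t (Dom (C1 K) f))"
   by (simp add: two_naturalD(4)[OF t])
  then show "F1 H (t (Cod (C1 K) f)) *[C1 M] F1 H (F1 F f) = F1 H (F1 G f) *[C1 M] F1 H (t (Dom (C1 K) f))"
   by (simp add: H)
 next
  fix u assume [simp]: "u \<in> Arr (C2 K)"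
  have "F2 H (Id (C2 L) (t (tgt0 K u)) \<star>[L] F2 F u) = F2 H (F2 G u \<star>[L] Id (C2 L) (t (src0 K u)))"
   by (simp add: two_naturalD(5)[OF t])
  then show "Id (C2 M) (F1 H (t (tgt0 K u))) \<star>[M] F2 H (F2 F u)
   = F2 H (F2 G u) \<star>[M] Id (C2 M) (F1 H (t (src0 K u)))"
   by (simp add: H)
 qed (simp add: hom_def H)
 moreover have "iso_arrow (C1 M) (F1 H (t x))" if "x \<in> Obj (C1 K)" for x
  using that by (intro preserves_iso[OF H(15)]) simp_all
 ultimately show ?thesis
  by (intro two_naturally_isomorphicI[rotated 2]) (simp_all add: two_functor_comp[OF F assms(2)] two_functor_comp[OF G assms(2)])
qed

lemma two_equivalenceI:
 assumes "two_functor K L F" "two_functor L K G"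
  "two_naturally_isomorphic K K two_id (two_comp G F)" "two_naturally_isomorphic L L (two_comp F G) two_id"
 shows "two_equivalence K L F"
 using assms by (auto simp: two_equivalence_def)

lemma two_equivalence_functor: "two_equivalence K L F ==> two_functor K L F"
 by (simp add: two_equivalence_def)

lemma two_equivalence_comp:
 assumes "two_equivalence K L F" "two_equivalence L M G"
 shows "two_equivalence K M (two_comp G F)"
proof -
 obtain F' G' where F: "two_functor K L F" "two_functor L K F'"
   "two_naturally_isomorphic K K two_id (two_comp F' F)" "two_naturally_isomorphic L L (two_comp F F') two_id"
  and G: "two_functor L M G" "two_functor M L G'"
   "two_naturally_isomorphic L L two_id (two_comp G' G)" "two_naturally_isomorphic M M (two_comp G G') two_id"
  using assms unfolding two_equivalence_def by blast
 note iso = two_naturally_isomorphic_comp_left two_naturally_isomorphic_comp_right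
 show ?thesis
 proof (rule two_equivalenceI[of _ _ _ "two_comp F' G'"])
  have "two_naturally_isomorphic K K (two_comp F' F) (two_comp F' (two_comp (two_comp G' G) F))"
   using iso(1)[OF iso(2)[OF G(3) F(1)] F(2)] by simp
  then show "two_naturally_isomorphic K K two_id (two_comp (two_comp F' G') (two_comp G F))"
   using two_naturally_isomorphic_trans[OF F(3)] by (simp add: two_comp_assoc)
  have "two_naturally_isomorphic M M (two_comp G (two_comp (two_comp F F') G')) (two_comp G G')"
   using iso(1)[OF iso(2)[OF F(4) G(2)] G(1)] by simp
  then show "two_naturally_isomorphic M M (two_comp (two_comp G F) (two_comp F' G')) two_id"
   using two_naturally_isomorphic_trans[OF _ G(4)] by (simp add: two_comp_assoc)
 qed (simp_all add: two_functor_comp[OF F(1) G(1)] two_functor_comp[OF G(2) F(2)])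
qed

text \<open>
 A quasi-inverse of \<open>P\<close> is a quasi-inverse of \<open>W\<close> followed by \<open>U\<close>: since \<open>P U \<cong> W\<close>, both composites
 reduce to those of \<open>U\<close> and \<open>W\<close> with their quasi-inverses.
\<close>

lemma two_equivalence_cancel:
 assumes U: "two_equivalence K L U" and W: "two_equivalence K J W" and P: "two_functor L J P"
  and PU: "two_naturally_isomorphic K J W (two_comp P U)"
 shows "two_equivalence L J P"
proof -
 obtain U' W' where U: "two_functor K L U" "two_functor L K U'"
   "two_naturally_isomorphic K K two_id (two_comp U' U)" "two_naturally_isomorphic L L (two_comp U U') two_id"
  and W: "two_functor K J W" "two_functor J K W'"
   "two_naturally_isomorphic K K two_id (two_comp W' W)" "two_naturally_isomorphic J J (two_comp W W') two_id"
  using U W unfolding two_equivalence_def by blast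
 note iso = two_naturally_isomorphic_comp_left two_naturally_isomorphic_comp_right
  and sym = two_naturally_isomorphic_sym and trans = two_naturally_isomorphic_trans
 have UW': "two_functor J L (two_comp U W')" using two_functor_comp[OF W(2) U(1)] .
 show ?thesis
 proof (rule two_equivalenceI[of _ _ _ "two_comp U W'"])
  have 1: "two_naturally_isomorphic L L (two_comp U U') (two_comp (two_comp U (two_comp W' W)) U')"
   using iso(2)[OF iso(1)[OF W(3) U(1)] U(2)] by simp
  have 2: "two_naturally_isomorphic L L (two_comp (two_comp U W') (two_comp W U'))
   (two_comp (two_comp U W') (two_comp (two_comp P U) U'))"
   using iso(1)[OF iso(2)[OF PU U(2)] UW'] .
  have 3: "two_naturally_isomorphic L L (two_comp (two_comp (two_comp U W') P) (two_comp U U'))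
   (two_comp (two_comp U W') P)"
   using iso(1)[OF U(4) two_functor_comp[OF P UW']] by simp
  show "two_naturally_isomorphic L L two_id (two_comp (two_comp U W') P)"
   using trans[OF trans[OF sym[OF U(4)] 1] trans[OF _ 3]] 2 by (simp add: two_comp_assoc)
  have "two_naturally_isomorphic J J (two_comp (two_comp P U) W') (two_comp W W')"
   using sym[OF iso(2)[OF PU W(2)]] .
  then show "two_naturally_isomorphic J J (two_comp P (two_comp U W')) two_id"
   using trans[OF _ W(4)] by (simp add: two_comp_assoc)
 qed (simp_all add: P UW')
qed

text \<open>
 Equality, not isomorphism, of 1-cells is required: the 2-functors below are bijective on 1-cells with
 given ends, which makes quasi-inverses strict 2-functors.
\<close>

definition locally_faithful ::
 "('x, 'f, 'c) two_cat => ('x, 'f, 'c, 'y, 'g, 'd) two_ftor => bool" where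
 "locally_faithful K F \<longleftrightarrow>
   (\<forall>f\<in>Arr (C1 K). \<forall>f'\<in>Arr (C1 K). Dom (C1 K) f = Dom (C1 K) f' --> Cod (C1 K) f = Cod (C1 K) f' -->
    F1 F f = F1 F f' --> f = f') \<and>
   (\<forall>u\<in>Arr (C2 K). \<forall>u'\<in>Arr (C2 K). Dom (C2 K) u = Dom (C2 K) u' --> Cod (C2 K) u = Cod (C2 K) u' -->
    F2 F u = F2 F u' --> u = u')"

definition locally_full ::
 "('x, 'f, 'c) two_cat => ('y, 'g, 'd) two_cat => ('x, 'f, 'c, 'y, 'g, 'd) two_ftor => bool" where
 "locally_full K L F \<longleftrightarrow>
   (\<forall>x\<in>Obj (C1 K). \<forall>y\<in>Obj (C1 K). \<forall>g\<in>hom (C1 L) (F0 F x) (F0 F y). \<exists>f\<in>hom (C1 K) x y. F1 F f = g) \<and>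
   (\<forall>f\<in>Arr (C1 K). \<forall>f'\<in>Arr (C1 K). Dom (C1 K) f = Dom (C1 K) f' --> Cod (C1 K) f = Cod (C1 K) f' -->
    (\<forall>v\<in>hom (C2 L) (F1 F f) (F1 F f'). \<exists>u\<in>hom (C2 K) f f'. F2 F u = v))"

lemma locally_faithfulD:
 assumes "locally_faithful K F"
 shows "[|F1 F f = F1 F f'; f \<in> Arr (C1 K); f' \<in> Arr (C1 K); Dom (C1 K) f = Dom (C1 K) f'; Cod (C1 K) f = Cod (C1 K) f'|]
   ==> f = f'"
  "[|F2 F u = F2 F u'; u \<in> Arr (C2 K); u' \<in> Arr (C2 K); Dom (C2 K) u = Dom (C2 K) u'; Cod (C2 K) u = Cod (C2 K) u'|]
   ==> u = u'"
 using assms unfolding locally_faithful_def by blast+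

text \<open>
 An equation between parallel cells of the form \<open>G \<dots>\<close> holds if it holds after \<open>F\<close>; so a map into the
 source of \<open>F\<close> with cells of the right boundaries is a 2-functor as soon as its composite with \<open>F\<close> is.
\<close>

lemma two_functor_reflect:
 assumes F: "two_functor K L F" and faithful: "locally_faithful K F"
  and J: "two_functor J L (two_comp F G)"
  and G0: "\<And>x. x \<in> Obj (C1 J) ==> F0 G x \<in> Obj (C1 K)"
  and G1: "\<And>f. f \<in> Arr (C1 J) ==> F1 G f \<in> hom (C1 K) (F0 G (Dom (C1 J) f)) (F0 G (Cod (C1 J) f))"
  and G2: "\<And>u. u \<in> Arr (C2 J) ==> F2 G u \<in> hom (C2 K) (F1 G (Dom (C2 J) u)) (F1 G (Cod (C2 J) u))"
 shows "two_functor J K G"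
proof -
 note [simp] = two_functor_simps[OF F] two_functor_simps[OF J, simplified two_comp_def two_ftor.simps o_apply]
  homD[OF G1] homD[OF G2] G0
 note ff = locally_faithfulD[OF faithful]
 have [simp]: "src0 K (F2 G u) = F0 G (src0 J u)" "tgt0 K (F2 G u) = F0 G (tgt0 J u)" if "u \<in> Arr (C2 J)" for u
  using that by (simp_all add: src0_def[of K "F2 G u"] tgt0_def[of K "F2 G u"] del: two_category_sides(5,6))
   simp_all
 show ?thesis
 proof (rule two_functorI)
  show "preserves_cat (C1 J) (C1 K) (F0 G) (F1 G)"
   by (rule preserves_catI) (auto intro!: G0 G1 ff)
  show "preserves_cat (C2 J) (C2 K) (F1 G) (F2 G)"
   by (rule preserves_catI) (auto intro!: G2 ff)
 qed (auto intro!: ff)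
qed

text \<open>
 A 2-functor that is an isomorphism on the hom-categories and essentially surjective has a
 quasi-inverse: on 1-cells and 2-cells it takes the unique preimage of the conjugate by the chosen
 isomorphisms.
\<close>

lemma two_equivalence_criterion:
 assumes F: "two_functor K L F" and faithful: "locally_faithful K F" and full: "locally_full K L F"
  and surj: "\<And>y. y \<in> Obj (C1 L) ==> \<exists>x\<in>Obj (C1 K). \<exists>i\<in>hom (C1 L) (F0 F x) y. iso_arrow (C1 L) i"
 shows "two_equivalence K L F"
proof -
 note [simp] = two_functor_simps[OF F]
 note ff = locally_faithfulD[OF faithful]
 obtain g0 i where gi: "\<And>y. y \<in> Obj (C1 L) ==> g0 y \<in> Obj (C1 K) \<and> i y \<in> hom (C1 L) (F0 F (g0 y)) y \<and> iso_arrow (C1 L) (i y)"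
  using surj by metis
 define j where "j y = inv_arrow (C1 L) (i y)" for y
 have [simp]: "g0 y \<in> Obj (C1 K)" "i y \<in> Arr (C1 L)" "Dom (C1 L) (i y) = F0 F (g0 y)" "Cod (C1 L) (i y) = y" "iso_arrow (C1 L) (i y)"
   "j y \<in> Arr (C1 L)" "Dom (C1 L) (j y) = y" "Cod (C1 L) (j y) = F0 F (g0 y)" "iso_arrow (C1 L) (j y)"
   "j y *[C1 L] i y = Id (C1 L) (F0 F (g0 y))" "i y *[C1 L] j y = Id (C1 L) y"
  if "y \<in> Obj (C1 L)" for y
  using gi[OF that] by (simp_all add: j_def hom_def)
 have inv: "inverse_arrows (C1 L) (i y) (j y)" if "y \<in> Obj (C1 L)" for y
  using that by (intro inverse_arrowsI) simp_all
 have full1: "\<exists>f. f \<in> hom (C1 K) x y \<and> F1 F f = g"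
  if "x \<in> Obj (C1 K)" "y \<in> Obj (C1 K)" "g \<in> hom (C1 L) (F0 F x) (F0 F y)" for x y g
  using full that unfolding locally_full_def by blast
 have "\<forall>g\<in>Arr (C1 L). \<exists>f. f \<in> hom (C1 K) (g0 (Dom (C1 L) g)) (g0 (Cod (C1 L) g)) \<and>
   F1 F f = j (Cod (C1 L) g) *[C1 L] (g *[C1 L] i (Dom (C1 L) g))"
  using full1 by (simp add: hom_def)
 then obtain g1 where g1: "\<And>g. g \<in> Arr (C1 L) ==> g1 g \<in> hom (C1 K) (g0 (Dom (C1 L) g)) (g0 (Cod (C1 L) g)) \<and>
   F1 F (g1 g) = j (Cod (C1 L) g) *[C1 L] (g *[C1 L] i (Dom (C1 L) g))"
  by metis
 have [simp]: "g1 g \<in> Arr (C1 K)" "Dom (C1 K) (g1 g) = g0 (Dom (C1 L) g)" "Cod (C1 K) (g1 g) = g0 (Cod (C1 L) g)"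
  and Fg1: "F1 F (g1 g) = j (Cod (C1 L) g) *[C1 L] (g *[C1 L] i (Dom (C1 L) g))"
  if "g \<in> Arr (C1 L)" for g
  using g1[OF that] by (simp_all add: hom_def)
 have "\<forall>\<beta>\<in>Arr (C2 L). \<exists>\<alpha>. \<alpha> \<in> hom (C2 K) (g1 (Dom (C2 L) \<beta>)) (g1 (Cod (C2 L) \<beta>)) \<and>
   F2 F \<alpha> = Id (C2 L) (j (tgt0 L \<beta>)) \<star>[L] (\<beta> \<star>[L] Id (C2 L) (i (src0 L \<beta>)))"
 proof
  fix \<beta> assume [simp]: "\<beta> \<in> Arr (C2 L)"
  show "\<exists>\<alpha>. \<alpha> \<in> hom (C2 K) (g1 (Dom (C2 L) \<beta>)) (g1 (Cod (C2 L) \<beta>)) \<and>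
   F2 F \<alpha> = Id (C2 L) (j (tgt0 L \<beta>)) \<star>[L] (\<beta> \<star>[L] Id (C2 L) (i (src0 L \<beta>)))"
  proof -
   have "Id (C2 L) (j (tgt0 L \<beta>)) \<star>[L] (\<beta> \<star>[L] Id (C2 L) (i (src0 L \<beta>)))
    \<in> hom (C2 L) (F1 F (g1 (Dom (C2 L) \<beta>))) (F1 F (g1 (Cod (C2 L) \<beta>)))"
    by (simp add: hom_def Fg1)
   moreover have "g1 (Dom (C2 L) \<beta>) \<in> Arr (C1 K)" "g1 (Cod (C2 L) \<beta>) \<in> Arr (C1 K)"
    "Dom (C1 K) (g1 (Dom (C2 L) \<beta>)) = Dom (C1 K) (g1 (Cod (C2 L) \<beta>))"
    "Cod (C1 K) (g1 (Dom (C2 L) \<beta>)) = Cod (C1 K) (g1 (Cod (C2 L) \<beta>))" by simp_all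
   ultimately show ?thesis using full unfolding locally_full_def by blast
  qed
 qed
 then obtain g2 where g2: "\<And>\<beta>. \<beta> \<in> Arr (C2 L) ==> g2 \<beta> \<in> hom (C2 K) (g1 (Dom (C2 L) \<beta>)) (g1 (Cod (C2 L) \<beta>)) \<and>
   F2 F (g2 \<beta>) = Id (C2 L) (j (tgt0 L \<beta>)) \<star>[L] (\<beta> \<star>[L] Id (C2 L) (i (src0 L \<beta>)))"
  by metis
 have [simp]: "g2 \<beta> \<in> Arr (C2 K)" "Dom (C2 K) (g2 \<beta>) = g1 (Dom (C2 L) \<beta>)" "Cod (C2 K) (g2 \<beta>) = g1 (Cod (C2 L) \<beta>)"
  and Fg2: "F2 F (g2 \<beta>) = Id (C2 L) (j (tgt0 L \<beta>)) \<star>[L] (\<beta> \<star>[L] Id (C2 L) (i (src0 L \<beta>)))"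
  if "\<beta> \<in> Arr (C2 L)" for \<beta>
  using g2[OF that] by (simp_all add: hom_def)
 have [simp]: "src0 K (g2 \<beta>) = g0 (src0 L \<beta>)" "tgt0 K (g2 \<beta>) = g0 (tgt0 L \<beta>)" if "\<beta> \<in> Arr (C2 L)" for \<beta>
  using that
  by (simp_all add: src0_def tgt0_def del: two_category_sides(5-8))
 define G where "G = \<lparr>F0 = g0, F1 = g1, F2 = g2\<rparr>"
 \<comment> \<open>By construction \<open>F G\<close> is the conjugate of the identity by the isomorphisms \<open>i\<close>.\<close>
 have FG: "two_naturally_isomorphic L L (two_comp F G) two_id"
  by (rule two_functor_conjugate[OF two_functor_id[OF two_functorD(2)[OF F]], of i j])
   (simp_all add: inv G_def two_comp_def two_id_def hom_def Fg1 Fg2)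
 then have G: "two_functor L K G"
  by (intro two_functor_reflect[OF F faithful])
   (simp_all add: two_naturally_isomorphic_def two_comp_def hom_def G_def)
 have "\<forall>x\<in>Obj (C1 K). \<exists>u. u \<in> hom (C1 K) x (g0 (F0 F x)) \<and> F1 F u = j (F0 F x)"
  "\<forall>x\<in>Obj (C1 K). \<exists>v. v \<in> hom (C1 K) (g0 (F0 F x)) x \<and> F1 F v = i (F0 F x)"
  using full1 by (simp_all add: hom_def)
 then obtain u v where "\<And>x. x \<in> Obj (C1 K) ==> u x \<in> hom (C1 K) x (g0 (F0 F x)) \<and> F1 F (u x) = j (F0 F x)"
  "\<And>x. x \<in> Obj (C1 K) ==> v x \<in> hom (C1 K) (g0 (F0 F x)) x \<and> F1 F (v x) = i (F0 F x)" by metis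
 then have [simp]: "u x \<in> Arr (C1 K)" "Dom (C1 K) (u x) = x" "Cod (C1 K) (u x) = g0 (F0 F x)" "F1 F (u x) = j (F0 F x)"
   "v x \<in> Arr (C1 K)" "Dom (C1 K) (v x) = g0 (F0 F x)" "Cod (C1 K) (v x) = x" "F1 F (v x) = i (F0 F x)"
  if "x \<in> Obj (C1 K)" for x
  using that by (simp_all add: hom_def)
 have "iso_arrow (C1 K) (u x)" if [simp]: "x \<in> Obj (C1 K)" for x
 proof -
  have "inverse_arrows (C1 K) (u x) (v x)" by (intro inverse_arrowsI ff(1)) simp_all
  then show ?thesis by (auto simp: iso_arrow_def)
 qed
 moreover have "two_natural K K two_id (two_comp G F) u"
  unfolding two_natural_def
 proof (intro conjI ballI)
  fix f assume [simp]: "f \<in> Arr (C1 K)"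
  show "u (Cod (C1 K) f) *[C1 K] F1 two_id f = F1 (two_comp G F) f *[C1 K] u (Dom (C1 K) f)"
   by (rule ff(1)) (simp_all add: two_id_def two_comp_def G_def Fg1)
 next
  fix \<alpha> assume [simp]: "\<alpha> \<in> Arr (C2 K)"
  show "Id (C2 K) (u (tgt0 K \<alpha>)) \<star>[K] F2 two_id \<alpha> = F2 (two_comp G F) \<alpha> \<star>[K] Id (C2 K) (u (src0 K \<alpha>))"
   by (rule ff(2), (simp_all add: two_id_def two_comp_def G_def Fg2)[3])
    (rule ff(1), simp_all add: two_id_def two_comp_def G_def Fg1)+
 qed (simp_all add: hom_def G_def two_id_def two_comp_def)
 ultimately have "two_naturally_isomorphic K K two_id (two_comp G F)"
  by (intro two_naturally_isomorphicI[where t = u]) (simp_all add: two_functor_id two_functor_comp[OF F G])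
 then show ?thesis using F G FG by (rule_tac two_equivalenceI)
qed

text \<open>
 Conversely, structure that is mapped injectively into a 2-category by operation preserving maps
 inherits the laws of a 2-category. This is how all the 2-categories below are obtained from that
 of categories over \<open>B\<close>.
\<close>

definition closed_graph :: "('o, 'm) cat => bool" where
 "closed_graph C \<longleftrightarrow> (\<forall>f\<in>Arr C. Dom C f \<in> Obj C \<and> Cod C f \<in> Obj C) \<and> (\<forall>a\<in>Obj C. Id C a \<in> hom C a a) \<and>
   (\<forall>f\<in>Arr C. \<forall>g\<in>Arr C. Dom C g = Cod C f --> g *[C] f \<in> hom C (Dom C f) (Cod C g))"

lemma closed_graphD:
 assumes "closed_graph C"
 shows "f \<in> Arr C ==> Dom C f \<in> Obj C" "f \<in> Arr C ==> Cod C f \<in> Obj C"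
  "a \<in> Obj C ==> Id C a \<in> Arr C" "a \<in> Obj C ==> Dom C (Id C a) = a" "a \<in> Obj C ==> Cod C (Id C a) = a"
  "f \<in> Arr C ==> g \<in> Arr C ==> Dom C g = Cod C f ==> g *[C] f \<in> Arr C"
  "f \<in> Arr C ==> g \<in> Arr C ==> Dom C g = Cod C f ==> Dom C (g *[C] f) = Dom C f"
  "f \<in> Arr C ==> g \<in> Arr C ==> Dom C g = Cod C f ==> Cod C (g *[C] f) = Cod C g"
 using assms by (simp_all add: closed_graph_def hom_def)

lemma closed_graphI:
 assumes "\<And>f. f \<in> Arr C ==> Dom C f \<in> Obj C" "\<And>f. f \<in> Arr C ==> Cod C f \<in> Obj C"
  and "\<And>a. a \<in> Obj C ==> Id C a \<in> hom C a a"
  and "\<And>f g. f \<in> Arr C ==> g \<in> Arr C ==> Dom C g = Cod C f ==> g *[C] f \<in> hom C (Dom C f) (Cod C g)"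
 shows "closed_graph C"
 using assms by (simp add: closed_graph_def)

lemma category_reflect:
 assumes C: "closed_graph C" and D: "category D" and F: "preserves_cat C D fo fm"
  and faithful: "\<And>f g. fm f = fm g ==> f \<in> Arr C ==> g \<in> Arr C ==> Dom C f = Dom C g ==> Cod C f = Cod C g ==> f = g"
 shows "category C"
proof -
 note [simp] = closed_graphD[OF C] preserves_catD[OF F] D
 show ?thesis
  by (rule categoryI) (auto intro!: faithful simp: hom_def)
qed

lemma two_category_reflect:
 assumes L: "two_category L"
  and M: "closed_graph (C1 M)" "closed_graph (C2 M)" "Obj (C2 M) = Arr (C1 M)"
   "\<And>u. u \<in> Arr (C2 M) ==> Dom (C1 M) (Cod (C2 M) u) = Dom (C1 M) (Dom (C2 M) u)"
   "\<And>u. u \<in> Arr (C2 M) ==> Cod (C1 M) (Cod (C2 M) u) = Cod (C1 M) (Dom (C2 M) u)"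
   "\<And>u v. u \<in> Arr (C2 M) ==> v \<in> Arr (C2 M) ==> src0 M v = tgt0 M u ==>
    v \<star>[M] u \<in> hom (C2 M) (Dom (C2 M) v *[C1 M] Dom (C2 M) u) (Cod (C2 M) v *[C1 M] Cod (C2 M) u)"
  and F: "preserves_cat (C1 M) (C1 L) (F0 F) (F1 F)" "preserves_cat (C2 M) (C2 L) (F1 F) (F2 F)"
   "\<And>u v. u \<in> Arr (C2 M) ==> v \<in> Arr (C2 M) ==> src0 M v = tgt0 M u ==> F2 F (v \<star>[M] u) = F2 F v \<star>[L] F2 F u"
  and faithful: "locally_faithful M F"
 shows "two_functor M L F"
proof -
 note ff = locally_faithfulD[OF faithful]
 have C1: "category (C1 M)" by (rule category_reflect[OF M(1) _ F(1) ff(1)]) (use L in simp_all)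
 have C2: "category (C2 M)" by (rule category_reflect[OF M(2) _ F(2) ff(2)]) (use L in simp_all)
 note [simp] = C1 C2 L M(3) homD[OF M(6)] preserves_catD[OF F(1)] F(3)
  preserves_catD[OF F(2), unfolded M(3)]
 have [simp]: "Dom (C2 M) u \<in> Arr (C1 M)" "Cod (C2 M) u \<in> Arr (C1 M)" "src0 M u \<in> Obj (C1 M)" "tgt0 M u \<in> Obj (C1 M)"
  and a: "Dom (C1 M) (Dom (C2 M) u) = src0 M u" "Cod (C1 M) (Dom (C2 M) u) = tgt0 M u"
   "Dom (C1 M) (Cod (C2 M) u) = src0 M u" "Cod (C1 M) (Cod (C2 M) u) = tgt0 M u"
  if "u \<in> Arr (C2 M)" for u
 proof -
  show 1: "Dom (C2 M) u \<in> Arr (C1 M)" "Cod (C2 M) u \<in> Arr (C1 M)"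
   using category_Arr[OF C2 that] M(3) by simp_all
  show "src0 M u \<in> Obj (C1 M)" "tgt0 M u \<in> Obj (C1 M)" using 1 by (simp_all add: src0_def tgt0_def)
  show "Dom (C1 M) (Dom (C2 M) u) = src0 M u" "Cod (C1 M) (Dom (C2 M) u) = tgt0 M u"
   "Dom (C1 M) (Cod (C2 M) u) = src0 M u" "Cod (C1 M) (Cod (C2 M) u) = tgt0 M u"
   using that M(4,5) by (simp_all add: src0_def tgt0_def)
 qed
 have [simp]: "src0 M (v \<star>[M] u) = src0 M u" "tgt0 M (v \<star>[M] u) = tgt0 M v"
  if "u \<in> Arr (C2 M)" "v \<in> Arr (C2 M)" "src0 M v = tgt0 M u" for u v
  using that by (simp_all add: src0_def[of M "v \<star>[M] u"] tgt0_def[of M "v \<star>[M] u"] a)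
 have [simp]: "src0 M (v *[C2 M] u) = src0 M u" "tgt0 M (v *[C2 M] u) = tgt0 M u"
  if "u \<in> Arr (C2 M)" "v \<in> Arr (C2 M)" "Dom (C2 M) v = Cod (C2 M) u" for u v
  using that by (simp_all add: src0_def[of M "v *[C2 M] u"] tgt0_def[of M "v *[C2 M] u"] a)
 have [simp]: "src0 M (Id (C2 M) f) = Dom (C1 M) f" "tgt0 M (Id (C2 M) f) = Cod (C1 M) f"
  if "f \<in> Arr (C1 M)" for f
  using that by (simp_all add: src0_def[of M "Id (C2 M) f"] tgt0_def[of M "Id (C2 M) f"])
 have [simp]: "src0 L (F2 F u) = F0 F (src0 M u)" "tgt0 L (F2 F u) = F0 F (tgt0 M u)"
  if "u \<in> Arr (C2 M)" for u
  using that by (simp_all add: src0_def[of L "F2 F u"] tgt0_def[of L "F2 F u"] a del: two_category_sides)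
 have sides: "src0 M v = src0 M u" "tgt0 M v = tgt0 M u"
  if "u \<in> Arr (C2 M)" "v \<in> Arr (C2 M)" "Dom (C2 M) v = Cod (C2 M) u" for u v
  using a(1,2)[OF that(2)] that a by simp_all
 have "two_category M"
  unfolding two_category_def
 proof (intro conjI ballI impI)
  show "Obj (C2 M) = Arr (C1 M)" by simp
  show "\<And>u v. [|u \<in> Arr (C2 M); v \<in> Arr (C2 M); src0 M v = tgt0 M u|]
    ==> v \<star>[M] u \<in> hom (C2 M) (Dom (C2 M) v *[C1 M] Dom (C2 M) u) (Cod (C2 M) v *[C1 M] Cod (C2 M) u)"
   by (rule M(6))
  fix u u' v v'
  assume [simp]: "u \<in> Arr (C2 M)" "u' \<in> Arr (C2 M)" "v \<in> Arr (C2 M)" "v' \<in> Arr (C2 M)"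
   "Dom (C2 M) u' = Cod (C2 M) u" "Dom (C2 M) v' = Cod (C2 M) v" "src0 M v = tgt0 M u"
  have [simp]: "src0 M u' = src0 M u" "tgt0 M u' = tgt0 M u" "src0 M v' = tgt0 M u" "tgt0 M v' = tgt0 M v"
   using sides[of u u'] sides[of v v'] by simp_all
  show "(v' *[C2 M] v) \<star>[M] (u' *[C2 M] u) = (v' \<star>[M] u') *[C2 M] (v \<star>[M] u)"
   by (rule ff(2)) (simp_all add: a two_category_interchange)
 next
  fix u v \<gamma> assume [simp]: "u \<in> Arr (C2 M)" "v \<in> Arr (C2 M)" "\<gamma> \<in> Arr (C2 M)" "src0 M v = tgt0 M u" "src0 M \<gamma> = tgt0 M v"
  show "\<gamma> \<star>[M] (v \<star>[M] u) = (\<gamma> \<star>[M] v) \<star>[M] u"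
   by (rule ff(2)) (simp_all add: a)
 next
  fix u assume [simp]: "u \<in> Arr (C2 M)"
  show "u \<star>[M] Id (C2 M) (Id (C1 M) (src0 M u)) = u" by (rule ff(2)) (simp_all add: a)
  show "Id (C2 M) (Id (C1 M) (tgt0 M u)) \<star>[M] u = u" by (rule ff(2)) (simp_all add: a)
 next
  fix f g assume [simp]: "f \<in> Arr (C1 M)" "g \<in> Arr (C1 M)" "Dom (C1 M) g = Cod (C1 M) f"
  show "Id (C2 M) g \<star>[M] Id (C2 M) f = Id (C2 M) (g *[C1 M] f)" by (rule ff(2)) (simp_all add: a)
 qed (simp_all add: a)
 then show ?thesis using L F by (intro two_functorI) simp_all
qed

lemma full_sub_simps [simp]:
 "C1 (full_sub K P) = (C1 K)\<lparr>Obj := {x \<in> Obj (C1 K). P x}, Arr := {f \<in> Arr (C1 K). P (Dom (C1 K) f) \<and> P (Cod (C1 K) f)}\<rparr>"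
 "C2 (full_sub K P) = (C2 K)\<lparr>Obj := {f \<in> Obj (C2 K). P (Dom (C1 K) f) \<and> P (Cod (C1 K) f)},
   Arr := {u \<in> Arr (C2 K). P (src0 K u) \<and> P (tgt0 K u)}\<rparr>"
 "HComp (full_sub K P) = HComp K"
 "src0 (full_sub K P) = src0 K" "tgt0 (full_sub K P) = tgt0 K"
 by (simp_all add: full_sub_def src0_def tgt0_def fun_eq_iff)

lemma two_category_full_sub:
 assumes "two_category K"
 shows "two_category (full_sub K P)"
proof -
 note [simp] = two_category_cats[OF assms] two_category_sides[OF assms] two_category_HComp[OF assms] assms
 have sides: "src0 K v = src0 K u" "tgt0 K v = tgt0 K u"
  if "u \<in> Arr (C2 K)" "v \<in> Arr (C2 K)" "Dom (C2 K) v = Cod (C2 K) u" for u v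
  using two_category_sides_eq[OF assms that] by simp_all
 have "two_functor (full_sub K P) K two_id"
 proof (rule two_category_reflect[OF assms])
  show "closed_graph (C1 (full_sub K P))" by (rule closed_graphI) (auto simp: hom_def)
  show "closed_graph (C2 (full_sub K P))" by (rule closed_graphI) (auto simp: hom_def sides)
  show "locally_faithful (full_sub K P) two_id" by (auto simp: locally_faithful_def two_id_def)
 qed (auto simp: hom_def two_id_def preserves_cat_def sides)
 then show ?thesis by (rule two_functorD)
qed

lemma two_functor_full_sub:
 assumes F: "two_functor K L F" and PQ: "\<And>x. x \<in> Obj (C1 K) ==> P x ==> Q (F0 F x)"
 shows "two_functor (full_sub K P) (full_sub L Q) F"
proof -
 note [simp] = two_functor_simps[OF F]
 show ?thesis
  by (rule two_functorI) (auto simp: two_category_full_sub preserves_cat_def hom_def PQ)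
qed

lemma locally_faithful_full_sub: "locally_faithful K F ==> locally_faithful (full_sub K P) F"
 unfolding locally_faithful_def by simp

lemma locally_full_full_sub:
 assumes K: "two_category K" and full: "locally_full K L F"
 shows "locally_full (full_sub K P) (full_sub L Q) F"
proof -
 note [simp] = two_category_cats[OF K]
 have [simp]: "src0 K u = Dom (C1 K) (Dom (C2 K) u)" "tgt0 K u = Cod (C1 K) (Dom (C2 K) u)" for u
  by (simp_all add: src0_def tgt0_def)
 show ?thesis
  unfolding locally_full_def
 proof (intro conjI ballI impI)
  fix x y g assume "x \<in> Obj (C1 (full_sub K P))" "y \<in> Obj (C1 (full_sub K P))"
   "g \<in> hom (C1 (full_sub L Q)) (F0 F x) (F0 F y)"
  then have "\<exists>f\<in>hom (C1 K) x y. F1 F f = g" "P x" "P y" using full unfolding locally_full_def by (auto simp: hom_def)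
  then show "\<exists>f\<in>hom (C1 (full_sub K P)) x y. F1 F f = g" by (auto simp: hom_def)
 next
  fix f f' v assume "f \<in> Arr (C1 (full_sub K P))" "f' \<in> Arr (C1 (full_sub K P))"
   "Dom (C1 (full_sub K P)) f = Dom (C1 (full_sub K P)) f'" "Cod (C1 (full_sub K P)) f = Cod (C1 (full_sub K P)) f'"
   "v \<in> hom (C2 (full_sub L Q)) (F1 F f) (F1 F f')"
  then have "\<exists>u\<in>hom (C2 K) f f'. F2 F u = v" "P (Dom (C1 K) f)" "P (Cod (C1 K) f)"
   using full unfolding locally_full_def by (auto simp: hom_def)
  then show "\<exists>u\<in>hom (C2 (full_sub K P)) f f'. F2 F u = v" by (auto simp: hom_def)
 qed
qed

section \<open>Functors and natural transformations\<close>

lemma is_functorI: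
 assumes "category (FDom F)" "category (FCod F)" "FO F \<in> extensional (Obj (FDom F))" "FM F \<in> extensional (Arr (FDom F))"
  "\<And>a. a \<in> Obj (FDom F) ==> FO F a \<in> Obj (FCod F)"
  "\<And>f. f \<in> Arr (FDom F) ==> FM F f \<in> hom (FCod F) (FO F (Dom (FDom F) f)) (FO F (Cod (FDom F) f))"
  "\<And>a. a \<in> Obj (FDom F) ==> FM F (Id (FDom F) a) = Id (FCod F) (FO F a)"
  "\<And>f g. f \<in> Arr (FDom F) ==> g \<in> Arr (FDom F) ==> Dom (FDom F) g = Cod (FDom F) f ==>
   FM F (g *[FDom F] f) = FM F g *[FCod F] FM F f"
 shows "is_functor F"
 using assms by (simp add: is_functor_def preserves_cat_def)

lemma functor_preserves: "is_functor F ==> preserves_cat (FDom F) (FCod F) (FO F) (FM F)"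
 by (simp add: is_functor_def)

lemma functor_simps [simp]:
 assumes "is_functor F"
 shows "category (FDom F)" "category (FCod F)"
  "FCod F = D ==> a \<in> Obj (FDom F) ==> FO F a \<in> Obj D"
  "FCod F = D ==> f \<in> Arr (FDom F) ==> FM F f \<in> Arr D"
  "FCod F = D ==> f \<in> Arr (FDom F) ==> Dom D (FM F f) = FO F (Dom (FDom F) f)"
  "FCod F = D ==> f \<in> Arr (FDom F) ==> Cod D (FM F f) = FO F (Cod (FDom F) f)"
  "FDom F = C ==> a \<in> Obj C ==> FM F (Id C a) = Id (FCod F) (FO F a)"
  "FDom F = C ==> f \<in> Arr C ==> g \<in> Arr C ==> Dom C g = Cod C f ==>
   FM F (g *[C] f) = FM F g *[FCod F] FM F f"
  "FCod F = D ==> iso_arrow (FDom F) f ==> iso_arrow D (FM F f)"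
proof -
 have 1: "category (FDom F)" "category (FCod F)" "preserves_cat (FDom F) (FCod F) (FO F) (FM F)"
  using assms by (simp_all add: is_functor_def)
 note 2 = preserves_catD[OF 1(3)] preserves_iso[OF 1(3) 1(1)]
 show "category (FDom F)" "category (FCod F)" by (rule 1)+
 show "FCod F = D ==> a \<in> Obj (FDom F) ==> FO F a \<in> Obj D" using 2(1) by blast
 show "FCod F = D ==> f \<in> Arr (FDom F) ==> FM F f \<in> Arr D" using 2(2) by blast
 show "FCod F = D ==> f \<in> Arr (FDom F) ==> Dom D (FM F f) = FO F (Dom (FDom F) f)" using 2(3) by blast
 show "FCod F = D ==> f \<in> Arr (FDom F) ==> Cod D (FM F f) = FO F (Cod (FDom F) f)" using 2(4) by blast
 show "FDom F = C ==> a \<in> Obj C ==> FM F (Id C a) = Id (FCod F) (FO F a)" using 2(5) by blast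
 show "FDom F = C ==> f \<in> Arr C ==> g \<in> Arr C ==> Dom C g = Cod C f ==>
   FM F (g *[C] f) = FM F g *[FCod F] FM F f" using 2(6) by blast
 show "FCod F = D ==> iso_arrow (FDom F) f ==> iso_arrow D (FM F f)" using 2(7) by blast
qed

lemma functor_extensional:
 "is_functor F ==> FO F \<in> extensional (Obj (FDom F))" "is_functor F ==> FM F \<in> extensional (Arr (FDom F))"
 unfolding is_functor_def by blast+

lemma functor_inv_arrow [simp]:
 assumes "is_functor F" "FDom F = C" "iso_arrow C f"
 shows "FM F (inv_arrow C f) = inv_arrow (FCod F) (FM F f)"
proof -
 note [simp] = assms
 have "category C" using functor_simps(1)[OF assms(1)] by simp
 moreover from this have "inverse_arrows (FDom F) f (inv_arrow C f)" by (simp add: inverse_inv_arrow)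
 ultimately show ?thesis by (intro inv_arrow_eq[symmetric] preserves_inverse[OF functor_preserves]) simp_all
qed

lemma ftor_eqI:
 assumes "is_functor F" "is_functor G" "FDom F = FDom G" "FCod F = FCod G"
  "\<And>x. x \<in> Obj (FDom G) ==> FO F x = FO G x" "\<And>f. f \<in> Arr (FDom G) ==> FM F f = FM G f"
 shows "F = G"
proof -
 have "FO F = FO G"
  by (rule extensionalityI[where A = "Obj (FDom G)"]) (use assms functor_extensional(1)[of F] functor_extensional(1)[of G] in simp_all)
 moreover have "FM F = FM G"
  by (rule extensionalityI[where A = "Arr (FDom G)"]) (use assms functor_extensional(2)[of F] functor_extensional(2)[of G] in simp_all)
 ultimately show ?thesis using assms by (cases F, cases G) simp
qed

lemma ftid_simps [simp]:
 "FDom (ftid C) = C" "FCod (ftid C) = C" "x \<in> Obj C ==> FO (ftid C) x = x" "f \<in> Arr C ==> FM (ftid C) f = f"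
 by (simp_all add: ftid_def)

lemma is_functor_ftid [simp]: "category C ==> is_functor (ftid C)"
 by (rule is_functorI) (simp_all add: hom_def, simp_all add: ftid_def)

lemma ftcomp_simps [simp]:
 "FDom (ftcomp G F) = FDom F" "FCod (ftcomp G F) = FCod G"
 "x \<in> Obj (FDom F) ==> FO (ftcomp G F) x = FO G (FO F x)" "f \<in> Arr (FDom F) ==> FM (ftcomp G F) f = FM G (FM F f)"
 by (simp_all add: ftcomp_def compose_def)

lemma is_functor_ftcomp [simp]:
 assumes "is_functor F" "is_functor G" "FDom G = FCod F"
 shows "is_functor (ftcomp G F)"
 by (rule is_functorI) (use assms in "simp_all add: hom_def", simp_all add: ftcomp_def)

lemma ftcomp_ftid [simp]:
 "is_functor F ==> FDom F = C ==> ftcomp F (ftid C) = F" "is_functor F ==> FCod F = D ==> ftcomp (ftid D) F = F"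
 by (auto intro!: ftor_eqI)

lemma ftcomp_assoc [simp]:
 "is_functor F ==> is_functor G ==> is_functor H ==> FDom G = FCod F ==> FDom H = FCod G ==>
  ftcomp (ftcomp H G) F = ftcomp H (ftcomp G F)"
 by (auto intro!: ftor_eqI)

lemma is_ntI:
 assumes "is_functor (NSrc u)" "is_functor (NTgt u)" "FDom (NSrc u) = FDom (NTgt u)" "FCod (NSrc u) = FCod (NTgt u)"
  "NMap u \<in> extensional (Obj (FDom (NTgt u)))"
  "\<And>a. a \<in> Obj (FDom (NTgt u)) ==> NMap u a \<in> hom (FCod (NTgt u)) (FO (NSrc u) a) (FO (NTgt u) a)"
  "\<And>f. f \<in> Arr (FDom (NTgt u)) ==> NMap u (Cod (FDom (NTgt u)) f) *[FCod (NTgt u)] FM (NSrc u) f =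
   FM (NTgt u) f *[FCod (NTgt u)] NMap u (Dom (FDom (NTgt u)) f)"
 shows "is_nt u"
 using assms by (simp add: is_nt_def)

lemma nt_simps [simp]:
 assumes "is_nt u"
 shows "is_functor (NSrc u)" "is_functor (NTgt u)" "FDom (NTgt u) = FDom (NSrc u)" "FCod (NTgt u) = FCod (NSrc u)"
  "FCod (NSrc u) = D ==> a \<in> Obj (FDom (NSrc u)) ==> NMap u a \<in> Arr D"
  "FCod (NSrc u) = D ==> a \<in> Obj (FDom (NSrc u)) ==> Dom D (NMap u a) = FO (NSrc u) a"
  "FCod (NSrc u) = D ==> a \<in> Obj (FDom (NSrc u)) ==> Cod D (NMap u a) = FO (NTgt u) a"
proof -
 have 1: "FCod (NSrc u) = FCod (NTgt u)" "FDom (NSrc u) = FDom (NTgt u)"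
  "\<And>a. a \<in> Obj (FDom (NSrc u)) ==> NMap u a \<in> hom (FCod (NSrc u)) (FO (NSrc u) a) (FO (NTgt u) a)"
  using assms unfolding is_nt_def by blast+
 show "is_functor (NSrc u)" "is_functor (NTgt u)" using assms unfolding is_nt_def by blast+
 show "FDom (NTgt u) = FDom (NSrc u)" "FCod (NTgt u) = FCod (NSrc u)" by (simp_all add: 1)
 show "FCod (NSrc u) = D ==> a \<in> Obj (FDom (NSrc u)) ==> NMap u a \<in> Arr D"
  "FCod (NSrc u) = D ==> a \<in> Obj (FDom (NSrc u)) ==> Dom D (NMap u a) = FO (NSrc u) a"
  "FCod (NSrc u) = D ==> a \<in> Obj (FDom (NSrc u)) ==> Cod D (NMap u a) = FO (NTgt u) a"
  using homD[OF 1(3)] by blast+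
qed

lemma nt_natural:
 assumes "is_nt u" "FDom (NSrc u) = C" "FCod (NSrc u) = D" "f \<in> Arr C" "Dom C f = a" "Cod C f = b"
 shows "NMap u b *[D] FM (NSrc u) f = FM (NTgt u) f *[D] NMap u a"
 using assms unfolding is_nt_def by blast

lemma nt_extensional: "is_nt u ==> NMap u \<in> extensional (Obj (FDom (NSrc u)))"
 unfolding is_nt_def by blast

lemma nt_eqI:
 assumes "is_nt u" "is_nt v" "NSrc u = NSrc v" "NTgt u = NTgt v"
  "\<And>a. a \<in> Obj (FDom (NSrc v)) ==> NMap u a = NMap v a"
 shows "u = v"
proof -
 have "NMap u = NMap v"
  by (rule extensionalityI[where A = "Obj (FDom (NSrc v))"])
   (use assms nt_extensional[of u] nt_extensional[of v] in simp_all)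
 then show ?thesis using assms by (cases u, cases v) simp
qed

lemma nid_simps [simp]:
 "NSrc (nid F) = F" "NTgt (nid F) = F" "a \<in> Obj (FDom F) ==> NMap (nid F) a = Id (FCod F) (FO F a)"
 by (simp_all add: nid_def)

lemma is_nt_nid [simp]: "is_functor F ==> is_nt (nid F)"
 by (rule is_ntI) (simp_all add: hom_def, simp add: nid_def)

lemma ncomp_simps [simp]:
 "NSrc (ncomp v u) = NSrc u" "NTgt (ncomp v u) = NTgt v"
 "a \<in> Obj (FDom (NSrc u)) ==> NMap (ncomp v u) a = NMap v a *[FCod (NSrc u)] NMap u a"
 by (simp_all add: ncomp_def)

lemma is_nt_ncomp [simp]:
 assumes "is_nt u" "is_nt v" "NSrc v = NTgt u"
 shows "is_nt (ncomp v u)"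
proof -
 let ?C = "FDom (NSrc u)" and ?D = "FCod (NSrc u)"
 note [simp] = assms
 have [simp]: "FDom (NTgt v) = ?C" "FCod (NTgt v) = ?D" using nt_simps(3,4)[OF assms(2)] by simp_all
 show ?thesis
 proof (rule is_ntI)
  show "NMap (ncomp v u) \<in> extensional (Obj (FDom (NTgt (ncomp v u))))" by (simp add: ncomp_def)
  fix f assume "f \<in> Arr (FDom (NTgt (ncomp v u)))"
  then have [simp]: "f \<in> Arr ?C" by simp
  let ?a = "Dom ?C f" and ?b = "Cod ?C f"
  have "(NMap v ?b *[?D] NMap u ?b) *[?D] FM (NSrc u) f = (NMap v ?b *[?D] FM (NTgt u) f) *[?D] NMap u ?a"
   by (simp add: nt_natural[OF assms(1) refl refl \<open>f \<in> Arr ?C\<close> refl refl])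
  also have "NMap v ?b *[?D] FM (NTgt u) f = FM (NTgt v) f *[?D] NMap v ?a"
   using nt_natural[OF assms(2), of ?C ?D f] by simp
  finally show "NMap (ncomp v u) (Cod (FDom (NTgt (ncomp v u))) f) *[FCod (NTgt (ncomp v u))] FM (NSrc (ncomp v u)) f =
   FM (NTgt (ncomp v u)) f *[FCod (NTgt (ncomp v u))] NMap (ncomp v u) (Dom (FDom (NTgt (ncomp v u))) f)" by simp
 qed (simp_all add: hom_def)
qed

lemma whisker_left_simps [simp]:
 "NSrc (whisker_left K u) = ftcomp K (NSrc u)" "NTgt (whisker_left K u) = ftcomp K (NTgt u)"
 "a \<in> Obj (FDom (NSrc u)) ==> NMap (whisker_left K u) a = FM K (NMap u a)"
 by (simp_all add: whisker_left_def)

lemma is_nt_whisker_left [simp]: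
 assumes "is_nt u" "is_functor K" "FDom K = FCod (NSrc u)"
 shows "is_nt (whisker_left K u)"
proof (rule is_ntI)
 note [simp] = assms
 fix f assume f: "f \<in> Arr (FDom (NTgt (whisker_left K u)))"
 let ?C = "FDom (NSrc u)" and ?D = "FCod (NSrc u)"
 have [simp]: "f \<in> Arr ?C" using f by simp
 have "FM K (NMap u (Cod ?C f) *[?D] FM (NSrc u) f) = FM K (FM (NTgt u) f *[?D] NMap u (Dom ?C f))"
  by (simp only: nt_natural[OF assms(1) refl refl \<open>f \<in> Arr ?C\<close> refl refl])
 then show "NMap (whisker_left K u) (Cod (FDom (NTgt (whisker_left K u))) f) *[FCod (NTgt (whisker_left K u))]
   FM (NSrc (whisker_left K u)) f =
  FM (NTgt (whisker_left K u)) f *[FCod (NTgt (whisker_left K u))]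
   NMap (whisker_left K u) (Dom (FDom (NTgt (whisker_left K u))) f)"
  by simp
qed (use assms in "simp_all add: hom_def", simp add: whisker_left_def)

lemma whisker_right_simps [simp]:
 "NSrc (whisker_right u H) = ftcomp (NSrc u) H" "NTgt (whisker_right u H) = ftcomp (NTgt u) H"
 "a \<in> Obj (FDom H) ==> NMap (whisker_right u H) a = NMap u (FO H a)"
 by (simp_all add: whisker_right_def)

lemma is_nt_whisker_right [simp]:
 assumes "is_nt u" "is_functor H" "FCod H = FDom (NSrc u)"
 shows "is_nt (whisker_right u H)"
proof (rule is_ntI)
 note [simp] = assms
 fix f assume f: "f \<in> Arr (FDom (NTgt (whisker_right u H)))"
 then show "NMap (whisker_right u H) (Cod (FDom (NTgt (whisker_right u H))) f) *[FCod (NTgt (whisker_right u H))]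
   FM (NSrc (whisker_right u H)) f =
  FM (NTgt (whisker_right u H)) f *[FCod (NTgt (whisker_right u H))]
   NMap (whisker_right u H) (Dom (FDom (NTgt (whisker_right u H))) f)"
  using nt_natural[OF assms(1) refl refl, of "FM H f"] by simp
qed (use assms in "simp_all add: hom_def", simp add: whisker_right_def)

lemma hcomp_simps [simp]:
 "NSrc (hcomp v u) = ftcomp (NSrc v) (NSrc u)" "NTgt (hcomp v u) = ftcomp (NTgt v) (NTgt u)"
 "is_nt u ==> a \<in> Obj (FDom (NSrc u)) ==>
  NMap (hcomp v u) a = NMap v (FO (NTgt u) a) *[FCod (NSrc v)] FM (NSrc v) (NMap u a)"
 by (simp_all add: hcomp_def)

lemma is_nt_hcomp [simp]:
 assumes "is_nt u" "is_nt v" "FDom (NSrc v) = FCod (NSrc u)"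
 shows "is_nt (hcomp v u)"
 unfolding hcomp_def using assms by simp

lemma nat_iso_iff: "is_nat_iso_between F G u \<longleftrightarrow>
 is_nt u \<and> NSrc u = F \<and> NTgt u = G \<and> (\<forall>a\<in>Obj (FDom F). iso_arrow (FCod F) (NMap u a))"
 by (auto simp: is_nat_iso_between_def is_nt_between_def)

lemma ninv_simps [simp]:
 "NSrc (ninv u) = NTgt u" "NTgt (ninv u) = NSrc u"
 "a \<in> Obj (FDom (NSrc u)) ==> NMap (ninv u) a = inv_arrow (FCod (NSrc u)) (NMap u a)"
 by (simp_all add: ninv_def)

lemma is_nt_ninv [simp]:
 assumes "is_nt u" "\<And>a. a \<in> Obj (FDom (NSrc u)) ==> iso_arrow (FCod (NSrc u)) (NMap u a)"
 shows "is_nt (ninv u)"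
proof -
 let ?C = "FDom (NSrc u)" and ?D = "FCod (NSrc u)"
 note [simp] = assms
 have nat: "inv_arrow ?D (NMap u (Cod ?C f)) *[?D] FM (NTgt u) f = FM (NSrc u) f *[?D] inv_arrow ?D (NMap u (Dom ?C f))"
  if [simp]: "f \<in> Arr ?C" for f
 proof -
  let ?a = "Dom ?C f" and ?b = "Cod ?C f"
  have "NMap u ?b *[?D] (inv_arrow ?D (NMap u ?b) *[?D] FM (NTgt u) f) = Id ?D (FO (NTgt u) ?b) *[?D] FM (NTgt u) f"
   by (rule comp_comp_eq) simp_all
  moreover have "NMap u ?b *[?D] (FM (NSrc u) f *[?D] inv_arrow ?D (NMap u ?a)) =
    FM (NTgt u) f *[?D] (NMap u ?a *[?D] inv_arrow ?D (NMap u ?a))"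
   by (rule comp_eq_comp) (simp_all add: nt_natural[OF assms(1), of ?C ?D f])
  ultimately show ?thesis
   by - (rule iso_cancel_left[of ?D "NMap u ?b"], simp_all)
 qed
 show ?thesis
  by (rule is_ntI) (simp_all add: hom_def nat, simp add: ninv_def)
qed

lemma ninv_ninv:
 assumes "is_nt u" "\<And>a. a \<in> Obj (FDom (NSrc u)) ==> iso_arrow (FCod (NSrc u)) (NMap u a)"
 shows "ninv (ninv u) = u"
 using assms by (intro nt_eqI is_nt_ninv) (simp_all add: inv_arrow_inv_arrow)

text \<open>
 A functor that is bijective on objects and on arrows is invertible; this is how isomorphisms over
 \<open>B\<close> are recognized.
\<close>

lemma functor_inverse:
 assumes F: "is_functor F" and FO: "bij_betw (FO F) (Obj (FDom F)) (Obj (FCod F))"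
  and FM: "bij_betw (FM F) (Arr (FDom F)) (Arr (FCod F))"
 obtains G where "is_functor G" "FDom G = FCod F" "FCod G = FDom F" "ftcomp G F = ftid (FDom F)" "ftcomp F G = ftid (FCod F)"
proof -
 let ?C = "FDom F" and ?D = "FCod F"
 note [simp] = F
 define G where "G = \<lparr>FDom = ?D, FCod = ?C, FO = (\<lambda>a\<in>Obj ?D. the_inv_into (Obj ?C) (FO F) a),
  FM = (\<lambda>f\<in>Arr ?D. the_inv_into (Arr ?C) (FM F) f)\<rparr>"
 have [simp]: "FDom G = ?D" "FCod G = ?C" by (simp_all add: G_def)
 have injO: "inj_on (FO F) (Obj ?C)" and injM: "inj_on (FM F) (Arr ?C)"
  using FO FM by (simp_all add: bij_betw_def)
 have [simp]: "FO G a \<in> Obj ?C" "FO F (FO G a) = a" if "a \<in> Obj ?D" for a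
  using that bij_betw_apply[OF bij_betw_the_inv_into[OF FO]] f_the_inv_into_f_bij_betw[OF FO] by (simp_all add: G_def)
 have [simp]: "FM G f \<in> Arr ?C" "FM F (FM G f) = f" if "f \<in> Arr ?D" for f
  using that bij_betw_apply[OF bij_betw_the_inv_into[OF FM]] f_the_inv_into_f_bij_betw[OF FM] by (simp_all add: G_def)
 have Dom: "Dom ?C (FM G f) = FO G (Dom ?D f)" and Cod: "Cod ?C (FM G f) = FO G (Cod ?D f)" if [simp]: "f \<in> Arr ?D" for f
 proof -
  have "FO F (Dom ?C (FM G f)) = Dom ?D (FM F (FM G f))" by (subst functor_simps(5)[OF F]) simp_all
  then show "Dom ?C (FM G f) = FO G (Dom ?D f)" by (intro inj_onD[OF injO]) simp_all
  have "FO F (Cod ?C (FM G f)) = Cod ?D (FM F (FM G f))" by (subst functor_simps(6)[OF F]) simp_all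
  then show "Cod ?C (FM G f) = FO G (Cod ?D f)" by (intro inj_onD[OF injO]) simp_all
 qed
 have G: "is_functor G"
  by (rule is_functorI) (auto simp: hom_def Dom Cod intro!: inj_onD[OF injM], simp_all add: G_def)
 have "ftcomp G F = ftid ?C"
  by (rule ftor_eqI) (use G in "auto intro: inj_onD[OF injO] inj_onD[OF injM]")
 moreover have "ftcomp F G = ftid ?D"
  by (rule ftor_eqI) (use G in auto)
 ultimately show thesis using that[OF G] by simp
qed

section \<open>The 2-category of categories over a base\<close>

lemma object_overD [simp]:
 assumes "object_over B p"
 shows "is_functor p" "FCod p = B"
 using assms by (simp_all add: object_over_def)

lemma functor_overD:
 assumes "functor_over B (p, H, q)"
 shows "object_over B p" "object_over B q" "is_functor H" "FDom H = FDom p" "FCod H = FDom q"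
  "x \<in> Obj (FDom p) ==> FO q (FO H x) = FO p x" "f \<in> Arr (FDom p) ==> FM q (FM H f) = FM p f"
  "is_functor p" "FCod p = B" "is_functor q" "FCod q = B"
proof -
 have 1: "ftcomp q H = p" "FDom H = FDom p" using assms by (simp_all add: functor_over_def)
 have 2: "object_over B p" "object_over B q" using assms by (simp_all add: functor_over_def)
 show "is_functor p" "FCod p = B" "is_functor q" "FCod q = B" using object_overD[OF 2(1)] object_overD[OF 2(2)] by blast+
 show "x \<in> Obj (FDom p) ==> FO q (FO H x) = FO p x" "f \<in> Arr (FDom p) ==> FM q (FM H f) = FM p f"
  using ftcomp_simps(3,4)[of _ H q] 1 by auto
qed (use assms in "simp_all add: functor_over_def")

lemma functor_overI:
 assumes "object_over B p" "object_over B q" "is_functor H" "FDom H = FDom p" "FCod H = FDom q"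
  "\<And>x. x \<in> Obj (FDom p) ==> FO q (FO H x) = FO p x" "\<And>f. f \<in> Arr (FDom p) ==> FM q (FM H f) = FM p f"
 shows "functor_over B (p, H, q)"
 using assms by (auto simp: functor_over_def intro!: ftor_eqI)

lemma transformation_overD:
 assumes "transformation_over B (p, u, q)"
 shows "is_nt u" "functor_over B (p, NSrc u, q)" "functor_over B (p, NTgt u, q)"
  "e \<in> Obj (FDom p) ==> FM q (NMap u e) = Id B (FO p e)"
 using assms by (simp_all add: transformation_over_def)

lemma CAT_over_simps [simp]:
 "Obj (C1 (CAT_over B)) = {p. object_over B p}" "Arr (C1 (CAT_over B)) = {H. functor_over B H}"
 "Dom (C1 (CAT_over B)) (p, H, q) = p" "Cod (C1 (CAT_over B)) (p, H, q) = q"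
 "Id (C1 (CAT_over B)) p = (p, ftid (FDom p), p)"
 "(q', K, r) *[C1 (CAT_over B)] (p, H, q) = (p, ftcomp K H, r)"
 "Obj (C2 (CAT_over B)) = {H. functor_over B H}" "Arr (C2 (CAT_over B)) = {u. transformation_over B u}"
 "Dom (C2 (CAT_over B)) (p, u, q) = (p, NSrc u, q)" "Cod (C2 (CAT_over B)) (p, u, q) = (p, NTgt u, q)"
 "Id (C2 (CAT_over B)) (p, H, q) = (p, nid H, q)"
 "(q', v, r) *[C2 (CAT_over B)] (p, u, q) = (p, ncomp v u, q)"
 "(q', v, r) \<star>[CAT_over B] (p, u, q) = (p, hcomp v u, r)"
 "src0 (CAT_over B) (p, u, q) = p" "tgt0 (CAT_over B) (p, u, q) = q"
 by (simp_all add: CAT_over_def src0_def tgt0_def)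

lemma transformation_overI:
 assumes "is_nt u" "functor_over B (p, NSrc u, q)" "functor_over B (p, NTgt u, q)"
  "\<And>e. e \<in> Obj (FDom p) ==> FM q (NMap u e) = Id B (FO p e)"
 shows "transformation_over B (p, u, q)"
 using assms by (simp add: transformation_over_def)

lemma functor_over_id: "object_over B p ==> functor_over B (p, ftid (FDom p), p)"
 by (rule functor_overI) simp_all

lemma functor_over_comp:
 assumes H: "functor_over B (p, H, q)" and K: "functor_over B (q, K, r)"
 shows "functor_over B (p, ftcomp K H, r)"
proof -
 note [simp] = functor_overD[OF H] functor_overD[OF K]
 show ?thesis by (rule functor_overI) simp_all
qed

lemma transformation_over_id:
 assumes H: "functor_over B (p, H, q)"
 shows "transformation_over B (p, nid H, q)"
proof -
 note [simp] = functor_overD[OF H]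
 show ?thesis by (rule transformation_overI) (simp_all add: H)
qed

lemma transformation_over_comp:
 assumes a: "transformation_over B (p, u, q)" and b: "transformation_over B (p, v, q)" and ab: "NSrc v = NTgt u"
  and B: "category B"
 shows "transformation_over B (p, ncomp v u, q)"
proof -
 note [simp] = transformation_overD[OF a] transformation_overD[OF b] ab B
  functor_overD[OF transformation_overD(2)[OF a]] functor_overD[OF transformation_overD(2)[OF b]]
  functor_overD[OF transformation_overD(3)[OF a]]
 show ?thesis
  using functor_simps(3)[of p B] by (intro transformation_overI) simp_all
qed

lemma transformation_over_hcomp:
 assumes a: "transformation_over B (p, u, q)" and b: "transformation_over B (q, v, r)" and B: "category B"
 shows "transformation_over B (p, hcomp v u, r)"
proof -
 note [simp] = transformation_overD[OF a] transformation_overD[OF b] B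
  functor_overD[OF transformation_overD(2)[OF a]] functor_overD[OF transformation_overD(2)[OF b]]
  functor_overD[OF transformation_overD(3)[OF a]]  functor_overD[OF transformation_overD(3)[OF b]]
 show ?thesis
  using functor_simps(3)[of p B] functor_over_comp[OF transformation_overD(2)[OF a] transformation_overD(2)[OF b]]
   functor_over_comp[OF transformation_overD(3)[OF a] transformation_overD(3)[OF b]]
  by (intro transformation_overI) simp_all
qed

lemma category_CAT_over1: "category (C1 (CAT_over B))"
proof (rule categoryI)
 let ?C = "C1 (CAT_over B)"
 fix f assume "f \<in> Arr ?C"
 then obtain p H q where f [simp]: "f = (p, H, q)" and H: "functor_over B (p, H, q)" by (cases f) auto
 note [simp] = functor_overD[OF H]
 show "Dom ?C f \<in> Obj ?C" "Cod ?C f \<in> Obj ?C" "f *[?C] Id ?C (Dom ?C f) = f" "Id ?C (Cod ?C f) *[?C] f = f"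
  by simp_all
 fix g assume "g \<in> Arr ?C" "Dom ?C g = Cod ?C f"
 then obtain K r where g [simp]: "g = (q, K, r)" and K: "functor_over B (q, K, r)" by (cases g) auto
 note [simp] = functor_overD[OF K]
 show "g *[?C] f \<in> hom ?C (Dom ?C f) (Cod ?C g)"
  using functor_over_comp[OF H K] by (simp add: hom_def)
 fix h assume "h \<in> Arr ?C" "Dom ?C h = Cod ?C g"
 then obtain L s where h [simp]: "h = (r, L, s)" and L: "functor_over B (r, L, s)" by (cases h) auto
 note [simp] = functor_overD[OF L]
 show "h *[?C] (g *[?C] f) = (h *[?C] g) *[?C] f" by simp
qed (simp add: hom_def functor_over_id)

text \<open>
 Equality of functors and of transformations is extensional, so that every law reduces to an equation
 in the category that serves as target.
\<close>

lemma two_category_CAT_over: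
 assumes B: "category B"
 shows "two_category (CAT_over B :: (('e, 'h, 'o, 'm) ftor, ('e, 'h, 'o, 'm) over1, ('e, 'h, 'o, 'm) over2) two_cat)"
proof -
 let ?K = "CAT_over B :: (('e, 'h, 'o, 'm) ftor, ('e, 'h, 'o, 'm) over1, ('e, 'h, 'o, 'm) over2) two_cat"
 note [simp] = B
 have 2: "category (C2 ?K)"
 proof (rule categoryI)
  let ?C = "C2 ?K"
  fix f assume "f \<in> Arr ?C"
  then obtain p u q where f [simp]: "f = (p, u, q)" and a: "transformation_over B (p, u, q)" by (cases f) auto
  note [simp] = transformation_overD[OF a] functor_overD[OF transformation_overD(2)[OF a]] functor_overD[OF transformation_overD(3)[OF a]]
  show "Dom ?C f \<in> Obj ?C" "Cod ?C f \<in> Obj ?C" "f *[?C] Id ?C (Dom ?C f) = f" "Id ?C (Cod ?C f) *[?C] f = f"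
   by (auto intro!: nt_eqI)
  fix g assume "g \<in> Arr ?C" "Dom ?C g = Cod ?C f"
  then obtain v where g [simp]: "g = (p, v, q)" and b: "transformation_over B (p, v, q)" and [simp]: "NSrc v = NTgt u"
   by (cases g) auto
  note [simp] = transformation_overD[OF b] functor_overD[OF transformation_overD(3)[OF b]]
  show "g *[?C] f \<in> hom ?C (Dom ?C f) (Cod ?C g)"
   using transformation_over_comp[OF a b] by (simp add: hom_def)
  fix h assume "h \<in> Arr ?C" "Dom ?C h = Cod ?C g"
  then obtain \<gamma> where h [simp]: "h = (p, \<gamma>, q)" and c: "transformation_over B (p, \<gamma>, q)" and [simp]: "NSrc \<gamma> = NTgt v"
   by (cases h) auto
  note [simp] = transformation_overD[OF c] functor_overD[OF transformation_overD(3)[OF c]]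
  show "h *[?C] (g *[?C] f) = (h *[?C] g) *[?C] f"
   by (auto intro!: nt_eqI)
 qed (use transformation_over_id in "auto simp add: hom_def")
 show ?thesis
  unfolding two_category_def
 proof (intro conjI ballI impI)
  show "category (C1 ?K)" by (rule category_CAT_over1)
  show "category (C2 ?K)" by (rule 2)
  show "Obj (C2 ?K) = Arr (C1 ?K)" by simp
  fix u0 assume "u0 \<in> Arr (C2 ?K)"
  then obtain p u q where u0: "u0 = (p, u, q)" and a: "transformation_over B (p, u, q)" by (cases u0) auto
  note [simp] = u0 transformation_overD[OF a] functor_overD[OF transformation_overD(2)[OF a]] functor_overD[OF transformation_overD(3)[OF a]]
  show "Dom (C1 ?K) (Cod (C2 ?K) u0) = src0 ?K u0" "Cod (C1 ?K) (Cod (C2 ?K) u0) = tgt0 ?K u0" by simp_all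
  show "u0 \<star>[?K] Id (C2 ?K) (Id (C1 ?K) (src0 ?K u0)) = u0" "Id (C2 ?K) (Id (C1 ?K) (tgt0 ?K u0)) \<star>[?K] u0 = u0"
   by (auto intro!: nt_eqI)
  fix v0 assume "v0 \<in> Arr (C2 ?K)" and "src0 ?K v0 = tgt0 ?K u0"
  then obtain v r where v0: "v0 = (q, v, r)" and b: "transformation_over B (q, v, r)" by (cases v0) auto
  note [simp] = v0 transformation_overD[OF b] functor_overD[OF transformation_overD(2)[OF b]] functor_overD[OF transformation_overD(3)[OF b]]
  show "v0 \<star>[?K] u0 \<in> hom (C2 ?K) (Dom (C2 ?K) v0 *[C1 ?K] Dom (C2 ?K) u0) (Cod (C2 ?K) v0 *[C1 ?K] Cod (C2 ?K) u0)"
   using transformation_over_hcomp[OF a b] by (simp add: hom_def)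
  fix \<gamma>0 assume "\<gamma>0 \<in> Arr (C2 ?K)" and "src0 ?K \<gamma>0 = tgt0 ?K v0"
  then obtain \<gamma> s where \<gamma>0: "\<gamma>0 = (r, \<gamma>, s)" and c: "transformation_over B (r, \<gamma>, s)" by (cases \<gamma>0) auto
  note [simp] = \<gamma>0 transformation_overD[OF c] functor_overD[OF transformation_overD(2)[OF c]] functor_overD[OF transformation_overD(3)[OF c]]
  show "\<gamma>0 \<star>[?K] (v0 \<star>[?K] u0) = (\<gamma>0 \<star>[?K] v0) \<star>[?K] u0"
   by (auto intro!: nt_eqI)
 next
  fix f0 g0 assume f0: "f0 \<in> Arr (C1 ?K)" and g0: "g0 \<in> Arr (C1 ?K)" and e: "Dom (C1 ?K) g0 = Cod (C1 ?K) f0"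
  then obtain p f q g r where [simp]: "f0 = (p, f, q)" "g0 = (q, g, r)" and f: "functor_over B (p, f, q)"
   and g: "functor_over B (q, g, r)" by (cases f0, cases g0) auto
  note [simp] = functor_overD[OF f] functor_overD[OF g]
  show "Id (C2 ?K) g0 \<star>[?K] Id (C2 ?K) f0 = Id (C2 ?K) (g0 *[C1 ?K] f0)" by (auto intro!: nt_eqI)
 next
  fix u0 u1 v0 v1 assume "u0 \<in> Arr (C2 ?K)" "u1 \<in> Arr (C2 ?K)" "v0 \<in> Arr (C2 ?K)" "v1 \<in> Arr (C2 ?K)"
   and e: "Dom (C2 ?K) u1 = Cod (C2 ?K) u0" "Dom (C2 ?K) v1 = Cod (C2 ?K) v0" "src0 ?K v0 = tgt0 ?K u0"
  then obtain p u q u' v r v' where [simp]: "u0 = (p, u, q)" "v0 = (q, v, r)" "u1 = (p, u', q)" "v1 = (q, v', r)"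
    "NSrc u' = NTgt u" "NSrc v' = NTgt v"
   and a: "transformation_over B (p, u, q)" "transformation_over B (p, u', q)"
    "transformation_over B (q, v, r)" "transformation_over B (q, v', r)"
   by (cases u0, cases u1, cases v0, cases v1) auto
  note 1 = transformation_overD[OF a(1)] transformation_overD[OF a(2)] transformation_overD[OF a(3)] transformation_overD[OF a(4)]
  note [simp] = 1 functor_overD[OF 1(2)] functor_overD[OF 1(3)] functor_overD[OF 1(7)] functor_overD[OF 1(10)] functor_overD[OF 1(11)] functor_overD[OF 1(15)]
  have nat: "NMap v' (FO (NTgt u') a) *[FDom r] (FM (NTgt v) (NMap u' a) *[FDom r] x) =
    FM (NTgt v') (NMap u' a) *[FDom r] (NMap v' (FO (NTgt u) a) *[FDom r] x)"
   if "a \<in> Obj (FDom p)" "x \<in> Arr (FDom r)" "Cod (FDom r) x = FO (NTgt v) (FO (NTgt u) a)" for a x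
   using that nt_natural[OF 1(13), of "FDom q" "FDom r" "NMap u' a"] by (intro comp_eq_comp) simp_all
  have nat': "NMap v (FO (NTgt u') a) *[FDom r] (FM (NSrc v) (NMap u' a) *[FDom r] x) =
    FM (NTgt v) (NMap u' a) *[FDom r] (NMap v (FO (NTgt u) a) *[FDom r] x)"
   if "a \<in> Obj (FDom p)" "x \<in> Arr (FDom r)" "Cod (FDom r) x = FO (NSrc v) (FO (NTgt u) a)" for a x
   using that nt_natural[OF 1(9), of "FDom q" "FDom r" "NMap u' a"] by (intro comp_eq_comp) simp_all
  show "(v1 *[C2 ?K] v0) \<star>[?K] (u1 *[C2 ?K] u0) = (v1 \<star>[?K] u1) *[C2 ?K] (v0 \<star>[?K] u0)"
   by (auto simp: nat' intro!: nt_eqI)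
 qed
qed

section \<open>The Grothendieck construction\<close>

lemma op_cat_simps [simp]:
 "Obj (op_cat C) = Obj C" "Arr (op_cat C) = Arr C" "Dom (op_cat C) = Cod C" "Cod (op_cat C) = Dom C"
 "Id (op_cat C) = Id C" "g *[op_cat C] f = f *[C] g"
 by (simp_all add: op_cat_def)

abbreviation "is_oplax B \<equiv> oplax_transformation (op_cat B)"
abbreviation "is_oplax2 B \<equiv> oplax_modification (op_cat B)"
abbreviation "is_bi B \<equiv> pseudo_double_functor (HH B) ADJ"
abbreviation "is_bi1 B \<equiv> vertical_transformation (HH B) ADJ"
abbreviation "is_bi2 B \<equiv> double_modification (HH B) ADJ"

lemma category_op_cat [simp]: "category C ==> category (op_cat C)"
 by (rule categoryI) (simp_all add: hom_def)

lemma total_cat_simps [simp]: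
 "GO b e \<in> Obj (total_cat B \<Phi>) \<longleftrightarrow> b \<in> Obj B \<and> e \<in> Obj (PO \<Phi> b)"
 "GA d f h e \<in> Arr (total_cat B \<Phi>) \<longleftrightarrow> f \<in> Arr B \<and> d \<in> Obj (PO \<Phi> (Dom B f)) \<and> e \<in> Obj (PO \<Phi> (Cod B f)) \<and>
   h \<in> Arr (PO \<Phi> (Dom B f)) \<and> Dom (PO \<Phi> (Dom B f)) h = d \<and> Cod (PO \<Phi> (Dom B f)) h = FO (PM \<Phi> f) e"
 "Dom (total_cat B \<Phi>) (GA d f h e) = GO (Dom B f) d" "Cod (total_cat B \<Phi>) (GA d f h e) = GO (Cod B f) e"
 "Id (total_cat B \<Phi>) (GO b e) = GA e (Id B b) (NMap (Pdelta \<Phi> b) e) e"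
 "GA e' g k w *[total_cat B \<Phi>] GA d f h e = GA d (g *[B] f)
   (NMap (Pgamma \<Phi> f g) w *[PO \<Phi> (Dom B f)] (FM (PM \<Phi> f) k *[PO \<Phi> (Dom B f)] h)) w"
 by (auto simp: total_cat_def Let_def hom_def)

lemma total_cat_ObjE:
 assumes "x \<in> Obj (total_cat B \<Phi>)"
 obtains b e where "x = GO b e" "b \<in> Obj B" "e \<in> Obj (PO \<Phi> b)"
 using assms by (auto simp: total_cat_def)

lemma total_cat_ArrE:
 assumes "x \<in> Arr (total_cat B \<Phi>)"
 obtains d f h e where "x = GA d f h e" "f \<in> Arr B" "d \<in> Obj (PO \<Phi> (Dom B f))" "e \<in> Obj (PO \<Phi> (Cod B f))"
  "h \<in> Arr (PO \<Phi> (Dom B f))" "Dom (PO \<Phi> (Dom B f)) h = d" "Cod (PO \<Phi> (Dom B f)) h = FO (PM \<Phi> f) e"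
 using assms by (auto simp: total_cat_def hom_def)

lemma total_proj_simps [simp]:
 "FDom (total_proj B E) = E" "FCod (total_proj B E) = B"
 "x \<in> Obj E ==> FO (total_proj B E) x = ob_base x" "f \<in> Arr E ==> FM (total_proj B E) f = ar_base f"
 by (simp_all add: total_proj_def)

text \<open>
 Every arrow of the total category is an arrow of a fibre, regarded as a vertical arrow, followed
 by a Cartesian lift. These two kinds of arrows and the relations between them determine all that
 follows.
\<close>

definition vertical :: "('o, 'm) cat => ('o, 'm, ('o, 'm, 'a) univ) psftor => 'o => ('o, 'm, 'a) univ => ('o, 'm, 'a) univ" where
 "vertical B \<Phi> b h = GA (Dom (PO \<Phi> b) h) (Id B b)
   (NMap (Pdelta \<Phi> b) (Cod (PO \<Phi> b) h) *[PO \<Phi> b] h) (Cod (PO \<Phi> b) h)"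

definition lift :: "('o, 'm) cat => ('o, 'm, ('o, 'm, 'a) univ) psftor => 'm => ('o, 'm, 'a) univ => ('o, 'm, 'a) univ" where
 "lift B \<Phi> f e = GA (FO (PM \<Phi> f) e) f (Id (PO \<Phi> (Dom B f)) (FO (PM \<Phi> f) e)) e"

text \<open>
 The composition of \<open>op_cat B\<close> is rewritten in terms of \<open>B\<close>: for \<open>f : a \<rightarrow> b\<close> the functor \<open>PM \<Phi> f\<close> leads
 from the fibre over \<open>b\<close> to the fibre over \<open>a\<close>.
\<close>

locale indexed =
 fixes B :: "('o, 'm) cat" and \<Phi> :: "('o, 'm, ('o, 'm, 'a) univ) psftor"
 assumes base [simp]: "category B" and pseudo: "pseudo_functor (op_cat B) \<Phi>"
begin

lemma fibre [simp]: "b \<in> Obj B ==> category (PO \<Phi> b)"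
 using pseudo unfolding pseudo_functor_def by auto

lemma reindexing [simp]:
 assumes "f \<in> Arr B"
 shows "is_functor (PM \<Phi> f)" "FDom (PM \<Phi> f) = PO \<Phi> (Cod B f)" "FCod (PM \<Phi> f) = PO \<Phi> (Dom B f)"
proof -
 have "\<forall>f\<in>Arr B. is_functor (PM \<Phi> f) \<and> FDom (PM \<Phi> f) = PO \<Phi> (Cod B f) \<and> FCod (PM \<Phi> f) = PO \<Phi> (Dom B f)"
  using pseudo unfolding pseudo_functor_def op_cat_simps by (elim conjE)
 then show "is_functor (PM \<Phi> f)" "FDom (PM \<Phi> f) = PO \<Phi> (Cod B f)" "FCod (PM \<Phi> f) = PO \<Phi> (Dom B f)"
  using assms by blast+
qed

lemma delta [simp]:
 assumes "b \<in> Obj B"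
 shows "is_nt (Pdelta \<Phi> b)" "NSrc (Pdelta \<Phi> b) = ftid (PO \<Phi> b)" "NTgt (Pdelta \<Phi> b) = PM \<Phi> (Id B b)"
  "e \<in> Obj (PO \<Phi> b) ==> iso_arrow (PO \<Phi> b) (NMap (Pdelta \<Phi> b) e)"
proof -
 have "\<forall>a\<in>Obj B. is_nat_iso_between (ftid (PO \<Phi> a)) (PM \<Phi> (Id B a)) (Pdelta \<Phi> a)"
  using pseudo unfolding pseudo_functor_def op_cat_simps by (elim conjE)
 then show "is_nt (Pdelta \<Phi> b)" "NSrc (Pdelta \<Phi> b) = ftid (PO \<Phi> b)" "NTgt (Pdelta \<Phi> b) = PM \<Phi> (Id B b)"
  "e \<in> Obj (PO \<Phi> b) ==> iso_arrow (PO \<Phi> b) (NMap (Pdelta \<Phi> b) e)"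
  using assms by (auto simp: nat_iso_iff)
qed

lemma gamma [simp]:
 assumes "f \<in> Arr B" "g \<in> Arr B" "Dom B g = Cod B f"
 shows "is_nt (Pgamma \<Phi> f g)" "NSrc (Pgamma \<Phi> f g) = ftcomp (PM \<Phi> f) (PM \<Phi> g)" "NTgt (Pgamma \<Phi> f g) = PM \<Phi> (g *[B] f)"
  "Dom B f = a ==> e \<in> Obj (PO \<Phi> (Cod B g)) ==> iso_arrow (PO \<Phi> a) (NMap (Pgamma \<Phi> f g) e)"
proof -
 have "\<forall>g\<in>Arr B. \<forall>f\<in>Arr B. Cod B f = Dom B g --> is_nat_iso_between (ftcomp (PM \<Phi> f) (PM \<Phi> g)) (PM \<Phi> (g *[B] f)) (Pgamma \<Phi> f g)"
  using pseudo unfolding pseudo_functor_def op_cat_simps by (elim conjE)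
 then have "is_nat_iso_between (ftcomp (PM \<Phi> f) (PM \<Phi> g)) (PM \<Phi> (g *[B] f)) (Pgamma \<Phi> f g)"
  using assms by simp
 then show "is_nt (Pgamma \<Phi> f g)" "NSrc (Pgamma \<Phi> f g) = ftcomp (PM \<Phi> f) (PM \<Phi> g)" "NTgt (Pgamma \<Phi> f g) = PM \<Phi> (g *[B] f)"
  "Dom B f = a ==> e \<in> Obj (PO \<Phi> (Cod B g)) ==> iso_arrow (PO \<Phi> a) (NMap (Pgamma \<Phi> f g) e)"
  using assms by (auto simp: nat_iso_iff)
qed

lemma unit:
 assumes "f \<in> Arr B" "e \<in> Obj (PO \<Phi> (Cod B f))"
 shows "NMap (Pgamma \<Phi> f (Id B (Cod B f))) e *[PO \<Phi> (Dom B f)] FM (PM \<Phi> f) (NMap (Pdelta \<Phi> (Cod B f)) e)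
   = Id (PO \<Phi> (Dom B f)) (FO (PM \<Phi> f) e)"
  "NMap (Pgamma \<Phi> (Id B (Dom B f)) f) e *[PO \<Phi> (Dom B f)] NMap (Pdelta \<Phi> (Dom B f)) (FO (PM \<Phi> f) e)
   = Id (PO \<Phi> (Dom B f)) (FO (PM \<Phi> f) e)"
 using pseudo assms unfolding pseudo_functor_def op_cat_simps by blast+

lemma associativity:
 assumes "f \<in> Arr B" "g \<in> Arr B" "l \<in> Arr B" "Dom B g = Cod B f" "Dom B l = Cod B g" "e \<in> Obj (PO \<Phi> (Cod B l))"
 shows "NMap (Pgamma \<Phi> f (l *[B] g)) e *[PO \<Phi> (Dom B f)] FM (PM \<Phi> f) (NMap (Pgamma \<Phi> g l) e) =
  NMap (Pgamma \<Phi> (g *[B] f) l) e *[PO \<Phi> (Dom B f)] NMap (Pgamma \<Phi> f g) (FO (PM \<Phi> l) e)"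
proof -
 have *: "\<forall>f\<in>Arr B. \<forall>g\<in>Arr B. \<forall>h\<in>Arr B. Cod B g = Dom B f --> Cod B h = Dom B g -->
    (\<forall>x\<in>Obj (PO \<Phi> (Cod B f)).
     Comp (PO \<Phi> (Dom B h)) (NMap (Pgamma \<Phi> h (f *[B] g)) x) (FM (PM \<Phi> h) (NMap (Pgamma \<Phi> g f) x)) =
     Comp (PO \<Phi> (Dom B h)) (NMap (Pgamma \<Phi> (g *[B] h) f) x) (NMap (Pgamma \<Phi> h g) (FO (PM \<Phi> f) x)))"
  using pseudo unfolding pseudo_functor_def op_cat_simps by (elim conjE)
 show ?thesis
  by (rule *[rule_format]) (use assms in simp_all)
qed

lemma delta_natural:
 assumes "b \<in> Obj B" "h \<in> Arr (PO \<Phi> b)"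
 shows "FM (PM \<Phi> (Id B b)) h *[PO \<Phi> b] NMap (Pdelta \<Phi> b) (Dom (PO \<Phi> b) h) = NMap (Pdelta \<Phi> b) (Cod (PO \<Phi> b) h) *[PO \<Phi> b] h"
 using nt_natural[of "Pdelta \<Phi> b" "PO \<Phi> b" "PO \<Phi> b" h] assms by simp

lemma gamma_natural:
 assumes "f \<in> Arr B" "g \<in> Arr B" "Dom B g = Cod B f" "h \<in> Arr (PO \<Phi> (Cod B g))"
 shows "FM (PM \<Phi> (g *[B] f)) h *[PO \<Phi> (Dom B f)] NMap (Pgamma \<Phi> f g) (Dom (PO \<Phi> (Cod B g)) h) =
  NMap (Pgamma \<Phi> f g) (Cod (PO \<Phi> (Cod B g)) h) *[PO \<Phi> (Dom B f)] FM (PM \<Phi> f) (FM (PM \<Phi> g) h)"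
 using nt_natural[of "Pgamma \<Phi> f g" "PO \<Phi> (Cod B g)" "PO \<Phi> (Dom B f)" h] assms by simp

abbreviation "E \<equiv> total_cat B \<Phi>"

text \<open>
 The two sides of associativity differ by the naturality of \<open>\<gamma>\<close> and by its coherence.
\<close>

lemma category_total: "category E"
proof (rule categoryI)
 fix x assume "x \<in> Obj E"
 then show "Id E x \<in> hom E x x" by (elim total_cat_ObjE) (simp add: hom_def)
next
 fix x assume "x \<in> Arr E"
 then obtain d f h e where [simp]: "x = GA d f h e" "f \<in> Arr B" "e \<in> Obj (PO \<Phi> (Cod B f))"
  "h \<in> Arr (PO \<Phi> (Dom B f))" "Cod (PO \<Phi> (Dom B f)) h = FO (PM \<Phi> f) e" and d [simp]: "d = Dom (PO \<Phi> (Dom B f)) h"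
  by (elim total_cat_ArrE) auto
 show "Dom E x \<in> Obj E" "Cod E x \<in> Obj E" by simp_all
 have "FM (PM \<Phi> (Id B (Dom B f))) h *[PO \<Phi> (Dom B f)] NMap (Pdelta \<Phi> (Dom B f)) d =
   NMap (Pdelta \<Phi> (Dom B f)) (FO (PM \<Phi> f) e) *[PO \<Phi> (Dom B f)] h"
  using delta_natural[of "Dom B f" h] by simp
 moreover have "NMap (Pgamma \<Phi> (Id B (Dom B f)) f) e *[PO \<Phi> (Dom B f)] (NMap (Pdelta \<Phi> (Dom B f)) (FO (PM \<Phi> f) e) *[PO \<Phi> (Dom B f)] h)
  = Id (PO \<Phi> (Dom B f)) (FO (PM \<Phi> f) e) *[PO \<Phi> (Dom B f)] h"
  by (rule comp_comp_eq) (simp_all add: unit)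
 ultimately show "x *[E] Id E (Dom E x) = x" by simp
 have "NMap (Pgamma \<Phi> f (Id B (Cod B f))) e *[PO \<Phi> (Dom B f)] (FM (PM \<Phi> f) (NMap (Pdelta \<Phi> (Cod B f)) e) *[PO \<Phi> (Dom B f)] h)
  = Id (PO \<Phi> (Dom B f)) (FO (PM \<Phi> f) e) *[PO \<Phi> (Dom B f)] h"
  by (rule comp_comp_eq) (simp_all add: unit)
 then show "Id E (Cod E x) *[E] x = x" by simp
 fix y assume "y \<in> Arr E" "Dom E y = Cod E x"
 then obtain g k w where [simp]: "y = GA e g k w" "g \<in> Arr B" "w \<in> Obj (PO \<Phi> (Cod B g))" "Dom B g = Cod B f"
  "k \<in> Arr (PO \<Phi> (Cod B f))" "Dom (PO \<Phi> (Cod B f)) k = e" "Cod (PO \<Phi> (Cod B f)) k = FO (PM \<Phi> g) w"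
  by (elim total_cat_ArrE) auto
 show "y *[E] x \<in> hom E (Dom E x) (Cod E y)" by (simp add: hom_def)
 fix z assume "z \<in> Arr E" "Dom E z = Cod E y"
 then obtain l m v where [simp]: "z = GA w l m v" "l \<in> Arr B" "v \<in> Obj (PO \<Phi> (Cod B l))" "Dom B l = Cod B g"
  "m \<in> Arr (PO \<Phi> (Cod B g))" "Dom (PO \<Phi> (Cod B g)) m = w" "Cod (PO \<Phi> (Cod B g)) m = FO (PM \<Phi> l) v"
  by (elim total_cat_ArrE) auto
 let ?C = "PO \<Phi> (Dom B f)"
 have "NMap (Pgamma \<Phi> (g *[B] f) l) v *[?C] (FM (PM \<Phi> (g *[B] f)) m *[?C] (NMap (Pgamma \<Phi> f g) w *[?C] (FM (PM \<Phi> f) k *[?C] h)))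
  = NMap (Pgamma \<Phi> (g *[B] f) l) v *[?C] (NMap (Pgamma \<Phi> f g) (FO (PM \<Phi> l) v) *[?C] (FM (PM \<Phi> f) (FM (PM \<Phi> g) m) *[?C] (FM (PM \<Phi> f) k *[?C] h)))"
  using gamma_natural[of f g m] by (subst comp_eq_comp) (rule fibre | assumption | simp)+
 also have "\<dots> = NMap (Pgamma \<Phi> f (l *[B] g)) v *[?C] (FM (PM \<Phi> f) (NMap (Pgamma \<Phi> g l) v) *[?C] (FM (PM \<Phi> f) (FM (PM \<Phi> g) m) *[?C] (FM (PM \<Phi> f) k *[?C] h)))"
  by (rule comp_eq_comp) (simp_all add: associativity)
 finally show "z *[E] (y *[E] x) = (z *[E] y) *[E] x" by simp
qed

lemma object_over_total_proj [simp]: "object_over B (total_proj B E)"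
proof -
 note [simp] = category_total
 have "is_functor (total_proj B E)"
 proof (rule is_functorI)
  show "FO (total_proj B E) \<in> extensional (Obj (FDom (total_proj B E)))"
   "FM (total_proj B E) \<in> extensional (Arr (FDom (total_proj B E)))" by (simp_all add: total_proj_def)
  fix x assume "x \<in> Arr (FDom (total_proj B E))"
  then have [simp]: "x \<in> Arr E" by simp
  show "FM (total_proj B E) x \<in> hom (FCod (total_proj B E)) (FO (total_proj B E) (Dom (FDom (total_proj B E)) x)) (FO (total_proj B E) (Cod (FDom (total_proj B E)) x))"
   using \<open>x \<in> Arr E\<close> by (elim total_cat_ArrE) (auto simp: hom_def)
  fix y assume "y \<in> Arr (FDom (total_proj B E))" "Dom (FDom (total_proj B E)) y = Cod (FDom (total_proj B E)) x"
  then have [simp]: "y \<in> Arr E" "Dom E y = Cod E x" by simp_all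
  have "ar_base (y *[E] x) = ar_base y *[B] ar_base x"
   using \<open>x \<in> Arr E\<close> \<open>y \<in> Arr E\<close> by (elim total_cat_ArrE) simp
  then show "FM (total_proj B E) (y *[FDom (total_proj B E)] x) = FM (total_proj B E) y *[FCod (total_proj B E)] FM (total_proj B E) x"
   by simp
 next
  fix x assume "x \<in> Obj (FDom (total_proj B E))"
  then have "x \<in> Obj E" by simp
  then show "FO (total_proj B E) x \<in> Obj (FCod (total_proj B E))"
   "FM (total_proj B E) (Id (FDom (total_proj B E)) x) = Id (FCod (total_proj B E)) (FO (total_proj B E) x)"
   by (elim total_cat_ObjE, simp)+
 qed simp_all
 then show ?thesis by (simp add: object_over_def)
qed

lemma vertical_simps [simp]:
 assumes "b \<in> Obj B" "h \<in> Arr (PO \<Phi> b)"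
 shows "vertical B \<Phi> b h \<in> Arr E" "Dom E (vertical B \<Phi> b h) = GO b (Dom (PO \<Phi> b) h)"
  "Cod E (vertical B \<Phi> b h) = GO b (Cod (PO \<Phi> b) h)"
 using assms by (simp_all add: vertical_def)

lemma lift_simps [simp]:
 assumes "f \<in> Arr B" "e \<in> Obj (PO \<Phi> (Cod B f))"
 shows "lift B \<Phi> f e \<in> Arr E" "Dom E (lift B \<Phi> f e) = GO (Dom B f) (FO (PM \<Phi> f) e)"
  "Cod E (lift B \<Phi> f e) = GO (Cod B f) e"
 using assms by (simp_all add: lift_def)

lemma vertical_Id: "b \<in> Obj B ==> e \<in> Obj (PO \<Phi> b) ==> vertical B \<Phi> b (Id (PO \<Phi> b) e) = Id E (GO b e)"
 by (simp add: vertical_def)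

text \<open>
 In a composite with a vertical arrow the comparison isomorphisms cancel by the unit laws of the
 pseudo-functor, and only composition in a fibre remains.
\<close>

lemma vertical_comp_left:
 assumes "GA d f h e \<in> Arr E" "k \<in> Arr (PO \<Phi> (Cod B f))" "Dom (PO \<Phi> (Cod B f)) k = e" "b = Cod B f"
 shows "vertical B \<Phi> b k *[E] GA d f h e = GA d f (FM (PM \<Phi> f) k *[PO \<Phi> (Dom B f)] h) (Cod (PO \<Phi> b) k)"
proof -
 let ?C = "PO \<Phi> (Dom B f)" and ?e' = "Cod (PO \<Phi> (Cod B f)) k"
 have [simp]: "f \<in> Arr B" "d \<in> Obj (PO \<Phi> (Dom B f))" "e \<in> Obj (PO \<Phi> (Cod B f))" "h \<in> Arr ?C" "Dom ?C h = d" "Cod ?C h = FO (PM \<Phi> f) e"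
  using assms by simp_all
 note [simp] = assms(2-)
 have "NMap (Pgamma \<Phi> f (Id B (Cod B f))) ?e' *[?C] (FM (PM \<Phi> f) (NMap (Pdelta \<Phi> (Cod B f)) ?e') *[?C] (FM (PM \<Phi> f) k *[?C] h))
  = Id ?C (FO (PM \<Phi> f) ?e') *[?C] (FM (PM \<Phi> f) k *[?C] h)"
  by (rule comp_comp_eq) (simp_all add: unit)
 then show ?thesis by (simp add: vertical_def)
qed

lemma vertical_comp_right:
 assumes "GA d f h e \<in> Arr E" "k \<in> Arr (PO \<Phi> (Dom B f))" "Cod (PO \<Phi> (Dom B f)) k = d" "b = Dom B f"
 shows "GA d f h e *[E] vertical B \<Phi> b k = GA (Dom (PO \<Phi> b) k) f (h *[PO \<Phi> b] k) e"
proof -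
 let ?C = "PO \<Phi> (Dom B f)"
 have [simp]: "f \<in> Arr B" "d \<in> Obj (PO \<Phi> (Dom B f))" "e \<in> Obj (PO \<Phi> (Cod B f))" "h \<in> Arr ?C" "Dom ?C h = d" "Cod ?C h = FO (PM \<Phi> f) e"
  using assms by simp_all
 note [simp] = assms(2-)
 have "FM (PM \<Phi> (Id B (Dom B f))) h *[?C] (NMap (Pdelta \<Phi> (Dom B f)) d *[?C] k) =
   NMap (Pdelta \<Phi> (Dom B f)) (FO (PM \<Phi> f) e) *[?C] (h *[?C] k)"
  using delta_natural[of "Dom B f" h] by (intro comp_eq_comp) simp_all
 moreover have "NMap (Pgamma \<Phi> (Id B (Dom B f)) f) e *[?C] (NMap (Pdelta \<Phi> (Dom B f)) (FO (PM \<Phi> f) e) *[?C] (h *[?C] k)) =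
  Id ?C (FO (PM \<Phi> f) e) *[?C] (h *[?C] k)"
  by (rule comp_comp_eq) (simp_all add: unit)
 ultimately show ?thesis by (simp add: vertical_def)
qed

lemma vertical_Comp:
 assumes "b \<in> Obj B" "h \<in> Arr (PO \<Phi> b)" "k \<in> Arr (PO \<Phi> b)" "Dom (PO \<Phi> b) k = Cod (PO \<Phi> b) h"
 shows "vertical B \<Phi> b (k *[PO \<Phi> b] h) = vertical B \<Phi> b k *[E] vertical B \<Phi> b h"
 using vertical_comp_right[of "Dom (PO \<Phi> b) k" "Id B b" "NMap (Pdelta \<Phi> b) (Cod (PO \<Phi> b) k) *[PO \<Phi> b] k" "Cod (PO \<Phi> b) k" h b] assms
 by (simp add: vertical_def)

lemma lift_vertical:
 assumes "GA d f h e \<in> Arr E" "a = Dom B f"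
 shows "lift B \<Phi> f e *[E] vertical B \<Phi> a h = GA d f h e"
 using vertical_comp_right[of "FO (PM \<Phi> f) e" f "Id (PO \<Phi> (Dom B f)) (FO (PM \<Phi> f) e)" e h a] assms
 by (simp add: lift_def)

lemma vertical_inject:
 assumes "vertical B \<Phi> b h = vertical B \<Phi> b k" "b \<in> Obj B" "h \<in> Arr (PO \<Phi> b)" "k \<in> Arr (PO \<Phi> b)"
 shows "h = k"
proof -
 have eq: "Cod (PO \<Phi> b) k = Cod (PO \<Phi> b) h"
  "NMap (Pdelta \<Phi> b) (Cod (PO \<Phi> b) h) *[PO \<Phi> b] h = NMap (Pdelta \<Phi> b) (Cod (PO \<Phi> b) k) *[PO \<Phi> b] k"
  using assms(1) by (auto simp: vertical_def)
 show ?thesis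
  by (rule iso_cancel_left[OF _ _ _ _ _ _ _ eq(2)[unfolded eq(1)]]) (use assms(2-) eq(1) in simp_all)
qed

text \<open>
 Arrows over an identity are vertical, because \<open>\<delta>\<close> is invertible.
\<close>

lemma vertical_arrow:
 assumes "GA d (Id B b) h e \<in> Arr E" "b \<in> Obj B"
 shows "GA d (Id B b) h e = vertical B \<Phi> b (inv_arrow (PO \<Phi> b) (NMap (Pdelta \<Phi> b) e) *[PO \<Phi> b] h)"
  "inv_arrow (PO \<Phi> b) (NMap (Pdelta \<Phi> b) e) *[PO \<Phi> b] h \<in> Arr (PO \<Phi> b)"
  "Dom (PO \<Phi> b) (inv_arrow (PO \<Phi> b) (NMap (Pdelta \<Phi> b) e) *[PO \<Phi> b] h) = d"
  "Cod (PO \<Phi> b) (inv_arrow (PO \<Phi> b) (NMap (Pdelta \<Phi> b) e) *[PO \<Phi> b] h) = e"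
proof -
 let ?C = "PO \<Phi> b"
 have [simp]: "e \<in> Obj ?C" "h \<in> Arr ?C" "Dom ?C h = d" "Cod ?C h = FO (PM \<Phi> (Id B b)) e" "b \<in> Obj B"
  using assms by simp_all
 have "NMap (Pdelta \<Phi> b) e *[?C] (inv_arrow ?C (NMap (Pdelta \<Phi> b) e) *[?C] h) = Id ?C (FO (PM \<Phi> (Id B b)) e) *[?C] h"
  by (rule comp_comp_eq) simp_all
 then show "GA d (Id B b) h e = vertical B \<Phi> b (inv_arrow ?C (NMap (Pdelta \<Phi> b) e) *[?C] h)"
  by (simp add: vertical_def)
qed (use assms in simp_all)

text \<open>
 Together with functoriality of \<open>vertical\<close> and the unique factorization, the next three relations
 present the total category. They express naturality in the fibre and the effect of \<open>\<delta>\<close> and \<open>\<gamma>\<close>.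
\<close>

lemma lift_natural:
 assumes "f \<in> Arr B" "h \<in> Arr (PO \<Phi> (Cod B f))" "a = Dom B f" "b = Cod B f"
 shows "lift B \<Phi> f (Cod (PO \<Phi> b) h) *[E] vertical B \<Phi> a (FM (PM \<Phi> f) h) =
  vertical B \<Phi> b h *[E] lift B \<Phi> f (Dom (PO \<Phi> b) h)"
 using assms by (subst lift_vertical[of "FO (PM \<Phi> f) (Dom (PO \<Phi> (Cod B f)) h)"]) (simp_all add: lift_def vertical_comp_left)

lemma lift_Id:
 assumes "b \<in> Obj B" "e \<in> Obj (PO \<Phi> b)"
 shows "lift B \<Phi> (Id B b) e *[E] vertical B \<Phi> b (NMap (Pdelta \<Phi> b) e) = Id E (GO b e)"
 using assms by (subst lift_vertical[of e]) simp_all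

lemma lift_Comp:
 assumes "f \<in> Arr B" "g \<in> Arr B" "Dom B g = Cod B f" "e \<in> Obj (PO \<Phi> (Cod B g))" "a = Dom B f"
 shows "lift B \<Phi> g e *[E] lift B \<Phi> f (FO (PM \<Phi> g) e) = lift B \<Phi> (g *[B] f) e *[E] vertical B \<Phi> a (NMap (Pgamma \<Phi> f g) e)"
 using assms by (subst lift_vertical[of "FO (PM \<Phi> f) (FO (PM \<Phi> g) e)"]) (simp_all add: lift_def)

end

lemma IND_simps [simp]:
 "Obj (C1 (IND B)) = {\<Phi>. pseudo_functor (op_cat B) \<Phi>}" "Arr (C1 (IND B)) = {\<tau>. is_oplax B \<tau>}"
 "Dom (C1 (IND B)) = TSrc" "Cod (C1 (IND B)) = TTgt" "Id (C1 (IND B)) = lax_id (op_cat B)"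
 "Comp (C1 (IND B)) = oplax_comp (op_cat B)"
 "Obj (C2 (IND B)) = {\<tau>. is_oplax B \<tau>}" "Arr (C2 (IND B)) = {\<Xi>. is_oplax2 B \<Xi>}"
 "Dom (C2 (IND B)) = MSrc" "Cod (C2 (IND B)) = MTgt" "Id (C2 (IND B)) = pmod_id (op_cat B)"
 "Comp (C2 (IND B)) = pmod_comp (op_cat B)"
 "HComp (IND B) \<Theta> \<Xi> = \<lparr>MSrc = oplax_comp (op_cat B) (MSrc \<Theta>) (MSrc \<Xi>), MTgt = oplax_comp (op_cat B) (MTgt \<Theta>) (MTgt \<Xi>),
   MO = (\<lambda>a\<in>Obj B. hcomp (MO \<Theta> a) (MO \<Xi> a))\<rparr>"
 "src0 (IND B) \<Xi> = TSrc (MSrc \<Xi>)" "tgt0 (IND B) \<Xi> = TTgt (MSrc \<Xi>)"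
 by (simp_all add: IND_def Let_def src0_def tgt0_def)

text \<open>
 The values of the Grothendieck construction on 1-cells and 2-cells without their source and target
 in the 2-category of categories over \<open>B\<close>.
\<close>

definition groth1 where "groth1 B \<tau> = fst (snd (F1 (Groth B) \<tau>))"
definition groth2 where "groth2 B \<Xi> = fst (snd (F2 (Groth B) \<Xi>))"

lemma Groth_simps [simp]:
 "F0 (Groth B) \<Phi> = total_proj B (total_cat B \<Phi>)"
 "F1 (Groth B) \<tau> = (total_proj B (total_cat B (TSrc \<tau>)), groth1 B \<tau>, total_proj B (total_cat B (TTgt \<tau>)))"
 "F2 (Groth B) \<Xi> = (total_proj B (total_cat B (TSrc (MSrc \<Xi>))), groth2 B \<Xi>, total_proj B (total_cat B (TTgt (MSrc \<Xi>))))"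
 by (simp_all add: groth1_def groth2_def Groth_def Let_def)

lemma groth1_simps [simp]:
 "FDom (groth1 B \<tau>) = total_cat B (TSrc \<tau>)" "FCod (groth1 B \<tau>) = total_cat B (TTgt \<tau>)"
 "b \<in> Obj B ==> e \<in> Obj (PO (TSrc \<tau>) b) ==> FO (groth1 B \<tau>) (GO b e) = GO b (FO (TO \<tau> b) e)"
 "GA d f h e \<in> Arr (total_cat B (TSrc \<tau>)) ==> FM (groth1 B \<tau>) (GA d f h e) = GA (FO (TO \<tau> (Dom B f)) d) f
   (NMap (TM \<tau> f) e *[PO (TTgt \<tau>) (Dom B f)] FM (TO \<tau> (Dom B f)) h) (FO (TO \<tau> (Cod B f)) e)"
 by (simp_all add: groth1_def Groth_def Let_def)

lemma groth1_extensional: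
 "FO (groth1 B \<tau>) \<in> extensional (Obj (total_cat B (TSrc \<tau>)))" "FM (groth1 B \<tau>) \<in> extensional (Arr (total_cat B (TSrc \<tau>)))"
 by (simp_all add: groth1_def Groth_def Let_def)

lemma groth2_simps [simp]:
 "NSrc (groth2 B \<Xi>) = groth1 B (MSrc \<Xi>)" "NTgt (groth2 B \<Xi>) = groth1 B (MTgt \<Xi>)"
 "NMap (groth2 B \<Xi>) \<in> extensional (Obj (total_cat B (TSrc (MSrc \<Xi>))))"
 by (simp_all add: groth1_def groth2_def Groth_def Let_def)

lemma groth2_vertical:
 assumes "b \<in> Obj B" "e \<in> Obj (PO (TSrc (MSrc \<Xi>)) b)"
  "Dom (PO (TTgt (MSrc \<Xi>)) b) (NMap (MO \<Xi> b) e) = FO (TO (MSrc \<Xi>) b) e"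
  "Cod (PO (TTgt (MSrc \<Xi>)) b) (NMap (MO \<Xi> b) e) = FO (TO (MTgt \<Xi>) b) e"
 shows "NMap (groth2 B \<Xi>) (GO b e) = vertical B (TTgt (MSrc \<Xi>)) b (NMap (MO \<Xi> b) e)"
 using assms by (simp add: groth2_def Groth_def Let_def vertical_def)

text \<open>
 The data of an oplax transformation before its coherence equations. They already determine a map on
 the arrows of the total categories, whose functoriality follows from the equations.
\<close>

definition oplax_frame :: "('o, 'm) cat => ('o, 'm, 'u) ptrans => bool" where
 "oplax_frame C \<tau> \<longleftrightarrow> ptrans_frame C \<tau> \<and>
   (\<forall>f\<in>Arr C. is_nt_between (ftcomp (TO \<tau> (Cod C f)) (PM (TSrc \<tau>) f))
                (ftcomp (PM (TTgt \<tau>) f) (TO \<tau> (Dom C f))) (TM \<tau> f))"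

lemma oplax_transformation_iff:
 "is_oplax B \<tau> \<longleftrightarrow> oplax_frame (op_cat B) \<tau> \<and>
  (\<forall>b\<in>Obj B. \<forall>e\<in>Obj (PO (TSrc \<tau>) b). NMap (TM \<tau> (Id B b)) e *[PO (TTgt \<tau>) b] FM (TO \<tau> b) (NMap (Pdelta (TSrc \<tau>) b) e)
   = NMap (Pdelta (TTgt \<tau>) b) (FO (TO \<tau> b) e)) \<and>
  (\<forall>f\<in>Arr B. \<forall>g\<in>Arr B. Dom B g = Cod B f --> (\<forall>e\<in>Obj (PO (TSrc \<tau>) (Cod B g)).
   NMap (TM \<tau> (g *[B] f)) e *[PO (TTgt \<tau>) (Dom B f)] FM (TO \<tau> (Dom B f)) (NMap (Pgamma (TSrc \<tau>) f g) e) =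
   NMap (Pgamma (TTgt \<tau>) f g) (FO (TO \<tau> (Cod B g)) e) *[PO (TTgt \<tau>) (Dom B f)]
    (FM (PM (TTgt \<tau>) f) (NMap (TM \<tau> g) e) *[PO (TTgt \<tau>) (Dom B f)] NMap (TM \<tau> f) (FO (PM (TSrc \<tau>) g) e))))"
 unfolding oplax_transformation_def oplax_frame_def op_cat_simps by (auto simp: eq_commute)

lemma oplax_modification_iff:
 "is_oplax2 B \<Xi> \<longleftrightarrow>
   is_oplax B (MSrc \<Xi>) \<and> is_oplax B (MTgt \<Xi>) \<and> pmod_frame (op_cat B) \<Xi> \<and>
   (\<forall>f\<in>Arr B. \<forall>e\<in>Obj (PO (TSrc (MSrc \<Xi>)) (Cod B f)).
    NMap (TM (MTgt \<Xi>) f) e *[PO (TTgt (MSrc \<Xi>)) (Dom B f)] NMap (MO \<Xi> (Dom B f)) (FO (PM (TSrc (MSrc \<Xi>)) f) e) =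
    FM (PM (TTgt (MSrc \<Xi>)) f) (NMap (MO \<Xi> (Cod B f)) e) *[PO (TTgt (MSrc \<Xi>)) (Dom B f)] NMap (TM (MSrc \<Xi>) f) e)"
 by (simp add: oplax_modification_def)

locale indexed_pair = Phi: indexed B \<Phi> + Psi: indexed B \<Psi>
 for B :: "('o, 'm) cat" and \<Phi> :: "('o, 'm, ('o, 'm, 'a) univ) psftor" and \<Psi> :: "('o, 'm, ('o, 'm, 'a) univ) psftor"
begin

text \<open>
 A functor over \<open>B\<close> between total categories maps vertical arrows to vertical arrows, which yields
 its restrictions to the fibres, and maps the lift of \<open>f\<close> to an arrow over \<open>f\<close>, whose vertical part
 is the 2-cell at \<open>f\<close>. The equations of an oplax transformation are the images of the relations
 between vertical arrows and lifts.
\<close>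

lemma functor_over_is_groth1:
 assumes H: "functor_over B (total_proj B (total_cat B \<Phi>), H, total_proj B (total_cat B \<Psi>))"
 shows "\<exists>\<tau>. is_oplax B \<tau> \<and> TSrc \<tau> = \<Phi> \<and> TTgt \<tau> = \<Psi> \<and> groth1 B \<tau> = H"
proof -
 let ?D = "total_cat B \<Psi>" and ?E = "total_cat B \<Phi>"
 note [simp] = Phi.category_total Psi.category_total
 have [simp]: "is_functor H" "FDom H = ?E" "FCod H = ?D" using functor_overD[OF H] by simp_all
 have baseO: "ob_base (FO H x) = ob_base x" if "x \<in> Obj ?E" for x
  using functor_overD(6)[OF H, of x] that by simp
 have baseM: "ar_base (FM H x) = ar_base x" if "x \<in> Arr ?E" for x
  using functor_overD(7)[OF H, of x] that by simp
 define t where "t b e = ob_fibre (FO H (GO b e))" for b e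
 have HO [simp]: "FO H (GO b e) = GO b (t b e)" "t b e \<in> Obj (PO \<Psi> b)" if be: "b \<in> Obj B" "e \<in> Obj (PO \<Phi> b)" for b e
 proof -
  have 1: "FO H (GO b e) \<in> Obj ?D" "ob_base (FO H (GO b e)) = b" using be baseO[of "GO b e"] by simp_all
  from 1(1) obtain b' e' where "FO H (GO b e) = GO b' e'" "e' \<in> Obj (PO \<Psi> b')" by (elim total_cat_ObjE)
  then show "FO H (GO b e) = GO b (t b e)" "t b e \<in> Obj (PO \<Psi> b)" using 1(2) by (simp_all add: t_def)
 qed
 define m where "m x = ar_fibre (FM H x)" for x
 have HM: "FM H (GA d f h e) = GA (t (Dom B f) d) f (m (GA d f h e)) (t (Cod B f) e)"
   "GA (t (Dom B f) d) f (m (GA d f h e)) (t (Cod B f) e) \<in> Arr ?D" if x: "GA d f h e \<in> Arr ?E" for d f h e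
 proof -
  let ?x = "GA d f h e"
  have 1: "FM H ?x \<in> Arr ?D" "Dom ?D (FM H ?x) = FO H (Dom ?E ?x)" "Cod ?D (FM H ?x) = FO H (Cod ?E ?x)" "ar_base (FM H ?x) = f"
   using x baseM[OF x] by simp_all
  from 1(1) obtain d' f' h' e' where y: "FM H ?x = GA d' f' h' e'" by (elim total_cat_ArrE)
  have "d' = t (Dom B f) d" "e' = t (Cod B f) e" "f' = f" "h' = m ?x" using 1(2-4) x unfolding y by (simp_all add: m_def y)
  then show "FM H ?x = GA (t (Dom B f) d) f (m ?x) (t (Cod B f) e)" "GA (t (Dom B f) d) f (m ?x) (t (Cod B f) e) \<in> Arr ?D"
   using y 1(1) by simp_all
 qed
 define T where "T b h = inv_arrow (PO \<Psi> b) (NMap (Pdelta \<Psi> b) (t b (Cod (PO \<Phi> b) h))) *[PO \<Psi> b] m (vertical B \<Phi> b h)" for b h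
 have HV: "FM H (vertical B \<Phi> b h) = vertical B \<Psi> b (T b h)" and
  T [simp]: "T b h \<in> Arr (PO \<Psi> b)" "Dom (PO \<Psi> b) (T b h) = t b (Dom (PO \<Phi> b) h)" "Cod (PO \<Psi> b) (T b h) = t b (Cod (PO \<Phi> b) h)"
  if bh: "b \<in> Obj B" "h \<in> Arr (PO \<Phi> b)" for b h
 proof -
  have 1: "GA (t b (Dom (PO \<Phi> b) h)) (Id B b) (m (vertical B \<Phi> b h)) (t b (Cod (PO \<Phi> b) h)) \<in> Arr ?D"
   "FM H (vertical B \<Phi> b h) = GA (t b (Dom (PO \<Phi> b) h)) (Id B b) (m (vertical B \<Phi> b h)) (t b (Cod (PO \<Phi> b) h))"
   using HM[OF Phi.vertical_simps(1)[OF bh, unfolded vertical_def]] bh(1) unfolding vertical_def by simp_all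
  show "FM H (vertical B \<Phi> b h) = vertical B \<Psi> b (T b h)" "T b h \<in> Arr (PO \<Psi> b)"
   "Dom (PO \<Psi> b) (T b h) = t b (Dom (PO \<Phi> b) h)" "Cod (PO \<Psi> b) (T b h) = t b (Cod (PO \<Phi> b) h)"
   unfolding 1(2) T_def using Psi.vertical_arrow[OF 1(1)] bh(1) by blast+
 qed
 have T_Id: "T b (Id (PO \<Phi> b) e) = Id (PO \<Psi> b) (t b e)" if be: "b \<in> Obj B" "e \<in> Obj (PO \<Phi> b)" for b e
 proof (rule Psi.vertical_inject)
  show "vertical B \<Psi> b (T b (Id (PO \<Phi> b) e)) = vertical B \<Psi> b (Id (PO \<Psi> b) (t b e))"
   using be by (subst HV[symmetric]) (simp_all add: Phi.vertical_Id Psi.vertical_Id del: total_cat_simps(5))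
 qed (use be in simp_all)
 have T_Comp: "T b (k *[PO \<Phi> b] h) = T b k *[PO \<Psi> b] T b h"
  if bh: "b \<in> Obj B" "h \<in> Arr (PO \<Phi> b)" "k \<in> Arr (PO \<Phi> b)" "Dom (PO \<Phi> b) k = Cod (PO \<Phi> b) h" for b h k
 proof (rule Psi.vertical_inject)
  show "vertical B \<Psi> b (T b (k *[PO \<Phi> b] h)) = vertical B \<Psi> b (T b k *[PO \<Psi> b] T b h)"
   using bh by (subst HV[symmetric]) (simp_all add: Phi.vertical_Comp Psi.vertical_Comp HV)
 qed (use bh in simp_all)
 define TOb where "TOb b = \<lparr>FDom = PO \<Phi> b, FCod = PO \<Psi> b, FO = (\<lambda>e\<in>Obj (PO \<Phi> b). t b e), FM = (\<lambda>h\<in>Arr (PO \<Phi> b). T b h)\<rparr>" for b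
 have TOb [simp]: "FDom (TOb b) = PO \<Phi> b" "FCod (TOb b) = PO \<Psi> b"
  "e \<in> Obj (PO \<Phi> b) ==> FO (TOb b) e = t b e" "h \<in> Arr (PO \<Phi> b) ==> FM (TOb b) h = T b h" for b e h
  by (simp_all add: TOb_def)
 have [simp]: "is_functor (TOb b)" if "b \<in> Obj B" for b
  by (rule is_functorI) (use that in "simp_all add: hom_def T_Id T_Comp", simp_all add: TOb_def)
 define s where "s f e = m (lift B \<Phi> f e)" for f e
 have HL: "FM H (lift B \<Phi> f e) = lift B \<Psi> f (t (Cod B f) e) *[?D] vertical B \<Psi> (Dom B f) (s f e)"
  and s [simp]: "s f e \<in> Arr (PO \<Psi> (Dom B f))" "Dom (PO \<Psi> (Dom B f)) (s f e) = t (Dom B f) (FO (PM \<Phi> f) e)"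
   "Cod (PO \<Psi> (Dom B f)) (s f e) = FO (PM \<Psi> f) (t (Cod B f) e)"
  if fe: "f \<in> Arr B" "e \<in> Obj (PO \<Phi> (Cod B f))" for f e
 proof -
  have 1: "GA (t (Dom B f) (FO (PM \<Phi> f) e)) f (s f e) (t (Cod B f) e) \<in> Arr ?D"
   "FM H (lift B \<Phi> f e) = GA (t (Dom B f) (FO (PM \<Phi> f) e)) f (s f e) (t (Cod B f) e)"
   unfolding s_def using HM[OF Phi.lift_simps(1)[OF fe, unfolded lift_def]] unfolding lift_def by simp_all
  show "FM H (lift B \<Phi> f e) = lift B \<Psi> f (t (Cod B f) e) *[?D] vertical B \<Psi> (Dom B f) (s f e)"
   unfolding 1(2) by (rule Psi.lift_vertical[OF 1(1) refl, symmetric])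
  show "s f e \<in> Arr (PO \<Psi> (Dom B f))" "Dom (PO \<Psi> (Dom B f)) (s f e) = t (Dom B f) (FO (PM \<Phi> f) e)"
   "Cod (PO \<Psi> (Dom B f)) (s f e) = FO (PM \<Psi> f) (t (Cod B f) e)"
   using 1(1) by simp_all
 qed
 have lift_inject: "h = k"
  if "lift B \<Psi> f e *[?D] vertical B \<Psi> (Dom B f) h = lift B \<Psi> f e *[?D] vertical B \<Psi> (Dom B f) k" "f \<in> Arr B" "e \<in> Obj (PO \<Psi> (Cod B f))"
   "h \<in> Arr (PO \<Psi> (Dom B f))" "Cod (PO \<Psi> (Dom B f)) h = FO (PM \<Psi> f) e"
   "k \<in> Arr (PO \<Psi> (Dom B f))" "Cod (PO \<Psi> (Dom B f)) k = FO (PM \<Psi> f) e" for f e h k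
  using that by (simp add: Psi.lift_vertical[of "Dom (PO \<Psi> (Dom B f)) h"] Psi.lift_vertical[of "Dom (PO \<Psi> (Dom B f)) k"])
 have s_natural: "s f (Cod (PO \<Phi> (Cod B f)) h) *[PO \<Psi> (Dom B f)] T (Dom B f) (FM (PM \<Phi> f) h) =
   FM (PM \<Psi> f) (T (Cod B f) h) *[PO \<Psi> (Dom B f)] s f (Dom (PO \<Phi> (Cod B f)) h)"
  if [simp]: "f \<in> Arr B" "h \<in> Arr (PO \<Phi> (Cod B f))" for f h
 proof (rule lift_inject[where e = "t (Cod B f) (Cod (PO \<Phi> (Cod B f)) h)" and f = f])
  let ?a = "Dom B f" and ?b = "Cod B f"
  let ?d = "Dom (PO \<Phi> ?b) h" and ?e = "Cod (PO \<Phi> ?b) h"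
  have "lift B \<Psi> f (t ?b ?e) *[?D] vertical B \<Psi> ?a (s f ?e *[PO \<Psi> ?a] T ?a (FM (PM \<Phi> f) h)) =
   FM H (lift B \<Phi> f ?e *[?E] vertical B \<Phi> ?a (FM (PM \<Phi> f) h))"
   by (simp add: Psi.vertical_Comp HV HL)
  also have "\<dots> = FM H (vertical B \<Phi> ?b h *[?E] lift B \<Phi> f ?d)" by (simp add: Phi.lift_natural)
  also have "\<dots> = (vertical B \<Psi> ?b (T ?b h) *[?D] lift B \<Psi> f (t ?b ?d)) *[?D] vertical B \<Psi> ?a (s f ?d)" by (simp add: HV HL)
  also have "vertical B \<Psi> ?b (T ?b h) *[?D] lift B \<Psi> f (t ?b ?d) = lift B \<Psi> f (t ?b ?e) *[?D] vertical B \<Psi> ?a (FM (PM \<Psi> f) (T ?b h))"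
   using Psi.lift_natural[of f "T ?b h"] by simp
  finally show "lift B \<Psi> f (t ?b ?e) *[?D] vertical B \<Psi> ?a (s f ?e *[PO \<Psi> ?a] T ?a (FM (PM \<Phi> f) h)) =
   lift B \<Psi> f (t ?b ?e) *[?D] vertical B \<Psi> ?a (FM (PM \<Psi> f) (T ?b h) *[PO \<Psi> ?a] s f ?d)"
   by (simp add: Psi.vertical_Comp)
 qed simp_all
 define \<tau> where "\<tau> = \<lparr>TSrc = \<Phi>, TTgt = \<Psi>, TO = (\<lambda>b\<in>Obj B. TOb b),
  TM = (\<lambda>f\<in>Arr B. \<lparr>NSrc = ftcomp (TOb (Dom B f)) (PM \<Phi> f), NTgt = ftcomp (PM \<Psi> f) (TOb (Cod B f)),
   NMap = (\<lambda>e\<in>Obj (PO \<Phi> (Cod B f)). s f e)\<rparr>)\<rparr>"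
 have [simp]: "TSrc \<tau> = \<Phi>" "TTgt \<tau> = \<Psi>" "b \<in> Obj B ==> TO \<tau> b = TOb b"
  "f \<in> Arr B ==> NSrc (TM \<tau> f) = ftcomp (TOb (Dom B f)) (PM \<Phi> f)"
  "f \<in> Arr B ==> NTgt (TM \<tau> f) = ftcomp (PM \<Psi> f) (TOb (Cod B f))"
  "f \<in> Arr B ==> e \<in> Obj (PO \<Phi> (Cod B f)) ==> NMap (TM \<tau> f) e = s f e" for b e f
  by (simp_all add: \<tau>_def)
 have "is_nt (TM \<tau> f)" if [simp]: "f \<in> Arr B" for f
  by (rule is_ntI) (simp_all add: hom_def s_natural, simp add: \<tau>_def)
 then have frame: "oplax_frame (op_cat B) \<tau>"
  by (simp add: oplax_frame_def ptrans_frame_def Phi.pseudo Psi.pseudo is_nt_between_def) (simp add: \<tau>_def)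
 have "is_oplax B \<tau>"
  unfolding oplax_transformation_iff
 proof (intro conjI ballI impI frame)
  fix b e assume [simp]: "b \<in> Obj B" "e \<in> Obj (PO (TSrc \<tau>) b)"
  have [simp]: "e \<in> Obj (PO \<Phi> b)" using \<open>e \<in> Obj (PO (TSrc \<tau>) b)\<close> by simp
  have s': "s (Id B b) e \<in> Arr (PO \<Psi> b)" "Dom (PO \<Psi> b) (s (Id B b) e) = t b (FO (PM \<Phi> (Id B b)) e)"
   "Cod (PO \<Psi> b) (s (Id B b) e) = FO (PM \<Psi> (Id B b)) (t b e)"
   "FM H (lift B \<Phi> (Id B b) e) = lift B \<Psi> (Id B b) (t b e) *[?D] vertical B \<Psi> b (s (Id B b) e)"
   using s[of "Id B b" e] HL[of "Id B b" e] by simp_all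
  have "s (Id B b) e *[PO \<Psi> b] T b (NMap (Pdelta \<Phi> b) e) = NMap (Pdelta \<Psi> b) (t b e)"
  proof (rule lift_inject[where f = "Id B b" and e = "t b e"])
   have "lift B \<Psi> (Id B b) (t b e) *[?D] vertical B \<Psi> b (s (Id B b) e *[PO \<Psi> b] T b (NMap (Pdelta \<Phi> b) e)) =
    FM H (lift B \<Phi> (Id B b) e *[?E] vertical B \<Phi> b (NMap (Pdelta \<Phi> b) e))"
    by (simp add: Psi.vertical_Comp HV s')
   also have "\<dots> = lift B \<Psi> (Id B b) (t b e) *[?D] vertical B \<Psi> b (NMap (Pdelta \<Psi> b) (t b e))"
    by (simp add: Phi.lift_Id Psi.lift_Id del: total_cat_simps(5))
   finally show "lift B \<Psi> (Id B b) (t b e) *[?D] vertical B \<Psi> (Dom B (Id B b)) (s (Id B b) e *[PO \<Psi> b] T b (NMap (Pdelta \<Phi> b) e)) =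
    lift B \<Psi> (Id B b) (t b e) *[?D] vertical B \<Psi> (Dom B (Id B b)) (NMap (Pdelta \<Psi> b) (t b e))" by simp
  qed (simp_all add: s')
  then show "NMap (TM \<tau> (Id B b)) e *[PO (TTgt \<tau>) b] FM (TO \<tau> b) (NMap (Pdelta (TSrc \<tau>) b) e)
   = NMap (Pdelta (TTgt \<tau>) b) (FO (TO \<tau> b) e)" by simp
 next
  fix f g e assume [simp]: "f \<in> Arr B" "g \<in> Arr B" "Dom B g = Cod B f" "e \<in> Obj (PO (TSrc \<tau>) (Cod B g))"
  have [simp]: "e \<in> Obj (PO \<Phi> (Cod B g))" using \<open>e \<in> Obj (PO (TSrc \<tau>) (Cod B g))\<close> by simp
  let ?a = "Dom B f" and ?c = "Cod B g" and ?e = "FO (PM \<Phi> g) e"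
  note s' [simp] = s[of g e, simplified] s[of "g *[B] f" e, simplified] HL[of g e, simplified] HL[of "g *[B] f" e, simplified]
  have "s (g *[B] f) e *[PO \<Psi> ?a] T ?a (NMap (Pgamma \<Phi> f g) e) =
   NMap (Pgamma \<Psi> f g) (t ?c e) *[PO \<Psi> ?a] (FM (PM \<Psi> f) (s g e) *[PO \<Psi> ?a] s f ?e)"
  proof (rule lift_inject[where f = "g *[B] f" and e = "t ?c e"])
   have "lift B \<Psi> (g *[B] f) (t ?c e) *[?D] vertical B \<Psi> ?a (s (g *[B] f) e *[PO \<Psi> ?a] T ?a (NMap (Pgamma \<Phi> f g) e)) =
    FM H (lift B \<Phi> (g *[B] f) e *[?E] vertical B \<Phi> ?a (NMap (Pgamma \<Phi> f g) e))"
    by (simp add: Psi.vertical_Comp HV)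
   also have "\<dots> = FM H (lift B \<Phi> g e *[?E] lift B \<Phi> f ?e)" by (simp only: Phi.lift_Comp[of f g e, simplified])
   also have "\<dots> = lift B \<Psi> g (t ?c e) *[?D] ((vertical B \<Psi> (Cod B f) (s g e) *[?D] lift B \<Psi> f (t (Cod B f) ?e)) *[?D] vertical B \<Psi> ?a (s f ?e))"
    by (simp add: HL)
   also have "vertical B \<Psi> (Cod B f) (s g e) *[?D] lift B \<Psi> f (t (Cod B f) ?e) =
    lift B \<Psi> f (FO (PM \<Psi> g) (t ?c e)) *[?D] vertical B \<Psi> ?a (FM (PM \<Psi> f) (s g e))"
    using Psi.lift_natural[of f "s g e"] by simp
   also have "lift B \<Psi> g (t ?c e) *[?D] ((lift B \<Psi> f (FO (PM \<Psi> g) (t ?c e)) *[?D] vertical B \<Psi> ?a (FM (PM \<Psi> f) (s g e))) *[?D] vertical B \<Psi> ?a (s f ?e)) =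
    (lift B \<Psi> g (t ?c e) *[?D] lift B \<Psi> f (FO (PM \<Psi> g) (t ?c e))) *[?D] (vertical B \<Psi> ?a (FM (PM \<Psi> f) (s g e)) *[?D] vertical B \<Psi> ?a (s f ?e))" by simp
   also have "lift B \<Psi> g (t ?c e) *[?D] lift B \<Psi> f (FO (PM \<Psi> g) (t ?c e)) =
     lift B \<Psi> (g *[B] f) (t ?c e) *[?D] vertical B \<Psi> ?a (NMap (Pgamma \<Psi> f g) (t ?c e))"
    by (rule Psi.lift_Comp) simp_all
   finally show "lift B \<Psi> (g *[B] f) (t ?c e) *[?D] vertical B \<Psi> (Dom B (g *[B] f)) (s (g *[B] f) e *[PO \<Psi> ?a] T ?a (NMap (Pgamma \<Phi> f g) e)) =
    lift B \<Psi> (g *[B] f) (t ?c e) *[?D] vertical B \<Psi> (Dom B (g *[B] f))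
     (NMap (Pgamma \<Psi> f g) (t ?c e) *[PO \<Psi> ?a] (FM (PM \<Psi> f) (s g e) *[PO \<Psi> ?a] s f ?e))"
    by (simp add: Psi.vertical_Comp)
  qed simp_all
  then show "NMap (TM \<tau> (g *[B] f)) e *[PO (TTgt \<tau>) (Dom B f)] FM (TO \<tau> (Dom B f)) (NMap (Pgamma (TSrc \<tau>) f g) e) =
   NMap (Pgamma (TTgt \<tau>) f g) (FO (TO \<tau> (Cod B g)) e) *[PO (TTgt \<tau>) (Dom B f)]
    (FM (PM (TTgt \<tau>) f) (NMap (TM \<tau> g) e) *[PO (TTgt \<tau>) (Dom B f)] NMap (TM \<tau> f) (FO (PM (TSrc \<tau>) g) e))"
   by simp
 qed
 moreover have "groth1 B \<tau> = H"
 proof -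
  have O: "FO (groth1 B \<tau>) x = FO H x" if "x \<in> Obj ?E" for x
   using that by (elim total_cat_ObjE) simp
  have M: "FM (groth1 B \<tau>) x = FM H x" if "x \<in> Arr ?E" for x
  proof -
   from that obtain d f h e where x [simp]: "x = GA d f h e" "f \<in> Arr B" "d \<in> Obj (PO \<Phi> (Dom B f))" "e \<in> Obj (PO \<Phi> (Cod B f))"
    "h \<in> Arr (PO \<Phi> (Dom B f))" "Dom (PO \<Phi> (Dom B f)) h = d" "Cod (PO \<Phi> (Dom B f)) h = FO (PM \<Phi> f) e"
    by (elim total_cat_ArrE)
   have "FM H x = FM H (lift B \<Phi> f e *[?E] vertical B \<Phi> (Dom B f) h)" by (simp add: Phi.lift_vertical[of d])
   also have "\<dots> = lift B \<Psi> f (t (Cod B f) e) *[?D] vertical B \<Psi> (Dom B f) (s f e *[PO \<Psi> (Dom B f)] T (Dom B f) h)"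
    by (simp add: HL HV Psi.vertical_Comp)
   also have "\<dots> = FM (groth1 B \<tau>) x"
    by (subst Psi.lift_vertical[of "t (Dom B f) d"]) simp_all
   finally show ?thesis by simp
  qed
  have "FO (groth1 B \<tau>) = FO H"
   by (rule extensionalityI[where A = "Obj ?E"]) (use groth1_extensional[of B \<tau>] functor_extensional[of H] O in simp_all)
  moreover have "FM (groth1 B \<tau>) = FM H"
   by (rule extensionalityI[where A = "Arr ?E"]) (use groth1_extensional[of B \<tau>] functor_extensional[of H] M in simp_all)
  ultimately show ?thesis
   using groth1_simps(1,2)[of B \<tau>] by (cases "groth1 B \<tau>", cases H) (use \<open>FDom H = ?E\<close> \<open>FCod H = ?D\<close> in simp)
 qed
 ultimately show ?thesis by auto
qed

end

locale oplax_data = indexed_pair B \<Phi> \<Psi>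
 for B :: "('o, 'm) cat" and \<Phi> \<Psi> :: "('o, 'm, ('o, 'm, 'a) univ) psftor" +
 fixes \<tau> :: "('o, 'm, ('o, 'm, 'a) univ) ptrans"
 assumes frame: "oplax_frame (op_cat B) \<tau>" and TSrc [simp]: "TSrc \<tau> = \<Phi>" and TTgt [simp]: "TTgt \<tau> = \<Psi>"
begin

lemma TO [simp]:
 assumes "b \<in> Obj B"
 shows "is_functor (TO \<tau> b)" "FDom (TO \<tau> b) = PO \<Phi> b" "FCod (TO \<tau> b) = PO \<Psi> b"
proof -
 have "\<forall>b\<in>Obj B. is_functor (TO \<tau> b) \<and> FDom (TO \<tau> b) = PO \<Phi> b \<and> FCod (TO \<tau> b) = PO \<Psi> b"
  using frame unfolding oplax_frame_def ptrans_frame_def op_cat_simps TSrc TTgt by (elim conjE)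
 then show "is_functor (TO \<tau> b)" "FDom (TO \<tau> b) = PO \<Phi> b" "FCod (TO \<tau> b) = PO \<Psi> b"
  using assms by blast+
qed

lemma TM [simp]:
 assumes "f \<in> Arr B"
 shows "is_nt (TM \<tau> f)" "NSrc (TM \<tau> f) = ftcomp (TO \<tau> (Dom B f)) (PM \<Phi> f)" "NTgt (TM \<tau> f) = ftcomp (PM \<Psi> f) (TO \<tau> (Cod B f))"
 using frame assms unfolding oplax_frame_def is_nt_between_def op_cat_simps TSrc TTgt by blast+

lemma TM_natural:
 assumes "f \<in> Arr B" "h \<in> Arr (PO \<Phi> (Cod B f))"
 shows "NMap (TM \<tau> f) (Cod (PO \<Phi> (Cod B f)) h) *[PO \<Psi> (Dom B f)] FM (TO \<tau> (Dom B f)) (FM (PM \<Phi> f) h) =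
  FM (PM \<Psi> f) (FM (TO \<tau> (Cod B f)) h) *[PO \<Psi> (Dom B f)] NMap (TM \<tau> f) (Dom (PO \<Phi> (Cod B f)) h)"
 using nt_natural[of "TM \<tau> f" "PO \<Phi> (Cod B f)" "PO \<Psi> (Dom B f)" h] assms by simp

lemma extensional: "TO \<tau> \<in> extensional (Obj B)" "TM \<tau> \<in> extensional (Arr B)"
 using frame unfolding oplax_frame_def ptrans_frame_def op_cat_simps by blast+

lemma groth1_Arr:
 assumes "x \<in> Arr (total_cat B \<Phi>)"
 shows "FM (groth1 B \<tau>) x \<in> hom (total_cat B \<Psi>) (FO (groth1 B \<tau>) (Dom (total_cat B \<Phi>) x)) (FO (groth1 B \<tau>) (Cod (total_cat B \<Phi>) x))"
proof -
 from assms obtain d f h e where [simp]: "x = GA d f h e" "f \<in> Arr B" "d \<in> Obj (PO \<Phi> (Dom B f))" "e \<in> Obj (PO \<Phi> (Cod B f))"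
  "h \<in> Arr (PO \<Phi> (Dom B f))" "Dom (PO \<Phi> (Dom B f)) h = d" "Cod (PO \<Phi> (Dom B f)) h = FO (PM \<Phi> f) e"
  by (elim total_cat_ArrE)
 have [simp]: "FM (groth1 B \<tau>) (GA d f h e) = GA (FO (TO \<tau> (Dom B f)) d) f
   (NMap (TM \<tau> f) e *[PO \<Psi> (Dom B f)] FM (TO \<tau> (Dom B f)) h) (FO (TO \<tau> (Cod B f)) e)"
  by (subst groth1_simps) simp_all
 show ?thesis by (simp add: hom_def)
qed

lemma groth1_vertical:
 assumes oplax: "is_oplax B \<tau>" and bh: "b \<in> Obj B" "h \<in> Arr (PO \<Phi> b)"
 shows "FM (groth1 B \<tau>) (vertical B \<Phi> b h) = vertical B \<Psi> b (FM (TO \<tau> b) h)"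
proof -
 note [simp] = bh
 let ?e = "Cod (PO \<Phi> b) h"
 have "vertical B \<Phi> b h \<in> Arr (total_cat B (TSrc \<tau>))" by simp
 then have 1: "FM (groth1 B \<tau>) (vertical B \<Phi> b h) = GA (FO (TO \<tau> b) (Dom (PO \<Phi> b) h)) (Id B b)
   (NMap (TM \<tau> (Id B b)) ?e *[PO \<Psi> b] (FM (TO \<tau> b) (NMap (Pdelta \<Phi> b) ?e) *[PO \<Psi> b] FM (TO \<tau> b) h)) (FO (TO \<tau> b) ?e)"
  unfolding vertical_def by (subst groth1_simps) (auto simp del: total_cat_simps)
 have "NMap (TM \<tau> (Id B b)) ?e *[PO \<Psi> b] FM (TO \<tau> b) (NMap (Pdelta \<Phi> b) ?e) = NMap (Pdelta \<Psi> b) (FO (TO \<tau> b) ?e)"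
  using oplax unfolding oplax_transformation_iff TSrc TTgt by simp
 then have "NMap (TM \<tau> (Id B b)) ?e *[PO \<Psi> b] (FM (TO \<tau> b) (NMap (Pdelta \<Phi> b) ?e) *[PO \<Psi> b] FM (TO \<tau> b) h) =
   NMap (Pdelta \<Psi> b) (FO (TO \<tau> b) ?e) *[PO \<Psi> b] FM (TO \<tau> b) h"
  by (intro comp_comp_eq) simp_all
 then show ?thesis unfolding 1 by (simp add: vertical_def)
qed

lemma groth1_lift:
 assumes "f \<in> Arr B" "e \<in> Obj (PO \<Phi> (Cod B f))"
 shows "FM (groth1 B \<tau>) (lift B \<Phi> f e) = GA (FO (TO \<tau> (Dom B f)) (FO (PM \<Phi> f) e)) f (NMap (TM \<tau> f) e) (FO (TO \<tau> (Cod B f)) e)"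
 using assms unfolding lift_def by (subst groth1_simps) simp_all

lemma functor_over_groth1:
 assumes oplax: "is_oplax B \<tau>"
 shows "functor_over B (total_proj B (total_cat B \<Phi>), groth1 B \<tau>, total_proj B (total_cat B \<Psi>))"
proof -
 let ?D = "total_cat B \<Psi>" and ?E = "total_cat B \<Phi>" and ?H = "groth1 B \<tau>"
 note [simp] = Phi.category_total Psi.category_total
 have "is_functor ?H"
 proof (rule is_functorI)
  fix x assume "x \<in> Obj (FDom ?H)"
  then obtain b e where [simp]: "x = GO b e" "b \<in> Obj B" "e \<in> Obj (PO \<Phi> b)" by (auto elim: total_cat_ObjE)
  show "FO ?H x \<in> Obj (FCod ?H)" by simp
  have "FM ?H (vertical B \<Phi> b (Id (PO \<Phi> b) e)) = vertical B \<Psi> b (Id (PO \<Psi> b) (FO (TO \<tau> b) e))"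
   by (simp add: groth1_vertical[OF oplax])
  then show "FM ?H (Id (FDom ?H) x) = Id (FCod ?H) (FO ?H x)"
   by (simp add: Phi.vertical_Id Psi.vertical_Id del: total_cat_simps(5))
 next
  fix x y assume "x \<in> Arr (FDom ?H)" "y \<in> Arr (FDom ?H)" "Dom (FDom ?H) y = Cod (FDom ?H) x"
  then have xy: "x \<in> Arr ?E" "y \<in> Arr ?E" "Dom ?E y = Cod ?E x" by simp_all
  from xy(1) obtain d f h e where [simp]: "x = GA d f h e" "f \<in> Arr B" "d \<in> Obj (PO \<Phi> (Dom B f))" "e \<in> Obj (PO \<Phi> (Cod B f))"
   "h \<in> Arr (PO \<Phi> (Dom B f))" "Dom (PO \<Phi> (Dom B f)) h = d" "Cod (PO \<Phi> (Dom B f)) h = FO (PM \<Phi> f) e"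
   by (elim total_cat_ArrE)
  from xy(2,3) obtain g k w where [simp]: "y = GA e g k w" "g \<in> Arr B" "w \<in> Obj (PO \<Phi> (Cod B g))" "Dom B g = Cod B f"
   "k \<in> Arr (PO \<Phi> (Cod B f))" "Dom (PO \<Phi> (Cod B f)) k = e" "Cod (PO \<Phi> (Cod B f)) k = FO (PM \<Phi> g) w"
   by (elim total_cat_ArrE) auto
  let ?a = "Dom B f" and ?b = "Cod B f" and ?c = "Cod B g"
  let ?C = "PO \<Psi> ?a"
  have x: "FM ?H x = GA (FO (TO \<tau> ?a) d) f (NMap (TM \<tau> f) e *[?C] FM (TO \<tau> ?a) h) (FO (TO \<tau> ?b) e)"
   and y: "FM ?H y = GA (FO (TO \<tau> ?b) e) g (NMap (TM \<tau> g) w *[PO \<Psi> ?b] FM (TO \<tau> ?b) k) (FO (TO \<tau> ?c) w)"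
   and yx: "FM ?H (y *[?E] x) = GA (FO (TO \<tau> ?a) d) (g *[B] f) (NMap (TM \<tau> (g *[B] f)) w *[?C]
     (FM (TO \<tau> ?a) (NMap (Pgamma \<Phi> f g) w) *[?C] (FM (TO \<tau> ?a) (FM (PM \<Phi> f) k) *[?C] FM (TO \<tau> ?a) h))) (FO (TO \<tau> ?c) w)"
   by (simp_all add: groth1_simps(4))
  have 1: "NMap (TM \<tau> (g *[B] f)) w *[?C] FM (TO \<tau> ?a) (NMap (Pgamma \<Phi> f g) w) =
   NMap (Pgamma \<Psi> f g) (FO (TO \<tau> ?c) w) *[?C] (FM (PM \<Psi> f) (NMap (TM \<tau> g) w) *[?C] NMap (TM \<tau> f) (FO (PM \<Phi> g) w))"
   using oplax unfolding oplax_transformation_iff TSrc TTgt by simp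
  have 2: "NMap (TM \<tau> f) (FO (PM \<Phi> g) w) *[?C] FM (TO \<tau> ?a) (FM (PM \<Phi> f) k) = FM (PM \<Psi> f) (FM (TO \<tau> ?b) k) *[?C] NMap (TM \<tau> f) e"
   using TM_natural[of f k] by simp
  have "NMap (TM \<tau> (g *[B] f)) w *[?C] (FM (TO \<tau> ?a) (NMap (Pgamma \<Phi> f g) w) *[?C] (FM (TO \<tau> ?a) (FM (PM \<Phi> f) k) *[?C] FM (TO \<tau> ?a) h))
   = (NMap (Pgamma \<Psi> f g) (FO (TO \<tau> ?c) w) *[?C] (FM (PM \<Psi> f) (NMap (TM \<tau> g) w) *[?C] NMap (TM \<tau> f) (FO (PM \<Phi> g) w))) *[?C]
    (FM (TO \<tau> ?a) (FM (PM \<Phi> f) k) *[?C] FM (TO \<tau> ?a) h)"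
   by (rule comp_comp_eq) (simp_all add: 1)
  also have "\<dots> = NMap (Pgamma \<Psi> f g) (FO (TO \<tau> ?c) w) *[?C] (FM (PM \<Psi> f) (NMap (TM \<tau> g) w) *[?C]
    ((NMap (TM \<tau> f) (FO (PM \<Phi> g) w) *[?C] FM (TO \<tau> ?a) (FM (PM \<Phi> f) k)) *[?C] FM (TO \<tau> ?a) h))" by simp
  finally show "FM ?H (y *[FDom ?H] x) = FM ?H y *[FCod ?H] FM ?H x"
   unfolding groth1_simps(1,2) TSrc TTgt x y yx 2 by simp
 qed (use groth1_extensional[of B \<tau>] groth1_Arr in simp_all)
 then show ?thesis
 proof (rule_tac functor_overI)
  show "x \<in> Obj (FDom (total_proj B ?E)) ==> FO (total_proj B ?D) (FO ?H x) = FO (total_proj B ?E) x" for x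
   by (auto elim!: total_cat_ObjE)
  show "x \<in> Arr (FDom (total_proj B ?E)) ==> FM (total_proj B ?D) (FM ?H x) = FM (total_proj B ?E) x" for x
   using groth1_Arr[of x] by (auto elim!: total_cat_ArrE simp: hom_def)
 qed simp_all
qed

lemma groth1_inject:
 assumes \<sigma>: "oplax_data B \<Phi> \<Psi> \<sigma>"
  and eq: "\<And>x. x \<in> Arr (total_cat B \<Phi>) ==> FM (groth1 B \<sigma>) x = FM (groth1 B \<tau>) x"
  and iso: "is_oplax B \<sigma>" "\<And>b h. b \<in> Obj B ==> h \<in> Arr (PO \<Phi> b) ==>
   FM (groth1 B \<tau>) (vertical B \<Phi> b h) = vertical B \<Psi> b (FM (TO \<tau> b) h)"
 shows "\<sigma> = \<tau>"
proof -
 interpret S: oplax_data B \<Phi> \<Psi> \<sigma> by (rule \<sigma>)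
 have M: "FM (TO \<sigma> b) h = FM (TO \<tau> b) h" if bh: "b \<in> Obj B" "h \<in> Arr (PO \<Phi> b)" for b h
  using eq[of "vertical B \<Phi> b h"] bh by - (rule Psi.vertical_inject[of b], simp_all add: iso(2) S.groth1_vertical[OF iso(1)])
 have O: "FO (TO \<sigma> b) e = FO (TO \<tau> b) e" if bh: "b \<in> Obj B" "e \<in> Obj (PO \<Phi> b)" for b e
 proof -
  have "Dom (PO \<Psi> b) (FM (TO \<sigma> b) (Id (PO \<Phi> b) e)) = Dom (PO \<Psi> b) (FM (TO \<tau> b) (Id (PO \<Phi> b) e))"
   using M[of b "Id (PO \<Phi> b) e"] bh by simp
  then show ?thesis using bh by simp
 qed
 have TO: "TO \<sigma> b = TO \<tau> b" if "b \<in> Obj B" for b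
  by (rule ftor_eqI) (use that in "simp_all add: M O")
 have TM: "TM \<sigma> f = TM \<tau> f" if f [simp]: "f \<in> Arr B" for f
 proof (rule nt_eqI)
  fix e assume "e \<in> Obj (FDom (NSrc (TM \<tau> f)))"
  then have e: "e \<in> Obj (PO \<Phi> (Cod B f))" by simp
  show "NMap (TM \<sigma> f) e = NMap (TM \<tau> f) e"
   using eq[of "lift B \<Phi> f e"] e by (simp add: groth1_lift S.groth1_lift)
 qed (simp_all add: TO)
 have "TO \<sigma> = TO \<tau>" by (rule extensionalityI[where A = "Obj B"]) (simp_all add: extensional S.extensional TO)
 moreover have "TM \<sigma> = TM \<tau>" by (rule extensionalityI[where A = "Arr B"]) (simp_all add: extensional S.extensional TM)
 ultimately show ?thesis using TSrc TTgt S.TSrc S.TTgt by (cases \<sigma>, cases \<tau>) simp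
qed

end

text \<open>
 Naturality of a vertical transformation between the induced functors need only be checked on
 vertical arrows and on lifts. On the former it is naturality over each fibre, on the latter it is
 the equation of a modification.
\<close>

locale oplax_parallel = S: oplax_data B \<Phi> \<Psi> \<sigma> + T: oplax_data B \<Phi> \<Psi> \<tau>
 for B :: "('o, 'm) cat" and \<Phi> \<Psi> :: "('o, 'm, ('o, 'm, 'a) univ) psftor" and \<sigma> \<tau> +
 assumes S: "is_oplax B \<sigma>" and T: "is_oplax B \<tau>"
begin

lemma groth_transformation:
 assumes u [simp]: "NSrc u = groth1 B \<sigma>" "NTgt u = groth1 B \<tau>" "NMap u \<in> extensional (Obj (total_cat B \<Phi>))"
  and m: "\<And>b. b \<in> Obj B ==> is_nt (m b)" "\<And>b. b \<in> Obj B ==> NSrc (m b) = TO \<sigma> b" "\<And>b. b \<in> Obj B ==> NTgt (m b) = TO \<tau> b"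
  and NMap: "\<And>b e. b \<in> Obj B ==> e \<in> Obj (PO \<Phi> b) ==> NMap u (GO b e) = vertical B \<Psi> b (NMap (m b) e)"
  and modification: "\<And>f e. f \<in> Arr B ==> e \<in> Obj (PO \<Phi> (Cod B f)) ==>
   NMap (TM \<tau> f) e *[PO \<Psi> (Dom B f)] NMap (m (Dom B f)) (FO (PM \<Phi> f) e) =
   FM (PM \<Psi> f) (NMap (m (Cod B f)) e) *[PO \<Psi> (Dom B f)] NMap (TM \<sigma> f) e"
 shows "transformation_over B (total_proj B (total_cat B \<Phi>), u, total_proj B (total_cat B \<Psi>))"
proof -
 let ?D = "total_cat B \<Psi>" and ?E = "total_cat B \<Phi>"
 note [simp] = S.Phi.category_total S.Psi.category_total m NMap
 note ov = S.functor_over_groth1[OF S] T.functor_over_groth1[OF T]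
 have [simp]: "is_functor (groth1 B \<sigma>)" "is_functor (groth1 B \<tau>)" using functor_overD[OF ov(1)] functor_overD[OF ov(2)] by simp_all
 have "is_nt u"
 proof (rule is_ntI)
  fix x assume "x \<in> Obj (FDom (NTgt u))"
  then obtain b e where [simp]: "x = GO b e" "b \<in> Obj B" "e \<in> Obj (PO \<Phi> b)" by (auto elim: total_cat_ObjE)
  show "NMap u x \<in> hom (FCod (NTgt u)) (FO (NSrc u) x) (FO (NTgt u) x)"
   by (simp add: hom_def)
 next
  fix x assume "x \<in> Arr (FDom (NTgt u))"
  then have "x \<in> Arr ?E" by simp
  then obtain d f h e where [simp]: "x = GA d f h e" "f \<in> Arr B" "d \<in> Obj (PO \<Phi> (Dom B f))" "e \<in> Obj (PO \<Phi> (Cod B f))"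
   "h \<in> Arr (PO \<Phi> (Dom B f))" "Dom (PO \<Phi> (Dom B f)) h = d" "Cod (PO \<Phi> (Dom B f)) h = FO (PM \<Phi> f) e"
   by (elim total_cat_ArrE)
  let ?a = "Dom B f" and ?b = "Cod B f"
  let ?C = "PO \<Psi> ?a"
  have s: "FM (groth1 B \<sigma>) x = GA (FO (TO \<sigma> ?a) d) f (NMap (TM \<sigma> f) e *[?C] FM (TO \<sigma> ?a) h) (FO (TO \<sigma> ?b) e)"
   and t: "FM (groth1 B \<tau>) x = GA (FO (TO \<tau> ?a) d) f (NMap (TM \<tau> f) e *[?C] FM (TO \<tau> ?a) h) (FO (TO \<tau> ?b) e)"
   by (simp_all add: groth1_simps(4))
  have "NMap (m ?a) (FO (PM \<Phi> f) e) *[?C] FM (TO \<sigma> ?a) h = FM (TO \<tau> ?a) h *[?C] NMap (m ?a) d"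
   using nt_natural[of "m ?a" "PO \<Phi> ?a" ?C h] by simp
  moreover have "NMap (TM \<tau> f) e *[?C] (NMap (m ?a) (FO (PM \<Phi> f) e) *[?C] FM (TO \<sigma> ?a) h) =
   FM (PM \<Psi> f) (NMap (m ?b) e) *[?C] (NMap (TM \<sigma> f) e *[?C] FM (TO \<sigma> ?a) h)"
   by (rule comp_eq_comp) (simp_all add: modification)
  ultimately show "NMap u (Cod (FDom (NTgt u)) x) *[FCod (NTgt u)] FM (NSrc u) x = FM (NTgt u) x *[FCod (NTgt u)] NMap u (Dom (FDom (NTgt u)) x)"
   using S.Psi.vertical_comp_left[of "FO (TO \<sigma> ?a) d" f "NMap (TM \<sigma> f) e *[?C] FM (TO \<sigma> ?a) h" "FO (TO \<sigma> ?b) e" "NMap (m ?b) e" ?b]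
    S.Psi.vertical_comp_right[of "FO (TO \<tau> ?a) d" f "NMap (TM \<tau> f) e *[?C] FM (TO \<tau> ?a) h" "FO (TO \<tau> ?b) e" "NMap (m ?a) d" ?a]
   unfolding u(1,2) s t by simp
 qed simp_all
 then show ?thesis
  by (rule transformation_overI) (auto simp: ov vertical_def elim!: total_cat_ObjE)
qed

lemma transformation_is_groth:
 assumes "transformation_over B (total_proj B (total_cat B \<Phi>), u, total_proj B (total_cat B \<Psi>))"
  and u [simp]: "NSrc u = groth1 B \<sigma>" "NTgt u = groth1 B \<tau>"
 obtains m where "\<And>b. b \<in> Obj B ==> is_nt (m b)" "\<And>b. b \<in> Obj B ==> NSrc (m b) = TO \<sigma> b" "\<And>b. b \<in> Obj B ==> NTgt (m b) = TO \<tau> b"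
  and "\<And>b e. b \<in> Obj B ==> e \<in> Obj (PO \<Phi> b) ==> NMap u (GO b e) = vertical B \<Psi> b (NMap (m b) e)"
  and "\<And>f e. f \<in> Arr B ==> e \<in> Obj (PO \<Phi> (Cod B f)) ==>
   NMap (TM \<tau> f) e *[PO \<Psi> (Dom B f)] NMap (m (Dom B f)) (FO (PM \<Phi> f) e) =
   FM (PM \<Psi> f) (NMap (m (Cod B f)) e) *[PO \<Psi> (Dom B f)] NMap (TM \<sigma> f) e"
proof -
 let ?D = "total_cat B \<Psi>" and ?E = "total_cat B \<Phi>"
 note [simp] = S.Phi.category_total S.Psi.category_total
 note ov = S.functor_over_groth1[OF S] T.functor_over_groth1[OF T]
 have nt [simp]: "is_nt u" and over: "x \<in> Obj ?E ==> FM (total_proj B ?D) (NMap u x) = Id B (FO (total_proj B ?E) x)" for x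
  using transformation_overD[OF assms(1)] by simp_all
 define n where "n b e = inv_arrow (PO \<Psi> b) (NMap (Pdelta \<Psi> b) (FO (TO \<tau> b) e)) *[PO \<Psi> b] ar_fibre (NMap u (GO b e))" for b e
 have n: "NMap u (GO b e) = vertical B \<Psi> b (n b e)" and [simp]: "n b e \<in> Arr (PO \<Psi> b)" "Dom (PO \<Psi> b) (n b e) = FO (TO \<sigma> b) e"
  "Cod (PO \<Psi> b) (n b e) = FO (TO \<tau> b) e"
  if [simp]: "b \<in> Obj B" "e \<in> Obj (PO \<Phi> b)" for b e
 proof -
  have 1: "NMap u (GO b e) \<in> Arr ?D" "Dom ?D (NMap u (GO b e)) = GO b (FO (TO \<sigma> b) e)"
   "Cod ?D (NMap u (GO b e)) = GO b (FO (TO \<tau> b) e)" "ar_base (NMap u (GO b e)) = Id B b"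
   using over[of "GO b e"] by simp_all
  from 1(1) obtain d f h w where y: "NMap u (GO b e) = GA d f h w" by (elim total_cat_ArrE)
  have y': "NMap u (GO b e) = GA (FO (TO \<sigma> b) e) (Id B b) (ar_fibre (NMap u (GO b e))) (FO (TO \<tau> b) e)"
   using 1(2-4) unfolding y by simp
  have 2: "GA (FO (TO \<sigma> b) e) (Id B b) (ar_fibre (NMap u (GO b e))) (FO (TO \<tau> b) e) \<in> Arr ?D"
   using 1(1) y' by (simp only:)
  show "NMap u (GO b e) = vertical B \<Psi> b (n b e)" "n b e \<in> Arr (PO \<Psi> b)" "Dom (PO \<Psi> b) (n b e) = FO (TO \<sigma> b) e"
   "Cod (PO \<Psi> b) (n b e) = FO (TO \<tau> b) e"
   unfolding n_def using S.Psi.vertical_arrow[OF 2] y' by simp_all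
 qed
 define m where "m b = \<lparr>NSrc = TO \<sigma> b, NTgt = TO \<tau> b, NMap = (\<lambda>e\<in>Obj (PO \<Phi> b). n b e)\<rparr>" for b
 have [simp]: "NSrc (m b) = TO \<sigma> b" "NTgt (m b) = TO \<tau> b" "e \<in> Obj (PO \<Phi> b) ==> NMap (m b) e = n b e" for b e
  by (simp_all add: m_def)
 have "is_nt (m b)" if [simp]: "b \<in> Obj B" for b
 proof (rule is_ntI)
  fix h assume "h \<in> Arr (FDom (NTgt (m b)))"
  then have [simp]: "h \<in> Arr (PO \<Phi> b)" by simp
  let ?d = "Dom (PO \<Phi> b) h" and ?e = "Cod (PO \<Phi> b) h"
  have "NMap u (GO b ?e) *[?D] FM (groth1 B \<sigma>) (vertical B \<Phi> b h) = FM (groth1 B \<tau>) (vertical B \<Phi> b h) *[?D] NMap u (GO b ?d)"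
   using nt_natural[OF nt, of ?E ?D "vertical B \<Phi> b h"] by simp
  then have "vertical B \<Psi> b (n b ?e *[PO \<Psi> b] FM (TO \<sigma> b) h) = vertical B \<Psi> b (FM (TO \<tau> b) h *[PO \<Psi> b] n b ?d)"
   by (simp add: n S.groth1_vertical[OF S] T.groth1_vertical[OF T] S.Psi.vertical_Comp)
  then have "n b ?e *[PO \<Psi> b] FM (TO \<sigma> b) h = FM (TO \<tau> b) h *[PO \<Psi> b] n b ?d"
   by (rule S.Psi.vertical_inject) simp_all
  then show "NMap (m b) (Cod (FDom (NTgt (m b))) h) *[FCod (NTgt (m b))] FM (NSrc (m b)) h = FM (NTgt (m b)) h *[FCod (NTgt (m b))] NMap (m b) (Dom (FDom (NTgt (m b))) h)"
   by simp
 qed (simp_all add: hom_def, simp add: m_def)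
 moreover have "NMap (TM \<tau> f) e *[PO \<Psi> (Dom B f)] NMap (m (Dom B f)) (FO (PM \<Phi> f) e) =
   FM (PM \<Psi> f) (NMap (m (Cod B f)) e) *[PO \<Psi> (Dom B f)] NMap (TM \<sigma> f) e" if [simp]: "f \<in> Arr B" "e \<in> Obj (PO \<Phi> (Cod B f))" for f e
 proof -
  let ?a = "Dom B f" and ?b = "Cod B f" and ?d = "FO (PM \<Phi> f) e"
  have "NMap u (GO ?b e) *[?D] FM (groth1 B \<sigma>) (lift B \<Phi> f e) = FM (groth1 B \<tau>) (lift B \<Phi> f e) *[?D] NMap u (GO ?a ?d)"
   using nt_natural[OF nt, of ?E ?D "lift B \<Phi> f e"] by simp
  then show ?thesis
   using S.Psi.vertical_comp_left[of "FO (TO \<sigma> ?a) ?d" f "NMap (TM \<sigma> f) e" "FO (TO \<sigma> ?b) e" "n ?b e" ?b]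
    S.Psi.vertical_comp_right[of "FO (TO \<tau> ?a) ?d" f "NMap (TM \<tau> f) e" "FO (TO \<tau> ?b) e" "n ?a ?d" ?a]
   by (simp add: n S.groth1_lift T.groth1_lift)
 qed
 ultimately show thesis by (intro that[of m]) (simp_all add: n)
qed

end

lemma oplax_dataI:
 assumes "category B" "oplax_frame (op_cat B) \<tau>"
 shows "oplax_data B (TSrc \<tau>) (TTgt \<tau>) \<tau>"
proof -
 have "pseudo_functor (op_cat B) (TSrc \<tau>)" "pseudo_functor (op_cat B) (TTgt \<tau>)"
  using assms(2) unfolding oplax_frame_def ptrans_frame_def by blast+
 then show ?thesis using assms by unfold_locales simp_all
qed

lemma oplax_transformation_frame: "is_oplax B \<tau> ==> oplax_frame (op_cat B) \<tau>"
 by (simp add: oplax_transformation_iff)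

lemma oplax_frameI:
 assumes "pseudo_functor (op_cat B) (TSrc \<tau>)" "pseudo_functor (op_cat B) (TTgt \<tau>)" "TO \<tau> \<in> extensional (Obj B)" "TM \<tau> \<in> extensional (Arr B)"
  "\<And>b. b \<in> Obj B ==> is_functor (TO \<tau> b)" "\<And>b. b \<in> Obj B ==> FDom (TO \<tau> b) = PO (TSrc \<tau>) b" "\<And>b. b \<in> Obj B ==> FCod (TO \<tau> b) = PO (TTgt \<tau>) b"
  "\<And>f. f \<in> Arr B ==> is_nt (TM \<tau> f)" "\<And>f. f \<in> Arr B ==> NSrc (TM \<tau> f) = ftcomp (TO \<tau> (Dom B f)) (PM (TSrc \<tau>) f)"
  "\<And>f. f \<in> Arr B ==> NTgt (TM \<tau> f) = ftcomp (PM (TTgt \<tau>) f) (TO \<tau> (Cod B f))"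
 shows "oplax_frame (op_cat B) \<tau>"
 using assms by (simp add: oplax_frame_def ptrans_frame_def is_nt_between_def)

lemma comp_frame_simps [simp]:
 "TSrc (oplax_comp C \<sigma> \<tau>) = TSrc \<tau>" "TTgt (oplax_comp C \<sigma> \<tau>) = TTgt \<sigma>"
 "b \<in> Obj C ==> TO (oplax_comp C \<sigma> \<tau>) b = ftcomp (TO \<sigma> b) (TO \<tau> b)"
 "f \<in> Arr C ==> TM (oplax_comp C \<sigma> \<tau>) f = ncomp (whisker_right (TM \<sigma> f) (TO \<tau> (Dom C f))) (whisker_left (TO \<sigma> (Cod C f)) (TM \<tau> f))"
 by (simp_all add: oplax_comp_def)

lemma id_frame_simps [simp]:
 "TSrc (lax_id C \<Phi>) = \<Phi>" "TTgt (lax_id C \<Phi>) = \<Phi>"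
 "b \<in> Obj C ==> TO (lax_id C \<Phi>) b = ftid (PO \<Phi> b)" "f \<in> Arr C ==> TM (lax_id C \<Phi>) f = nid (PM \<Phi> f)"
 by (simp_all add: lax_id_def)

text \<open>
 The composite of two functors over \<open>B\<close> is induced by some oplax transformation. As the
 induced functor determines its transformation, this is the composite transformation.
\<close>

lemma oplax_comp:
 assumes \<tau>: "is_oplax B \<tau>" and \<sigma>: "is_oplax B \<sigma>" and eq: "TSrc \<sigma> = TTgt \<tau>"
  and B: "category B"
 shows "is_oplax B (oplax_comp (op_cat B) \<sigma> \<tau>)"
  "groth1 B (oplax_comp (op_cat B) \<sigma> \<tau>) = ftcomp (groth1 B \<sigma>) (groth1 B \<tau>)"
proof -
 let ?\<rho> = "oplax_comp (op_cat B) \<sigma> \<tau>"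
 obtain \<Phi> \<Psi> \<Omega> where ends: "TSrc \<tau> = \<Phi>" "TTgt \<tau> = \<Psi>" "TSrc \<sigma> = \<Psi>" "TTgt \<sigma> = \<Omega>" using eq by blast
 interpret T: oplax_data B \<Phi> \<Psi> \<tau> using oplax_dataI[OF B oplax_transformation_frame[OF \<tau>]] by (simp only: ends)
 interpret S: oplax_data B \<Psi> \<Omega> \<sigma> using oplax_dataI[OF B oplax_transformation_frame[OF \<sigma>]] by (simp only: ends)
 interpret P: indexed_pair B \<Phi> \<Omega> by unfold_locales
 note fT = T.functor_over_groth1[OF \<tau>] and fS = S.functor_over_groth1[OF \<sigma>]
 have [simp]: "is_functor (groth1 B \<sigma>)" "is_functor (groth1 B \<tau>)" using functor_overD[OF fT] functor_overD[OF fS] by simp_all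
 have "oplax_frame (op_cat B) ?\<rho>"
  by (rule oplax_frameI) (simp_all add: T.Phi.pseudo S.Psi.pseudo, simp_all add: oplax_comp_def)
 then interpret R: oplax_data B \<Phi> \<Omega> ?\<rho> by unfold_locales simp_all
 have *: "FM (groth1 B ?\<rho>) x = FM (groth1 B \<sigma>) (FM (groth1 B \<tau>) x)" if "x \<in> Arr (total_cat B \<Phi>)" for x
 proof -
  from that obtain d f h e where [simp]: "x = GA d f h e" "f \<in> Arr B" "d \<in> Obj (PO \<Phi> (Dom B f))" "e \<in> Obj (PO \<Phi> (Cod B f))"
   "h \<in> Arr (PO \<Phi> (Dom B f))" "Dom (PO \<Phi> (Dom B f)) h = d" "Cod (PO \<Phi> (Dom B f)) h = FO (PM \<Phi> f) e"
   by (elim total_cat_ArrE)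
  show ?thesis by (simp add: groth1_simps(4))
 qed
 have V: "FM (groth1 B ?\<rho>) (vertical B \<Phi> b h) = vertical B \<Omega> b (FM (TO ?\<rho> b) h)" if "b \<in> Obj B" "h \<in> Arr (PO \<Phi> b)" for b h
  using that by (simp add: * T.groth1_vertical[OF \<tau>] S.groth1_vertical[OF \<sigma>])
 obtain \<rho> where \<rho>: "is_oplax B \<rho>" "TSrc \<rho> = \<Phi>" "TTgt \<rho> = \<Omega>" "groth1 B \<rho> = ftcomp (groth1 B \<sigma>) (groth1 B \<tau>)"
  using P.functor_over_is_groth1[OF functor_over_comp[OF fT fS]] by blast
 have "oplax_data B \<Phi> \<Omega> \<rho>" using oplax_dataI[OF B oplax_transformation_frame[OF \<rho>(1)]] \<rho>(2,3) by simp
 then have "\<rho> = ?\<rho>"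
  by (rule R.groth1_inject) (use * \<rho> V in simp_all)
 then show "is_oplax B ?\<rho>" "groth1 B ?\<rho> = ftcomp (groth1 B \<sigma>) (groth1 B \<tau>)"
  using \<rho> by simp_all
qed

lemma oplax_id:
 assumes "pseudo_functor (op_cat B) \<Phi>" and B: "category B"
 shows "is_oplax B (lax_id (op_cat B) \<Phi>)" "groth1 B (lax_id (op_cat B) \<Phi>) = ftid (total_cat B \<Phi>)"
proof -
 interpret indexed B \<Phi> using assms by unfold_locales
 interpret P: indexed_pair B \<Phi> \<Phi> by unfold_locales
 let ?\<rho> = "lax_id (op_cat B) \<Phi>"
 have "oplax_frame (op_cat B) ?\<rho>"
  by (rule oplax_frameI) (simp_all add: pseudo, simp_all add: lax_id_def)
 then interpret R: oplax_data B \<Phi> \<Phi> ?\<rho> by unfold_locales simp_all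
 have *: "FM (groth1 B ?\<rho>) x = x" if "x \<in> Arr E" for x
 proof -
  from that obtain d f h e where [simp]: "x = GA d f h e" "f \<in> Arr B" "d \<in> Obj (PO \<Phi> (Dom B f))" "e \<in> Obj (PO \<Phi> (Cod B f))"
   "h \<in> Arr (PO \<Phi> (Dom B f))" "Dom (PO \<Phi> (Dom B f)) h = d" "Cod (PO \<Phi> (Dom B f)) h = FO (PM \<Phi> f) e"
   by (elim total_cat_ArrE)
  show ?thesis by (simp add: groth1_simps(4))
 qed
 have "functor_over B (total_proj B E, ftid E, total_proj B E)"
  using functor_over_id[of B "total_proj B E"] by simp
 then obtain \<rho> where \<rho>: "is_oplax B \<rho>" "TSrc \<rho> = \<Phi>" "TTgt \<rho> = \<Phi>" "groth1 B \<rho> = ftid E"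
  using P.functor_over_is_groth1 by blast
 have "oplax_data B \<Phi> \<Phi> \<rho>" using oplax_dataI[OF B oplax_transformation_frame[OF \<rho>(1)]] \<rho>(2,3) by simp
 then have "\<rho> = ?\<rho>"
  by (rule R.groth1_inject) (use * \<rho> in simp_all)
 then show "is_oplax B ?\<rho>" "groth1 B ?\<rho> = ftid E"
  using \<rho> by simp_all
qed

lemma pmod_frameD:
 assumes "pmod_frame C \<Xi>"
 shows "TSrc (MTgt \<Xi>) = TSrc (MSrc \<Xi>)" "TTgt (MTgt \<Xi>) = TTgt (MSrc \<Xi>)" "MO \<Xi> \<in> extensional (Obj C)"
  "b \<in> Obj C ==> is_nt (MO \<Xi> b)" "b \<in> Obj C ==> NSrc (MO \<Xi> b) = TO (MSrc \<Xi>) b" "b \<in> Obj C ==> NTgt (MO \<Xi> b) = TO (MTgt \<Xi>) b"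
 using assms unfolding pmod_frame_def is_nt_between_def by simp_all

lemma groth2_eqI:
 assumes "NSrc u = groth1 B (MSrc \<Xi>)" "NTgt u = groth1 B (MTgt \<Xi>)" "NMap u \<in> extensional (Obj (total_cat B (TSrc (MSrc \<Xi>))))"
  "\<And>b e. b \<in> Obj B ==> e \<in> Obj (PO (TSrc (MSrc \<Xi>)) b) ==> NMap (groth2 B \<Xi>) (GO b e) = NMap u (GO b e)"
 shows "groth2 B \<Xi> = u"
proof -
 have "NMap (groth2 B \<Xi>) = NMap u"
  by (rule extensionalityI[where A = "Obj (total_cat B (TSrc (MSrc \<Xi>)))"]) (use assms in "auto elim!: total_cat_ObjE")
 then show ?thesis using assms(1,2) groth2_simps(1,2)[of B \<Xi>] by (cases "groth2 B \<Xi>", cases u) simp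
qed

text \<open>
 The component of the induced transformation at \<open>(b, e)\<close> is the vertical arrow of the component of the
 modification, from which the latter is recovered.
\<close>

context oplax_parallel
begin

lemma groth2_MO:
 assumes "pmod_frame (op_cat B) \<Xi>" "MSrc \<Xi> = \<sigma>" "MTgt \<Xi> = \<tau>" "b \<in> Obj B" "e \<in> Obj (PO \<Phi> b)"
 shows "NMap (groth2 B \<Xi>) (GO b e) = vertical B \<Psi> b (NMap (MO \<Xi> b) e)"
 using assms pmod_frameD[OF assms(1)] groth2_vertical[of b B e \<Xi>] by simp

lemma groth2_inject:
 assumes \<Xi>: "pmod_frame (op_cat B) \<Xi>" "MSrc \<Xi> = \<sigma>" "MTgt \<Xi> = \<tau>"
  and \<Theta>: "pmod_frame (op_cat B) \<Theta>" "MSrc \<Theta> = \<sigma>" "MTgt \<Theta> = \<tau>"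
  and eq: "groth2 B \<Xi> = groth2 B \<Theta>"
 shows "\<Xi> = \<Theta>"
proof -
 have "MO \<Xi> = MO \<Theta>"
 proof (rule extensionalityI[where A = "Obj B"])
  fix b assume [simp]: "b \<in> Obj B"
  show "MO \<Xi> b = MO \<Theta> b"
  proof (rule nt_eqI)
   fix e assume "e \<in> Obj (FDom (NSrc (MO \<Theta> b)))"
   then have [simp]: "e \<in> Obj (PO \<Phi> b)" using pmod_frameD[OF \<Theta>(1)] \<Theta>(2) by simp
   have "vertical B \<Psi> b (NMap (MO \<Xi> b) e) = vertical B \<Psi> b (NMap (MO \<Theta> b) e)"
    using groth2_MO[OF \<Xi>, of b e] groth2_MO[OF \<Theta>, of b e] eq by simp
   then show "NMap (MO \<Xi> b) e = NMap (MO \<Theta> b) e"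
    by (rule S.Psi.vertical_inject) (use pmod_frameD[OF \<Xi>(1)] pmod_frameD[OF \<Theta>(1)] \<Xi>(2,3) \<Theta>(2,3) in simp_all)
  qed (use pmod_frameD[OF \<Xi>(1)] pmod_frameD[OF \<Theta>(1)] \<Xi>(2,3) \<Theta>(2,3) in simp_all)
 qed (use pmod_frameD(3)[OF \<Xi>(1)] pmod_frameD(3)[OF \<Theta>(1)] in simp_all)
 then show ?thesis using \<Xi>(2,3) \<Theta>(2,3) by (cases \<Xi>, cases \<Theta>) simp
qed

lemma transformation_over_groth2:
 assumes "is_oplax2 B \<Xi>" "MSrc \<Xi> = \<sigma>" "MTgt \<Xi> = \<tau>"
 shows "transformation_over B (total_proj B (total_cat B \<Phi>), groth2 B \<Xi>, total_proj B (total_cat B \<Psi>))"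
proof -
 have frame: "pmod_frame (op_cat B) \<Xi>" and eq: "\<forall>f\<in>Arr B. \<forall>e\<in>Obj (PO \<Phi> (Cod B f)).
    NMap (TM \<tau> f) e *[PO \<Psi> (Dom B f)] NMap (MO \<Xi> (Dom B f)) (FO (PM \<Phi> f) e) =
    FM (PM \<Psi> f) (NMap (MO \<Xi> (Cod B f)) e) *[PO \<Psi> (Dom B f)] NMap (TM \<sigma> f) e"
  using assms unfolding oplax_modification_iff by simp_all
 show ?thesis
  by (rule groth_transformation[where m = "MO \<Xi>"])
   (use assms(2,3) pmod_frameD[OF frame] eq groth2_simps(3)[of B \<Xi>] groth2_MO[OF frame] in simp_all)
qed

lemma transformation_is_groth2:
 assumes "transformation_over B (total_proj B (total_cat B \<Phi>), u, total_proj B (total_cat B \<Psi>))"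
  and u: "NSrc u = groth1 B \<sigma>" "NTgt u = groth1 B \<tau>"
 obtains \<Xi> where "is_oplax2 B \<Xi>" "MSrc \<Xi> = \<sigma>" "MTgt \<Xi> = \<tau>" "groth2 B \<Xi> = u"
proof -
 obtain m where m [simp]: "\<And>b. b \<in> Obj B ==> is_nt (m b)" "\<And>b. b \<in> Obj B ==> NSrc (m b) = TO \<sigma> b" "\<And>b. b \<in> Obj B ==> NTgt (m b) = TO \<tau> b"
  and NMap: "\<And>b e. b \<in> Obj B ==> e \<in> Obj (PO \<Phi> b) ==> NMap u (GO b e) = vertical B \<Psi> b (NMap (m b) e)"
  and eq: "\<And>f e. f \<in> Arr B ==> e \<in> Obj (PO \<Phi> (Cod B f)) ==>
   NMap (TM \<tau> f) e *[PO \<Psi> (Dom B f)] NMap (m (Dom B f)) (FO (PM \<Phi> f) e) =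
   FM (PM \<Psi> f) (NMap (m (Cod B f)) e) *[PO \<Psi> (Dom B f)] NMap (TM \<sigma> f) e"
  using transformation_is_groth[OF assms] by blast
 define \<Xi> where "\<Xi> = \<lparr>MSrc = \<sigma>, MTgt = \<tau>, MO = (\<lambda>b\<in>Obj B. m b)\<rparr>"
 have [simp]: "MSrc \<Xi> = \<sigma>" "MTgt \<Xi> = \<tau>" "b \<in> Obj B ==> MO \<Xi> b = m b" for b by (simp_all add: \<Xi>_def)
 have frame: "pmod_frame (op_cat B) \<Xi>"
  by (simp add: pmod_frame_def is_nt_between_def) (simp add: \<Xi>_def)
 have "is_oplax2 B \<Xi>"
  unfolding oplax_modification_iff by (simp add: S T frame eq)
 moreover have "groth2 B \<Xi> = u"
  by (rule groth2_eqI) (use u nt_extensional[OF transformation_overD(1)[OF assms(1)]] in "simp_all add: groth2_MO[OF frame] NMap")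
 ultimately show thesis using that by simp
qed

lemma oplax_modification_if_groth2:
 assumes "pmod_frame (op_cat B) \<Xi>" "MSrc \<Xi> = \<sigma>" "MTgt \<Xi> = \<tau>"
  and "transformation_over B (total_proj B (total_cat B \<Phi>), groth2 B \<Xi>, total_proj B (total_cat B \<Psi>))"
 shows "is_oplax2 B \<Xi>"
proof -
 obtain \<Theta> where \<Theta>: "is_oplax2 B \<Theta>" "MSrc \<Theta> = \<sigma>" "MTgt \<Theta> = \<tau>" "groth2 B \<Theta> = groth2 B \<Xi>"
  using transformation_is_groth2[OF assms(4)] assms(2,3) by auto
 have "\<Theta> = \<Xi>"
  by (rule groth2_inject) (use \<Theta> assms in "simp_all add: oplax_modification_iff")
 then show ?thesis using \<Theta>(1) by simp
qed

end

lemma oplax_parallelI: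
 assumes "category B" "is_oplax B \<sigma>" "is_oplax B \<tau>"
  and ends: "TSrc \<tau> = \<Phi>" "TTgt \<tau> = \<Psi>" "TSrc \<sigma> = \<Phi>" "TTgt \<sigma> = \<Psi>"
 shows "oplax_parallel B \<Phi> \<Psi> \<sigma> \<tau>"
proof -
 have "oplax_data B \<Phi> \<Psi> \<sigma>" using oplax_dataI[OF assms(1) oplax_transformation_frame[OF assms(2)]] by (simp only: ends)
 moreover have "oplax_data B \<Phi> \<Psi> \<tau>" using oplax_dataI[OF assms(1) oplax_transformation_frame[OF assms(3)]] by (simp only: ends)
 ultimately show ?thesis using assms(2,3) by (simp add: oplax_parallel_def oplax_parallel_axioms_def)
qed

lemma oplax_modificationD:
 assumes "category B" "is_oplax2 B \<Xi>" and ends: "TSrc (MSrc \<Xi>) = \<Phi>" "TTgt (MSrc \<Xi>) = \<Psi>"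
 shows "oplax_parallel B \<Phi> \<Psi> (MSrc \<Xi>) (MTgt \<Xi>)" "pmod_frame (op_cat B) \<Xi>"
  "is_oplax B (MSrc \<Xi>)" "is_oplax B (MTgt \<Xi>)"
  "transformation_over B (total_proj B (total_cat B \<Phi>), groth2 B \<Xi>, total_proj B (total_cat B \<Psi>))"
proof -
 show 1: "pmod_frame (op_cat B) \<Xi>" "is_oplax B (MSrc \<Xi>)" "is_oplax B (MTgt \<Xi>)"
  using assms(2) by (simp_all add: oplax_modification_iff)
 show 2: "oplax_parallel B \<Phi> \<Psi> (MSrc \<Xi>) (MTgt \<Xi>)"
  by (rule oplax_parallelI) (use 1 assms pmod_frameD(1,2)[OF 1(1)] in simp_all)
 show "transformation_over B (total_proj B (total_cat B \<Phi>), groth2 B \<Xi>, total_proj B (total_cat B \<Psi>))"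
  by (rule oplax_parallel.transformation_over_groth2[OF 2 assms(2)]) simp_all
qed

lemma oplax_whisker_frame:
 assumes B: "category B" and \<Xi>: "is_oplax2 B \<Xi>" and \<Theta>: "is_oplax2 B \<Theta>"
  and e: "TSrc (MSrc \<Theta>) = TTgt (MSrc \<Xi>)"
 defines "P \<equiv> \<lparr>MSrc = oplax_comp (op_cat B) (MSrc \<Theta>) (MSrc \<Xi>), MTgt = oplax_comp (op_cat B) (MTgt \<Theta>) (MTgt \<Xi>),
    MO = (\<lambda>a\<in>Obj B. hcomp (MO \<Theta> a) (MO \<Xi> a))\<rparr>"
 shows "is_oplax2 B P" "groth2 B P = hcomp (groth2 B \<Theta>) (groth2 B \<Xi>)"
proof -
 obtain \<Phi> \<Psi> \<Omega> where ends: "TSrc (MSrc \<Xi>) = \<Phi>" "TTgt (MSrc \<Xi>) = \<Psi>" "TSrc (MSrc \<Theta>) = \<Psi>" "TTgt (MSrc \<Theta>) = \<Omega>" using e by blast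
 note X = oplax_modificationD[OF B \<Xi> ends(1,2)] and Y = oplax_modificationD[OF B \<Theta> ends(3,4)]
 interpret X: oplax_parallel B \<Phi> \<Psi> "MSrc \<Xi>" "MTgt \<Xi>" by (rule X)
 interpret Y: oplax_parallel B \<Psi> \<Omega> "MSrc \<Theta>" "MTgt \<Theta>" by (rule Y)
 note S = oplax_comp[OF X(3) Y(3) _ B, simplified] and T = oplax_comp[OF X(4) Y(4) _ B, simplified]
 interpret Z: oplax_parallel B \<Phi> \<Omega> "oplax_comp (op_cat B) (MSrc \<Theta>) (MSrc \<Xi>)" "oplax_comp (op_cat B) (MTgt \<Theta>) (MTgt \<Xi>)"
  by (rule oplax_parallelI[OF B S(1) T(1)]) simp_all
 note [simp] = transformation_overD(1)[OF X(5)] transformation_overD(1)[OF Y(5)] pmod_frameD[OF X(2), simplified] pmod_frameD[OF Y(2), simplified]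
 have [simp]: "MSrc P = oplax_comp (op_cat B) (MSrc \<Theta>) (MSrc \<Xi>)" "MTgt P = oplax_comp (op_cat B) (MTgt \<Theta>) (MTgt \<Xi>)"
  "b \<in> Obj B ==> MO P b = hcomp (MO \<Theta> b) (MO \<Xi> b)" for b
  by (simp_all add: P_def)
 have frame: "pmod_frame (op_cat B) P"
  by (simp add: pmod_frame_def is_nt_between_def) (simp add: P_def)
 have eq: "groth2 B P = hcomp (groth2 B \<Theta>) (groth2 B \<Xi>)"
 proof (rule groth2_eqI)
  have "is_nt (hcomp (groth2 B \<Theta>) (groth2 B \<Xi>))" by simp
  from nt_extensional[OF this] show "NMap (hcomp (groth2 B \<Theta>) (groth2 B \<Xi>)) \<in> extensional (Obj (total_cat B (TSrc (MSrc P))))" by simp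
  fix b e assume [simp]: "b \<in> Obj B" and "e \<in> Obj (PO (TSrc (MSrc P)) b)"
  then have [simp]: "e \<in> Obj (PO \<Phi> b)" by simp
  show "NMap (groth2 B P) (GO b e) = NMap (hcomp (groth2 B \<Theta>) (groth2 B \<Xi>)) (GO b e)"
   by (simp add: Z.groth2_MO[OF frame] X.groth2_MO[OF X(2)] Y.groth2_MO[OF Y(2)] Y.S.groth1_vertical[OF Y.S] Y.S.Psi.vertical_Comp)
 qed (simp_all add: S T)
 show "is_oplax2 B P"
  by (rule Z.oplax_modification_if_groth2[OF frame]) (use transformation_over_hcomp[OF X(5) Y(5) B] eq in simp_all)
 show "groth2 B P = hcomp (groth2 B \<Theta>) (groth2 B \<Xi>)" by (rule eq)
qed

lemma pmod_comp_simps [simp]: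
 "MSrc (pmod_comp C \<Theta> \<Xi>) = MSrc \<Xi>" "MTgt (pmod_comp C \<Theta> \<Xi>) = MTgt \<Theta>"
 "b \<in> Obj C ==> MO (pmod_comp C \<Theta> \<Xi>) b = ncomp (MO \<Theta> b) (MO \<Xi> b)" "MO (pmod_comp C \<Theta> \<Xi>) \<in> extensional (Obj C)"
 "MSrc (pmod_id C \<tau>) = \<tau>" "MTgt (pmod_id C \<tau>) = \<tau>" "b \<in> Obj C ==> MO (pmod_id C \<tau>) b = nid (TO \<tau> b)"
 "MO (pmod_id C \<tau>) \<in> extensional (Obj C)"
 by (simp_all add: pmod_comp_def pmod_id_def)

lemma oplax_pmod_comp:
 assumes B: "category B" and \<Xi>: "is_oplax2 B \<Xi>" and \<Theta>: "is_oplax2 B \<Theta>"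
  and e: "MSrc \<Theta> = MTgt \<Xi>"
 shows "is_oplax2 B (pmod_comp (op_cat B) \<Theta> \<Xi>)" "groth2 B (pmod_comp (op_cat B) \<Theta> \<Xi>) = ncomp (groth2 B \<Theta>) (groth2 B \<Xi>)"
proof -
 have fX: "pmod_frame (op_cat B) \<Xi>" using oplax_modificationD(2)[OF B \<Xi> refl refl] .
 obtain \<Phi> \<Psi> where ends: "TSrc (MSrc \<Xi>) = \<Phi>" "TTgt (MSrc \<Xi>) = \<Psi>" by blast
 then have ends': "TSrc (MSrc \<Theta>) = \<Phi>" "TTgt (MSrc \<Theta>) = \<Psi>" using pmod_frameD[OF fX] e by simp_all
 note X = oplax_modificationD[OF B \<Xi> ends] and Y = oplax_modificationD[OF B \<Theta> ends']
 interpret X: oplax_parallel B \<Phi> \<Psi> "MSrc \<Xi>" "MTgt \<Xi>" by (rule X)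
 interpret Y: oplax_parallel B \<Phi> \<Psi> "MSrc \<Theta>" "MTgt \<Theta>" by (rule Y)
 let ?P = "pmod_comp (op_cat B) \<Theta> \<Xi>"
 interpret Z: oplax_parallel B \<Phi> \<Psi> "MSrc \<Xi>" "MTgt \<Theta>"
  by (rule oplax_parallelI[OF B X(3) Y(4)]) simp_all
 note [simp] = transformation_overD(1)[OF X(5)] transformation_overD(1)[OF Y(5)] pmod_frameD[OF X(2), simplified] pmod_frameD[OF Y(2), simplified] e
 have frame: "pmod_frame (op_cat B) ?P"
  using pmod_comp_simps(4)[of "op_cat B" \<Theta> \<Xi>] by (simp add: pmod_frame_def is_nt_between_def)
 have eq: "groth2 B ?P = ncomp (groth2 B \<Theta>) (groth2 B \<Xi>)"
 proof (rule groth2_eqI)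
  have "is_nt (ncomp (groth2 B \<Theta>) (groth2 B \<Xi>))" by simp
  from nt_extensional[OF this] show "NMap (ncomp (groth2 B \<Theta>) (groth2 B \<Xi>)) \<in> extensional (Obj (total_cat B (TSrc (MSrc ?P))))" by simp
  fix b e assume [simp]: "b \<in> Obj B" and "e \<in> Obj (PO (TSrc (MSrc ?P)) b)"
  then have [simp]: "e \<in> Obj (PO \<Phi> b)" by simp
  show "NMap (groth2 B ?P) (GO b e) = NMap (ncomp (groth2 B \<Theta>) (groth2 B \<Xi>)) (GO b e)"
   by (simp add: Z.groth2_MO[OF frame] X.groth2_MO[OF X(2)] Y.groth2_MO[OF Y(2)] X.S.Psi.vertical_Comp)
 qed simp_all
 show "is_oplax2 B ?P"
  by (rule Z.oplax_modification_if_groth2[OF frame]) (use transformation_over_comp[OF X(5) Y(5) _ B] eq in simp_all)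
 show "groth2 B ?P = ncomp (groth2 B \<Theta>) (groth2 B \<Xi>)" by (rule eq)
qed

lemma oplax_pmod_id:
 assumes B: "category B" and \<tau>: "is_oplax B \<tau>"
 shows "is_oplax2 B (pmod_id (op_cat B) \<tau>)" "groth2 B (pmod_id (op_cat B) \<tau>) = nid (groth1 B \<tau>)"
proof -
 obtain \<Phi> \<Psi> where ends: "TSrc \<tau> = \<Phi>" "TTgt \<tau> = \<Psi>" by blast
 interpret Z: oplax_parallel B \<Phi> \<Psi> \<tau> \<tau> by (rule oplax_parallelI[OF B \<tau> \<tau> ends ends])
 note H = Z.S.functor_over_groth1[OF \<tau>]
 note [simp] = functor_overD(3)[OF H]
 let ?P = "pmod_id (op_cat B) \<tau>"
 have frame: "pmod_frame (op_cat B) ?P"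
  using pmod_comp_simps(8)[of "op_cat B" \<tau>] by (simp add: pmod_frame_def is_nt_between_def)
 have eq: "groth2 B ?P = nid (groth1 B \<tau>)"
 proof (rule groth2_eqI)
  have "is_nt (nid (groth1 B \<tau>))" by simp
  from nt_extensional[OF this] show "NMap (nid (groth1 B \<tau>)) \<in> extensional (Obj (total_cat B (TSrc (MSrc ?P))))" by simp
  fix b e assume [simp]: "b \<in> Obj B" and "e \<in> Obj (PO (TSrc (MSrc ?P)) b)"
  then have [simp]: "e \<in> Obj (PO \<Phi> b)" by simp
  show "NMap (groth2 B ?P) (GO b e) = NMap (nid (groth1 B \<tau>)) (GO b e)"
   by (simp add: Z.groth2_MO[OF frame] Z.S.Psi.vertical_Id)
 qed simp_all
 show "is_oplax2 B ?P"
  by (rule Z.oplax_modification_if_groth2[OF frame]) (use transformation_over_id[OF H] eq in simp_all)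
 show "groth2 B ?P = nid (groth1 B \<tau>)" by (rule eq)
qed

text \<open>
 The Grothendieck construction is injective and preserves the operations, so oplax transformations and
 modifications inherit the laws of a 2-category from functors and transformations over \<open>B\<close>; it is
 full because the latter are all of the form considered above.
\<close>

lemma Groth_embedding:
 fixes B :: "('o, 'm) cat"
 assumes B: "category B"
 shows "two_functor (IND B) (CAT_over B) (Groth B :: ('o, 'm, ('o, 'm, 'a) univ) groth_two_ftor)"
  and "locally_faithful (IND B) (Groth B :: ('o, 'm, ('o, 'm, 'a) univ) groth_two_ftor)"
  and "locally_full (IND B) (CAT_over B) (Groth B :: ('o, 'm, ('o, 'm, 'a) univ) groth_two_ftor)"
proof -
 let ?G = "Groth B :: ('o, 'm, ('o, 'm, 'a) univ) groth_two_ftor"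
 let ?M = "IND B :: ('o, 'm, ('o, 'm, 'a) univ) ps_two_cat"
 have ends: "pseudo_functor (op_cat B) (TSrc \<tau>)" "pseudo_functor (op_cat B) (TTgt \<tau>)" if "is_oplax B \<tau>"
  for \<tau> :: "('o, 'm, ('o, 'm, 'a) univ) ptrans"
  using that unfolding oplax_transformation_def ptrans_frame_def by blast+
 have data: "oplax_data B (TSrc \<tau>) (TTgt \<tau>) \<tau>" if "is_oplax B \<tau>" for \<tau> :: "('o, 'm, ('o, 'm, 'a) univ) ptrans"
  by (intro oplax_dataI B oplax_transformation_frame that)
 have over1: "functor_over B (total_proj B (total_cat B (TSrc \<tau>)), groth1 B \<tau>, total_proj B (total_cat B (TTgt \<tau>)))"
  if "is_oplax B \<tau>" for \<tau> :: "('o, 'm, ('o, 'm, 'a) univ) ptrans"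
  by (rule oplax_data.functor_over_groth1[OF data[OF that] that])
 have obj: "object_over B (total_proj B (total_cat B \<Phi>))" if "pseudo_functor (op_cat B) \<Phi>" for \<Phi> :: "('o, 'm, ('o, 'm, 'a) univ) psftor"
  using indexed.object_over_total_proj[of B \<Phi>] that B by (simp add: indexed_def)
 have mod: "pmod_frame (op_cat B) \<Xi>" "is_oplax B (MSrc \<Xi>)" "is_oplax B (MTgt \<Xi>)"
  "TSrc (MTgt \<Xi>) = TSrc (MSrc \<Xi>)" "TTgt (MTgt \<Xi>) = TTgt (MSrc \<Xi>)"
  "transformation_over B (total_proj B (total_cat B (TSrc (MSrc \<Xi>))), groth2 B \<Xi>, total_proj B (total_cat B (TTgt (MSrc \<Xi>))))"
  if "is_oplax2 B \<Xi>" for \<Xi> :: "('o, 'm, ('o, 'm, 'a) univ) pmod"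
  using oplax_modificationD[OF B that refl refl] pmod_frameD(1,2)[of "op_cat B" \<Xi>] by simp_all
 show faithful: "locally_faithful ?M ?G"
  unfolding locally_faithful_def
 proof (intro conjI ballI impI)
  fix \<tau> \<tau>' assume "\<tau> \<in> Arr (C1 ?M)" "\<tau>' \<in> Arr (C1 ?M)" "Dom (C1 ?M) \<tau> = Dom (C1 ?M) \<tau>'" "Cod (C1 ?M) \<tau> = Cod (C1 ?M) \<tau>'" "F1 ?G \<tau> = F1 ?G \<tau>'"
  then have *: "is_oplax B \<tau>" "is_oplax B \<tau>'" "TSrc \<tau> = TSrc \<tau>'" "TTgt \<tau> = TTgt \<tau>'" "groth1 B \<tau> = groth1 B \<tau>'"
   by simp_all
  show "\<tau> = \<tau>'"
   by (rule oplax_data.groth1_inject[OF data[OF *(2)] data[OF *(1), unfolded *(3,4)] _ *(1)])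
    (use * oplax_data.groth1_vertical[OF data[OF *(2)] *(2)] in auto)
 next
  fix \<Xi> \<Theta> assume "\<Xi> \<in> Arr (C2 ?M)" "\<Theta> \<in> Arr (C2 ?M)" "Dom (C2 ?M) \<Xi> = Dom (C2 ?M) \<Theta>" "Cod (C2 ?M) \<Xi> = Cod (C2 ?M) \<Theta>" "F2 ?G \<Xi> = F2 ?G \<Theta>"
  then have *: "is_oplax2 B \<Xi>" "is_oplax2 B \<Theta>" "MSrc \<Xi> = MSrc \<Theta>" "MTgt \<Xi> = MTgt \<Theta>" "groth2 B \<Xi> = groth2 B \<Theta>"
   by simp_all
  show "\<Xi> = \<Theta>"
   by (rule oplax_parallel.groth2_inject[OF oplax_modificationD(1)[OF B *(2) refl refl]]) (use * mod(1) in simp_all)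
 qed
 show "locally_full ?M (CAT_over B) ?G"
  unfolding locally_full_def
 proof (intro conjI ballI impI)
  fix \<Phi> \<Psi> g assume *: "\<Phi> \<in> Obj (C1 ?M)" "\<Psi> \<in> Obj (C1 ?M)" and g: "g \<in> hom (C1 (CAT_over B)) (F0 ?G \<Phi>) (F0 ?G \<Psi>)"
  interpret indexed_pair B \<Phi> \<Psi> using * B by unfold_locales simp_all
  obtain H where H: "g = (total_proj B (total_cat B \<Phi>), H, total_proj B (total_cat B \<Psi>))" "functor_over B g"
   using g by (cases g) (auto simp: hom_def)
  show "\<exists>\<tau>\<in>hom (C1 ?M) \<Phi> \<Psi>. F1 ?G \<tau> = g"
   using functor_over_is_groth1[of H] H by (auto simp: hom_def)
 next
  fix \<sigma> \<tau> v assume \<sigma>: "\<sigma> \<in> Arr (C1 ?M)" and \<tau>: "\<tau> \<in> Arr (C1 ?M)" and e: "Dom (C1 ?M) \<sigma> = Dom (C1 ?M) \<tau>" "Cod (C1 ?M) \<sigma> = Cod (C1 ?M) \<tau>"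
   and v: "v \<in> hom (C2 (CAT_over B)) (F1 ?G \<sigma>) (F1 ?G \<tau>)"
  obtain \<Phi> \<Psi> where ends: "TSrc \<tau> = \<Phi>" "TTgt \<tau> = \<Psi>" "TSrc \<sigma> = \<Phi>" "TTgt \<sigma> = \<Psi>" using e by simp
  interpret oplax_parallel B \<Phi> \<Psi> \<sigma> \<tau> by (rule oplax_parallelI[OF B]) (use \<sigma> \<tau> ends in simp_all)
  obtain u where u: "v = (total_proj B (total_cat B \<Phi>), u, total_proj B (total_cat B \<Psi>))" "transformation_over B v"
    "NSrc u = groth1 B \<sigma>" "NTgt u = groth1 B \<tau>"
   using v by (cases v) (auto simp: hom_def)
  obtain \<Xi> where "is_oplax2 B \<Xi>" "MSrc \<Xi> = \<sigma>" "MTgt \<Xi> = \<tau>" "groth2 B \<Xi> = u"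
   using transformation_is_groth2[of u] u by auto
  then show "\<exists>\<Xi>\<in>hom (C2 ?M) \<sigma> \<tau>. F2 ?G \<Xi> = v"
   using u(1) by (intro bexI[of _ \<Xi>]) (simp_all add: hom_def)
 qed
 show "two_functor ?M (CAT_over B) ?G"
 proof (rule two_category_reflect[OF two_category_CAT_over[OF B]])
  show "closed_graph (C1 ?M)"
   by (rule closed_graphI) (simp_all add: hom_def ends oplax_id B oplax_comp)
  show "closed_graph (C2 ?M)"
   by (rule closed_graphI) (simp_all add: hom_def mod(2,3) oplax_pmod_id B oplax_pmod_comp)
  show "Obj (C2 ?M) = Arr (C1 ?M)" by simp
  show "locally_faithful ?M ?G" by (rule faithful)
  show "preserves_cat (C1 ?M) (C1 (CAT_over B)) (F0 ?G) (F1 ?G)"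
   by (rule preserves_catI) (simp_all add: hom_def oplax_id oplax_comp obj over1 B)
  show "preserves_cat (C2 ?M) (C2 (CAT_over B)) (F1 ?G) (F2 ?G)"
   by (rule preserves_catI) (simp_all add: hom_def oplax_pmod_id oplax_pmod_comp over1 mod B)
 qed (simp_all add: hom_def mod B oplax_whisker_frame)
qed

section \<open>Bifibrations\<close>

subsection \<open>Adjunctions from universal arrows\<close>

definition universal_arrow :: "('p, 'n, 'o, 'm) ftor => 'o => 'm => 'p => bool" where
 "universal_arrow G x u w \<longleftrightarrow> w \<in> Obj (FDom G) \<and> u \<in> hom (FCod G) x (FO G w) \<and>
   (\<forall>y\<in>Obj (FDom G). \<forall>h\<in>hom (FCod G) x (FO G y). \<exists>!k. k \<in> hom (FDom G) w y \<and> FM G k *[FCod G] u = h)"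

lemma adjunction_simps [simp]:
 assumes "adjunction a"
 shows "is_functor (ALeft a)" "is_functor (ARight a)" "FDom (ARight a) = ATgt a" "FCod (ARight a) = ASrc a"
  "is_nt (AUnit a)" "NSrc (AUnit a) = ftid (ASrc a)" "NTgt (AUnit a) = ftcomp (ARight a) (ALeft a)"
  "is_nt (ACounit a)" "NSrc (ACounit a) = ftcomp (ALeft a) (ARight a)" "NTgt (ACounit a) = ftid (ATgt a)"
 using assms unfolding adjunction_def is_nt_between_def by blast+

lemma adjunction_triangles:
 assumes "adjunction a"
 shows "ASrc a = C ==> ATgt a = D ==> x \<in> Obj C ==> NMap (ACounit a) (FO (ALeft a) x) *[D] FM (ALeft a) (NMap (AUnit a) x) = Id D (FO (ALeft a) x)"
  "ASrc a = C ==> ATgt a = D ==> y \<in> Obj D ==> FM (ARight a) (NMap (ACounit a) y) *[C] NMap (AUnit a) (FO (ARight a) y) = Id C (FO (ARight a) y)"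
 using assms unfolding adjunction_def by blast+

lemma adj_transpose_simps [simp]:
 assumes "adjunction a" "x \<in> Obj (ASrc a)" "f \<in> Arr (ATgt a)" "Dom (ATgt a) f = FO (ALeft a) x"
 shows "ASrc a = C ==> adj_transpose a x f \<in> Arr C" "ASrc a = C ==> Dom C (adj_transpose a x f) = x"
  "ASrc a = C ==> Cod C (adj_transpose a x f) = FO (ARight a) (Cod (ATgt a) f)"
 using assms by (auto simp: adj_transpose_def)

definition adj_cotranspose :: "('o, 'm, 'p, 'n) adj => 'p => 'm => 'n" where
 "adj_cotranspose a y h = NMap (ACounit a) y *[ATgt a] FM (ALeft a) h"

lemma adj_cotranspose_simps [simp]:
 assumes "adjunction a" "y \<in> Obj (ATgt a)" "h \<in> Arr (ASrc a)" "Cod (ASrc a) h = FO (ARight a) y"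
 shows "ATgt a = D ==> adj_cotranspose a y h \<in> Arr D" "ATgt a = D ==> Dom D (adj_cotranspose a y h) = FO (ALeft a) (Dom (ASrc a) h)"
  "ATgt a = D ==> Cod D (adj_cotranspose a y h) = y"
 using assms by (auto simp: adj_cotranspose_def)

lemma transpose_cotranspose:
 assumes a [simp]: "adjunction a" and [simp]: "y \<in> Obj (ATgt a)" "h \<in> Arr (ASrc a)" "Cod (ASrc a) h = FO (ARight a) y" and x: "Dom (ASrc a) h = x"
 shows "adj_transpose a x (adj_cotranspose a y h) = h"
proof -
 let ?C = "ASrc a" and ?D = "ATgt a"
 have "FM (ARight a) (FM (ALeft a) h) *[?C] NMap (AUnit a) x = NMap (AUnit a) (FO (ARight a) y) *[?C] h"
  using nt_natural[of "AUnit a" ?C ?C h] x by auto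
 moreover have "FM (ARight a) (NMap (ACounit a) y) *[?C] (NMap (AUnit a) (FO (ARight a) y) *[?C] h) = Id ?C (FO (ARight a) y) *[?C] h"
  by (rule comp_comp_eq) (simp_all add: adjunction_triangles)
 ultimately show ?thesis using x by (auto simp: adj_transpose_def adj_cotranspose_def)
qed

lemma cotranspose_transpose:
 assumes a [simp]: "adjunction a" and [simp]: "x \<in> Obj (ASrc a)" "f \<in> Arr (ATgt a)" "Dom (ATgt a) f = FO (ALeft a) x" and y: "Cod (ATgt a) f = y"
 shows "adj_cotranspose a y (adj_transpose a x f) = f"
proof -
 let ?C = "ASrc a" and ?D = "ATgt a"
 have "NMap (ACounit a) y *[?D] FM (ALeft a) (FM (ARight a) f) = f *[?D] NMap (ACounit a) (FO (ALeft a) x)"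
  using nt_natural[of "ACounit a" ?D ?D f] y by auto
 then have "NMap (ACounit a) y *[?D] (FM (ALeft a) (FM (ARight a) f) *[?D] FM (ALeft a) (NMap (AUnit a) x)) =
   f *[?D] (NMap (ACounit a) (FO (ALeft a) x) *[?D] FM (ALeft a) (NMap (AUnit a) x))"
  using y by (intro comp_eq_comp) auto
 then show ?thesis using y by (auto simp: adj_transpose_def adj_cotranspose_def adjunction_triangles)
qed

lemma adjunction_universal_arrow:
 assumes a [simp]: "adjunction a" and x [simp]: "x \<in> Obj (ASrc a)"
 shows "universal_arrow (ARight a) x (NMap (AUnit a) x) (FO (ALeft a) x)"
 unfolding universal_arrow_def
proof (intro conjI ballI)
 fix y h assume "y \<in> Obj (FDom (ARight a))" "h \<in> hom (FCod (ARight a)) x (FO (ARight a) y)"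
 then have [simp]: "y \<in> Obj (ATgt a)" "h \<in> Arr (ASrc a)" "Dom (ASrc a) h = x" "Cod (ASrc a) h = FO (ARight a) y"
  by (simp_all add: hom_def)
 show "\<exists>!k. k \<in> hom (FDom (ARight a)) (FO (ALeft a) x) y \<and> FM (ARight a) k *[FCod (ARight a)] NMap (AUnit a) x = h"
 proof (rule ex1I[of _ "adj_cotranspose a y h"])
  show "adj_cotranspose a y h \<in> hom (FDom (ARight a)) (FO (ALeft a) x) y \<and>
    FM (ARight a) (adj_cotranspose a y h) *[FCod (ARight a)] NMap (AUnit a) x = h"
   using transpose_cotranspose[of a y h x] by (simp add: hom_def adj_transpose_def)
  fix k assume "k \<in> hom (FDom (ARight a)) (FO (ALeft a) x) y \<and> FM (ARight a) k *[FCod (ARight a)] NMap (AUnit a) x = h"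
  then show "k = adj_cotranspose a y h"
   using cotranspose_transpose[of a x k y] by (simp add: hom_def adj_transpose_def)
 qed
qed (simp_all add: hom_def)

text \<open>
 The left adjoint maps \<open>h : x \<rightarrow> x'\<close> to the unique factorization of \<open>u' \<circ> h\<close> through the universal
 arrow of \<open>x\<close>, where \<open>u'\<close> is that of \<open>x'\<close>; everything else follows from uniqueness of factorizations.
\<close>

lemma right_adjoint_if_universal_arrows:
 assumes G [simp]: "is_functor G" and ex: "\<And>x. x \<in> Obj (FCod G) ==> \<exists>u w. universal_arrow G x u w"
 shows "is_right_adjoint G"
proof -
 let ?C = "FCod G" and ?D = "FDom G"
 obtain u w where univ: "\<And>x. x \<in> Obj ?C ==> universal_arrow G x (u x) (w x)" using ex by metis
 have [simp]: "w x \<in> Obj ?D" "u x \<in> Arr ?C" "Dom ?C (u x) = x" "Cod ?C (u x) = FO G (w x)" if "x \<in> Obj ?C" for x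
  using univ[OF that] by (simp_all add: universal_arrow_def hom_def)
 have ex1: "\<exists>!k. k \<in> hom ?D (w x) y \<and> FM G k *[?C] u x = h" if "x \<in> Obj ?C" "y \<in> Obj ?D" "h \<in> hom ?C x (FO G y)" for x y h
  using univ[OF that(1)] that unfolding universal_arrow_def by blast
 define t where "t x y h = (THE k. k \<in> hom ?D (w x) y \<and> FM G k *[?C] u x = h)" for x y h
 have t [simp]: "t x y h \<in> Arr ?D" "Dom ?D (t x y h) = w x" "Cod ?D (t x y h) = y" "FM G (t x y h) *[?C] u x = h"
  if "h \<in> Arr ?C" "Dom ?C h = x" "Cod ?C h = FO G y" "x \<in> Obj ?C" "y \<in> Obj ?D" for x y h
  using theI'[OF ex1[of x y h]] that by (simp_all add: t_def hom_def)
 have unique: "k = l" if "k \<in> Arr ?D" "Dom ?D k = w x" "l \<in> Arr ?D" "Dom ?D l = w x" "Cod ?D k = Cod ?D l" "FM G k *[?C] u x = FM G l *[?C] u x" "x \<in> Obj ?C" for k l x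
  using ex1[of x "Cod ?D l" "FM G l *[?C] u x"] that by (simp add: hom_def) blast
 define F where "F = \<lparr>FDom = ?C, FCod = ?D, FO = (\<lambda>x\<in>Obj ?C. w x),
  FM = (\<lambda>f\<in>Arr ?C. t (Dom ?C f) (w (Cod ?C f)) (u (Cod ?C f) *[?C] f))\<rparr>"
 have F [simp]: "FDom F = ?C" "FCod F = ?D" "x \<in> Obj ?C ==> FO F x = w x"
  "f \<in> Arr ?C ==> FM F f = t (Dom ?C f) (w (Cod ?C f)) (u (Cod ?C f) *[?C] f)" for x f
  by (simp_all add: F_def)
 have GF: "FM G (FM F f) *[?C] u x = u y *[?C] f"
  if "f \<in> Arr ?C" "Dom ?C f = x" "Cod ?C f = y" for f x y
  using that by auto
 have [simp]: "is_functor F"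
 proof (rule is_functorI)
  show "FO F \<in> extensional (Obj (FDom F))" "FM F \<in> extensional (Arr (FDom F))" by (simp_all add: F_def)
  fix f g assume "f \<in> Arr (FDom F)" "g \<in> Arr (FDom F)" "Dom (FDom F) g = Cod (FDom F) f"
  then have [simp]: "f \<in> Arr ?C" "g \<in> Arr ?C" "Dom ?C g = Cod ?C f" by simp_all
  have "FM G (FM F g) *[?C] (FM G (FM F f) *[?C] u (Dom ?C f)) = u (Cod ?C g) *[?C] (g *[?C] f)"
  proof -
   have "FM G (FM F g) *[?C] (u (Cod ?C f) *[?C] f) = u (Cod ?C g) *[?C] (g *[?C] f)"
    by (rule comp_eq_comp) simp_all
   then show ?thesis by simp
  qed
  then show "FM F (g *[FDom F] f) = FM F g *[FCod F] FM F f"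
   by - (rule unique[of _ "Dom ?C f"], simp_all)
 next
  fix x assume "x \<in> Obj (FDom F)"
  then have [simp]: "x \<in> Obj ?C" by simp
  show "FM F (Id (FDom F) x) = Id (FCod F) (FO F x)"
   by (rule unique[of _ x]) simp_all
 qed (simp_all add: hom_def)
 define \<eta> where "\<eta> = \<lparr>NSrc = ftid ?C, NTgt = ftcomp G F, NMap = (\<lambda>x\<in>Obj ?C. u x)\<rparr>"
 have [simp]: "NSrc \<eta> = ftid ?C" "NTgt \<eta> = ftcomp G F" "x \<in> Obj ?C ==> NMap \<eta> x = u x" for x by (simp_all add: \<eta>_def)
 have [simp]: "is_nt \<eta>" by (rule is_ntI) (simp_all add: hom_def, simp add: \<eta>_def)
 define \<epsilon> where "\<epsilon> = \<lparr>NSrc = ftcomp F G, NTgt = ftid ?D, NMap = (\<lambda>y\<in>Obj ?D. t (FO G y) y (Id ?C (FO G y)))\<rparr>"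
 have [simp]: "NSrc \<epsilon> = ftcomp F G" "NTgt \<epsilon> = ftid ?D" "y \<in> Obj ?D ==> NMap \<epsilon> y = t (FO G y) y (Id ?C (FO G y))" for y by (simp_all add: \<epsilon>_def)
 have comp1: "FM G (t (FO G y) y (Id ?C (FO G y))) *[?C] (u (FO G y) *[?C] h) = h"
  if [simp]: "y \<in> Obj ?D" "h \<in> Arr ?C" "Cod ?C h = FO G y" for y h
 proof -
  have "FM G (t (FO G y) y (Id ?C (FO G y))) *[?C] (u (FO G y) *[?C] h) = Id ?C (FO G y) *[?C] h"
   by (rule comp_comp_eq) simp_all
  then show ?thesis by simp
 qed
 have [simp]: "is_nt \<epsilon>"
 proof (rule is_ntI)
  fix f assume "f \<in> Arr (FDom (NTgt \<epsilon>))"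
  then have [simp]: "f \<in> Arr ?D" by simp
  let ?x = "Dom ?D f" and ?y = "Cod ?D f"
  show "NMap \<epsilon> (Cod (FDom (NTgt \<epsilon>)) f) *[FCod (NTgt \<epsilon>)] FM (NSrc \<epsilon>) f = FM (NTgt \<epsilon>) f *[FCod (NTgt \<epsilon>)] NMap \<epsilon> (Dom (FDom (NTgt \<epsilon>)) f)"
   by (rule unique[of _ "FO G ?x"]) (simp_all add: comp1)
 qed (simp_all add: hom_def, simp add: \<epsilon>_def)
 define a where "a = \<lparr>ALeft = F, ARight = G, AUnit = \<eta>, ACounit = \<epsilon>\<rparr>"
 have [simp]: "ALeft a = F" "ARight a = G" "AUnit a = \<eta>" "ACounit a = \<epsilon>" by (simp_all add: a_def)
 have "NMap \<epsilon> (w x) *[?D] FM F (u x) = Id ?D (w x)" if [simp]: "x \<in> Obj ?C" for x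
  by (rule unique[of _ x]) (simp_all add: comp1)
 then have "adjunction a"
  by (simp add: adjunction_def is_nt_between_def)
 then show ?thesis unfolding is_right_adjoint_def by (intro exI[of _ a]) simp
qed

lemma is_right_adjointE:
 assumes "is_right_adjoint G"
 obtains a where "adjunction a" "ARight a = G"
 using assms by (auto simp: is_right_adjoint_def)

subsection \<open>Invariance of bifibrations\<close>

lemma cartesianD:
 assumes "cartesian p \<phi>" "\<psi> \<in> Arr (FDom p)" "Cod (FDom p) \<psi> = Cod (FDom p) \<phi>"
  "g \<in> Arr (FCod p)" "Dom (FCod p) g = FO p (Dom (FDom p) \<psi>)" "Cod (FCod p) g = FO p (Dom (FDom p) \<phi>)"
  "FM p \<psi> = FM p \<phi> *[FCod p] g"
 shows "\<exists>!w. w \<in> hom (FDom p) (Dom (FDom p) \<psi>) (Dom (FDom p) \<phi>) \<and> FM p w = g \<and> \<phi> *[FDom p] w = \<psi>"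
 using assms unfolding cartesian_def by (simp add: hom_def)

text \<open>
 The image under \<open>K\<close> of a Cartesian arrow is Cartesian, since \<open>H\<close> and \<open>K\<close> translate the factorization
 problems into each other.
\<close>

lemma fibration_transfer:
 assumes H: "functor_over B (p, H, q)" and K: "functor_over B (q, K, p)"
  and KH: "ftcomp K H = ftid (FDom p)" and HK: "ftcomp H K = ftid (FDom q)" and q: "fibration q"
 shows "fibration p"
 unfolding fibration_def
proof (intro conjI ballI impI)
 note [simp] = functor_overD[OF H] functor_overD[OF K]
 let ?P = "FDom p" and ?Q = "FDom q"
 have [simp]: "FO K (FO H x) = x" if "x \<in> Obj ?P" for x
  using ftcomp_simps(3)[of x H K] that by (simp add: KH)
 have [simp]: "FM K (FM H f) = f" if "f \<in> Arr ?P" for f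
  using ftcomp_simps(4)[of f H K] that by (simp add: KH)
 have [simp]: "FO H (FO K x) = x" if "x \<in> Obj ?Q" for x
  using ftcomp_simps(3)[of x K H] that by (simp add: HK)
 have [simp]: "FM H (FM K f) = f" if "f \<in> Arr ?Q" for f
  using ftcomp_simps(4)[of f K H] that by (simp add: HK)
 show "is_functor p" by simp
 fix e f assume e [simp]: "e \<in> Obj ?P" and "f \<in> Arr (FCod p)" "Cod (FCod p) f = FO p e"
 then have f [simp]: "f \<in> Arr B" "Cod B f = FO p e" by simp_all
 obtain \<phi> where cart: "cartesian q \<phi>" and \<phi>: "Cod ?Q \<phi> = FO H e" "FM q \<phi> = f"
 proof -
  have "FO H e \<in> Obj ?Q" "f \<in> Arr (FCod q)" "Cod (FCod q) f = FO q (FO H e)" by simp_all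
  then show thesis using q that unfolding fibration_def by blast
 qed
 have [simp]: "\<phi> \<in> Arr ?Q" using cart by (simp add: cartesian_def)
 have "cartesian p (FM K \<phi>)"
  unfolding cartesian_def
 proof (intro conjI ballI impI)
  fix \<psi> g assume [simp]: "\<psi> \<in> Arr ?P" and g: "g \<in> hom (FCod p) (FO p (Dom ?P \<psi>)) (FO p (Dom ?P (FM K \<phi>)))"
   and cod: "Cod ?P \<psi> = Cod ?P (FM K \<phi>)" and eq: "FM p \<psi> = FM p (FM K \<phi>) *[FCod p] g"
  have "\<exists>!w. w \<in> hom ?Q (Dom ?Q (FM H \<psi>)) (Dom ?Q \<phi>) \<and> FM q w = g \<and> \<phi> *[?Q] w = FM H \<psi>"
   by (rule cartesianD[OF cart, of "FM H \<psi>" g]) (use g cod eq in "simp_all add: hom_def \<phi>")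
  then obtain w where w0: "w \<in> hom ?Q (Dom ?Q (FM H \<psi>)) (Dom ?Q \<phi>) \<and> FM q w = g \<and> \<phi> *[?Q] w = FM H \<psi>"
   and unique: "\<And>w'. w' \<in> hom ?Q (Dom ?Q (FM H \<psi>)) (Dom ?Q \<phi>) \<and> FM q w' = g \<and> \<phi> *[?Q] w' = FM H \<psi> ==> w' = w"
   by - (erule ex1E, blast)
  have w: "w \<in> Arr ?Q" "Dom ?Q w = FO H (Dom ?P \<psi>)" "Cod ?Q w = Dom ?Q \<phi>" "FM q w = g" "\<phi> *[?Q] w = FM H \<psi>"
   using w0 by (simp_all add: hom_def)
  show "\<exists>!w. w \<in> hom ?P (Dom ?P \<psi>) (Dom ?P (FM K \<phi>)) \<and> FM p w = g \<and> FM K \<phi> *[?P] w = \<psi>"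
  proof (rule ex1I[of _ "FM K w"])
   have "FM K \<phi> *[?P] FM K w = FM K (\<phi> *[?Q] w)" using w(1-3) by simp
   then show "FM K w \<in> hom ?P (Dom ?P \<psi>) (Dom ?P (FM K \<phi>)) \<and> FM p (FM K w) = g \<and> FM K \<phi> *[?P] FM K w = \<psi>"
    using w by (simp add: hom_def)
   fix w' assume "w' \<in> hom ?P (Dom ?P \<psi>) (Dom ?P (FM K \<phi>)) \<and> FM p w' = g \<and> FM K \<phi> *[?P] w' = \<psi>"
   then have w': "w' \<in> Arr ?P" "Dom ?P w' = Dom ?P \<psi>" "Cod ?P w' = FO K (Dom ?Q \<phi>)" "FM p w' = g" "FM K \<phi> *[?P] w' = \<psi>"
    by (simp_all add: hom_def)
   have "FM H \<psi> = FM H (FM K \<phi>) *[?Q] FM H w'" unfolding w'(5)[symmetric] using w'(1-3) by simp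
   then have "FM H w' = w" using w'(1-4) by (intro unique) (simp add: hom_def)
   then show "w' = FM K w" using w'(1) by auto
  qed
 qed simp
 then show "\<exists>\<phi>. cartesian p \<phi> \<and> Cod ?P \<phi> = e \<and> FM p \<phi> = f"
  using \<phi> by (intro exI[of _ "FM K \<phi>"]) simp
qed

lemma op_ftor_simps [simp]:
 "FDom (op_ftor F) = op_cat (FDom F)" "FCod (op_ftor F) = op_cat (FCod F)" "FO (op_ftor F) = FO F" "FM (op_ftor F) = FM F"
 by (simp_all add: op_ftor_def)

lemma is_functor_op_ftor [simp]: "is_functor F ==> is_functor (op_ftor F)"
 by (rule is_functorI) (simp_all add: hom_def functor_extensional)

lemma op_ftor_ftcomp: "op_ftor (ftcomp G F) = ftcomp (op_ftor G) (op_ftor F)"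
 by (simp add: op_ftor_def ftcomp_def)

lemma op_ftor_ftid: "op_ftor (ftid C) = ftid (op_cat C)"
 by (simp add: op_ftor_def ftid_def)

lemma functor_over_op:
 assumes "functor_over B (p, H, q)"
 shows "functor_over (op_cat B) (op_ftor p, op_ftor H, op_ftor q)"
proof -
 note [simp] = functor_overD[OF assms]
 show ?thesis by (rule functor_overI) (simp_all add: object_over_def)
qed

lemma bifibration_transfer:
 assumes H: "functor_over B (p, H, q)" and K: "functor_over B (q, K, p)"
  and KH: "ftcomp K H = ftid (FDom p)" and HK: "ftcomp H K = ftid (FDom q)" and q: "bifibration q"
 shows "bifibration p"
proof -
 have "fibration (op_ftor p)"
  by (rule fibration_transfer[OF functor_over_op[OF H] functor_over_op[OF K]])
   (use q in "simp_all add: op_ftor_ftcomp[symmetric] KH HK op_ftor_ftid bifibration_def opfibration_def")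
 then show ?thesis using fibration_transfer[OF H K KH HK] q by (simp add: bifibration_def opfibration_def)
qed

lemma inv_arrow_cancel [simp]:
 assumes "category C" "iso_arrow C f" "x \<in> Arr C"
 shows "Cod C x = Cod C f ==> f *[C] (inv_arrow C f *[C] x) = x" "Cod C x = Dom C f ==> inv_arrow C f *[C] (f *[C] x) = x"
 using assms comp_comp_eq[OF assms(1) inv_arrow(5)[OF assms(1,2)], of x] comp_comp_eq[OF assms(1) inv_arrow(4)[OF assms(1,2)], of x]
  iso_arrow_Arr[of C f] by simp_all

subsection \<open>Total categories that are bifibrations\<close>

context indexed
begin

text \<open>
 The lift of \<open>f\<close> is Cartesian: an arrow over \<open>f g\<close> is turned into one over \<open>g\<close> with the inverse of \<open>\<gamma>\<close>.
\<close>

lemma fibration_total: "fibration (total_proj B E)"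
 unfolding fibration_def
proof (intro conjI ballI impI)
 let ?p = "total_proj B E"
 note [simp] = category_total
 show "is_functor ?p" using object_over_total_proj by (rule object_overD)
 fix x f assume "x \<in> Obj (FDom ?p)" "f \<in> Arr (FCod ?p)" "Cod (FCod ?p) f = FO ?p x"
 then obtain e where [simp]: "x = GO (Cod B f) e" "f \<in> Arr B" "e \<in> Obj (PO \<Phi> (Cod B f))"
  by (auto elim: total_cat_ObjE)
 let ?a = "Dom B f" and ?d = "FO (PM \<Phi> f) e"
 have "cartesian ?p (lift B \<Phi> f e)"
  unfolding cartesian_def
 proof (intro conjI ballI impI)
  fix y g assume "y \<in> Arr (FDom ?p)" and g: "g \<in> hom (FCod ?p) (FO ?p (Dom (FDom ?p) y)) (FO ?p (Dom (FDom ?p) (lift B \<Phi> f e)))"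
   and cod: "Cod (FDom ?p) y = Cod (FDom ?p) (lift B \<Phi> f e)" and eq: "FM ?p y = FM ?p (lift B \<Phi> f e) *[FCod ?p] g"
  then have y: "y \<in> Arr E" by simp
  then obtain w m h e' where y0: "y = GA w m h e'" "m \<in> Arr B" "w \<in> Obj (PO \<Phi> (Dom B m))"
   "h \<in> Arr (PO \<Phi> (Dom B m))" "Dom (PO \<Phi> (Dom B m)) h = w" "Cod (PO \<Phi> (Dom B m)) h = FO (PM \<Phi> m) e'" by (elim total_cat_ArrE)
  have [simp]: "e' = e" and m: "m = f *[B] g" using cod eq y y0(1) by (simp_all add: lift_def)
  have Dom: "Dom B g = Dom B m" and [simp]: "g \<in> Arr B" "Cod B g = ?a" using g y y0(1) by (simp_all add: hom_def lift_def)
  have [simp]: "y = GA w (f *[B] g) h e" "w \<in> Obj (PO \<Phi> (Dom B g))"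
    "h \<in> Arr (PO \<Phi> (Dom B g))" "Dom (PO \<Phi> (Dom B g)) h = w" "Cod (PO \<Phi> (Dom B g)) h = FO (PM \<Phi> (f *[B] g)) e"
   using y0 unfolding Dom by (simp_all add: m)
  let ?C = "PO \<Phi> (Dom B g)" and ?\<gamma> = "NMap (Pgamma \<Phi> g f) e"
  have comp: "lift B \<Phi> f e *[E] GA w g k ?d = GA w (f *[B] g) (?\<gamma> *[?C] k) e"
   if "k \<in> Arr ?C" "Cod ?C k = FO (PM \<Phi> g) ?d" for k
   using that by (simp add: lift_def)
  have inv: "?\<gamma> *[?C] (inv_arrow ?C ?\<gamma> *[?C] h) = h"
   by simp
  show "\<exists>!z. z \<in> hom (FDom ?p) (Dom (FDom ?p) y) (Dom (FDom ?p) (lift B \<Phi> f e)) \<and> FM ?p z = g \<and> lift B \<Phi> f e *[FDom ?p] z = y"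
  proof (rule ex1I[of _ "GA w g (inv_arrow ?C ?\<gamma> *[?C] h) ?d"])
   show "GA w g (inv_arrow ?C ?\<gamma> *[?C] h) ?d \<in> hom (FDom ?p) (Dom (FDom ?p) y) (Dom (FDom ?p) (lift B \<Phi> f e)) \<and>
    FM ?p (GA w g (inv_arrow ?C ?\<gamma> *[?C] h) ?d) = g \<and> lift B \<Phi> f e *[FDom ?p] GA w g (inv_arrow ?C ?\<gamma> *[?C] h) ?d = y"
    by (simp add: hom_def comp inv)
   fix z assume z: "z \<in> hom (FDom ?p) (Dom (FDom ?p) y) (Dom (FDom ?p) (lift B \<Phi> f e)) \<and> FM ?p z = g \<and> lift B \<Phi> f e *[FDom ?p] z = y"
   then have "z \<in> Arr E" by (simp add: hom_def)
   with z obtain k where [simp]: "z = GA w g k ?d" "k \<in> Arr ?C" "Dom ?C k = w" "Cod ?C k = FO (PM \<Phi> g) ?d"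
    by (elim total_cat_ArrE) (auto simp: hom_def)
   have "?\<gamma> *[?C] k = ?\<gamma> *[?C] (inv_arrow ?C ?\<gamma> *[?C] h)" using z comp[of k] inv by simp
   then have "k = inv_arrow ?C ?\<gamma> *[?C] h" by - (rule iso_cancel_left[of ?C ?\<gamma>], simp_all)
   then show "z = GA w g (inv_arrow ?C ?\<gamma> *[?C] h) ?d" by simp
  qed
 qed simp
 then show "\<exists>\<phi>. cartesian ?p \<phi> \<and> Cod (FDom ?p) \<phi> = x \<and> FM ?p \<phi> = f"
  by (intro exI[of _ "lift B \<Phi> f e"]) (simp add: lift_def)
qed

text \<open>
 The opcartesian arrows out of \<open>(a, d)\<close> are the universal arrows from \<open>d\<close> to the reindexing functor:
 an arrow over \<open>g f\<close> corresponds, by composition with the inverse of \<open>\<gamma>\<close>, to an arrow into \<open>f\<^sup>* g\<^sup>* e\<close>.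
\<close>

lemma opcartesian_if_universal:
 assumes f [simp]: "f \<in> Arr B" and univ: "universal_arrow (PM \<Phi> f) d u w"
 shows "cartesian (op_ftor (total_proj B E)) (GA d f u w)"
 unfolding cartesian_def
proof (intro conjI ballI impI)
 let ?p = "op_ftor (total_proj B E)" and ?C = "PO \<Phi> (Dom B f)"
 have u [simp]: "w \<in> Obj (PO \<Phi> (Cod B f))" "u \<in> Arr ?C" "Dom ?C u = d" "Cod ?C u = FO (PM \<Phi> f) w" "d \<in> Obj ?C"
  using univ category_Arr(1)[of ?C u] by (simp_all add: universal_arrow_def hom_def)
 show "GA d f u w \<in> Arr (FDom ?p)" by simp
 fix y g assume y: "y \<in> Arr (FDom ?p)" and g: "g \<in> hom (FCod ?p) (FO ?p (Dom (FDom ?p) y)) (FO ?p (Dom (FDom ?p) (GA d f u w)))"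
  and cod: "Cod (FDom ?p) y = Cod (FDom ?p) (GA d f u w)" and eq: "FM ?p y = FM ?p (GA d f u w) *[FCod ?p] g"
 from y have "y \<in> Arr E" by simp
 then obtain d' m h e where y0: "y = GA d' m h e" "m \<in> Arr B" "e \<in> Obj (PO \<Phi> (Cod B m))"
  "h \<in> Arr (PO \<Phi> (Dom B m))" "Dom (PO \<Phi> (Dom B m)) h = d'" "Cod (PO \<Phi> (Dom B m)) h = FO (PM \<Phi> m) e" by (elim total_cat_ArrE)
 have [simp]: "d' = d" and m: "m = g *[B] f" "Dom B m = Dom B f" using cod eq \<open>y \<in> Arr E\<close> y0(1) by simp_all
 have Cod: "Cod B g = Cod B m" and [simp]: "g \<in> Arr B" "Dom B g = Cod B f" using g \<open>y \<in> Arr E\<close> y0(1) by (simp_all add: hom_def)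
 have [simp]: "y = GA d (g *[B] f) h e" "e \<in> Obj (PO \<Phi> (Cod B g))"
   "h \<in> Arr ?C" "Dom ?C h = d" "Cod ?C h = FO (PM \<Phi> (g *[B] f)) e"
  using y0 unfolding Cod m(2) by (simp_all add: m(1))
 let ?\<gamma> = "NMap (Pgamma \<Phi> f g) e"
 let ?h = "inv_arrow ?C ?\<gamma> *[?C] h"
 have inv: "?\<gamma> *[?C] ?h = h"
  by simp
 have "\<exists>!k. k \<in> hom (PO \<Phi> (Cod B f)) w (FO (PM \<Phi> g) e) \<and> FM (PM \<Phi> f) k *[?C] u = ?h"
  using univ unfolding universal_arrow_def by (simp add: hom_def)
 then obtain k where k: "k \<in> hom (PO \<Phi> (Cod B f)) w (FO (PM \<Phi> g) e) \<and> FM (PM \<Phi> f) k *[?C] u = ?h"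
  and unique: "\<And>k'. k' \<in> hom (PO \<Phi> (Cod B f)) w (FO (PM \<Phi> g) e) \<and> FM (PM \<Phi> f) k' *[?C] u = ?h ==> k' = k"
  by - (erule ex1E, blast)
 have [simp]: "k \<in> Arr (PO \<Phi> (Cod B f))" "Dom (PO \<Phi> (Cod B f)) k = w" "Cod (PO \<Phi> (Cod B f)) k = FO (PM \<Phi> g) e"
  and fk: "FM (PM \<Phi> f) k *[?C] u = ?h"
  using k by (simp_all add: hom_def)
 show "\<exists>!z. z \<in> hom (FDom ?p) (Dom (FDom ?p) y) (Dom (FDom ?p) (GA d f u w)) \<and> FM ?p z = g \<and> GA d f u w *[FDom ?p] z = y"
 proof (rule ex1I[of _ "GA w g k e"])
  show "GA w g k e \<in> hom (FDom ?p) (Dom (FDom ?p) y) (Dom (FDom ?p) (GA d f u w)) \<and> FM ?p (GA w g k e) = g \<and>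
    GA d f u w *[FDom ?p] GA w g k e = y"
   using fk inv by (simp add: hom_def)
  fix z assume z: "z \<in> hom (FDom ?p) (Dom (FDom ?p) y) (Dom (FDom ?p) (GA d f u w)) \<and> FM ?p z = g \<and> GA d f u w *[FDom ?p] z = y"
  then have "z \<in> Arr E" by (simp add: hom_def)
  with z obtain k' where [simp]: "z = GA w g k' e" "k' \<in> Arr (PO \<Phi> (Cod B f))" "Dom (PO \<Phi> (Cod B f)) k' = w" "Cod (PO \<Phi> (Cod B f)) k' = FO (PM \<Phi> g) e"
   by (elim total_cat_ArrE) (auto simp: hom_def)
  have "?\<gamma> *[?C] (FM (PM \<Phi> f) k' *[?C] u) = ?\<gamma> *[?C] ?h" using z inv by simp
  then have "FM (PM \<Phi> f) k' *[?C] u = ?h" by - (rule iso_cancel_left[of ?C ?\<gamma>], simp_all)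
  then show "z = GA w g k e" using unique[of k'] by (simp add: hom_def)
 qed
qed

lemma universal_if_opcartesian:
 assumes f [simp]: "f \<in> Arr B" and cart: "cartesian (op_ftor (total_proj B E)) (GA d f u w)"
 shows "universal_arrow (PM \<Phi> f) d u w"
 unfolding universal_arrow_def
proof (intro conjI ballI)
 let ?p = "op_ftor (total_proj B E)" and ?C = "PO \<Phi> (Dom B f)" and ?D = "PO \<Phi> (Cod B f)"
 have "GA d f u w \<in> Arr E" using cart by (simp add: cartesian_def)
 then have u [simp]: "w \<in> Obj ?D" "u \<in> Arr ?C" "Dom ?C u = d" "Cod ?C u = FO (PM \<Phi> f) w" "d \<in> Obj ?C" by simp_all
 show "w \<in> Obj (FDom (PM \<Phi> f))" "u \<in> hom (FCod (PM \<Phi> f)) d (FO (PM \<Phi> f) w)" by (simp_all add: hom_def)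
 fix y h assume "y \<in> Obj (FDom (PM \<Phi> f))" "h \<in> hom (FCod (PM \<Phi> f)) d (FO (PM \<Phi> f) y)"
 then have [simp]: "y \<in> Obj ?D" "h \<in> Arr ?C" "Dom ?C h = d" "Cod ?C h = FO (PM \<Phi> f) y" by (simp_all add: hom_def)
 have vert: "vertical B \<Phi> (Cod B f) k *[E] GA d f u w = GA d f (FM (PM \<Phi> f) k *[?C] u) y"
  if "k \<in> Arr ?D" "Dom ?D k = w" "Cod ?D k = y" for k
  using that by (simp add: vertical_comp_left)
 have "\<exists>!z. z \<in> hom (FDom ?p) (Dom (FDom ?p) (GA d f h y)) (Dom (FDom ?p) (GA d f u w)) \<and> FM ?p z = Id B (Cod B f) \<and> GA d f u w *[FDom ?p] z = GA d f h y"
  by (rule cartesianD[OF cart]) simp_all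
 then obtain z where z0: "z \<in> hom (FDom ?p) (Dom (FDom ?p) (GA d f h y)) (Dom (FDom ?p) (GA d f u w)) \<and> FM ?p z = Id B (Cod B f) \<and> GA d f u w *[FDom ?p] z = GA d f h y"
  and unique0: "\<And>z'. z' \<in> hom (FDom ?p) (Dom (FDom ?p) (GA d f h y)) (Dom (FDom ?p) (GA d f u w)) \<and> FM ?p z' = Id B (Cod B f) \<and> GA d f u w *[FDom ?p] z' = GA d f h y ==> z' = z"
  by - (erule ex1E, blast)
 have "z \<in> Arr E" using z0 by (simp add: hom_def)
 then have z: "z \<in> hom E (GO (Cod B f) w) (GO (Cod B f) y)" "ar_base z = Id B (Cod B f)" "z *[E] GA d f u w = GA d f h y"
  using z0 by (simp_all add: hom_def)
 have unique: "z' = z" if "z' \<in> hom E (GO (Cod B f) w) (GO (Cod B f) y)" "ar_base z' = Id B (Cod B f)" "z' *[E] GA d f u w = GA d f h y" for z'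
  by (rule unique0) (use that in "simp add: hom_def")
 obtain w' m k0 y' where zz: "z = GA w' m k0 y'" using \<open>z \<in> Arr E\<close> by (elim total_cat_ArrE)
 have "w' = w" "m = Id B (Cod B f)" "y' = y" using z(1,2) by (simp_all add: zz hom_def)
 then have k0: "z = GA w (Id B (Cod B f)) k0 y" using zz by simp
 have "Cod B f \<in> Obj B" by simp
 note va = vertical_arrow[OF \<open>z \<in> Arr E\<close>[unfolded k0] this]
 obtain k where k: "z = vertical B \<Phi> (Cod B f) k" "k \<in> Arr ?D" "Dom ?D k = w" "Cod ?D k = y"
  by (rule that[OF _ va(2-4)]) (simp only: k0 va(1)[symmetric])
 show "\<exists>!k. k \<in> hom (FDom (PM \<Phi> f)) w y \<and> FM (PM \<Phi> f) k *[FCod (PM \<Phi> f)] u = h"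
 proof (rule ex1I[of _ k])
  show "k \<in> hom (FDom (PM \<Phi> f)) w y \<and> FM (PM \<Phi> f) k *[FCod (PM \<Phi> f)] u = h"
   using z(3) k vert[of k] by (simp add: hom_def)
  fix k' assume "k' \<in> hom (FDom (PM \<Phi> f)) w y \<and> FM (PM \<Phi> f) k' *[FCod (PM \<Phi> f)] u = h"
  then have k': "k' \<in> Arr ?D" "Dom ?D k' = w" "Cod ?D k' = y" "FM (PM \<Phi> f) k' *[?C] u = h" by (simp_all add: hom_def)
  have "vertical B \<Phi> (Cod B f) k' = z"
   by (rule unique) (use k' vert[of k'] in "simp_all add: hom_def", simp add: vertical_def)
  then have "vertical B \<Phi> (Cod B f) k' = vertical B \<Phi> (Cod B f) k" using k(1) by simp
  then show "k' = k" by (rule vertical_inject) (use k k' in simp_all)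
 qed
qed

lemma bifibration_total_iff: "bifibration (total_proj B E) \<longleftrightarrow> (\<forall>f\<in>Arr B. is_right_adjoint (PM \<Phi> f))"
proof
 let ?p = "op_ftor (total_proj B E)"
 assume bif: "bifibration (total_proj B E)"
 show "\<forall>f\<in>Arr B. is_right_adjoint (PM \<Phi> f)"
 proof (intro ballI right_adjoint_if_universal_arrows)
  fix f d assume [simp]: "f \<in> Arr B" and "d \<in> Obj (FCod (PM \<Phi> f))"
  then have "GO (Dom B f) d \<in> Obj (FDom ?p)" "f \<in> Arr (FCod ?p)" "Cod (FCod ?p) f = FO ?p (GO (Dom B f) d)" by simp_all
  then obtain \<phi> where cart: "cartesian ?p \<phi>" and \<phi>: "Cod (FDom ?p) \<phi> = GO (Dom B f) d" "FM ?p \<phi> = f"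
   using bif unfolding bifibration_def opfibration_def fibration_def by blast
  have "\<phi> \<in> Arr E" using cart by (simp add: cartesian_def)
  then obtain u w where "\<phi> = GA d f u w" using \<phi> by (elim total_cat_ArrE) auto
  then show "\<exists>u w. universal_arrow (PM \<Phi> f) d u w"
   using universal_if_opcartesian[of f d u w] cart by auto
 qed simp
next
 let ?p = "op_ftor (total_proj B E)"
 assume adj: "\<forall>f\<in>Arr B. is_right_adjoint (PM \<Phi> f)"
 have "fibration ?p"
  unfolding fibration_def
 proof (intro conjI ballI impI)
  show "is_functor ?p" using object_overD(1)[OF object_over_total_proj] by simp
  fix x f assume "x \<in> Obj (FDom ?p)" "f \<in> Arr (FCod ?p)" "Cod (FCod ?p) f = FO ?p x"
  then obtain d where [simp]: "x = GO (Dom B f) d" "f \<in> Arr B" "d \<in> Obj (PO \<Phi> (Dom B f))"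
   by (auto elim: total_cat_ObjE)
  have "is_right_adjoint (PM \<Phi> f)" using adj by simp
  then obtain a where a: "adjunction a" "ARight a = PM \<Phi> f" by (rule is_right_adjointE)
  have "ASrc a = PO \<Phi> (Dom B f)" using adjunction_simps(4)[OF a(1)] a(2) by simp
  then have univ: "universal_arrow (PM \<Phi> f) d (NMap (AUnit a) d) (FO (ALeft a) d)"
   using adjunction_universal_arrow[OF a(1), of d] a(2) by simp
  then have "GA d f (NMap (AUnit a) d) (FO (ALeft a) d) \<in> Arr E" by (simp add: universal_arrow_def hom_def)
  then show "\<exists>\<phi>. cartesian ?p \<phi> \<and> Cod (FDom ?p) \<phi> = x \<and> FM ?p \<phi> = f"
   using opcartesian_if_universal[OF _ univ] by (intro exI[of _ "GA d f (NMap (AUnit a) d) (FO (ALeft a) d)"]) simp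
 qed
 then show "bifibration (total_proj B E)"
  using fibration_total by (simp add: bifibration_def opfibration_def)
qed

end

subsection \<open>The indexed category of a cloven fibration\<close>

text \<open>
 A fibration with a choice \<open>c f e\<close> of a Cartesian arrow over \<open>f\<close> into \<open>e\<close>. The reindexing functors and the
 comparison isomorphisms are defined by factorization through chosen arrows. Two arrows over the same
 arrow of \<open>B\<close> are equal if their composites with a chosen arrow are, which proves all equations.
\<close>

locale cloven =
 fixes B :: "('o, 'm) cat" and p :: "(('o, 'm, 'a) univ, ('o, 'm, 'a) univ, 'o, 'm) ftor" and c
 assumes proj [simp]: "is_functor p" and base [simp]: "FCod p = B"
  and cleavage: "f \<in> Arr B ==> e \<in> Obj (FDom p) ==> FO p e = Cod B f ==>
   cartesian p (c f e) \<and> Cod (FDom p) (c f e) = e \<and> FM p (c f e) = f"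
begin

abbreviation "T \<equiv> FDom p"

lemma base_category [simp]: "category B"
 using functor_simps(2)[OF proj] by simp

lemma c [simp]:
 assumes "f \<in> Arr B" "e \<in> Obj T" "FO p e = Cod B f"
 shows "c f e \<in> Arr T" "Cod T (c f e) = e" "FM p (c f e) = f" "FO p (Dom T (c f e)) = Dom B f"
proof -
 show 1: "c f e \<in> Arr T" "Cod T (c f e) = e" "FM p (c f e) = f"
  using cleavage[OF assms] by (simp_all add: cartesian_def)
 show "FO p (Dom T (c f e)) = Dom B f" using functor_simps(5)[OF proj base, of "c f e"] 1 by simp
qed

definition "factor f e g \<psi> = (THE w. w \<in> hom T (Dom T \<psi>) (Dom T (c f e)) \<and> FM p w = g \<and> c f e *[T] w = \<psi>)"

lemma factor_ex1:
 assumes "f \<in> Arr B" "e \<in> Obj T" "FO p e = Cod B f" "\<psi> \<in> Arr T" "Cod T \<psi> = e" "g \<in> Arr B" "Cod B g = Dom B f" "FM p \<psi> = f *[B] g"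
 shows "\<exists>!w. w \<in> hom T (Dom T \<psi>) (Dom T (c f e)) \<and> FM p w = g \<and> c f e *[T] w = \<psi>"
proof (rule cartesianD)
 show "Dom (FCod p) g = FO p (Dom T \<psi>)" using functor_simps(5)[OF proj base, of \<psi>] assms by simp
qed (use assms cleavage[of f e] in simp_all)

lemma factor [simp]:
 assumes "f \<in> Arr B" "e \<in> Obj T" "FO p e = Cod B f" "\<psi> \<in> Arr T" "Cod T \<psi> = e" "g \<in> Arr B" "Cod B g = Dom B f" "FM p \<psi> = f *[B] g"
 shows "factor f e g \<psi> \<in> Arr T" "Dom T (factor f e g \<psi>) = Dom T \<psi>" "Cod T (factor f e g \<psi>) = Dom T (c f e)"
  "FM p (factor f e g \<psi>) = g" "c f e *[T] factor f e g \<psi> = \<psi>"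
 using theI'[OF factor_ex1[OF assms]] by (simp_all add: factor_def hom_def)

lemma factor_comp [simp]:
 assumes "f \<in> Arr B" "e \<in> Obj T" "FO p e = Cod B f" "\<psi> \<in> Arr T" "Cod T \<psi> = e" "g \<in> Arr B" "Cod B g = Dom B f" "FM p \<psi> = f *[B] g"
  "x \<in> Arr T" "Cod T x = Dom T \<psi>"
 shows "c f e *[T] (factor f e g \<psi> *[T] x) = \<psi> *[T] x"
 by (rule comp_comp_eq) (use assms in simp_all)

lemma unique:
 assumes "c f e *[T] w = c f e *[T] w'" "FM p w = FM p w'" "f \<in> Arr B" "e \<in> Obj T" "FO p e = Cod B f"
  "w \<in> Arr T" "w' \<in> Arr T" "Dom T w = Dom T w'" "Cod T w = Dom T (c f e)" "Cod T w' = Dom T (c f e)"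
 shows "w = w'"
proof -
 have "Cod B (FM p w') = Dom B f" using functor_simps(6)[OF proj base, of w'] assms(3-) by simp
 then have "\<exists>!w0. w0 \<in> hom T (Dom T (c f e *[T] w')) (Dom T (c f e)) \<and> FM p w0 = FM p w' \<and> c f e *[T] w0 = c f e *[T] w'"
  by (intro factor_ex1) (use assms(3-) in simp_all)
 moreover have "w \<in> hom T (Dom T (c f e *[T] w')) (Dom T (c f e)) \<and> FM p w = FM p w' \<and> c f e *[T] w = c f e *[T] w'"
  "w' \<in> hom T (Dom T (c f e *[T] w')) (Dom T (c f e)) \<and> FM p w' = FM p w' \<and> c f e *[T] w' = c f e *[T] w'"
  by (use assms in "simp_all add: hom_def")
 ultimately show ?thesis by blast
qed

definition "fib b = \<lparr>Obj = {e \<in> Obj T. FO p e = b}, Arr = {h \<in> Arr T. FM p h = Id B b}, Dom = Dom T, Cod = Cod T,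
 Id = Id T, Comp = Comp T\<rparr>"

lemma fib_simps [simp]:
 "e \<in> Obj (fib b) \<longleftrightarrow> e \<in> Obj T \<and> FO p e = b" "h \<in> Arr (fib b) \<longleftrightarrow> h \<in> Arr T \<and> FM p h = Id B b"
 "Dom (fib b) = Dom T" "Cod (fib b) = Cod T" "Id (fib b) = Id T" "Comp (fib b) = Comp T"
 by (simp_all add: fib_def)

lemma vertical_ends:
 assumes "h \<in> Arr T" "FM p h = Id B b" "b \<in> Obj B"
 shows "FO p (Dom T h) = b" "FO p (Cod T h) = b"
 using functor_simps(5,6)[OF proj base, of h] assms by simp_all

lemma category_fib [simp]: "b \<in> Obj B ==> category (fib b)"
 by (rule categoryI) (simp_all add: hom_def vertical_ends)

definition "reindex f = \<lparr>FDom = fib (Cod B f), FCod = fib (Dom B f), FO = (\<lambda>e\<in>Obj (fib (Cod B f)). Dom T (c f e)),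
 FM = (\<lambda>h\<in>Arr (fib (Cod B f)). factor f (Cod T h) (Id B (Dom B f)) (h *[T] c f (Dom T h)))\<rparr>"

lemma reindex_simps [simp]:
 "FDom (reindex f) = fib (Cod B f)" "FCod (reindex f) = fib (Dom B f)"
 "e \<in> Obj T ==> FO p e = Cod B f ==> FO (reindex f) e = Dom T (c f e)"
 "h \<in> Arr T ==> FM p h = Id B (Cod B f) ==> FM (reindex f) h = factor f (Cod T h) (Id B (Dom B f)) (h *[T] c f (Dom T h))"
 by (simp_all add: reindex_def)

lemma functor_reindex [simp]:
 assumes [simp]: "f \<in> Arr B"
 shows "is_functor (reindex f)"
proof (rule is_functorI)
 fix h k assume "h \<in> Arr (FDom (reindex f))" "k \<in> Arr (FDom (reindex f))" and "Dom (FDom (reindex f)) k = Cod (FDom (reindex f)) h"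
 then have hk [simp]: "h \<in> Arr T" "FM p h = Id B (Cod B f)" "k \<in> Arr T" "FM p k = Id B (Cod B f)" "Dom T k = Cod T h" by simp_all
 note [simp] = vertical_ends[OF hk(1,2)] vertical_ends[OF hk(3,4)]
 show "FM (reindex f) (k *[FDom (reindex f)] h) = FM (reindex f) k *[FCod (reindex f)] FM (reindex f) h"
  by (rule unique[of f "Cod T k"]) simp_all
next
 fix e assume "e \<in> Obj (FDom (reindex f))"
 then have [simp]: "e \<in> Obj T" "FO p e = Cod B f" by simp_all
 show "FM (reindex f) (Id (FDom (reindex f)) e) = Id (FCod (reindex f)) (FO (reindex f) e)"
  by (rule unique[of f e]) simp_all
qed (simp_all add: hom_def vertical_ends, simp_all add: reindex_def)

definition "delta b = \<lparr>NSrc = ftid (fib b), NTgt = reindex (Id B b), NMap = (\<lambda>e\<in>Obj (fib b). factor (Id B b) e (Id B b) (Id T e))\<rparr>"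

definition "gamma f g = \<lparr>NSrc = ftcomp (reindex f) (reindex g), NTgt = reindex (g *[B] f),
 NMap = (\<lambda>e\<in>Obj (fib (Cod B g)). factor (g *[B] f) e (Id B (Dom B f)) (c g e *[T] c f (Dom T (c g e))))\<rparr>"

lemma delta_simps [simp]:
 "NSrc (delta b) = ftid (fib b)" "NTgt (delta b) = reindex (Id B b)"
 "e \<in> Obj T ==> FO p e = b ==> NMap (delta b) e = factor (Id B b) e (Id B b) (Id T e)"
 by (simp_all add: delta_def)

lemma gamma_simps [simp]:
 "NSrc (gamma f g) = ftcomp (reindex f) (reindex g)" "NTgt (gamma f g) = reindex (g *[B] f)"
 "e \<in> Obj T ==> FO p e = Cod B g ==>
  NMap (gamma f g) e = factor (g *[B] f) e (Id B (Dom B f)) (c g e *[T] c f (Dom T (c g e)))"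
 by (simp_all add: gamma_def)

lemma is_nt_delta [simp]:
 assumes [simp]: "b \<in> Obj B"
 shows "is_nt (delta b)"
proof (rule is_ntI)
 fix h assume "h \<in> Arr (FDom (NTgt (delta b)))"
 then have h [simp]: "h \<in> Arr T" "FM p h = Id B b" by simp_all
 note [simp] = vertical_ends[OF h]
 show "NMap (delta b) (Cod (FDom (NTgt (delta b))) h) *[FCod (NTgt (delta b))] FM (NSrc (delta b)) h =
  FM (NTgt (delta b)) h *[FCod (NTgt (delta b))] NMap (delta b) (Dom (FDom (NTgt (delta b))) h)"
  by (rule unique[of "Id B b" "Cod T h"]) simp_all
qed (simp_all add: hom_def, simp add: delta_def)

lemma delta_iso:
 assumes [simp]: "b \<in> Obj B" "e \<in> Obj T" "FO p e = b"
 shows "iso_arrow (fib b) (NMap (delta b) e)"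
proof -
 have "NMap (delta b) e *[T] c (Id B b) e = Id T (Dom T (c (Id B b) e))"
  by (rule unique[of "Id B b" e]) simp_all
 then have "inverse_arrows (fib b) (NMap (delta b) e) (c (Id B b) e)"
  by (intro inverse_arrowsI) simp_all
 then show ?thesis by (auto simp: iso_arrow_def)
qed

lemma is_nt_gamma [simp]:
 assumes [simp]: "f \<in> Arr B" "g \<in> Arr B" "Dom B g = Cod B f"
 shows "is_nt (gamma f g)"
proof (rule is_ntI)
 fix h assume "h \<in> Arr (FDom (NTgt (gamma f g)))"
 then have h [simp]: "h \<in> Arr T" "FM p h = Id B (Cod B g)" by simp_all
 note [simp] = vertical_ends[OF h]
 show "NMap (gamma f g) (Cod (FDom (NTgt (gamma f g))) h) *[FCod (NTgt (gamma f g))] FM (NSrc (gamma f g)) h =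
  FM (NTgt (gamma f g)) h *[FCod (NTgt (gamma f g))] NMap (gamma f g) (Dom (FDom (NTgt (gamma f g))) h)"
 proof (rule unique[of "g *[B] f" "Cod T h"])
  let ?gh = "factor g (Cod T h) (Id B (Cod B f)) (h *[T] c g (Dom T h))"
  have "c g (Cod T h) *[T] (?gh *[T] c f (Dom T (c g (Dom T h)))) = h *[T] (c g (Dom T h) *[T] c f (Dom T (c g (Dom T h))))" by simp
  then show "c (g *[B] f) (Cod T h) *[T] (NMap (gamma f g) (Cod (FDom (NTgt (gamma f g))) h) *[FCod (NTgt (gamma f g))] FM (NSrc (gamma f g)) h) =
   c (g *[B] f) (Cod T h) *[T] (FM (NTgt (gamma f g)) h *[FCod (NTgt (gamma f g))] NMap (gamma f g) (Dom (FDom (NTgt (gamma f g))) h))"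
   by simp
 qed simp_all
qed (simp_all add: hom_def, simp add: gamma_def)

lemma gamma_iso:
 assumes [simp]: "f \<in> Arr B" "g \<in> Arr B" "Dom B g = Cod B f" "e \<in> Obj T" "FO p e = Cod B g"
 shows "iso_arrow (fib (Dom B f)) (NMap (gamma f g) e)"
proof -
 let ?e = "Dom T (c g e)" and ?a = "Dom B f"
 define i where "i = factor f ?e (Id B ?a) (factor g e f (c (g *[B] f) e))"
 have [simp]: "i \<in> Arr T" "Dom T i = Dom T (c (g *[B] f) e)" "Cod T i = Dom T (c f ?e)" "FM p i = Id B ?a"
  "c f ?e *[T] i = factor g e f (c (g *[B] f) e)"
  by (simp_all add: i_def)
 have [simp]: "c f ?e *[T] (i *[T] x) = factor g e f (c (g *[B] f) e) *[T] x" if "x \<in> Arr T" "Cod T x = Dom T (c (g *[B] f) e)" for x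
  by (rule comp_comp_eq) (use that in simp_all)
 have 1: "NMap (gamma f g) e *[T] i = Id T (Dom T (c (g *[B] f) e))"
  by (rule unique[of "g *[B] f" e]) simp_all
 have "c f ?e *[T] (i *[T] NMap (gamma f g) e) = c f ?e *[T] Id T (Dom T (c f ?e))"
  by (rule unique[of g e]) simp_all
 then have 2: "i *[T] NMap (gamma f g) e = Id T (Dom T (c f ?e))"
  by (rule unique) simp_all
 have "inverse_arrows (fib ?a) (NMap (gamma f g) e) i"
  using 1 2 by (intro inverse_arrowsI) simp_all
 then show ?thesis by (auto simp: iso_arrow_def)
qed

definition "Fib = \<lparr>PO = fib, PM = reindex, Pdelta = delta, Pgamma = gamma\<rparr>"

lemma Fib_simps [simp]: "PO Fib = fib" "PM Fib = reindex" "Pdelta Fib = delta" "Pgamma Fib = gamma"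
 by (simp_all add: Fib_def)

lemma pseudo_functor_Fib: "pseudo_functor (op_cat B) Fib"
 unfolding pseudo_functor_def op_cat_simps Fib_simps
proof (intro conjI ballI impI)
 fix f e assume [simp]: "f \<in> Arr B" and "e \<in> Obj (fib (Cod B f))"
 then have [simp]: "e \<in> Obj T" "FO p e = Cod B f" by simp_all
 show "NMap (gamma f (Id B (Cod B f))) e *[fib (Dom B f)] FM (reindex f) (NMap (delta (Cod B f)) e) = Id (fib (Dom B f)) (FO (reindex f) e)"
  by (rule unique[of f e]) simp_all
 show "NMap (gamma (Id B (Dom B f)) f) e *[fib (Dom B f)] NMap (delta (Dom B f)) (FO (reindex f) e) = Id (fib (Dom B f)) (FO (reindex f) e)"
  by (rule unique[of f e]) simp_all
next
 fix f g h e assume [simp]: "f \<in> Arr B" "g \<in> Arr B" "h \<in> Arr B" "Cod B g = Dom B f" "Cod B h = Dom B g" and "e \<in> Obj (fib (Cod B f))"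
 then have [simp]: "e \<in> Obj T" "FO p e = Cod B f" by simp_all
 show "NMap (gamma h (f *[B] g)) e *[fib (Dom B h)] FM (reindex h) (NMap (gamma g f) e) =
  NMap (gamma (g *[B] h) f) e *[fib (Dom B h)] NMap (gamma h g) (FO (reindex f) e)"
  by (rule unique[of "f *[B] (g *[B] h)" e]) simp_all
next
 show "is_nat_iso_between (ftid (fib b)) (reindex (Id B b)) (delta b)" if "b \<in> Obj B" for b
  using that by (simp add: nat_iso_iff delta_iso del: delta_simps(3))
 show "is_nat_iso_between (ftcomp (reindex g) (reindex f)) (reindex (f *[B] g)) (gamma g f)" if "f \<in> Arr B" "g \<in> Arr B" "Cod B g = Dom B f" for f g
  using that by (simp add: nat_iso_iff gamma_iso del: gamma_simps(3))
qed simp_all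

sublocale Fib: indexed B Fib
 by unfold_locales (simp_all add: pseudo_functor_Fib)

text \<open>
 An arrow of \<open>T\<close> factors uniquely through the chosen Cartesian lift of its image; so the functor that
 composes the vertical part with the lift is bijective.
\<close>

definition "assemble = \<lparr>FDom = total_cat B Fib, FCod = T, FO = (\<lambda>x\<in>Obj (total_cat B Fib). ob_fibre x),
 FM = (\<lambda>x\<in>Arr (total_cat B Fib). c (ar_base x) (ar_tgt x) *[T] ar_fibre x)\<rparr>"

lemma assemble_simps [simp]:
 "FDom assemble = total_cat B Fib" "FCod assemble = T" "x \<in> Obj (total_cat B Fib) ==> FO assemble x = ob_fibre x"
 "x \<in> Arr (total_cat B Fib) ==> FM assemble x = c (ar_base x) (ar_tgt x) *[T] ar_fibre x"
 by (simp_all add: assemble_def)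

lemma total_ArrE:
 assumes "x \<in> Arr (total_cat B Fib)"
 obtains f h e where "x = GA (Dom T h) f h e" "f \<in> Arr B" "e \<in> Obj T" "FO p e = Cod B f" "h \<in> Arr T" "FM p h = Id B (Dom B f)" "Cod T h = Dom T (c f e)"
  "FO p (Dom T h) = Dom B f"
 using assms by (elim total_cat_ArrE) (auto simp: vertical_ends)

lemma functor_assemble: "is_functor assemble"
proof (rule is_functorI)
 note [simp] = Fib.category_total
 fix x assume "x \<in> Arr (FDom assemble)"
 then have "x \<in> Arr (total_cat B Fib)" by simp
 then obtain f h e where [simp]: "x = GA (Dom T h) f h e" "f \<in> Arr B" "e \<in> Obj T" "FO p e = Cod B f" "h \<in> Arr T" "FM p h = Id B (Dom B f)" "Cod T h = Dom T (c f e)"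
  "FO p (Dom T h) = Dom B f" by (rule total_ArrE)
 show "FM assemble x \<in> hom (FCod assemble) (FO assemble (Dom (FDom assemble) x)) (FO assemble (Cod (FDom assemble) x))"
  by (simp add: hom_def)
 fix y assume "y \<in> Arr (FDom assemble)" and yx: "Dom (FDom assemble) y = Cod (FDom assemble) x"
 then have "y \<in> Arr (total_cat B Fib)" by simp
 then obtain g k w where y: "y = GA (Dom T k) g k w" "g \<in> Arr B" "w \<in> Obj T" "FO p w = Cod B g" "k \<in> Arr T" "FM p k = Id B (Dom B g)" "Cod T k = Dom T (c g w)"
  "FO p (Dom T k) = Dom B g" by (rule total_ArrE)
 have e: "Dom B g = Cod B f" "Dom T k = e" using yx y(1) by simp_all
 note [simp] = e y[unfolded e]
 have "y *[total_cat B Fib] x \<in> Arr (total_cat B Fib)"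
  by (rule category_Comp) simp_all
 then have "FM assemble (y *[FDom assemble] x) = c (g *[B] f) w *[T] (NMap (gamma f g) w *[T] (FM (reindex f) k *[T] h))"
  by simp
 also have "\<dots> = c g w *[T] (k *[T] (c f e *[T] h))" by simp
 finally show "FM assemble (y *[FDom assemble] x) = FM assemble y *[FCod assemble] FM assemble x" by simp
next
 fix x assume "x \<in> Obj (FDom assemble)"
 then obtain b e where "x = GO b e" "b \<in> Obj B" "e \<in> Obj T" "FO p e = b" by (auto elim: total_cat_ObjE)
 then show "FO assemble x \<in> Obj (FCod assemble)" "FM assemble (Id (FDom assemble) x) = Id (FCod assemble) (FO assemble x)"
  by simp_all
qed (use Fib.category_total in "simp_all", simp_all add: assemble_def)

lemma assemble_bij:
 "bij_betw (FO assemble) (Obj (FDom assemble)) (Obj (FCod assemble))" "bij_betw (FM assemble) (Arr (FDom assemble)) (Arr (FCod assemble))"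
proof -
 show "bij_betw (FO assemble) (Obj (FDom assemble)) (Obj (FCod assemble))"
 proof (rule bij_betw_byWitness[where f' = "\<lambda>e. GO (FO p e) e"])
  show "\<forall>x\<in>Obj (FDom assemble). GO (FO p (FO assemble x)) (FO assemble x) = x" by (auto elim: total_cat_ObjE)
  show "FO assemble ` Obj (FDom assemble) \<subseteq> Obj (FCod assemble)" by (auto elim: total_cat_ObjE)
 qed auto
 have c: "factor (ar_base x) (ar_tgt x) (Id B (Dom B (ar_base x))) (FM assemble x) = ar_fibre x"
  "FM assemble x \<in> Arr T" "FM p (FM assemble x) = ar_base x" "Cod T (FM assemble x) = ar_tgt x" "Dom T (FM assemble x) = ar_src x"
  if "x \<in> Arr (total_cat B Fib)" for x
 proof -
  from that obtain f h e where [simp]: "x = GA (Dom T h) f h e" "f \<in> Arr B" "e \<in> Obj T" "FO p e = Cod B f" "h \<in> Arr T" "FM p h = Id B (Dom B f)" "Cod T h = Dom T (c f e)"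
   "FO p (Dom T h) = Dom B f" by (rule total_ArrE)
  show "factor (ar_base x) (ar_tgt x) (Id B (Dom B (ar_base x))) (FM assemble x) = ar_fibre x"
   by (rule unique[of f e]) simp_all
  show "FM assemble x \<in> Arr T" "FM p (FM assemble x) = ar_base x" "Cod T (FM assemble x) = ar_tgt x" "Dom T (FM assemble x) = ar_src x" by simp_all
 qed
 show "bij_betw (FM assemble) (Arr (FDom assemble)) (Arr (FCod assemble))"
 proof (rule bij_betw_byWitness[where f' = "\<lambda>h. GA (Dom T h) (FM p h) (factor (FM p h) (Cod T h) (Id B (Dom B (FM p h))) h) (Cod T h)"])
  show "\<forall>x\<in>Arr (FDom assemble). GA (Dom T (FM assemble x)) (FM p (FM assemble x)) (factor (FM p (FM assemble x)) (Cod T (FM assemble x))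
   (Id B (Dom B (FM p (FM assemble x)))) (FM assemble x)) (Cod T (FM assemble x)) = x"
   using c by (auto elim: total_ArrE)
  show "FM assemble ` Arr (FDom assemble) \<subseteq> Arr (FCod assemble)" using c(2) by auto
 qed (auto simp: vertical_ends)
qed

lemma assemble_over: "functor_over B (total_proj B (total_cat B Fib), assemble, p)"
proof (rule functor_overI)
 show "object_over B (total_proj B (total_cat B Fib))" by (rule Fib.object_over_total_proj)
 show "object_over B p" by (simp add: object_over_def)
 show "is_functor assemble" by (rule functor_assemble)
 show "x \<in> Obj (FDom (total_proj B (total_cat B Fib))) ==> FO p (FO assemble x) = FO (total_proj B (total_cat B Fib)) x" for x
  by (auto elim!: total_cat_ObjE)
 fix x assume "x \<in> Arr (FDom (total_proj B (total_cat B Fib)))"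
 then have "x \<in> Arr (total_cat B Fib)" by simp
 then show "FM p (FM assemble x) = FM (total_proj B (total_cat B Fib)) x" by (rule total_ArrE) simp
qed simp_all

end

lemma functor_over_iso:
 assumes H: "functor_over B (p, H, q)" and bij: "bij_betw (FO H) (Obj (FDom H)) (Obj (FCod H))" "bij_betw (FM H) (Arr (FDom H)) (Arr (FCod H))"
 obtains K where "functor_over B (q, K, p)" "ftcomp K H = ftid (FDom p)" "ftcomp H K = ftid (FDom q)"
  "inverse_arrows (C1 (CAT_over B)) (p, H, q) (q, K, p)"
proof -
 note [simp] = functor_overD[OF H]
 obtain K where K: "is_functor K" "FDom K = FCod H" "FCod K = FDom H" "ftcomp K H = ftid (FDom H)" "ftcomp H K = ftid (FCod H)"
  by (rule functor_inverse[OF functor_overD(3)[OF H] bij])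
 note [simp] = K
 have 1: "FO H (FO K x) = x" if "x \<in> Obj (FDom q)" for x using ftcomp_simps(3)[of x K H] that by simp
 have 2: "FM H (FM K f) = f" if "f \<in> Arr (FDom q)" for f using ftcomp_simps(4)[of f K H] that by simp
 have over: "functor_over B (q, K, p)"
 proof (rule functor_overI)
  show "x \<in> Obj (FDom q) ==> FO p (FO K x) = FO q x" for x using functor_overD(6)[OF H, of "FO K x"] 1[of x] by simp
  show "f \<in> Arr (FDom q) ==> FM p (FM K f) = FM q f" for f using functor_overD(7)[OF H, of "FM K f"] 2[of f] by simp
 qed simp_all
 moreover have "inverse_arrows (C1 (CAT_over B)) (p, H, q) (q, K, p)"
  by (intro inverse_arrowsI) (simp_all add: H over)
 ultimately show thesis using that by simp
qed

text \<open>
 Fibres are taken with all their objects and arrows in the universe of the fibration itself, so that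
 the indexed category has the values required by the Grothendieck construction.
\<close>

lemma fibration_is_total:
 fixes p :: "(('o, 'm, 'a) univ, ('o, 'm, 'a) univ, 'o, 'm) ftor"
 assumes p: "fibration p" "FCod p = B"
 obtains \<Phi> H where "pseudo_functor (op_cat B) \<Phi>" "functor_over B (total_proj B (total_cat B \<Phi>), H, p)"
  "bij_betw (FO H) (Obj (FDom H)) (Obj (FCod H))" "bij_betw (FM H) (Arr (FDom H)) (Arr (FCod H))"
proof -
 define c where "c f e = (SOME \<phi>. cartesian p \<phi> \<and> Cod (FDom p) \<phi> = e \<and> FM p \<phi> = f)" for f e
 interpret cloven B p c
 proof
  show "is_functor p" "FCod p = B" using p by (simp_all add: fibration_def)
  fix f e assume "f \<in> Arr B" "e \<in> Obj (FDom p)" "FO p e = Cod B f"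
  then have "\<exists>\<phi>. cartesian p \<phi> \<and> Cod (FDom p) \<phi> = e \<and> FM p \<phi> = f" using p unfolding fibration_def by auto
  then show "cartesian p (c f e) \<and> Cod (FDom p) (c f e) = e \<and> FM p (c f e) = f" unfolding c_def by (rule someI_ex)
 qed
 show thesis by (rule that[OF pseudo_functor_Fib assemble_over assemble_bij])
qed

lemma iso_full_sub:
 assumes "inverse_arrows (C1 K) f g" "P (Dom (C1 K) f)" "P (Cod (C1 K) f)"
 shows "iso_arrow (C1 (full_sub K P)) f"
proof -
 have "inverse_arrows (C1 (full_sub K P)) f g"
  using inverse_arrowsD[OF assms(1)] assms(2,3) by (intro inverse_arrowsI) simp_all
 then show ?thesis by (auto simp: iso_arrow_def)
qed

text \<open>
 The embedding into categories over \<open>B\<close> reaches exactly the fibrations up to isomorphism; being a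
 bifibration is invariant under isomorphism and corresponds to reindexing by right adjoints.
\<close>

theorem Groth_equivalence:
 fixes B :: "('o, 'm) cat"
 assumes B: "category B"
 shows "two_equivalence (right_IND B) (BIFIB B) (Groth B :: ('o, 'm, ('o, 'm, 'a) univ) groth_two_ftor)"
proof (rule two_equivalence_criterion)
 let ?G = "Groth B :: ('o, 'm, ('o, 'm, 'a) univ) groth_two_ftor"
 note G = Groth_embedding[OF B]
 have ix: "indexed B \<Phi>" if "pseudo_functor (op_cat B) \<Phi>" for \<Phi> :: "('o, 'm, ('o, 'm, 'a) univ) psftor"
  using that B by unfold_locales
 show "two_functor (right_IND B) (BIFIB B) ?G"
  unfolding right_IND_def BIFIB_def
  by (rule two_functor_full_sub[OF G(1)]) (simp add: indexed.bifibration_total_iff[OF ix])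
 show "locally_faithful (right_IND B) ?G"
  unfolding right_IND_def by (rule locally_faithful_full_sub[OF G(2)])
 show "locally_full (right_IND B) (BIFIB B) ?G"
  unfolding right_IND_def BIFIB_def by (rule locally_full_full_sub[OF two_functorD(1)[OF G(1)] G(3)])
 fix q :: "(('o, 'm, 'a) univ, ('o, 'm, 'a) univ, 'o, 'm) ftor" assume "q \<in> Obj (C1 (BIFIB B))"
 then have q: "FCod q = B" "bifibration q" by (simp_all add: BIFIB_def)
 obtain \<Phi> H where \<Phi>: "pseudo_functor (op_cat B) \<Phi>" and H: "functor_over B (total_proj B (total_cat B \<Phi>), H, q)"
   "bij_betw (FO H) (Obj (FDom H)) (Obj (FCod H))" "bij_betw (FM H) (Arr (FDom H)) (Arr (FCod H))"
  using fibration_is_total[of q B] q unfolding bifibration_def by blast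
 obtain K where K: "functor_over B (q, K, total_proj B (total_cat B \<Phi>))" "ftcomp K H = ftid (FDom (total_proj B (total_cat B \<Phi>)))"
   "ftcomp H K = ftid (FDom q)" "inverse_arrows (C1 (CAT_over B)) (total_proj B (total_cat B \<Phi>), H, q) (q, K, total_proj B (total_cat B \<Phi>))"
  by (rule functor_over_iso[OF H])
 have bif: "bifibration (total_proj B (total_cat B \<Phi>))"
  by (rule bifibration_transfer[OF H(1) K(1-3) q(2)])
 have "\<Phi> \<in> Obj (C1 (right_IND B))"
  using \<Phi> bif indexed.bifibration_total_iff[OF ix[OF \<Phi>]] by (simp add: right_IND_def)
 moreover have "iso_arrow (C1 (BIFIB B)) (total_proj B (total_cat B \<Phi>), H, q)"
  unfolding BIFIB_def by (rule iso_full_sub[OF K(4)]) (use bif q in simp_all)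
 moreover have "(total_proj B (total_cat B \<Phi>), H, q) \<in> hom (C1 (BIFIB B)) (F0 ?G \<Phi>) q"
  using H(1) bif q by (simp add: hom_def BIFIB_def)
 ultimately show "\<exists>\<Phi>\<in>Obj (C1 (right_IND B)). \<exists>i\<in>hom (C1 (BIFIB B)) (F0 ?G \<Phi>) q. iso_arrow (C1 (BIFIB B)) i" by blast
qed

section \<open>Mates\<close>

lemma adj_transpose_Comp_left:
 assumes [simp]: "adjunction a" "x \<in> Obj (ASrc a)" "f \<in> Arr (ATgt a)" "Dom (ATgt a) f = FO (ALeft a) x" "g \<in> Arr (ATgt a)" "Dom (ATgt a) g = Cod (ATgt a) f"
  and D [simp]: "ATgt a = D"
 shows "adj_transpose a x (g *[D] f) = FM (ARight a) g *[ASrc a] adj_transpose a x f"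
 using assms(1-6) unfolding D[symmetric] by (simp add: adj_transpose_def del: D)

lemma adj_transpose_Comp_right:
 assumes [simp]: "adjunction a" "h \<in> Arr (ASrc a)" "f \<in> Arr (ATgt a)" "Dom (ATgt a) f = FO (ALeft a) (Cod (ASrc a) h)" and x: "Dom (ASrc a) h = x" and y: "Cod (ASrc a) h = y"
  and D: "ATgt a = D"
 shows "adj_transpose a x (f *[D] FM (ALeft a) h) = adj_transpose a y f *[ASrc a] h"
proof -
 have "FM (ARight a) (FM (ALeft a) h) *[ASrc a] NMap (AUnit a) (Dom (ASrc a) h) = NMap (AUnit a) (Cod (ASrc a) h) *[ASrc a] h"
  using nt_natural[of "AUnit a" "ASrc a" "ASrc a" h] by simp
 then show ?thesis unfolding x[symmetric] y[symmetric] D[symmetric] by (simp add: adj_transpose_def)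
qed

lemma adj_transpose_inject:
 assumes "adj_transpose a x f = adj_transpose a x g" "adjunction a" "x \<in> Obj (ASrc a)" "f \<in> Arr (ATgt a)" "Dom (ATgt a) f = FO (ALeft a) x"
  "g \<in> Arr (ATgt a)" "Dom (ATgt a) g = FO (ALeft a) x" "Cod (ATgt a) f = Cod (ATgt a) g"
 shows "f = g"
proof -
 have "f = adj_cotranspose a (Cod (ATgt a) g) (adj_transpose a x f)"
  by (rule cotranspose_transpose[symmetric]) (rule assms)+
 also have "\<dots> = adj_cotranspose a (Cod (ATgt a) g) (adj_transpose a x g)" by (simp only: assms(1))
 also have "\<dots> = g" by (rule cotranspose_transpose) (rule assms refl)+
 finally show ?thesis .
qed

lemma adj_transpose_Id: "adjunction a ==> x \<in> Obj (ASrc a) ==> ATgt a = D ==> adj_transpose a x (Id D (FO (ALeft a) x)) = NMap (AUnit a) x"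
 by (auto simp: adj_transpose_def)

lemma adj_transpose_counit: "adjunction a ==> y \<in> Obj (ATgt a) ==> adj_transpose a (FO (ARight a) y) (NMap (ACounit a) y) = Id (ASrc a) (FO (ARight a) y)"
 by (simp add: adj_transpose_def adjunction_triangles)

definition square_frame :: "('o, 'm) square => bool" where
 "square_frame s \<longleftrightarrow> adjunction (STop s) \<and> adjunction (SBot s) \<and> is_functor (SLeft s) \<and> is_functor (SRight s) \<and>
   FDom (SLeft s) = ASrc (STop s) \<and> FCod (SLeft s) = ASrc (SBot s) \<and>
   FDom (SRight s) = ATgt (STop s) \<and> FCod (SRight s) = ATgt (SBot s)"

lemma square_frameD [simp]:
 assumes "square_frame s"
 shows "adjunction (STop s)" "adjunction (SBot s)" "is_functor (SLeft s)" "is_functor (SRight s)"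
  "FDom (SLeft s) = ASrc (STop s)" "FCod (SLeft s) = ASrc (SBot s)" "FDom (SRight s) = ATgt (STop s)" "FCod (SRight s) = ATgt (SBot s)"
 using assms by (simp_all add: square_frame_def)

text \<open>
 The two members of a cell determine each other. It suffices that they correspond on the units;
 \<open>mate\<close> passes from the left to the right member and \<open>comate\<close> back.
\<close>

definition mates :: "('o, 'm) square => bool" where
 "mates s \<longleftrightarrow> (\<forall>x\<in>Obj (ASrc (STop s)). adj_transpose (SBot s) (FO (SLeft s) x) (NMap (SXi s) x) =
   NMap (SZeta s) (FO (ALeft (STop s)) x) *[ASrc (SBot s)] FM (SLeft s) (NMap (AUnit (STop s)) x))"

definition xi_nt where
 "xi_nt s \<longleftrightarrow> is_nt (SXi s) \<and> NSrc (SXi s) = ftcomp (ALeft (SBot s)) (SLeft s) \<and> NTgt (SXi s) = ftcomp (SRight s) (ALeft (STop s))"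

definition zeta_nt where
 "zeta_nt s \<longleftrightarrow> is_nt (SZeta s) \<and> NSrc (SZeta s) = ftcomp (SLeft s) (ARight (STop s)) \<and> NTgt (SZeta s) = ftcomp (ARight (SBot s)) (SRight s)"

lemma xi_ntD [simp]: "xi_nt s ==> is_nt (SXi s)" "xi_nt s ==> NSrc (SXi s) = ftcomp (ALeft (SBot s)) (SLeft s)"
  "xi_nt s ==> NTgt (SXi s) = ftcomp (SRight s) (ALeft (STop s))"
 by (simp_all add: xi_nt_def)

lemma zeta_ntD [simp]: "zeta_nt s ==> is_nt (SZeta s)" "zeta_nt s ==> NSrc (SZeta s) = ftcomp (SLeft s) (ARight (STop s))"
  "zeta_nt s ==> NTgt (SZeta s) = ftcomp (ARight (SBot s)) (SRight s)"
 by (simp_all add: zeta_nt_def)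

text \<open>
 An arrow out of \<open>F x\<close> is transposed by composing its image under the right adjoint with the unit.
 So the condition at the units implies the general one by naturality of \<open>SZeta\<close>.
\<close>

lemma mates_transpose:
 assumes [simp]: "square_frame s" "xi_nt s" "zeta_nt s" and m: "mates s"
  and [simp]: "x \<in> Obj (ASrc (STop s))" "f \<in> Arr (ATgt (STop s))" "Dom (ATgt (STop s)) f = FO (ALeft (STop s)) x" and y: "Cod (ATgt (STop s)) f = y"
 shows "adj_transpose (SBot s) (FO (SLeft s) x) (FM (SRight s) f *[ATgt (SBot s)] NMap (SXi s) x) =
  NMap (SZeta s) y *[ASrc (SBot s)] FM (SLeft s) (adj_transpose (STop s) x f)"
proof -
 let ?C = "ASrc (SBot s)"
 have eq: "adj_transpose (SBot s) (FO (SLeft s) x) (NMap (SXi s) x) =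
   NMap (SZeta s) (FO (ALeft (STop s)) x) *[?C] FM (SLeft s) (NMap (AUnit (STop s)) x)"
  using m by (simp add: mates_def)
 have nat: "NMap (SZeta s) y *[?C] FM (SLeft s) (FM (ARight (STop s)) f) = FM (ARight (SBot s)) (FM (SRight s) f) *[?C] NMap (SZeta s) (FO (ALeft (STop s)) x)"
  using nt_natural[of "SZeta s" "ATgt (STop s)" ?C f] y by auto
 have "NMap (SZeta s) y *[?C] (FM (SLeft s) (FM (ARight (STop s)) f) *[?C] FM (SLeft s) (NMap (AUnit (STop s)) x)) =
  FM (ARight (SBot s)) (FM (SRight s) f) *[?C] (NMap (SZeta s) (FO (ALeft (STop s)) x) *[?C] FM (SLeft s) (NMap (AUnit (STop s)) x))"
  by (rule comp_eq_comp) (use y in "auto simp: nat")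
 then show ?thesis
  by (subst adj_transpose_Comp_left) (simp_all add: eq adj_transpose_def[of "STop s"])
qed

lemma is_square_iff: "is_square s \<longleftrightarrow> square_frame s \<and> xi_nt s \<and> zeta_nt s \<and> mates s"
proof
 assume s: "is_square s"
 then have 1: "square_frame s" "xi_nt s" "zeta_nt s"
  unfolding is_square_def square_frame_def xi_nt_def zeta_nt_def is_nt_between_def by blast+
 have "mates s"
  unfolding mates_def
 proof
  fix x assume [simp]: "x \<in> Obj (ASrc (STop s))"
  note [simp] = 1
  let ?y = "FO (ALeft (STop s)) x"
  have y: "?y \<in> Obj (ATgt (STop s))" "Id (ATgt (STop s)) ?y \<in> hom (ATgt (STop s)) ?y ?y" by (simp_all add: hom_def)
  have "adj_transpose (SBot s) (FO (SLeft s) x) (FM (SRight s) (Id (ATgt (STop s)) ?y) *[ATgt (SBot s)] NMap (SXi s) x) =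
   NMap (SZeta s) ?y *[ASrc (SBot s)] FM (SLeft s) (adj_transpose (STop s) x (Id (ATgt (STop s)) ?y))"
   using s \<open>x \<in> Obj (ASrc (STop s))\<close> y unfolding is_square_def by blast
  then show "adj_transpose (SBot s) (FO (SLeft s) x) (NMap (SXi s) x) =
   NMap (SZeta s) ?y *[ASrc (SBot s)] FM (SLeft s) (NMap (AUnit (STop s)) x)"
   by (simp add: adj_transpose_Id)
 qed
 with 1 show "square_frame s \<and> xi_nt s \<and> zeta_nt s \<and> mates s" by simp
next
 assume 1: "square_frame s \<and> xi_nt s \<and> zeta_nt s \<and> mates s"
 then show "is_square s"
  using mates_transpose[of s] unfolding is_square_def is_nt_between_def by (simp add: hom_def)
qed

lemma is_squareD [simp]:
 assumes "is_square s"
 shows "square_frame s" "xi_nt s" "zeta_nt s" "mates s" "adjunction (STop s)" "adjunction (SBot s)" "is_functor (SLeft s)" "is_functor (SRight s)"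
  "FDom (SLeft s) = ASrc (STop s)" "FCod (SLeft s) = ASrc (SBot s)" "FDom (SRight s) = ATgt (STop s)" "FCod (SRight s) = ATgt (SBot s)"
  "is_nt (SXi s)" "NSrc (SXi s) = ftcomp (ALeft (SBot s)) (SLeft s)" "NTgt (SXi s) = ftcomp (SRight s) (ALeft (STop s))"
  "is_nt (SZeta s)" "NSrc (SZeta s) = ftcomp (SLeft s) (ARight (STop s))" "NTgt (SZeta s) = ftcomp (ARight (SBot s)) (SRight s)"
 using assms unfolding is_square_iff by simp_all

lemma square_xi:
 assumes s [simp]: "is_square s" and [simp]: "x \<in> Obj (ASrc (STop s))"
 shows "NMap (SXi s) x = adj_cotranspose (SBot s) (FO (SRight s) (FO (ALeft (STop s)) x))
  (NMap (SZeta s) (FO (ALeft (STop s)) x) *[ASrc (SBot s)] FM (SLeft s) (NMap (AUnit (STop s)) x))"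
proof -
 have "adj_transpose (SBot s) (FO (SLeft s) x) (NMap (SXi s) x) =
   NMap (SZeta s) (FO (ALeft (STop s)) x) *[ASrc (SBot s)] FM (SLeft s) (NMap (AUnit (STop s)) x)"
  using is_squareD(4)[OF s] unfolding mates_def by simp
 then show ?thesis
  using cotranspose_transpose[of "SBot s" "FO (SLeft s) x" "NMap (SXi s) x"] by simp
qed

lemma square_zeta:
 assumes s [simp]: "is_square s" and [simp]: "y \<in> Obj (ATgt (STop s))"
 shows "NMap (SZeta s) y = adj_transpose (SBot s) (FO (SLeft s) (FO (ARight (STop s)) y))
  (FM (SRight s) (NMap (ACounit (STop s)) y) *[ATgt (SBot s)] NMap (SXi s) (FO (ARight (STop s)) y))"
 by (subst mates_transpose[where y = y]) (simp_all add: adj_transpose_counit)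

lemma square_eq_zeta:
 assumes s: "is_square s" and t: "is_square t" and sides: "STop s = STop t" "SBot s = SBot t" "SLeft s = SLeft t" "SRight s = SRight t"
  and eq: "\<And>y. y \<in> Obj (ATgt (STop t)) ==> NMap (SZeta s) y = NMap (SZeta t) y"
 shows "s = t"
proof -
 have z: "SZeta s = SZeta t" by (rule nt_eqI) (use s t sides eq in simp_all)
 have "SXi s = SXi t"
 proof (rule nt_eqI)
  fix x assume "x \<in> Obj (FDom (NSrc (SXi t)))"
  then have "x \<in> Obj (ASrc (STop t))" using t by simp
  then show "NMap (SXi s) x = NMap (SXi t) x" using square_xi[OF s, of x] square_xi[OF t, of x] sides z by simp
 qed (use s t sides in simp_all)
 then show ?thesis using sides z by (cases s, cases t) simp
qed

lemma square_eq_xi: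
 assumes s: "is_square s" and t: "is_square t" and sides: "STop s = STop t" "SBot s = SBot t" "SLeft s = SLeft t" "SRight s = SRight t"
  and eq: "\<And>x. x \<in> Obj (ASrc (STop t)) ==> NMap (SXi s) x = NMap (SXi t) x"
 shows "s = t"
proof -
 have z: "SXi s = SXi t" by (rule nt_eqI) (use s t sides eq in simp_all)
 have "SZeta s = SZeta t"
 proof (rule nt_eqI)
  fix y assume "y \<in> Obj (FDom (NSrc (SZeta t)))"
  then have "y \<in> Obj (ATgt (STop t))" using t by simp
  then show "NMap (SZeta s) y = NMap (SZeta t) y" using square_zeta[OF s, of y] square_zeta[OF t, of y] sides z by simp
 qed (use s t sides in simp_all)
 then show ?thesis using sides z by (cases s, cases t) simp
qed

definition mate :: "('o, 'm) square => ('o, 'm, 'o, 'm) nt" where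
 "mate s = \<lparr>NSrc = ftcomp (SLeft s) (ARight (STop s)), NTgt = ftcomp (ARight (SBot s)) (SRight s),
   NMap = (\<lambda>y\<in>Obj (ATgt (STop s)). adj_transpose (SBot s) (FO (SLeft s) (FO (ARight (STop s)) y))
    (FM (SRight s) (NMap (ACounit (STop s)) y) *[ATgt (SBot s)] NMap (SXi s) (FO (ARight (STop s)) y)))\<rparr>"

definition comate :: "('o, 'm) square => ('o, 'm, 'o, 'm) nt" where
 "comate s = \<lparr>NSrc = ftcomp (ALeft (SBot s)) (SLeft s), NTgt = ftcomp (SRight s) (ALeft (STop s)),
   NMap = (\<lambda>x\<in>Obj (ASrc (STop s)). adj_cotranspose (SBot s) (FO (SRight s) (FO (ALeft (STop s)) x))
    (NMap (SZeta s) (FO (ALeft (STop s)) x) *[ASrc (SBot s)] FM (SLeft s) (NMap (AUnit (STop s)) x)))\<rparr>"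

text \<open>
 The transpose of \<open>K \<epsilon> \<circ> \<xi>\<close> serves as right member. Its naturality and the mate condition follow from
 those of transposition and from the triangle equations.
\<close>

lemma square_mate:
 assumes s [simp]: "square_frame s" "xi_nt s"
 shows "is_square (s\<lparr>SZeta := mate s\<rparr>)"
proof -
 let ?F = "ALeft (STop s)" and ?G = "ARight (STop s)" and ?F' = "ALeft (SBot s)" and ?G' = "ARight (SBot s)"
  and ?H = "SLeft s" and ?K = "SRight s"
 let ?C = "ASrc (STop s)" and ?D = "ATgt (STop s)" and ?C' = "ASrc (SBot s)" and ?D' = "ATgt (SBot s)"
 define r where "r y = FM ?K (NMap (ACounit (STop s)) y) *[?D'] NMap (SXi s) (FO ?G y)" for y
 have r [simp]: "r y \<in> Arr ?D'" "Dom ?D' (r y) = FO ?F' (FO ?H (FO ?G y))" "Cod ?D' (r y) = FO ?K y" if "y \<in> Obj ?D" for y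
  using that by (simp_all add: r_def)
 have m [simp]: "NSrc (mate s) = ftcomp ?H ?G" "NTgt (mate s) = ftcomp ?G' ?K"
  "y \<in> Obj ?D ==> NMap (mate s) y = adj_transpose (SBot s) (FO ?H (FO ?G y)) (r y)" for y
  by (simp_all add: mate_def r_def)
 have xi_nat: "NMap (SXi s) (Cod ?C h) *[?D'] FM ?F' (FM ?H h) = FM ?K (FM ?F h) *[?D'] NMap (SXi s) (Dom ?C h)" if "h \<in> Arr ?C" for h
  using nt_natural[of "SXi s" ?C ?D' h] that by simp
 have nt: "is_nt (mate s)"
 proof (rule is_ntI)
  fix g assume "g \<in> Arr (FDom (NTgt (mate s)))"
  then have g [simp]: "g \<in> Arr ?D" by simp
  let ?y = "Dom ?D g" and ?z = "Cod ?D g"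
  have 1: "NMap (ACounit (STop s)) ?z *[?D] FM ?F (FM ?G g) = g *[?D] NMap (ACounit (STop s)) ?y"
   using nt_natural[of "ACounit (STop s)" ?D ?D g] by simp
  have 2: "r ?z *[?D'] FM ?F' (FM ?H (FM ?G g)) = FM ?K g *[?D'] r ?y"
  proof -
   have "r ?z *[?D'] FM ?F' (FM ?H (FM ?G g)) = FM ?K (NMap (ACounit (STop s)) ?z) *[?D'] (FM ?K (FM ?F (FM ?G g)) *[?D'] NMap (SXi s) (FO ?G ?y))"
    using xi_nat[of "FM ?G g"] by (simp add: r_def)
   also have "\<dots> = FM ?K (NMap (ACounit (STop s)) ?z *[?D] FM ?F (FM ?G g)) *[?D'] NMap (SXi s) (FO ?G ?y)" by simp
   also have "\<dots> = FM ?K g *[?D'] r ?y" unfolding 1 by (simp add: r_def)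
   finally show ?thesis .
  qed
  have "adj_transpose (SBot s) (FO ?H (FO ?G ?z)) (r ?z) *[?C'] FM ?H (FM ?G g) = adj_transpose (SBot s) (FO ?H (FO ?G ?y)) (r ?z *[?D'] FM ?F' (FM ?H (FM ?G g)))"
   by (rule adj_transpose_Comp_right[symmetric]) simp_all
  also have "\<dots> = FM ?G' (FM ?K g) *[?C'] adj_transpose (SBot s) (FO ?H (FO ?G ?y)) (r ?y)"
   unfolding 2 by (rule adj_transpose_Comp_left) simp_all
  finally show "NMap (mate s) (Cod (FDom (NTgt (mate s))) g) *[FCod (NTgt (mate s))] FM (NSrc (mate s)) g =
    FM (NTgt (mate s)) g *[FCod (NTgt (mate s))] NMap (mate s) (Dom (FDom (NTgt (mate s))) g)" by simp
 qed (simp_all add: hom_def, simp add: mate_def)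
 have "mates (s\<lparr>SZeta := mate s\<rparr>)"
  unfolding mates_def
 proof
  fix x assume "x \<in> Obj (ASrc (STop (s\<lparr>SZeta := mate s\<rparr>)))"
  then have [simp]: "x \<in> Obj ?C" by simp
  let ?\<eta> = "NMap (AUnit (STop s)) x"
  have 3: "r (FO ?F x) *[?D'] FM ?F' (FM ?H ?\<eta>) = NMap (SXi s) x"
  proof -
   have "r (FO ?F x) *[?D'] FM ?F' (FM ?H ?\<eta>) = FM ?K (NMap (ACounit (STop s)) (FO ?F x)) *[?D'] (FM ?K (FM ?F ?\<eta>) *[?D'] NMap (SXi s) x)"
    using xi_nat[of ?\<eta>] by (simp add: r_def)
   also have "\<dots> = FM ?K (NMap (ACounit (STop s)) (FO ?F x) *[?D] FM ?F ?\<eta>) *[?D'] NMap (SXi s) x" by simp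
   also have "\<dots> = NMap (SXi s) x" by (subst adjunction_triangles(1)[OF _ refl refl]) simp_all
   finally show ?thesis .
  qed
  have "adj_transpose (SBot s) (FO ?H x) (r (FO ?F x) *[?D'] FM ?F' (FM ?H ?\<eta>)) =
    adj_transpose (SBot s) (FO ?H (FO ?G (FO ?F x))) (r (FO ?F x)) *[?C'] FM ?H ?\<eta>"
   by (rule adj_transpose_Comp_right) simp_all
  then show "adj_transpose (SBot (s\<lparr>SZeta := mate s\<rparr>)) (FO (SLeft (s\<lparr>SZeta := mate s\<rparr>)) x) (NMap (SXi (s\<lparr>SZeta := mate s\<rparr>)) x) =
   NMap (SZeta (s\<lparr>SZeta := mate s\<rparr>)) (FO (ALeft (STop (s\<lparr>SZeta := mate s\<rparr>))) x) *[ASrc (SBot (s\<lparr>SZeta := mate s\<rparr>))]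
    FM (SLeft (s\<lparr>SZeta := mate s\<rparr>)) (NMap (AUnit (STop (s\<lparr>SZeta := mate s\<rparr>))) x)"
   unfolding 3 by simp
 qed
 then show ?thesis using s nt unfolding is_square_iff square_frame_def xi_nt_def zeta_nt_def by simp
qed

lemma square_comate:
 assumes s [simp]: "square_frame s" "zeta_nt s"
 shows "is_square (s\<lparr>SXi := comate s\<rparr>)"
proof -
 let ?F = "ALeft (STop s)" and ?G = "ARight (STop s)" and ?F' = "ALeft (SBot s)" and ?G' = "ARight (SBot s)"
  and ?H = "SLeft s" and ?K = "SRight s"
 let ?C = "ASrc (STop s)" and ?D = "ATgt (STop s)" and ?C' = "ASrc (SBot s)" and ?D' = "ATgt (SBot s)"
 define r where "r x = NMap (SZeta s) (FO ?F x) *[?C'] FM ?H (NMap (AUnit (STop s)) x)" for x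
 have r [simp]: "r x \<in> Arr ?C'" "Dom ?C' (r x) = FO ?H x" "Cod ?C' (r x) = FO ?G' (FO ?K (FO ?F x))" if "x \<in> Obj ?C" for x
  using that by (simp_all add: r_def)
 have m [simp]: "NSrc (comate s) = ftcomp ?F' ?H" "NTgt (comate s) = ftcomp ?K ?F"
  "x \<in> Obj ?C ==> NMap (comate s) x = adj_cotranspose (SBot s) (FO ?K (FO ?F x)) (r x)" for x
  by (simp_all add: comate_def r_def)
 have tr: "adj_transpose (SBot s) (FO ?H x) (adj_cotranspose (SBot s) (FO ?K (FO ?F x)) (r x)) = r x" if "x \<in> Obj ?C" for x
  by (rule transpose_cotranspose) (use that in simp_all)
 have nt: "is_nt (comate s)"
 proof (rule is_ntI)
  fix f assume "f \<in> Arr (FDom (NTgt (comate s)))"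
  then have f [simp]: "f \<in> Arr ?C" by simp
  let ?x = "Dom ?C f" and ?y = "Cod ?C f"
  let ?a = "adj_cotranspose (SBot s) (FO ?K (FO ?F ?x)) (r ?x)" and ?b = "adj_cotranspose (SBot s) (FO ?K (FO ?F ?y)) (r ?y)"
  have 1: "FM ?G (FM ?F f) *[?C] NMap (AUnit (STop s)) ?x = NMap (AUnit (STop s)) ?y *[?C] f"
   using nt_natural[of "AUnit (STop s)" ?C ?C f] by simp
  have zn: "NMap (SZeta s) (FO ?F ?y) *[?C'] FM ?H (FM ?G (FM ?F f)) = FM ?G' (FM ?K (FM ?F f)) *[?C'] NMap (SZeta s) (FO ?F ?x)"
   using nt_natural[of "SZeta s" ?D ?C' "FM ?F f"] by simp
  have 2: "FM ?G' (FM ?K (FM ?F f)) *[?C'] r ?x = r ?y *[?C'] FM ?H f"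
  proof -
   have "FM ?G' (FM ?K (FM ?F f)) *[?C'] r ?x = NMap (SZeta s) (FO ?F ?y) *[?C'] (FM ?H (FM ?G (FM ?F f)) *[?C'] FM ?H (NMap (AUnit (STop s)) ?x))"
    unfolding r_def by (rule comp_eq_comp[symmetric]) (simp_all add: zn)
   also have "\<dots> = NMap (SZeta s) (FO ?F ?y) *[?C'] FM ?H (FM ?G (FM ?F f) *[?C] NMap (AUnit (STop s)) ?x)" by simp
   also have "\<dots> = r ?y *[?C'] FM ?H f" unfolding 1 by (simp add: r_def)
   finally show ?thesis .
  qed
  have "adj_transpose (SBot s) (FO ?H ?x) (?b *[?D'] FM ?F' (FM ?H f)) = adj_transpose (SBot s) (FO ?H ?y) ?b *[?C'] FM ?H f"
   by (rule adj_transpose_Comp_right) simp_all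
  also have "\<dots> = FM ?G' (FM ?K (FM ?F f)) *[?C'] adj_transpose (SBot s) (FO ?H ?x) ?a" by (simp add: tr 2)
  also have "\<dots> = adj_transpose (SBot s) (FO ?H ?x) (FM ?K (FM ?F f) *[?D'] ?a)"
   by (rule adj_transpose_Comp_left[symmetric]) simp_all
  finally have "?b *[?D'] FM ?F' (FM ?H f) = FM ?K (FM ?F f) *[?D'] ?a"
   by (rule adj_transpose_inject) simp_all
  then show "NMap (comate s) (Cod (FDom (NTgt (comate s))) f) *[FCod (NTgt (comate s))] FM (NSrc (comate s)) f =
    FM (NTgt (comate s)) f *[FCod (NTgt (comate s))] NMap (comate s) (Dom (FDom (NTgt (comate s))) f)" by simp
 qed (simp_all add: hom_def, simp add: comate_def)
 have "mates (s\<lparr>SXi := comate s\<rparr>)"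
  unfolding mates_def by (simp add: tr r_def[symmetric])
 then show ?thesis using s nt unfolding is_square_iff square_frame_def xi_nt_def zeta_nt_def by simp
qed

subsection \<open>The operations of the double category of adjunctions\<close>

lemma adjunctionI:
 assumes "is_functor (ALeft a)" "is_functor (ARight a)" "FDom (ARight a) = ATgt a" "FCod (ARight a) = ASrc a"
  "is_nt (AUnit a)" "NSrc (AUnit a) = ftid (ASrc a)" "NTgt (AUnit a) = ftcomp (ARight a) (ALeft a)"
  "is_nt (ACounit a)" "NSrc (ACounit a) = ftcomp (ALeft a) (ARight a)" "NTgt (ACounit a) = ftid (ATgt a)"
  "\<And>x. x \<in> Obj (ASrc a) ==> NMap (ACounit a) (FO (ALeft a) x) *[ATgt a] FM (ALeft a) (NMap (AUnit a) x) = Id (ATgt a) (FO (ALeft a) x)"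
  "\<And>y. y \<in> Obj (ATgt a) ==> FM (ARight a) (NMap (ACounit a) y) *[ASrc a] NMap (AUnit a) (FO (ARight a) y) = Id (ASrc a) (FO (ARight a) y)"
 shows "adjunction a"
 unfolding adjunction_def is_nt_between_def using assms by blast

lemma adj_eqI:
 assumes "adjunction a" "adjunction b" "ALeft a = ALeft b" "ARight a = ARight b"
  "\<And>x. x \<in> Obj (ASrc b) ==> NMap (AUnit a) x = NMap (AUnit b) x" "\<And>y. y \<in> Obj (ATgt b) ==> NMap (ACounit a) y = NMap (ACounit b) y"
 shows "a = b"
proof -
 have "AUnit a = AUnit b" by (rule nt_eqI) (use assms in simp_all)
 moreover have "ACounit a = ACounit b" by (rule nt_eqI) (use assms in simp_all)
 ultimately show ?thesis using assms(3,4) by (cases a, cases b) simp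
qed

lemma adj_id_simps [simp]:
 "ALeft (adj_id C) = ftid C" "ARight (adj_id C) = ftid C" "AUnit (adj_id C) = nid (ftid C)" "ACounit (adj_id C) = nid (ftid C)"
 by (simp_all add: adj_id_def)

lemma adjunction_adj_id [simp]: "category C ==> adjunction (adj_id C)"
 by (rule adjunctionI) simp_all

lemma adj_comp_simps [simp]:
 "ALeft (adj_comp b a) = ftcomp (ALeft b) (ALeft a)" "ARight (adj_comp b a) = ftcomp (ARight a) (ARight b)"
 "AUnit (adj_comp b a) = ncomp (whisker_left (ARight a) (whisker_right (AUnit b) (ALeft a))) (AUnit a)"
 "ACounit (adj_comp b a) = ncomp (ACounit b) (whisker_left (ALeft b) (whisker_right (ACounit a) (ARight b)))"
 by (simp_all add: adj_comp_def)

lemma adjunction_adj_comp [simp]: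
 assumes a [simp]: "adjunction a" and b [simp]: "adjunction b" and e [simp]: "ASrc b = ATgt a"
 shows "adjunction (adj_comp b a)"
proof (rule adjunctionI)
 let ?A = "ASrc a" and ?B = "ATgt a" and ?C = "ATgt b"
 fix x assume "x \<in> Obj (ASrc (adj_comp b a))"
 then have [simp]: "x \<in> Obj ?A" by simp
 let ?x = "FO (ALeft a) x"
 let ?\<eta> = "NMap (AUnit b) ?x"
 have 1: "NMap (ACounit a) (FO (ARight b) (FO (ALeft b) ?x)) *[?B] FM (ALeft a) (FM (ARight a) ?\<eta>) = ?\<eta> *[?B] NMap (ACounit a) ?x"
  using nt_natural[of "ACounit a" ?B ?B ?\<eta> ?x "FO (ARight b) (FO (ALeft b) ?x)"] by simp
 have "NMap (ACounit a) (FO (ARight b) (FO (ALeft b) ?x)) *[?B] (FM (ALeft a) (FM (ARight a) ?\<eta>) *[?B] FM (ALeft a) (NMap (AUnit a) x)) =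
   ?\<eta> *[?B] (NMap (ACounit a) ?x *[?B] FM (ALeft a) (NMap (AUnit a) x))"
  by (rule comp_eq_comp) (simp_all add: 1)
 also have "\<dots> = ?\<eta>" by (simp add: adjunction_triangles)
 finally have "FM (ALeft b) (NMap (ACounit a) (FO (ARight b) (FO (ALeft b) ?x)) *[?B] (FM (ALeft a) (FM (ARight a) ?\<eta>) *[?B] FM (ALeft a) (NMap (AUnit a) x))) =
  FM (ALeft b) ?\<eta>" by simp
 then show "NMap (ACounit (adj_comp b a)) (FO (ALeft (adj_comp b a)) x) *[ATgt (adj_comp b a)] FM (ALeft (adj_comp b a)) (NMap (AUnit (adj_comp b a)) x) =
   Id (ATgt (adj_comp b a)) (FO (ALeft (adj_comp b a)) x)"
  using adjunction_triangles(1)[OF b, of ?B ?C ?x] by simp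
next
 let ?A = "ASrc a" and ?B = "ATgt a" and ?C = "ATgt b"
 fix y assume "y \<in> Obj (ATgt (adj_comp b a))"
 then have [simp]: "y \<in> Obj ?C" by simp
 let ?y = "FO (ARight b) y"
 let ?\<epsilon> = "NMap (ACounit a) ?y"
 have 1: "FM (ARight b) (FM (ALeft b) ?\<epsilon>) *[?B] NMap (AUnit b) (FO (ALeft a) (FO (ARight a) ?y)) = NMap (AUnit b) ?y *[?B] ?\<epsilon>"
  using nt_natural[of "AUnit b" ?B ?B ?\<epsilon> "FO (ALeft a) (FO (ARight a) ?y)" ?y] by simp
 have "FM (ARight b) (NMap (ACounit b) y) *[?B] (FM (ARight b) (FM (ALeft b) ?\<epsilon>) *[?B] NMap (AUnit b) (FO (ALeft a) (FO (ARight a) ?y))) =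
  (FM (ARight b) (NMap (ACounit b) y) *[?B] NMap (AUnit b) ?y) *[?B] ?\<epsilon>" unfolding 1 by simp
 also have "\<dots> = ?\<epsilon>" by (subst adjunction_triangles(2)[OF b e refl]) simp_all
 finally have "FM (ARight a) (FM (ARight b) (NMap (ACounit b) y) *[?B] (FM (ARight b) (FM (ALeft b) ?\<epsilon>) *[?B] NMap (AUnit b) (FO (ALeft a) (FO (ARight a) ?y)))) *[?A]
  NMap (AUnit a) (FO (ARight a) ?y) = FM (ARight a) ?\<epsilon> *[?A] NMap (AUnit a) (FO (ARight a) ?y)" by (simp only:)
 then show "FM (ARight (adj_comp b a)) (NMap (ACounit (adj_comp b a)) y) *[ASrc (adj_comp b a)] NMap (AUnit (adj_comp b a)) (FO (ARight (adj_comp b a)) y) =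
   Id (ASrc (adj_comp b a)) (FO (ARight (adj_comp b a)) y)"
  using adjunction_triangles(2)[OF a, of ?A ?B ?y] by simp
qed simp_all

lemma adj_comp_id [simp]:
 "adjunction a ==> ASrc a = C ==> adj_comp a (adj_id C) = a" "adjunction a ==> ATgt a = C ==> adj_comp (adj_id C) a = a"
 by (auto intro!: adj_eqI)

lemma adj_comp_assoc:
 "adjunction a ==> adjunction b ==> adjunction c ==> ASrc b = ATgt a ==> ASrc c = ATgt b ==> adj_comp c (adj_comp b a) = adj_comp (adj_comp c b) a"
 by (auto intro!: adj_eqI)

lemma adj_transpose_adj_id: "category C ==> x \<in> Obj C ==> f \<in> Arr C ==> Dom C f = x ==> adj_transpose (adj_id C) x f = f"
 by (simp add: adj_transpose_def)

lemma adj_transpose_adj_comp: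
 assumes "adjunction a" "adjunction b" "ASrc b = ATgt a" "x \<in> Obj (ASrc a)" "f \<in> Arr (ATgt b)" "Dom (ATgt b) f = FO (ALeft b) (FO (ALeft a) x)"
 shows "adj_transpose (adj_comp b a) x f = adj_transpose a x (adj_transpose b (FO (ALeft a) x) f)"
 using assms by (simp add: adj_transpose_def)

definition vcomp :: "('o, 'm) square => ('o, 'm) square => ('o, 'm) square" where "vcomp = Comp (CV ADJ)"
definition sqcomp :: "('o, 'm) square => ('o, 'm) square => ('o, 'm) square" where "sqcomp = Comp (CH ADJ)"
definition vid :: "('o, 'm, 'o, 'm) adj => ('o, 'm) square" where "vid = Id (CV ADJ)"
definition hid :: "('o, 'm, 'o, 'm) ftor => ('o, 'm) square" where "hid = Id (CH ADJ)"

lemma ADJ_simps [simp]: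
 "Obj (Vert ADJ) = {C. category C}" "Arr (Vert ADJ) = {F. is_functor F}" "Dom (Vert ADJ) = FDom" "Cod (Vert ADJ) = FCod"
 "Id (Vert ADJ) = ftid" "Comp (Vert ADJ) = ftcomp"
 "Obj (Horz ADJ) = {C. category C}" "Arr (Horz ADJ) = {a. adjunction a}" "Dom (Horz ADJ) a = ASrc a" "Cod (Horz ADJ) a = ATgt a"
 "Id (Horz ADJ) = adj_id" "Comp (Horz ADJ) = adj_comp"
 "Obj (CV ADJ) = {a. adjunction a}" "Arr (CV ADJ) = {s. is_square s}" "Dom (CV ADJ) = STop" "Cod (CV ADJ) = SBot"
 "Id (CV ADJ) = vid" "Comp (CV ADJ) = vcomp"
 "Obj (CH ADJ) = {F. is_functor F}" "Arr (CH ADJ) = {s. is_square s}" "Dom (CH ADJ) = SLeft" "Cod (CH ADJ) = SRight"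
 "Id (CH ADJ) = hid" "Comp (CH ADJ) = sqcomp"
 unfolding vcomp_def sqcomp_def vid_def hid_def by (simp_all add: ADJ_def)

lemma vcomp_simps [simp]:
 "STop (vcomp d c) = STop c" "SBot (vcomp d c) = SBot d" "SLeft (vcomp d c) = ftcomp (SLeft d) (SLeft c)" "SRight (vcomp d c) = ftcomp (SRight d) (SRight c)"
 "SXi (vcomp d c) = ncomp (whisker_left (SRight d) (SXi c)) (whisker_right (SXi d) (SLeft c))"
 "SZeta (vcomp d c) = ncomp (whisker_right (SZeta d) (SRight c)) (whisker_left (SLeft d) (SZeta c))"
 by (simp_all add: vcomp_def ADJ_def)

lemma sqcomp_simps [simp]:
 "STop (sqcomp d c) = adj_comp (STop d) (STop c)" "SBot (sqcomp d c) = adj_comp (SBot d) (SBot c)" "SLeft (sqcomp d c) = SLeft c" "SRight (sqcomp d c) = SRight d"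
 "SXi (sqcomp d c) = ncomp (whisker_right (SXi d) (ALeft (STop c))) (whisker_left (ALeft (SBot d)) (SXi c))"
 "SZeta (sqcomp d c) = ncomp (whisker_left (ARight (SBot c)) (SZeta d)) (whisker_right (SZeta c) (ARight (STop d)))"
 by (simp_all add: sqcomp_def ADJ_def)

lemma vid_simps [simp]:
 "STop (vid a) = a" "SBot (vid a) = a" "SLeft (vid a) = ftid (ASrc a)" "SRight (vid a) = ftid (ATgt a)" "SXi (vid a) = nid (ALeft a)" "SZeta (vid a) = nid (ARight a)"
 by (simp_all add: vid_def ADJ_def)

lemma hid_simps [simp]:
 "STop (hid F) = adj_id (FDom F)" "SBot (hid F) = adj_id (FCod F)" "SLeft (hid F) = F" "SRight (hid F) = F" "SXi (hid F) = nid F" "SZeta (hid F) = nid F"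
 by (simp_all add: hid_def ADJ_def)

lemma is_squareI:
 assumes "adjunction (STop s)" "adjunction (SBot s)" "is_functor (SLeft s)" "is_functor (SRight s)"
  "FDom (SLeft s) = ASrc (STop s)" "FCod (SLeft s) = ASrc (SBot s)" "FDom (SRight s) = ATgt (STop s)" "FCod (SRight s) = ATgt (SBot s)"
  "is_nt (SXi s)" "NSrc (SXi s) = ftcomp (ALeft (SBot s)) (SLeft s)" "NTgt (SXi s) = ftcomp (SRight s) (ALeft (STop s))"
  "is_nt (SZeta s)" "NSrc (SZeta s) = ftcomp (SLeft s) (ARight (STop s))" "NTgt (SZeta s) = ftcomp (ARight (SBot s)) (SRight s)"
  "\<And>x. x \<in> Obj (ASrc (STop s)) ==> adj_transpose (SBot s) (FO (SLeft s) x) (NMap (SXi s) x) =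
   NMap (SZeta s) (FO (ALeft (STop s)) x) *[ASrc (SBot s)] FM (SLeft s) (NMap (AUnit (STop s)) x)"
 shows "is_square s"
 using assms unfolding is_square_iff square_frame_def xi_nt_def zeta_nt_def mates_def by blast

lemma is_square_vid [simp]: "adjunction a ==> is_square (vid a)"
 by (rule is_squareI) (simp_all add: adj_transpose_Id)

lemma is_square_hid [simp]: "is_functor F ==> is_square (hid F)"
 by (rule is_squareI) (simp_all add: adj_transpose_adj_id)

lemma square_unit:
 assumes s: "is_square s" and "x \<in> Obj (ASrc (STop s))" "SBot s = b" "SLeft s = H" "STop s = a" "ASrc b = C"
 shows "adj_transpose b (FO H x) (NMap (SXi s) x) = NMap (SZeta s) (FO (ALeft a) x) *[C] FM H (NMap (AUnit a) x)"
 using is_squareD(4)[OF s] assms(2-) unfolding mates_def by blast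

text \<open>
 The mate condition of a pasting follows by applying the conditions of the two cells in turn;
 transposition along a composite adjunction is transposition in two steps.
\<close>

lemma is_square_vcomp [simp]:
 assumes c [simp]: "is_square c" and d [simp]: "is_square d" and e [simp]: "STop d = SBot c"
 shows "is_square (vcomp d c)"
proof -
 let ?C = "ASrc (SBot d)" and ?D = "ATgt (SBot d)"
 have [simp]: "FDom (SLeft d) = ASrc (SBot c)" "FDom (SRight d) = ATgt (SBot c)" using is_squareD(9,11)[OF d] by simp_all
 have [simp]: "NTgt (SXi d) = ftcomp (SRight d) (ALeft (SBot c))" "NSrc (SZeta d) = ftcomp (SLeft d) (ARight (SBot c))"
  using is_squareD(15,17)[OF d] by simp_all
 show ?thesis
 proof (rule is_squareI)
  fix x assume "x \<in> Obj (ASrc (STop (vcomp d c)))"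
  then have [simp]: "x \<in> Obj (ASrc (STop c))" by simp
  let ?x = "FO (SLeft c) x" and ?y = "FO (ALeft (STop c)) x"
  have "adj_transpose (SBot d) (FO (SLeft d) ?x) (FM (SRight d) (NMap (SXi c) x) *[?D] NMap (SXi d) ?x) =
   NMap (SZeta d) (FO (SRight c) ?y) *[?C] FM (SLeft d) (adj_transpose (SBot c) ?x (NMap (SXi c) x))"
   using mates_transpose[of d ?x "NMap (SXi c) x"] by simp
  also have "adj_transpose (SBot c) ?x (NMap (SXi c) x) = NMap (SZeta c) ?y *[ASrc (SBot c)] FM (SLeft c) (NMap (AUnit (STop c)) x)"
   by (rule square_unit) simp_all
  finally show "adj_transpose (SBot (vcomp d c)) (FO (SLeft (vcomp d c)) x) (NMap (SXi (vcomp d c)) x) =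
   NMap (SZeta (vcomp d c)) (FO (ALeft (STop (vcomp d c))) x) *[ASrc (SBot (vcomp d c))] FM (SLeft (vcomp d c)) (NMap (AUnit (STop (vcomp d c))) x)"
   by simp
 qed simp_all
qed

lemma is_square_sqcomp [simp]:
 assumes c [simp]: "is_square c" and d [simp]: "is_square d" and e [simp]: "SLeft d = SRight c"
  and a: "ASrc (STop d) = ATgt (STop c)" and b: "ASrc (SBot d) = ATgt (SBot c)"
 shows "is_square (sqcomp d c)"
proof -
 note [simp] = a b
 have [simp]: "NSrc (SXi d) = ftcomp (ALeft (SBot d)) (SRight c)" "NSrc (SZeta d) = ftcomp (SRight c) (ARight (STop d))"
  using is_squareD(14,17)[OF d] by simp_all
 let ?A = "ASrc (SBot c)" and ?B = "ATgt (SBot c)" and ?C = "ATgt (SBot d)"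
 show ?thesis
 proof (rule is_squareI)
  fix x assume "x \<in> Obj (ASrc (STop (sqcomp d c)))"
  then have [simp]: "x \<in> Obj (ASrc (STop c))" by simp
  let ?x = "FO (SLeft c) x" and ?y = "FO (ALeft (STop c)) x"
  let ?z = "FO (ALeft (STop d)) ?y"
  have 1: "adj_transpose (SBot d) (FO (SRight c) ?y) (NMap (SXi d) ?y) = NMap (SZeta d) ?z *[?B] FM (SRight c) (NMap (AUnit (STop d)) ?y)"
   by (rule square_unit) simp_all
  have "adj_transpose (SBot d) (FO (ALeft (SBot c)) ?x) (NMap (SXi d) ?y *[?C] FM (ALeft (SBot d)) (NMap (SXi c) x)) =
   adj_transpose (SBot d) (FO (SRight c) ?y) (NMap (SXi d) ?y) *[?B] NMap (SXi c) x"
   using adj_transpose_Comp_right[of "SBot d" "NMap (SXi c) x" "NMap (SXi d) ?y"] by simp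
  also have "\<dots> = NMap (SZeta d) ?z *[?B] (FM (SRight c) (NMap (AUnit (STop d)) ?y) *[?B] NMap (SXi c) x)"
   unfolding 1 by simp
  finally have "adj_transpose (SBot c) ?x (adj_transpose (SBot d) (FO (ALeft (SBot c)) ?x) (NMap (SXi d) ?y *[?C] FM (ALeft (SBot d)) (NMap (SXi c) x))) =
   adj_transpose (SBot c) ?x (NMap (SZeta d) ?z *[?B] (FM (SRight c) (NMap (AUnit (STop d)) ?y) *[?B] NMap (SXi c) x))" by simp
  also have "\<dots> = FM (ARight (SBot c)) (NMap (SZeta d) ?z) *[?A] adj_transpose (SBot c) ?x (FM (SRight c) (NMap (AUnit (STop d)) ?y) *[?B] NMap (SXi c) x)"
   by (rule adj_transpose_Comp_left) simp_all
  also have "adj_transpose (SBot c) ?x (FM (SRight c) (NMap (AUnit (STop d)) ?y) *[?B] NMap (SXi c) x) =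
   NMap (SZeta c) (FO (ARight (STop d)) ?z) *[?A] FM (SLeft c) (adj_transpose (STop c) x (NMap (AUnit (STop d)) ?y))"
   by (rule mates_transpose) simp_all
  finally show "adj_transpose (SBot (sqcomp d c)) (FO (SLeft (sqcomp d c)) x) (NMap (SXi (sqcomp d c)) x) =
   NMap (SZeta (sqcomp d c)) (FO (ALeft (STop (sqcomp d c))) x) *[ASrc (SBot (sqcomp d c))] FM (SLeft (sqcomp d c)) (NMap (AUnit (STop (sqcomp d c))) x)"
   by (simp add: adj_transpose_adj_comp) (simp add: adj_transpose_def)
 qed simp_all
qed

lemma vcomp_vid [simp]:
 assumes "is_square s"
 shows "STop s = a ==> vcomp s (vid a) = s" "SBot s = a ==> vcomp (vid a) s = s"
 using assms by (auto intro!: square_eq_zeta)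

text \<open>
 Transposition along an identity adjunction does nothing. Hence the two members of a component of a
 modification coincide, and a modification is given by single transformations.
\<close>

lemma square_hid_SXi:
 assumes s: "is_square s" and top: "STop s = adj_id C" and bot: "SBot s = adj_id D"
 shows "SXi s = SZeta s"
proof -
 have C [simp]: "category C" "category D" using adjunction_simps(1)[OF is_squareD(5)[OF s]] adjunction_simps(1)[OF is_squareD(6)[OF s]]
  functor_simps(1)[of "ftid C"] functor_simps(1)[of "ftid D"] by (simp_all add: top bot)
 note [simp] = is_squareD[OF s, unfolded top bot adj_id_simps, simplified]
 show ?thesis
 proof (rule nt_eqI)
  fix x assume "x \<in> Obj (FDom (NSrc (SZeta s)))"
  then have [simp]: "x \<in> Obj C" by (simp add: top)
  have "adj_transpose (adj_id D) (FO (SLeft s) x) (NMap (SXi s) x) = NMap (SZeta s) (FO (ALeft (adj_id C)) x) *[D] FM (SLeft s) (NMap (AUnit (adj_id C)) x)"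
   by (rule square_unit[OF s]) (simp_all add: top bot)
  then show "NMap (SXi s) x = NMap (SZeta s) x" by (simp add: adj_transpose_adj_id)
 qed (simp_all add: top bot)
qed

text \<open>A globular cell is invertible as soon as one of its members is.\<close>

lemma globular_iso:
 assumes s [simp]: "is_square s" and sides: "SLeft s = ftid C" "SRight s = ftid D"
 shows "iso_arrow (CV ADJ) s \<longleftrightarrow> (\<forall>y\<in>Obj D. iso_arrow C (NMap (SZeta s) y))"
  "iso_arrow (CV ADJ) s \<longleftrightarrow> (\<forall>x\<in>Obj C. iso_arrow D (NMap (SXi s) x))"
proof -
 have ends [simp]: "ASrc (STop s) = C" "ASrc (SBot s) = C" "ATgt (STop s) = D" "ATgt (SBot s) = D"
  using is_squareD(9-12)[OF s] by (simp_all add: sides)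
 have cats [simp]: "category C" "category D" using is_squareD(7,8)[OF s] functor_simps(1)[of "ftid C"] functor_simps(1)[of "ftid D"] by (simp_all add: sides)
 note [simp] = sides
 have nts [simp]: "NSrc (SXi s) = ALeft (SBot s)" "NTgt (SXi s) = ALeft (STop s)" "NSrc (SZeta s) = ARight (STop s)" "NTgt (SZeta s) = ARight (SBot s)" by simp_all
 have fwd: "(\<forall>y\<in>Obj D. iso_arrow C (NMap (SZeta s) y)) \<and> (\<forall>x\<in>Obj C. iso_arrow D (NMap (SXi s) x))" if "iso_arrow (CV ADJ) s"
 proof -
  obtain t where inv: "inverse_arrows (CV ADJ) s t" using \<open>iso_arrow (CV ADJ) s\<close> by (auto simp: iso_arrow_def)
  note inv = inverse_arrowsD[OF inv, simplified]
  have t [simp]: "is_square t" "STop t = SBot s" "SBot t = STop s" using inv by simp_all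
  have 1: "SLeft (vcomp t s) = SLeft (vid (STop s))" "SRight (vcomp t s) = SRight (vid (STop s))" using inv(5) by (simp_all only:)
  have "FDom (SLeft t) = C" "FDom (SRight t) = D" using is_squareD(9,11)[OF t(1)] by simp_all
  then have t' [simp]: "SLeft t = ftid C" "SRight t = ftid D" using 1 by simp_all
  have nt' [simp]: "NSrc (SXi t) = ALeft (STop s)" "NTgt (SXi t) = ALeft (SBot s)" "NSrc (SZeta t) = ARight (SBot s)" "NTgt (SZeta t) = ARight (STop s)"
   using is_squareD[OF t(1)] by simp_all
  show ?thesis
  proof (intro conjI ballI)
   fix y assume [simp]: "y \<in> Obj D"
   have "NMap (SZeta (vcomp t s)) y = NMap (SZeta (vid (STop s))) y" "NMap (SZeta (vcomp s t)) y = NMap (SZeta (vid (SBot s))) y"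
    using inv(5,6) by (simp_all only:)
   then have "inverse_arrows C (NMap (SZeta s) y) (NMap (SZeta t) y)" by (intro inverse_arrowsI) simp_all
   then show "iso_arrow C (NMap (SZeta s) y)" by (auto simp: iso_arrow_def)
  next
   fix x assume [simp]: "x \<in> Obj C"
   have "NMap (SXi (vcomp t s)) x = NMap (SXi (vid (STop s))) x" "NMap (SXi (vcomp s t)) x = NMap (SXi (vid (SBot s))) x"
    using inv(5,6) by (simp_all only:)
   then have "inverse_arrows D (NMap (SXi s) x) (NMap (SXi t) x)" by (intro inverse_arrowsI) simp_all
   then show "iso_arrow D (NMap (SXi s) x)" by (auto simp: iso_arrow_def)
  qed
 qed
 have z: "iso_arrow (CV ADJ) s" if iso: "\<forall>y\<in>Obj D. iso_arrow C (NMap (SZeta s) y)"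
 proof -
  define t0 where "t0 = \<lparr>STop = SBot s, SBot = STop s, SLeft = ftid C, SRight = ftid D, SXi = undefined, SZeta = ninv (SZeta s)\<rparr>"
  define t where "t = t0\<lparr>SXi := comate t0\<rparr>"
  have "is_nt (ninv (SZeta s))"
   by (rule is_nt_ninv) (use iso in auto)
  then have "zeta_nt t0" unfolding zeta_nt_def t0_def by simp
  moreover have "square_frame t0" unfolding square_frame_def t0_def by simp
  ultimately have t [simp]: "is_square t" unfolding t_def by (intro square_comate)
  have t' [simp]: "STop t = SBot s" "SBot t = STop s" "SLeft t = ftid C" "SRight t = ftid D" "SZeta t = ninv (SZeta s)"
   by (simp_all add: t_def t0_def)
  have "vcomp t s = vid (STop s)" "vcomp s t = vid (SBot s)" by (rule square_eq_zeta; use iso in simp)+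
  then have "inverse_arrows (CV ADJ) s t" by (intro inverse_arrowsI) simp_all
  then show ?thesis by (auto simp: iso_arrow_def)
 qed
 have x: "iso_arrow (CV ADJ) s" if iso: "\<forall>y\<in>Obj C. iso_arrow D (NMap (SXi s) y)"
 proof -
  define t0 where "t0 = \<lparr>STop = SBot s, SBot = STop s, SLeft = ftid C, SRight = ftid D, SXi = ninv (SXi s), SZeta = undefined\<rparr>"
  define t where "t = t0\<lparr>SZeta := mate t0\<rparr>"
  have "is_nt (ninv (SXi s))"
   by (rule is_nt_ninv) (use iso in auto)
  then have "xi_nt t0" unfolding xi_nt_def t0_def by simp
  moreover have "square_frame t0" unfolding square_frame_def t0_def by simp
  ultimately have t [simp]: "is_square t" unfolding t_def by (intro square_mate)
  have t' [simp]: "STop t = SBot s" "SBot t = STop s" "SLeft t = ftid C" "SRight t = ftid D" "SXi t = ninv (SXi s)"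
   by (simp_all add: t_def t0_def)
  have "vcomp t s = vid (STop s)" "vcomp s t = vid (SBot s)" by (rule square_eq_xi; use iso in simp)+
  then have "inverse_arrows (CV ADJ) s t" by (intro inverse_arrowsI) simp_all
  then show ?thesis by (auto simp: iso_arrow_def)
 qed
 show "iso_arrow (CV ADJ) s \<longleftrightarrow> (\<forall>y\<in>Obj D. iso_arrow C (NMap (SZeta s) y))"
  "iso_arrow (CV ADJ) s \<longleftrightarrow> (\<forall>x\<in>Obj C. iso_arrow D (NMap (SXi s) x))" using fwd z x by blast+
qed

section \<open>Bi-indexed categories\<close>

lemma HH_simps [simp]:
 "Obj (Vert (HH B)) = Obj B" "Arr (Vert (HH B)) = Obj B" "Dom (Vert (HH B)) a = a" "Cod (Vert (HH B)) a = a" "Id (Vert (HH B)) a = a"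
 "Comp (Vert (HH B)) a a' = a'" "Horz (HH B) = B" "CH (HH B) = B"
 "Obj (CV (HH B)) = Arr B" "Arr (CV (HH B)) = Arr B" "Dom (CV (HH B)) f = f" "Cod (CV (HH B)) f = f" "Id (CV (HH B)) f = f" "Comp (CV (HH B)) f f' = f'"
 by (simp_all add: HH_def discrete_def)

lemma hid_ftid [simp]: "hid (ftid C) = vid (adj_id C)"
 by (simp add: vid_def hid_def ADJ_def)

lemma zeta_eq_iff:
 assumes "is_square s" "is_square t" "STop s = STop t" "SBot s = SBot t" "SLeft s = SLeft t" "SRight s = SRight t" "ATgt (STop t) = D"
 shows "s = t \<longleftrightarrow> (\<forall>y\<in>Obj D. NMap (SZeta s) y = NMap (SZeta t) y)"
 using square_eq_zeta[OF assms(1-6)] assms(7) by auto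

lemma xi_eq_iff:
 assumes "is_square s" "is_square t" "STop s = STop t" "SBot s = SBot t" "SLeft s = SLeft t" "SRight s = SRight t" "ASrc (STop t) = C"
 shows "s = t \<longleftrightarrow> (\<forall>x\<in>Obj C. NMap (SXi s) x = NMap (SXi t) x)"
 using square_eq_xi[OF assms(1-6)] assms(7) by auto

lemma sqcomp_vid [simp]:
 "adjunction a ==> adjunction b ==> ASrc b = ATgt a ==> sqcomp (vid b) (vid a) = vid (adj_comp b a)"
 by (auto intro!: square_eq_zeta)

definition globular :: "('o, 'm) square => ('o, 'm, 'o, 'm) adj => ('o, 'm, 'o, 'm) adj => bool" where
 "globular s a b \<longleftrightarrow> is_square s \<and> STop s = a \<and> SBot s = b \<and> SLeft s = ftid (ASrc a) \<and> SRight s = ftid (ATgt a)"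

text \<open>
 The data of a pseudo double functor on \<open>HH B\<close>, with the boundaries of its cells. Its values on identity
 vertical arrows and identity cells are forced. The invertibility and the coherence of the comparison
 cells are stated separately, because only they have to be tested on members.
\<close>

definition bi_frame :: "('o, 'm) cat => ('o, 'm, 'u) bi_indexed => bool" where
 "bi_frame B \<Omega> \<longleftrightarrow> category B \<and> (\<forall>a\<in>Obj B. category (DO \<Omega> a) \<and> DV \<Omega> a = ftid (DO \<Omega> a)) \<and>
   (\<forall>f\<in>Arr B. adjunction (DH \<Omega> f) \<and> ASrc (DH \<Omega> f) = DO \<Omega> (Dom B f) \<and> ATgt (DH \<Omega> f) = DO \<Omega> (Cod B f) \<and> DC \<Omega> f = vid (DH \<Omega> f)) \<and>
   (\<forall>a\<in>Obj B. globular (Ddelta \<Omega> a) (adj_id (DO \<Omega> a)) (DH \<Omega> (Id B a))) \<and>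
   (\<forall>f\<in>Arr B. \<forall>g\<in>Arr B. Dom B g = Cod B f --> globular (Dgamma \<Omega> f g) (adj_comp (DH \<Omega> g) (DH \<Omega> f)) (DH \<Omega> (g *[B] f)))"

definition bi_iso where
 "bi_iso B \<Omega> \<longleftrightarrow> (\<forall>a\<in>Obj B. iso_arrow (CV ADJ) (Ddelta \<Omega> a)) \<and>
   (\<forall>f\<in>Arr B. \<forall>g\<in>Arr B. Dom B g = Cod B f --> iso_arrow (CV ADJ) (Dgamma \<Omega> f g))"

definition bi_unit where
 "bi_unit B \<Omega> f \<longleftrightarrow> vcomp (Dgamma \<Omega> (Id B (Dom B f)) f) (sqcomp (vid (DH \<Omega> f)) (Ddelta \<Omega> (Dom B f))) = vid (DH \<Omega> f) \<and>
   vcomp (Dgamma \<Omega> f (Id B (Cod B f))) (sqcomp (Ddelta \<Omega> (Cod B f)) (vid (DH \<Omega> f))) = vid (DH \<Omega> f)"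

definition bi_assoc where
 "bi_assoc B \<Omega> f g h \<longleftrightarrow> vcomp (Dgamma \<Omega> (g *[B] f) h) (sqcomp (vid (DH \<Omega> h)) (Dgamma \<Omega> f g)) =
   vcomp (Dgamma \<Omega> f (h *[B] g)) (sqcomp (Dgamma \<Omega> g h) (vid (DH \<Omega> f)))"

definition bi_coherent where
 "bi_coherent B \<Omega> \<longleftrightarrow> (\<forall>f\<in>Arr B. bi_unit B \<Omega> f) \<and>
   (\<forall>f\<in>Arr B. \<forall>g\<in>Arr B. \<forall>h\<in>Arr B. Dom B g = Cod B f --> Dom B h = Cod B g --> bi_assoc B \<Omega> f g h)"

lemma bi_frameD:
 assumes "bi_frame B \<Omega>"
 shows "category B" "a \<in> Obj B ==> category (DO \<Omega> a)" "a \<in> Obj B ==> DV \<Omega> a = ftid (DO \<Omega> a)"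
  "f \<in> Arr B ==> adjunction (DH \<Omega> f)" "f \<in> Arr B ==> ASrc (DH \<Omega> f) = DO \<Omega> (Dom B f)" "f \<in> Arr B ==> ATgt (DH \<Omega> f) = DO \<Omega> (Cod B f)"
  "f \<in> Arr B ==> DC \<Omega> f = vid (DH \<Omega> f)" "a \<in> Obj B ==> globular (Ddelta \<Omega> a) (adj_id (DO \<Omega> a)) (DH \<Omega> (Id B a))"
  "f \<in> Arr B ==> g \<in> Arr B ==> Dom B g = Cod B f ==> globular (Dgamma \<Omega> f g) (adj_comp (DH \<Omega> g) (DH \<Omega> f)) (DH \<Omega> (g *[B] f))"
 using assms unfolding bi_frame_def by blast+

locale bi_frame_loc =
 fixes B :: "('o, 'm) cat" and \<Omega> :: "('o, 'm, 'u) bi_indexed"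
 assumes bi_frame: "bi_frame B \<Omega>"
begin

lemmas frame [simp] = bi_frameD(1-7)[OF bi_frame]

lemma delta [simp]:
 assumes "a \<in> Obj B"
 shows "is_square (Ddelta \<Omega> a)" "STop (Ddelta \<Omega> a) = adj_id (DO \<Omega> a)" "SBot (Ddelta \<Omega> a) = DH \<Omega> (Id B a)"
  "SLeft (Ddelta \<Omega> a) = ftid (DO \<Omega> a)" "SRight (Ddelta \<Omega> a) = ftid (DO \<Omega> a)"
 using bi_frameD(8)[OF bi_frame assms] by (simp_all add: globular_def)

lemma gamma [simp]:
 assumes "f \<in> Arr B" "g \<in> Arr B" "Dom B g = Cod B f"
 shows "is_square (Dgamma \<Omega> f g)" "STop (Dgamma \<Omega> f g) = adj_comp (DH \<Omega> g) (DH \<Omega> f)" "SBot (Dgamma \<Omega> f g) = DH \<Omega> (g *[B] f)"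
  "SLeft (Dgamma \<Omega> f g) = ftid (DO \<Omega> (Dom B f))" "SRight (Dgamma \<Omega> f g) = ftid (DO \<Omega> (Cod B g))"
 using bi_frameD(9)[OF bi_frame assms] assms by (simp_all add: globular_def)

lemma delta_members [simp]:
 assumes "a \<in> Obj B"
 shows "NSrc (SXi (Ddelta \<Omega> a)) = ALeft (DH \<Omega> (Id B a))" "NTgt (SXi (Ddelta \<Omega> a)) = ftid (DO \<Omega> a)"
  "NSrc (SZeta (Ddelta \<Omega> a)) = ftid (DO \<Omega> a)" "NTgt (SZeta (Ddelta \<Omega> a)) = ARight (DH \<Omega> (Id B a))"
 using assms by simp_all

lemma gamma_members [simp]:
 assumes "f \<in> Arr B" "g \<in> Arr B" "Dom B g = Cod B f"
 shows "NSrc (SXi (Dgamma \<Omega> f g)) = ALeft (DH \<Omega> (g *[B] f))" "NTgt (SXi (Dgamma \<Omega> f g)) = ftcomp (ALeft (DH \<Omega> g)) (ALeft (DH \<Omega> f))"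
  "NSrc (SZeta (Dgamma \<Omega> f g)) = ftcomp (ARight (DH \<Omega> f)) (ARight (DH \<Omega> g))" "NTgt (SZeta (Dgamma \<Omega> f g)) = ARight (DH \<Omega> (g *[B] f))"
 using assms by simp_all

text \<open>
 The conditions on comparison cells in terms of one kind of members. They turn into the conditions on
 the structure isomorphisms of \<open>V(\<Omega>)\<close> and, up to inversion, of \<open>U(\<Omega>)\<close>.
\<close>

lemma bi_iso_zeta:
 "bi_iso B \<Omega> \<longleftrightarrow> (\<forall>a\<in>Obj B. \<forall>y\<in>Obj (DO \<Omega> a). iso_arrow (DO \<Omega> a) (NMap (SZeta (Ddelta \<Omega> a)) y)) \<and>
  (\<forall>f\<in>Arr B. \<forall>g\<in>Arr B. Dom B g = Cod B f --> (\<forall>y\<in>Obj (DO \<Omega> (Cod B g)). iso_arrow (DO \<Omega> (Dom B f)) (NMap (SZeta (Dgamma \<Omega> f g)) y)))"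
 unfolding bi_iso_def using globular_iso(1)[OF delta(1,4,5)] globular_iso(1)[OF gamma(1,4,5)] by simp

lemma bi_iso_xi:
 "bi_iso B \<Omega> \<longleftrightarrow> (\<forall>a\<in>Obj B. \<forall>x\<in>Obj (DO \<Omega> a). iso_arrow (DO \<Omega> a) (NMap (SXi (Ddelta \<Omega> a)) x)) \<and>
  (\<forall>f\<in>Arr B. \<forall>g\<in>Arr B. Dom B g = Cod B f --> (\<forall>x\<in>Obj (DO \<Omega> (Dom B f)). iso_arrow (DO \<Omega> (Cod B g)) (NMap (SXi (Dgamma \<Omega> f g)) x)))"
 unfolding bi_iso_def using globular_iso(2)[OF delta(1,4,5)] globular_iso(2)[OF gamma(1,4,5)] by simp

lemma bi_unit_zeta:
 assumes [simp]: "f \<in> Arr B"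
 shows "bi_unit B \<Omega> f \<longleftrightarrow> (\<forall>y\<in>Obj (DO \<Omega> (Cod B f)).
  NMap (SZeta (Dgamma \<Omega> f (Id B (Cod B f)))) y *[DO \<Omega> (Dom B f)] FM (ARight (DH \<Omega> f)) (NMap (SZeta (Ddelta \<Omega> (Cod B f))) y) =
    Id (DO \<Omega> (Dom B f)) (FO (ARight (DH \<Omega> f)) y) \<and>
  NMap (SZeta (Dgamma \<Omega> (Id B (Dom B f)) f)) y *[DO \<Omega> (Dom B f)] NMap (SZeta (Ddelta \<Omega> (Dom B f))) (FO (ARight (DH \<Omega> f)) y) =
    Id (DO \<Omega> (Dom B f)) (FO (ARight (DH \<Omega> f)) y))"
 unfolding bi_unit_def by (subst (1 2) zeta_eq_iff[where D = "DO \<Omega> (Cod B f)"]) auto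

lemma bi_unit_xi:
 assumes [simp]: "f \<in> Arr B"
 shows "bi_unit B \<Omega> f \<longleftrightarrow> (\<forall>x\<in>Obj (DO \<Omega> (Dom B f)).
  FM (ALeft (DH \<Omega> f)) (NMap (SXi (Ddelta \<Omega> (Dom B f))) x) *[DO \<Omega> (Cod B f)] NMap (SXi (Dgamma \<Omega> (Id B (Dom B f)) f)) x =
    Id (DO \<Omega> (Cod B f)) (FO (ALeft (DH \<Omega> f)) x) \<and>
  NMap (SXi (Ddelta \<Omega> (Cod B f))) (FO (ALeft (DH \<Omega> f)) x) *[DO \<Omega> (Cod B f)] NMap (SXi (Dgamma \<Omega> f (Id B (Cod B f)))) x =
    Id (DO \<Omega> (Cod B f)) (FO (ALeft (DH \<Omega> f)) x))"
 unfolding bi_unit_def by (subst (1 2) xi_eq_iff[where C = "DO \<Omega> (Dom B f)"]) auto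

lemma bi_assoc_zeta:
 assumes [simp]: "f \<in> Arr B" "g \<in> Arr B" "h \<in> Arr B" "Dom B g = Cod B f" "Dom B h = Cod B g"
 shows "bi_assoc B \<Omega> f g h \<longleftrightarrow> (\<forall>y\<in>Obj (DO \<Omega> (Cod B h)).
  NMap (SZeta (Dgamma \<Omega> (g *[B] f) h)) y *[DO \<Omega> (Dom B f)] NMap (SZeta (Dgamma \<Omega> f g)) (FO (ARight (DH \<Omega> h)) y) =
  NMap (SZeta (Dgamma \<Omega> f (h *[B] g))) y *[DO \<Omega> (Dom B f)] FM (ARight (DH \<Omega> f)) (NMap (SZeta (Dgamma \<Omega> g h)) y))"
 unfolding bi_assoc_def by (subst zeta_eq_iff[where D = "DO \<Omega> (Cod B h)"]) (auto simp: adj_comp_assoc)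

lemma bi_assoc_xi:
 assumes [simp]: "f \<in> Arr B" "g \<in> Arr B" "h \<in> Arr B" "Dom B g = Cod B f" "Dom B h = Cod B g"
 shows "bi_assoc B \<Omega> f g h \<longleftrightarrow> (\<forall>x\<in>Obj (DO \<Omega> (Dom B f)).
  FM (ALeft (DH \<Omega> h)) (NMap (SXi (Dgamma \<Omega> f g)) x) *[DO \<Omega> (Cod B h)] NMap (SXi (Dgamma \<Omega> (g *[B] f) h)) x =
  NMap (SXi (Dgamma \<Omega> g h)) (FO (ALeft (DH \<Omega> f)) x) *[DO \<Omega> (Cod B h)] NMap (SXi (Dgamma \<Omega> f (h *[B] g))) x)"
 unfolding bi_assoc_def by (subst xi_eq_iff[where C = "DO \<Omega> (Dom B f)"]) (auto simp: adj_comp_assoc)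

end

text \<open>
 As \<open>HH B\<close> has only identity cells, naturality of the comparison cells amounts to the unit laws for
 vertical composition.
\<close>

lemma pseudo_double_functor_iff:
 assumes B: "category B"
 shows "is_bi B \<Omega> \<longleftrightarrow> bi_frame B \<Omega> \<and> bi_iso B \<Omega> \<and> bi_coherent B \<Omega>"
proof
 assume "is_bi B \<Omega>"
 then have iso: "bi_iso B \<Omega>" and lax: "lax_double_functor (HH B) ADJ \<Omega>"
  unfolding pseudo_double_functor_def bi_iso_def HH_simps by blast+
 note lax = lax[unfolded lax_double_functor_def HH_simps ADJ_simps]
 have "bi_coherent B \<Omega>"
  using lax unfolding bi_coherent_def bi_unit_def bi_assoc_def by blast
 moreover have "bi_frame B \<Omega>"
 proof -
  have p: "preserves_cat (Vert (HH B)) (Vert ADJ) (DO \<Omega>) (DV \<Omega>)" "preserves_cat (CV (HH B)) (CV ADJ) (DH \<Omega>) (DC \<Omega>)"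
   and h: "\<forall>h\<in>Arr B. DH \<Omega> h \<in> hom (Horz ADJ) (DO \<Omega> (Dom B h)) (DO \<Omega> (Cod B h))"
   and d: "\<forall>a\<in>Obj B. Ddelta \<Omega> a \<in> hom (CV ADJ) (adj_id (DO \<Omega> a)) (DH \<Omega> (Id B a)) \<and> Ddelta \<Omega> a \<in> hom (CH ADJ) (ftid (DO \<Omega> a)) (ftid (DO \<Omega> a))"
   and g: "\<forall>f\<in>Arr B. \<forall>g\<in>Arr B. Dom B g = Cod B f --> Dgamma \<Omega> f g \<in> hom (CV ADJ) (adj_comp (DH \<Omega> g) (DH \<Omega> f)) (DH \<Omega> (g *[B] f)) \<and>
    Dgamma \<Omega> f g \<in> hom (CH ADJ) (ftid (DO \<Omega> (Dom B f))) (ftid (DO \<Omega> (Cod B g)))"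
   using lax by blast+
  have [simp]: "category (DO \<Omega> a)" "DV \<Omega> a = ftid (DO \<Omega> a)" if "a \<in> Obj B" for a
   using preserves_catD(1,5)[OF p(1), of a] that by simp_all
  have [simp]: "adjunction (DH \<Omega> f)" "ASrc (DH \<Omega> f) = DO \<Omega> (Dom B f)" "ATgt (DH \<Omega> f) = DO \<Omega> (Cod B f)" "DC \<Omega> f = vid (DH \<Omega> f)" if "f \<in> Arr B" for f
   using preserves_catD(5)[OF p(2), of f] h that by (simp_all add: hom_def)
  show ?thesis
   using d g B unfolding bi_frame_def by (simp add: globular_def hom_def)
 qed
 ultimately show "bi_frame B \<Omega> \<and> bi_iso B \<Omega> \<and> bi_coherent B \<Omega>" using iso by blast
next
 assume *: "bi_frame B \<Omega> \<and> bi_iso B \<Omega> \<and> bi_coherent B \<Omega>"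
 then interpret bi_frame_loc B \<Omega> by unfold_locales simp
 have c: "vcomp (Dgamma \<Omega> (Id B (Dom B f)) f) (sqcomp (vid (DH \<Omega> f)) (Ddelta \<Omega> (Dom B f))) = vid (DH \<Omega> f)"
   "vcomp (Dgamma \<Omega> f (Id B (Cod B f))) (sqcomp (Ddelta \<Omega> (Cod B f)) (vid (DH \<Omega> f))) = vid (DH \<Omega> f)" if "f \<in> Arr B" for f
  using * that unfolding bi_coherent_def bi_unit_def by blast+
 have a: "vcomp (Dgamma \<Omega> (g *[B] f) h) (sqcomp (vid (DH \<Omega> h)) (Dgamma \<Omega> f g)) = vcomp (Dgamma \<Omega> f (h *[B] g)) (sqcomp (Dgamma \<Omega> g h) (vid (DH \<Omega> f)))"
  if "f \<in> Arr B" "g \<in> Arr B" "h \<in> Arr B" "Dom B g = Cod B f" "Dom B h = Cod B g" for f g h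
  using * that unfolding bi_coherent_def bi_assoc_def by blast
 have "lax_double_functor (HH B) ADJ \<Omega>"
  unfolding lax_double_functor_def HH_simps ADJ_simps
  by (intro conjI ballI impI) (simp_all add: preserves_cat_def hom_def c a)
 moreover have "\<forall>a\<in>Obj B. iso_arrow (CV ADJ) (Ddelta \<Omega> a)"
   "\<forall>f\<in>Arr B. \<forall>g\<in>Arr B. Dom B g = Cod B f --> iso_arrow (CV ADJ) (Dgamma \<Omega> f g)" using * unfolding bi_iso_def by blast+
 ultimately show "is_bi B \<Omega>" unfolding pseudo_double_functor_def HH_simps by blast
qed

subsection \<open>The forgetful maps\<close>

lemma VV_simps [simp]:
 "PO (F0 (VV B) \<Omega>) = DO \<Omega>" "PM (F0 (VV B) \<Omega>) f = ARight (DH \<Omega> f)" "Pdelta (F0 (VV B) \<Omega>) a = SZeta (Ddelta \<Omega> a)" "Pgamma (F0 (VV B) \<Omega>) f g = SZeta (Dgamma \<Omega> f g)"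
 "TSrc (F1 (VV B) \<tau>) = F0 (VV B) (VSrc \<tau>)" "TTgt (F1 (VV B) \<tau>) = F0 (VV B) (VTgt \<tau>)" "TO (F1 (VV B) \<tau>) = VO \<tau>"
 "f \<in> Arr B ==> TM (F1 (VV B) \<tau>) f = SZeta (VH \<tau> f)" "TM (F1 (VV B) \<tau>) \<in> extensional (Arr B)"
 "MSrc (F2 (VV B) \<Xi>) = F1 (VV B) (VMSrc \<Xi>)" "MTgt (F2 (VV B) \<Xi>) = F1 (VV B) (VMTgt \<Xi>)"
 "a \<in> Obj B ==> MO (F2 (VV B) \<Xi>) a = SZeta (VMC \<Xi> a)" "MO (F2 (VV B) \<Xi>) \<in> extensional (Obj B)"
 by (simp_all add: VV_def Let_def)

lemma UU_simps [simp]: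
 "PO (F0 (UU B) \<Omega>) = DO \<Omega>" "PM (F0 (UU B) \<Omega>) f = ALeft (DH \<Omega> f)"
 "Pdelta (F0 (UU B) \<Omega>) a = ninv (SXi (Ddelta \<Omega> a))" "Pgamma (F0 (UU B) \<Omega>) g f = ninv (SXi (Dgamma \<Omega> f g))"
 "TSrc (F1 (UU B) \<tau>) = F0 (UU B) (VSrc \<tau>)" "TTgt (F1 (UU B) \<tau>) = F0 (UU B) (VTgt \<tau>)" "TO (F1 (UU B) \<tau>) = VO \<tau>"
 "f \<in> Arr B ==> TM (F1 (UU B) \<tau>) f = SXi (VH \<tau> f)" "TM (F1 (UU B) \<tau>) \<in> extensional (Arr B)"
 "MSrc (F2 (UU B) \<Xi>) = F1 (UU B) (VMSrc \<Xi>)" "MTgt (F2 (UU B) \<Xi>) = F1 (UU B) (VMTgt \<Xi>)"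
 "a \<in> Obj B ==> MO (F2 (UU B) \<Xi>) a = SXi (VMC \<Xi> a)" "MO (F2 (UU B) \<Xi>) \<in> extensional (Obj B)"
 by (simp_all add: UU_def Let_def)

lemma inv_arrow_Id [simp]: "category C ==> a \<in> Obj C ==> inv_arrow C (Id C a) = Id C a"
 by (rule inv_arrow_eq) (auto intro!: inverse_arrowsI)

lemma inv_arrow_Comp:
 "category C ==> iso_arrow C f ==> iso_arrow C g ==> Dom C g = Cod C f ==> inv_arrow C (g *[C] f) = inv_arrow C f *[C] inv_arrow C g"
 by (intro inv_arrow_eq inverse_arrows_Comp inverse_inv_arrow)

lemma inv_arrow_inject:
 assumes "category C" "iso_arrow C f" "iso_arrow C g"
 shows "inv_arrow C f = inv_arrow C g \<longleftrightarrow> f = g"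
 using inv_arrow_inv_arrow[OF assms(1,2)] inv_arrow_inv_arrow[OF assms(1,3)] by metis

context bi_frame_loc
begin

lemma pseudo_functor_VV: "pseudo_functor (op_cat B) (F0 (VV B) \<Omega>) \<longleftrightarrow> bi_iso B \<Omega> \<and> bi_coherent B \<Omega>"
proof -
 have "pseudo_functor (op_cat B) (F0 (VV B) \<Omega>) \<longleftrightarrow> bi_iso B \<Omega> \<and>
   (\<forall>f\<in>Arr B. bi_unit B \<Omega> f) \<and> (\<forall>h\<in>Arr B. \<forall>g\<in>Arr B. \<forall>f\<in>Arr B. Cod B g = Dom B h --> Cod B f = Dom B g --> bi_assoc B \<Omega> f g h)"
  unfolding pseudo_functor_def op_cat_simps VV_simps nat_iso_iff bi_iso_zeta
  by (intro iffI conjI ballI impI; (elim conjE)?; simp add: bi_unit_zeta bi_assoc_zeta)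
 then show ?thesis unfolding bi_coherent_def by metis
qed

end

text \<open>
 The structure isomorphisms of \<open>U(\<Omega>)\<close> are the inverses of the left adjoint members. Equations between
 members are translated into equations between inverses by moving isomorphisms to the other side.
\<close>

lemma iso_shift:
 assumes [simp]: "category C" "iso_arrow C i" "iso_arrow C j" "i \<in> Arr C" "j \<in> Arr C" "f \<in> Arr C" "k \<in> Arr C"
  "Cod C f = Dom C i" "Dom C f = Dom C j" "Cod C k = Cod C i" "Dom C k = Cod C j"
 shows "f *[C] inv_arrow C j = inv_arrow C i *[C] k \<longleftrightarrow> i *[C] f = k *[C] j"
proof
 assume e: "f *[C] inv_arrow C j = inv_arrow C i *[C] k"
 have "i *[C] f = i *[C] ((f *[C] inv_arrow C j) *[C] j)" by simp
 also have "\<dots> = k *[C] j" unfolding e by simp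
 finally show "i *[C] f = k *[C] j" .
next
 assume e: "i *[C] f = k *[C] j"
 have "f *[C] inv_arrow C j = inv_arrow C i *[C] ((i *[C] f) *[C] inv_arrow C j)" by simp
 also have "\<dots> = inv_arrow C i *[C] k" unfolding e by simp
 finally show "f *[C] inv_arrow C j = inv_arrow C i *[C] k" .
qed

lemma inv_arrow_Comp_inject:
 assumes "category C" "iso_arrow C f" "iso_arrow C g" "Dom C g = Cod C f"
 shows "iso_arrow C h ==> iso_arrow C k ==> Dom C k = Cod C h ==>
   inv_arrow C f *[C] inv_arrow C g = inv_arrow C h *[C] inv_arrow C k \<longleftrightarrow> g *[C] f = k *[C] h"
  and "x \<in> Obj C ==> inv_arrow C f *[C] inv_arrow C g = Id C x \<longleftrightarrow> g *[C] f = Id C x"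
 using assms inv_arrow_inject[of C "g *[C] f" "k *[C] h"] inv_arrow_inject[of C "g *[C] f" "Id C x"] by (simp_all add: inv_arrow_Comp)

context bi_frame_loc
begin

lemma iso_members:
 assumes "bi_iso B \<Omega>"
 shows "a \<in> Obj B ==> x \<in> Obj (DO \<Omega> a) ==> iso_arrow (DO \<Omega> a) (NMap (SXi (Ddelta \<Omega> a)) x)"
  "f \<in> Arr B ==> g \<in> Arr B ==> Dom B g = Cod B f ==> x \<in> Obj (DO \<Omega> (Dom B f)) ==> Cod B g = c ==> iso_arrow (DO \<Omega> c) (NMap (SXi (Dgamma \<Omega> f g)) x)"
 using assms unfolding bi_iso_xi by blast+

lemma pseudo_functor_UU:
 assumes iso: "bi_iso B \<Omega>"
 shows "pseudo_functor B (F0 (UU B) \<Omega>) \<longleftrightarrow> bi_coherent B \<Omega>"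
proof -
 note [simp] = iso_members[OF iso]
 have [simp]: "is_nt (ninv (SXi (Ddelta \<Omega> a)))" if "a \<in> Obj B" for a
  by (rule is_nt_ninv) (use that in simp_all)
 have [simp]: "is_nt (ninv (SXi (Dgamma \<Omega> f g)))" if "f \<in> Arr B" "g \<in> Arr B" "Dom B g = Cod B f" for f g
  by (rule is_nt_ninv) (use that in simp_all)
 show ?thesis
  unfolding pseudo_functor_def UU_simps nat_iso_iff bi_coherent_def
  by (intro iffI conjI ballI impI; (elim conjE)?; simp add: bi_unit_xi bi_assoc_xi inv_arrow_Comp_inject)
qed

end

lemma BI_IND_simps [simp]:
 "Obj (C1 (BI_IND B)) = {\<Omega>. is_bi B \<Omega>}" "Arr (C1 (BI_IND B)) = {\<tau>. is_bi1 B \<tau>}"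
 "Dom (C1 (BI_IND B)) = VSrc" "Cod (C1 (BI_IND B)) = VTgt"
 "Id (C1 (BI_IND B)) \<Omega> = \<lparr>VSrc = \<Omega>, VTgt = \<Omega>, VO = (\<lambda>a\<in>Obj B. ftid (DO \<Omega> a)), VH = (\<lambda>f\<in>Arr B. vid (DH \<Omega> f))\<rparr>"
 "\<sigma> *[C1 (BI_IND B)] \<tau> = \<lparr>VSrc = VSrc \<tau>, VTgt = VTgt \<sigma>, VO = (\<lambda>a\<in>Obj B. ftcomp (VO \<sigma> a) (VO \<tau> a)), VH = (\<lambda>f\<in>Arr B. vcomp (VH \<sigma> f) (VH \<tau> f))\<rparr>"
 "Obj (C2 (BI_IND B)) = {\<tau>. is_bi1 B \<tau>}" "Arr (C2 (BI_IND B)) = {\<Xi>. is_bi2 B \<Xi>}"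
 "Dom (C2 (BI_IND B)) = VMSrc" "Cod (C2 (BI_IND B)) = VMTgt"
 "Id (C2 (BI_IND B)) \<tau> = \<lparr>VMSrc = \<tau>, VMTgt = \<tau>, VMC = (\<lambda>a\<in>Obj B. hid (VO \<tau> a))\<rparr>"
 "\<Theta> *[C2 (BI_IND B)] \<Xi> = \<lparr>VMSrc = VMSrc \<Xi>, VMTgt = VMTgt \<Theta>, VMC = (\<lambda>a\<in>Obj B. sqcomp (VMC \<Theta> a) (VMC \<Xi> a))\<rparr>"
 "\<Theta> \<star>[BI_IND B] \<Xi> = \<lparr>VMSrc = VMSrc \<Theta> *[C1 (BI_IND B)] VMSrc \<Xi>, VMTgt = VMTgt \<Theta> *[C1 (BI_IND B)] VMTgt \<Xi>,
   VMC = (\<lambda>a\<in>Obj B. vcomp (VMC \<Theta> a) (VMC \<Xi> a))\<rparr>"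
 "src0 (BI_IND B) \<Xi> = VSrc (VMSrc \<Xi>)" "tgt0 (BI_IND B) \<Xi> = VTgt (VMSrc \<Xi>)"
 by (simp_all add: BI_IND_def pseudo_double_functors_def vt_id_def vt_comp_def src0_def tgt0_def)

subsection \<open>Vertical transformations\<close>

text \<open>
 As for bi-indexed categories, the data with their boundaries are separated from the coherence
 equations, which can be tested on members.
\<close>

definition vt_frame :: "('o, 'm) cat => ('o, 'm, 'u) bi_indexed1 => bool" where
 "vt_frame B \<tau> \<longleftrightarrow> is_bi B (VSrc \<tau>) \<and> is_bi B (VTgt \<tau>) \<and>
   VO \<tau> \<in> extensional (Obj B) \<and> VH \<tau> \<in> extensional (Arr B) \<and>
   (\<forall>a\<in>Obj B. is_functor (VO \<tau> a) \<and> FDom (VO \<tau> a) = DO (VSrc \<tau>) a \<and> FCod (VO \<tau> a) = DO (VTgt \<tau>) a) \<and>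
   (\<forall>f\<in>Arr B. is_square (VH \<tau> f) \<and> STop (VH \<tau> f) = DH (VSrc \<tau>) f \<and> SBot (VH \<tau> f) = DH (VTgt \<tau>) f \<and>
    SLeft (VH \<tau> f) = VO \<tau> (Dom B f) \<and> SRight (VH \<tau> f) = VO \<tau> (Cod B f))"

definition vt_coherent :: "('o, 'm) cat => ('o, 'm, 'u) bi_indexed1 => bool" where
 "vt_coherent B \<tau> \<longleftrightarrow>
   (\<forall>a\<in>Obj B. vcomp (VH \<tau> (Id B a)) (Ddelta (VSrc \<tau>) a) = vcomp (Ddelta (VTgt \<tau>) a) (hid (VO \<tau> a))) \<and>
   (\<forall>f\<in>Arr B. \<forall>g\<in>Arr B. Dom B g = Cod B f -->
    vcomp (VH \<tau> (g *[B] f)) (Dgamma (VSrc \<tau>) f g) = vcomp (Dgamma (VTgt \<tau>) f g) (sqcomp (VH \<tau> g) (VH \<tau> f)))"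

locale vt_loc =
 fixes B :: "('o, 'm) cat" and \<Omega> \<Omega>' :: "('o, 'm, 'u) bi_indexed" and \<tau> :: "('o, 'm, 'u) bi_indexed1"
 assumes vt_frame: "vt_frame B \<tau>" and vt_ends [simp]: "VSrc \<tau> = \<Omega>" "VTgt \<tau> = \<Omega>'" and B: "category B"
begin

lemma ends_bi: "bi_frame B \<Omega>" "bi_frame B \<Omega>'" "bi_iso B \<Omega>" "bi_iso B \<Omega>'" "bi_coherent B \<Omega>" "bi_coherent B \<Omega>'"
 "is_bi B \<Omega>" "is_bi B \<Omega>'"
 using vt_frame pseudo_double_functor_iff[OF B] unfolding vt_frame_def vt_ends by blast+

sublocale S: bi_frame_loc B \<Omega> by unfold_locales (rule ends_bi)
sublocale T: bi_frame_loc B \<Omega>' by unfold_locales (rule ends_bi)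

lemma frame1 [simp]:
 "VO \<tau> \<in> extensional (Obj B)" "VH \<tau> \<in> extensional (Arr B)"
 "a \<in> Obj B ==> is_functor (VO \<tau> a)" "a \<in> Obj B ==> FDom (VO \<tau> a) = DO \<Omega> a" "a \<in> Obj B ==> FCod (VO \<tau> a) = DO \<Omega>' a"
 "f \<in> Arr B ==> is_square (VH \<tau> f)" "f \<in> Arr B ==> STop (VH \<tau> f) = DH \<Omega> f" "f \<in> Arr B ==> SBot (VH \<tau> f) = DH \<Omega>' f"
 "f \<in> Arr B ==> SLeft (VH \<tau> f) = VO \<tau> (Dom B f)" "f \<in> Arr B ==> SRight (VH \<tau> f) = VO \<tau> (Cod B f)"
 using vt_frame unfolding vt_frame_def vt_ends by blast+

lemma members1 [simp]:
 assumes "f \<in> Arr B"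
 shows "NSrc (SXi (VH \<tau> f)) = ftcomp (ALeft (DH \<Omega>' f)) (VO \<tau> (Dom B f))" "NTgt (SXi (VH \<tau> f)) = ftcomp (VO \<tau> (Cod B f)) (ALeft (DH \<Omega> f))"
  "NSrc (SZeta (VH \<tau> f)) = ftcomp (VO \<tau> (Dom B f)) (ARight (DH \<Omega> f))" "NTgt (SZeta (VH \<tau> f)) = ftcomp (ARight (DH \<Omega>' f)) (VO \<tau> (Cod B f))"
 using assms by simp_all

lemma vertical_transformation_iff: "is_bi1 B \<tau> \<longleftrightarrow> vt_coherent B \<tau>"
 using ends_bi(7,8) unfolding vertical_transformation_def vt_coherent_def HH_simps ADJ_simps vt_ends by (auto simp: hom_def)

lemma pseudo_functor_ends [simp]:
 "pseudo_functor (op_cat B) (F0 (VV B) \<Omega>)" "pseudo_functor (op_cat B) (F0 (VV B) \<Omega>')" "pseudo_functor B (F0 (UU B) \<Omega>)" "pseudo_functor B (F0 (UU B) \<Omega>')"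
 using S.pseudo_functor_VV T.pseudo_functor_VV S.pseudo_functor_UU T.pseudo_functor_UU ends_bi by blast+

lemma oplax_transformation_VV: "is_oplax B (F1 (VV B) \<tau>) \<longleftrightarrow> is_bi1 B \<tau>"
proof -
 have f: "oplax_frame (op_cat B) (F1 (VV B) \<tau>)" by (rule oplax_frameI) simp_all
 have "vcomp (VH \<tau> (Id B a)) (Ddelta \<Omega> a) = vcomp (Ddelta \<Omega>' a) (hid (VO \<tau> a)) \<longleftrightarrow> (\<forall>e\<in>Obj (DO \<Omega> a).
  NMap (SZeta (VH \<tau> (Id B a))) e *[DO \<Omega>' a] FM (VO \<tau> a) (NMap (SZeta (Ddelta \<Omega> a)) e) = NMap (SZeta (Ddelta \<Omega>' a)) (FO (VO \<tau> a) e))" if "a \<in> Obj B" for a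
  using that by (subst zeta_eq_iff[where D = "DO \<Omega> a"]) simp_all
 moreover have "vcomp (VH \<tau> (g *[B] f)) (Dgamma \<Omega> f g) = vcomp (Dgamma \<Omega>' f g) (sqcomp (VH \<tau> g) (VH \<tau> f)) \<longleftrightarrow> (\<forall>e\<in>Obj (DO \<Omega> (Cod B g)).
  NMap (SZeta (VH \<tau> (g *[B] f))) e *[DO \<Omega>' (Dom B f)] FM (VO \<tau> (Dom B f)) (NMap (SZeta (Dgamma \<Omega> f g)) e) =
  NMap (SZeta (Dgamma \<Omega>' f g)) (FO (VO \<tau> (Cod B g)) e) *[DO \<Omega>' (Dom B f)]
    (FM (ARight (DH \<Omega>' f)) (NMap (SZeta (VH \<tau> g)) e) *[DO \<Omega>' (Dom B f)] NMap (SZeta (VH \<tau> f)) (FO (ARight (DH \<Omega> g)) e)))"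
  if "f \<in> Arr B" "g \<in> Arr B" "Dom B g = Cod B f" for f g
  using that by (subst zeta_eq_iff[where D = "DO \<Omega> (Cod B g)"]) simp_all
 ultimately show ?thesis
  unfolding oplax_transformation_iff vertical_transformation_iff vt_coherent_def using f by simp
qed

lemma lax_transformation_UU: "lax_transformation B (F1 (UU B) \<tau>) \<longleftrightarrow> is_bi1 B \<tau>"
proof -
 note [simp] = S.iso_members[OF ends_bi(3)] T.iso_members[OF ends_bi(4)]
 have "vcomp (VH \<tau> (Id B a)) (Ddelta \<Omega> a) = vcomp (Ddelta \<Omega>' a) (hid (VO \<tau> a)) \<longleftrightarrow> (\<forall>x\<in>Obj (DO \<Omega> a).
  NMap (SXi (VH \<tau> (Id B a))) x *[DO \<Omega>' a] inv_arrow (DO \<Omega>' a) (NMap (SXi (Ddelta \<Omega>' a)) (FO (VO \<tau> a) x)) =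
  inv_arrow (DO \<Omega>' a) (FM (VO \<tau> a) (NMap (SXi (Ddelta \<Omega> a)) x)))" if "a \<in> Obj B" for a
 proof -
  note [simp] = that
  have "NMap (SXi (VH \<tau> (Id B a))) x *[DO \<Omega>' a] inv_arrow (DO \<Omega>' a) (NMap (SXi (Ddelta \<Omega>' a)) (FO (VO \<tau> a) x)) =
    inv_arrow (DO \<Omega>' a) (FM (VO \<tau> a) (NMap (SXi (Ddelta \<Omega> a)) x)) \<longleftrightarrow>
   FM (VO \<tau> a) (NMap (SXi (Ddelta \<Omega> a)) x) *[DO \<Omega>' a] NMap (SXi (VH \<tau> (Id B a))) x = NMap (SXi (Ddelta \<Omega>' a)) (FO (VO \<tau> a) x)" if "x \<in> Obj (DO \<Omega> a)" for x
   using iso_shift[of "DO \<Omega>' a" "FM (VO \<tau> a) (NMap (SXi (Ddelta \<Omega> a)) x)" "NMap (SXi (Ddelta \<Omega>' a)) (FO (VO \<tau> a) x)"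
    "NMap (SXi (VH \<tau> (Id B a))) x" "Id (DO \<Omega>' a) (FO (VO \<tau> a) x)"] that by simp
  then show ?thesis by (subst xi_eq_iff[where C = "DO \<Omega> a"]) simp_all
 qed
 moreover have "vcomp (VH \<tau> (g *[B] f)) (Dgamma \<Omega> f g) = vcomp (Dgamma \<Omega>' f g) (sqcomp (VH \<tau> g) (VH \<tau> f)) \<longleftrightarrow> (\<forall>x\<in>Obj (DO \<Omega> (Dom B f)).
  NMap (SXi (VH \<tau> (g *[B] f))) x *[DO \<Omega>' (Cod B g)] inv_arrow (DO \<Omega>' (Cod B g)) (NMap (SXi (Dgamma \<Omega>' f g)) (FO (VO \<tau> (Dom B f)) x)) =
  inv_arrow (DO \<Omega>' (Cod B g)) (FM (VO \<tau> (Cod B g)) (NMap (SXi (Dgamma \<Omega> f g)) x)) *[DO \<Omega>' (Cod B g)]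
    (NMap (SXi (VH \<tau> g)) (FO (ALeft (DH \<Omega> f)) x) *[DO \<Omega>' (Cod B g)] FM (ALeft (DH \<Omega>' g)) (NMap (SXi (VH \<tau> f)) x)))"
  if "f \<in> Arr B" "g \<in> Arr B" "Dom B g = Cod B f" for f g
 proof -
  note [simp] = that
  show ?thesis by (subst xi_eq_iff[where C = "DO \<Omega> (Dom B f)"]) (simp_all add: iso_shift)
 qed
 ultimately show ?thesis
  unfolding lax_transformation_def vertical_transformation_iff vt_coherent_def ptrans_frame_def is_nt_between_def by simp
qed

end

lemma whisker_ftid [simp]:
 "is_nt u ==> FCod (NSrc u) = D ==> whisker_left (ftid D) u = u" "is_nt u ==> FDom (NSrc u) = C ==> whisker_right u (ftid C) = u"
 by (auto intro!: nt_eqI)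

lemma vt_locI:
 assumes "category B" "is_bi1 B \<tau>" "VSrc \<tau> = \<Omega>" "VTgt \<tau> = \<Omega>'"
 shows "vt_loc B \<Omega> \<Omega>' \<tau>"
proof -
 have "vt_frame B \<tau>"
  using assms(2) unfolding vertical_transformation_def vt_frame_def HH_simps ADJ_simps by (auto simp: hom_def)
 with assms show ?thesis unfolding vt_loc_def by blast
qed

lemma ptrans_eqI:
 fixes \<sigma> \<tau> :: "('o, 'm, 'u) ptrans"
 assumes "TSrc \<sigma> = TSrc \<tau>" "TTgt \<sigma> = TTgt \<tau>" "TO \<sigma> \<in> extensional X" "TO \<tau> \<in> extensional X" "TM \<sigma> \<in> extensional M" "TM \<tau> \<in> extensional M"
  "\<And>a. a \<in> X ==> TO \<sigma> a = TO \<tau> a" "\<And>f. f \<in> M ==> TM \<sigma> f = TM \<tau> f"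
 shows "\<sigma> = \<tau>"
proof -
 have "TO \<sigma> = TO \<tau>" by (rule extensionalityI[OF assms(3,4,7)])
 moreover have "TM \<sigma> = TM \<tau>" by (rule extensionalityI[OF assms(5,6,8)])
 ultimately show ?thesis using assms(1,2) by (intro ptrans.equality) simp_all
qed

lemma lax_comp_simps [simp]:
 "TSrc (lax_comp C \<sigma> \<tau>) = TSrc \<tau>" "TTgt (lax_comp C \<sigma> \<tau>) = TTgt \<sigma>"
 "b \<in> Obj C ==> TO (lax_comp C \<sigma> \<tau>) b = ftcomp (TO \<sigma> b) (TO \<tau> b)"
 "f \<in> Arr C ==> TM (lax_comp C \<sigma> \<tau>) f = ncomp (whisker_left (TO \<sigma> (Cod C f)) (TM \<tau> f)) (whisker_right (TM \<sigma> f) (TO \<tau> (Dom C f)))"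
 by (simp_all add: lax_comp_def)

lemma comp_id_extensional [simp]:
 "TO (lax_comp C \<sigma> \<tau>) \<in> extensional (Obj C)" "TM (lax_comp C \<sigma> \<tau>) \<in> extensional (Arr C)"
 "TO (oplax_comp C \<sigma> \<tau>) \<in> extensional (Obj C)" "TM (oplax_comp C \<sigma> \<tau>) \<in> extensional (Arr C)"
 "TO (lax_id C \<Phi>) \<in> extensional (Obj C)" "TM (lax_id C \<Phi>) \<in> extensional (Arr C)"
 by (simp_all add: lax_comp_def oplax_comp_def lax_id_def)

text \<open>
 Members of a pasted cell are pasted members; so taking members commutes literally with composition.
 Composites of coherent data are coherent because this holds for oplax transformations.
\<close>

locale vt_pair = T: vt_loc B \<Omega> \<Omega>' \<tau> + S: vt_loc B \<Omega>' \<Omega>'' \<sigma> for B \<Omega> \<Omega>' \<Omega>'' \<sigma> \<tau>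
begin

abbreviation "composite \<equiv> \<sigma> *[C1 (BI_IND B)] \<tau>"

lemma composite_frame: "vt_loc B \<Omega> \<Omega>'' composite"
 unfolding vt_loc_def vt_frame_def using T.B T.ends_bi(7) S.ends_bi(8) by simp

lemma composite_VV: "F1 (VV B) composite = oplax_comp (op_cat B) (F1 (VV B) \<sigma>) (F1 (VV B) \<tau>)"
 by (rule ptrans_eqI[where X = "Obj B" and M = "Arr B"]) (use comp_id_extensional[of "op_cat B"] in simp_all)

lemma composite_UU: "F1 (UU B) composite = lax_comp B (F1 (UU B) \<sigma>) (F1 (UU B) \<tau>)"
 by (rule ptrans_eqI[where X = "Obj B" and M = "Arr B"]) simp_all

end

lemma identity_frame:
 assumes "category B" "is_bi B \<Omega>"
 shows "vt_loc B \<Omega> \<Omega> (Id (C1 (BI_IND B)) \<Omega>)"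
  "F1 (VV B) (Id (C1 (BI_IND B)) \<Omega>) = lax_id (op_cat B) (F0 (VV B) \<Omega>)" "F1 (UU B) (Id (C1 (BI_IND B)) \<Omega>) = lax_id B (F0 (UU B) \<Omega>)"
proof -
 interpret bi_frame_loc B \<Omega> using assms pseudo_double_functor_iff[OF assms(1)] unfolding bi_frame_loc_def by blast
 show "vt_loc B \<Omega> \<Omega> (Id (C1 (BI_IND B)) \<Omega>)" unfolding vt_loc_def vt_frame_def using assms by simp
 show "F1 (VV B) (Id (C1 (BI_IND B)) \<Omega>) = lax_id (op_cat B) (F0 (VV B) \<Omega>)"
  by (rule ptrans_eqI[where X = "Obj B" and M = "Arr B"]) (use comp_id_extensional[of "op_cat B"] in simp_all)
 show "F1 (UU B) (Id (C1 (BI_IND B)) \<Omega>) = lax_id B (F0 (UU B) \<Omega>)"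
  by (rule ptrans_eqI[where X = "Obj B" and M = "Arr B"]) simp_all
qed

subsection \<open>Modifications\<close>

locale vm_loc = S: vt_loc B \<Omega> \<Omega>' \<sigma> + T: vt_loc B \<Omega> \<Omega>' \<tau> for B and \<Omega> \<Omega>' :: "('o, 'm, 'u) bi_indexed" and \<sigma> \<tau> +
 fixes \<Xi> :: "('o, 'm, 'u) bi_indexed2"
 assumes vm_ends [simp]: "VMSrc \<Xi> = \<sigma>" "VMTgt \<Xi> = \<tau>"
  and vertical: "is_bi1 B \<sigma>" "is_bi1 B \<tau>"
  and VMC_extensional [simp]: "VMC \<Xi> \<in> extensional (Obj B)"
  and VMC: "\<And>a. a \<in> Obj B ==> is_square (VMC \<Xi> a) \<and> STop (VMC \<Xi> a) = adj_id (DO \<Omega> a) \<and> SBot (VMC \<Xi> a) = adj_id (DO \<Omega>' a) \<and>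
   SLeft (VMC \<Xi> a) = VO \<sigma> a \<and> SRight (VMC \<Xi> a) = VO \<tau> a"
begin

lemma frame2 [simp]:
 assumes "a \<in> Obj B"
 shows "is_square (VMC \<Xi> a)" "STop (VMC \<Xi> a) = adj_id (DO \<Omega> a)" "SBot (VMC \<Xi> a) = adj_id (DO \<Omega>' a)" "SLeft (VMC \<Xi> a) = VO \<sigma> a" "SRight (VMC \<Xi> a) = VO \<tau> a"
 using VMC[OF assms] by blast+

lemma members2 [simp]:
 assumes "a \<in> Obj B"
 shows "SXi (VMC \<Xi> a) = SZeta (VMC \<Xi> a)" "NSrc (SZeta (VMC \<Xi> a)) = VO \<sigma> a" "NTgt (SZeta (VMC \<Xi> a)) = VO \<tau> a"
 using assms square_hid_SXi[OF frame2(1-3)[OF assms]] by simp_all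

lemma pmod_frames [simp]: "pmod_frame (op_cat B) (F2 (VV B) \<Xi>)" "pmod_frame B (F2 (UU B) \<Xi>)"
 by (simp_all add: pmod_frame_def is_nt_between_def)

lemma double_modification_iff:
 "is_bi2 B \<Xi> \<longleftrightarrow> (\<forall>f\<in>Arr B. sqcomp (VH \<tau> f) (VMC \<Xi> (Dom B f)) = sqcomp (VMC \<Xi> (Cod B f)) (VH \<sigma> f))"
 using vertical unfolding double_modification_def HH_simps ADJ_simps vm_ends by (auto simp: hom_def)

lemma oplax_modification_VV: "is_oplax2 B (F2 (VV B) \<Xi>) \<longleftrightarrow> is_bi2 B \<Xi>"
proof -
 have "sqcomp (VH \<tau> f) (VMC \<Xi> (Dom B f)) = sqcomp (VMC \<Xi> (Cod B f)) (VH \<sigma> f) \<longleftrightarrow> (\<forall>y\<in>Obj (DO \<Omega> (Cod B f)).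
  NMap (SZeta (VH \<tau> f)) y *[DO \<Omega>' (Dom B f)] NMap (SZeta (VMC \<Xi> (Dom B f))) (FO (ARight (DH \<Omega> f)) y) =
  FM (ARight (DH \<Omega>' f)) (NMap (SZeta (VMC \<Xi> (Cod B f))) y) *[DO \<Omega>' (Dom B f)] NMap (SZeta (VH \<sigma> f)) y)" if "f \<in> Arr B" for f
  using that by (subst zeta_eq_iff[where D = "DO \<Omega> (Cod B f)"]) simp_all
 then show ?thesis using vertical unfolding oplax_modification_iff double_modification_iff
  by (simp add: S.oplax_transformation_VV T.oplax_transformation_VV)
qed

lemma lax_modification_UU: "lax_modification B (F2 (UU B) \<Xi>) \<longleftrightarrow> is_bi2 B \<Xi>"
proof -
 have "sqcomp (VH \<tau> f) (VMC \<Xi> (Dom B f)) = sqcomp (VMC \<Xi> (Cod B f)) (VH \<sigma> f) \<longleftrightarrow> (\<forall>x\<in>Obj (DO \<Omega> (Dom B f)).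
  NMap (SXi (VH \<tau> f)) x *[DO \<Omega>' (Cod B f)] FM (ALeft (DH \<Omega>' f)) (NMap (SXi (VMC \<Xi> (Dom B f))) x) =
  NMap (SXi (VMC \<Xi> (Cod B f))) (FO (ALeft (DH \<Omega> f)) x) *[DO \<Omega>' (Cod B f)] NMap (SXi (VH \<sigma> f)) x)" if "f \<in> Arr B" for f
  using that by (subst xi_eq_iff[where C = "DO \<Omega> (Dom B f)"]) simp_all
 then show ?thesis using vertical unfolding lax_modification_def double_modification_iff
  by (simp add: S.lax_transformation_UU T.lax_transformation_UU)
qed

end

lemma vm_locI:
 assumes B: "category B" and \<Xi>: "is_bi2 B \<Xi>" and ends: "VSrc (VMSrc \<Xi>) = \<Omega>" "VTgt (VMSrc \<Xi>) = \<Omega>'" "VMSrc \<Xi> = \<sigma>" "VMTgt \<Xi> = \<tau>"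
 shows "vm_loc B \<Omega> \<Omega>' \<sigma> \<tau> \<Xi>"
proof -
 have v: "is_bi1 B \<sigma>" "is_bi1 B \<tau>" "VSrc \<sigma> = \<Omega>" "VTgt \<sigma> = \<Omega>'" "VSrc \<tau> = \<Omega>" "VTgt \<tau> = \<Omega>'"
  using \<Xi> ends unfolding double_modification_def by auto
 interpret S: vt_loc B \<Omega> \<Omega>' \<sigma> by (rule vt_locI[OF B v(1,3,4)])
 interpret T: vt_loc B \<Omega> \<Omega>' \<tau> by (rule vt_locI[OF B v(2,5,6)])
 show ?thesis
  by unfold_locales (use \<Xi>[unfolded double_modification_def HH_simps ADJ_simps] v ends in "auto simp: hom_def")
qed

locale vm_comp = X: vm_loc B \<Omega> \<Omega>' \<rho> \<sigma> \<Xi> + Y: vm_loc B \<Omega> \<Omega>' \<sigma> \<tau> \<Theta> for B \<Omega> \<Omega>' \<rho> \<sigma> \<tau> \<Theta> \<Xi>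
begin

abbreviation "composite \<equiv> \<Theta> *[C2 (BI_IND B)] \<Xi>"

lemma composite_frame: "vm_loc B \<Omega> \<Omega>' \<rho> \<tau> composite"
 by unfold_locales (use X.vertical Y.vertical in simp_all)

lemma composite_VV: "F2 (VV B) composite = pmod_comp (op_cat B) (F2 (VV B) \<Theta>) (F2 (VV B) \<Xi>)"
 by (intro pmod.equality extensionalityI[of _ "Obj B"]) (use pmod_comp_simps(4)[of "op_cat B"] in simp_all)

lemma composite_UU: "F2 (UU B) composite = pmod_comp B (F2 (UU B) \<Theta>) (F2 (UU B) \<Xi>)"
 by (intro pmod.equality extensionalityI[of _ "Obj B"]) simp_all

end

locale vm_hcomp = X: vm_loc B \<Omega> \<Omega>' \<sigma> \<tau> \<Xi> + Y: vm_loc B \<Omega>' \<Omega>'' \<sigma>' \<tau>' \<Theta> for B \<Omega> \<Omega>' \<Omega>'' \<sigma> \<tau> \<sigma>' \<tau>' \<Theta> \<Xi> +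
 assumes composites: "is_bi1 B (\<sigma>' *[C1 (BI_IND B)] \<sigma>)" "is_bi1 B (\<tau>' *[C1 (BI_IND B)] \<tau>)"
begin

interpretation S: vt_pair B \<Omega> \<Omega>' \<Omega>'' \<sigma>' \<sigma> ..
interpretation T: vt_pair B \<Omega> \<Omega>' \<Omega>'' \<tau>' \<tau> ..

abbreviation "composite \<equiv> \<Theta> \<star>[BI_IND B] \<Xi>"

lemma composite_frame: "vm_loc B \<Omega> \<Omega>'' (\<sigma>' *[C1 (BI_IND B)] \<sigma>) (\<tau>' *[C1 (BI_IND B)] \<tau>) composite"
 unfolding vm_loc_def vm_loc_axioms_def using S.composite_frame T.composite_frame composites by simp

lemma composite_VV: "F2 (VV B) composite = F2 (VV B) \<Theta> \<star>[IND B] F2 (VV B) \<Xi>"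
 by (intro pmod.equality extensionalityI[of _ "Obj B"]) (simp_all add: S.composite_VV[simplified] T.composite_VV[simplified] hcomp_def)

lemma composite_UU: "F2 (UU B) composite = \<lparr>MSrc = lax_comp B (F1 (UU B) \<sigma>') (F1 (UU B) \<sigma>), MTgt = lax_comp B (F1 (UU B) \<tau>') (F1 (UU B) \<tau>),
  MO = (\<lambda>a\<in>Obj B. hcomp (MO (F2 (UU B) \<Theta>) a) (MO (F2 (UU B) \<Xi>) a))\<rparr>"
proof -
 \<comment> \<open>The left members are pasted in the other order; both members of the composite coincide.\<close>
 interpret vm_loc B \<Omega> \<Omega>'' "\<sigma>' *[C1 (BI_IND B)] \<sigma>" "\<tau>' *[C1 (BI_IND B)] \<tau>" composite by (rule composite_frame)
 show ?thesis
  by (intro pmod.equality extensionalityI[of _ "Obj B"])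
   (use members2(1) in "simp_all add: S.composite_UU[simplified] T.composite_UU[simplified] hcomp_def")
qed

end

subsection \<open>The 2-category of bi-indexed categories and its right adjoint members\<close>

text \<open>
 Each operation yields data with the right boundaries. Their coherence is that of the right adjoint
 members, which form a composite of oplax transformations or modifications and are therefore coherent.
\<close>

lemma BI_IND_closed:
 fixes B :: "('o, 'm) cat"
 assumes B: "category B"
 defines "K \<equiv> BI_IND B :: (('o, 'm, ('o, 'm, 'a) univ) bi_indexed, _, _) two_cat"
 shows "\<Omega> \<in> Obj (C1 K) ==> Id (C1 K) \<Omega> \<in> Arr (C1 K)"
  and "\<tau> \<in> Arr (C1 K) ==> \<sigma> \<in> Arr (C1 K) ==> VSrc \<sigma> = VTgt \<tau> ==> \<sigma> *[C1 K] \<tau> \<in> Arr (C1 K) \<and> F1 (VV B) (\<sigma> *[C1 K] \<tau>) = F1 (VV B) \<sigma> *[C1 (IND B)] F1 (VV B) \<tau>"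
  and "\<tau> \<in> Arr (C1 K) ==> Id (C2 K) \<tau> \<in> Arr (C2 K) \<and> F2 (VV B) (Id (C2 K) \<tau>) = Id (C2 (IND B)) (F1 (VV B) \<tau>)"
  and "\<Xi> \<in> Arr (C2 K) ==> \<Theta> \<in> Arr (C2 K) ==> VMSrc \<Theta> = VMTgt \<Xi> ==> \<Theta> *[C2 K] \<Xi> \<in> Arr (C2 K) \<and> F2 (VV B) (\<Theta> *[C2 K] \<Xi>) = F2 (VV B) \<Theta> *[C2 (IND B)] F2 (VV B) \<Xi>"
  and "\<Xi> \<in> Arr (C2 K) ==> \<Theta> \<in> Arr (C2 K) ==> src0 K \<Theta> = tgt0 K \<Xi> ==> \<Theta> \<star>[K] \<Xi> \<in> Arr (C2 K) \<and> F2 (VV B) (\<Theta> \<star>[K] \<Xi>) = F2 (VV B) \<Theta> \<star>[IND B] F2 (VV B) \<Xi>"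
proof -
 have I: "two_category (IND B :: ('o, 'm, ('o, 'm, 'a) univ) ps_two_cat)" by (rule two_functorD(1)[OF Groth_embedding(1)[OF B]])
 show "Id (C1 K) \<Omega> \<in> Arr (C1 K)" if "\<Omega> \<in> Obj (C1 K)"
 proof -
  have \<Omega>: "is_bi B \<Omega>" using that unfolding K_def by simp
  interpret vt_loc B \<Omega> \<Omega> "Id (C1 (BI_IND B)) \<Omega>" by (rule identity_frame(1)[OF B \<Omega>])
  show ?thesis
   using oplax_transformation_VV identity_frame(2)[OF B \<Omega>] oplax_id(1)[OF pseudo_functor_ends(1) B] unfolding K_def by simp
 qed
 show comp: "\<sigma> *[C1 K] \<tau> \<in> Arr (C1 K) \<and> F1 (VV B) (\<sigma> *[C1 K] \<tau>) = F1 (VV B) \<sigma> *[C1 (IND B)] F1 (VV B) \<tau>"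
  if "\<tau> \<in> Arr (C1 K)" "\<sigma> \<in> Arr (C1 K)" "VSrc \<sigma> = VTgt \<tau>" for \<sigma> \<tau>
 proof -
  have v: "is_bi1 B \<sigma>" "is_bi1 B \<tau>" using that unfolding K_def by simp_all
  obtain \<Omega> \<Omega>' \<Omega>'' where e: "VSrc \<tau> = \<Omega>" "VTgt \<tau> = \<Omega>'" "VTgt \<sigma> = \<Omega>''" by blast
  have e': "VSrc \<sigma> = \<Omega>'" using e that by simp
  interpret T: vt_loc B \<Omega> \<Omega>' \<tau> by (rule vt_locI[OF B v(2) e(1,2)])
  interpret S: vt_loc B \<Omega>' \<Omega>'' \<sigma> by (rule vt_locI[OF B v(1) e' e(3)])
  interpret vt_pair B \<Omega> \<Omega>' \<Omega>'' \<sigma> \<tau> ..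
  have "is_oplax B (F1 (VV B) composite)"
   unfolding composite_VV by (rule oplax_comp) (use v S.oplax_transformation_VV T.oplax_transformation_VV in "simp_all add: B")
  then show ?thesis unfolding K_def using vt_loc.oplax_transformation_VV[OF composite_frame] composite_VV by simp
 qed
 show "Id (C2 K) \<tau> \<in> Arr (C2 K) \<and> F2 (VV B) (Id (C2 K) \<tau>) = Id (C2 (IND B)) (F1 (VV B) \<tau>)" if "\<tau> \<in> Arr (C1 K)"
 proof -
  have v: "is_bi1 B \<tau>" using that unfolding K_def by simp
  obtain \<Omega> \<Omega>' where e: "VSrc \<tau> = \<Omega>" "VTgt \<tau> = \<Omega>'" by blast
  interpret T: vt_loc B \<Omega> \<Omega>' \<tau> by (rule vt_locI[OF B v e])
  interpret vm_loc B \<Omega> \<Omega>' \<tau> \<tau> "Id (C2 (BI_IND B)) \<tau>" by unfold_locales (simp_all add: v)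
  have eq: "F2 (VV B) (Id (C2 (BI_IND B)) \<tau>) = Id (C2 (IND B)) (F1 (VV B) \<tau>)"
   by (intro pmod.equality extensionalityI[of _ "Obj B"]) (use pmod_comp_simps(8)[of "op_cat B"] in simp_all)
  moreover have "is_oplax2 B (F2 (VV B) (Id (C2 (BI_IND B)) \<tau>))"
   unfolding eq using oplax_pmod_id(1)[OF B] v T.oplax_transformation_VV by simp
  ultimately show ?thesis unfolding K_def using oplax_modification_VV by simp
 qed
 show "\<Theta> *[C2 K] \<Xi> \<in> Arr (C2 K) \<and> F2 (VV B) (\<Theta> *[C2 K] \<Xi>) = F2 (VV B) \<Theta> *[C2 (IND B)] F2 (VV B) \<Xi>"
  if "\<Xi> \<in> Arr (C2 K)" "\<Theta> \<in> Arr (C2 K)" "VMSrc \<Theta> = VMTgt \<Xi>"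
 proof -
  have d: "is_bi2 B \<Xi>" "is_bi2 B \<Theta>" using that unfolding K_def by simp_all
  obtain \<Omega> \<Omega>' \<rho> \<sigma> \<tau> where e: "VSrc (VMSrc \<Xi>) = \<Omega>" "VTgt (VMSrc \<Xi>) = \<Omega>'" "VMSrc \<Xi> = \<rho>" "VMTgt \<Xi> = \<sigma>" "VMTgt \<Theta> = \<tau>" by blast
  interpret X: vm_loc B \<Omega> \<Omega>' \<rho> \<sigma> \<Xi> by (rule vm_locI[OF B d(1) e(1-4)])
  interpret Y: vm_loc B \<Omega> \<Omega>' \<sigma> \<tau> \<Theta> by (rule vm_locI[OF B d(2)]) (use e that in simp_all)
  interpret vm_comp B \<Omega> \<Omega>' \<rho> \<sigma> \<tau> \<Theta> \<Xi> ..
  have "is_oplax2 B (F2 (VV B) composite)"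
   unfolding composite_VV by (rule oplax_pmod_comp(1)) (use d X.oplax_modification_VV Y.oplax_modification_VV in "simp_all add: B")
  then show ?thesis unfolding K_def using vm_loc.oplax_modification_VV[OF composite_frame] composite_VV by simp
 qed
 show "\<Theta> \<star>[K] \<Xi> \<in> Arr (C2 K) \<and> F2 (VV B) (\<Theta> \<star>[K] \<Xi>) = F2 (VV B) \<Theta> \<star>[IND B] F2 (VV B) \<Xi>"
  if "\<Xi> \<in> Arr (C2 K)" "\<Theta> \<in> Arr (C2 K)" "src0 K \<Theta> = tgt0 K \<Xi>"
 proof -
  have d: "is_bi2 B \<Xi>" "is_bi2 B \<Theta>" using that unfolding K_def by simp_all
  obtain \<Omega> \<Omega>' \<Omega>'' \<sigma> \<tau> \<sigma>' \<tau>' where e: "VSrc (VMSrc \<Xi>) = \<Omega>" "VTgt (VMSrc \<Xi>) = \<Omega>'" "VMSrc \<Xi> = \<sigma>" "VMTgt \<Xi> = \<tau>"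
   "VTgt (VMSrc \<Theta>) = \<Omega>''" "VMSrc \<Theta> = \<sigma>'" "VMTgt \<Theta> = \<tau>'" by blast
  have e': "VSrc (VMSrc \<Theta>) = \<Omega>'" using that(3) e unfolding K_def by simp
  interpret X: vm_loc B \<Omega> \<Omega>' \<sigma> \<tau> \<Xi> by (rule vm_locI[OF B d(1) e(1-4)])
  interpret Y: vm_loc B \<Omega>' \<Omega>'' \<sigma>' \<tau>' \<Theta> by (rule vm_locI[OF B d(2) e' e(5-7)])
  interpret vm_hcomp B \<Omega> \<Omega>' \<Omega>'' \<sigma> \<tau> \<sigma>' \<tau>' \<Theta> \<Xi>
  proof
   show "is_bi1 B (\<sigma>' *[C1 (BI_IND B)] \<sigma>)" using comp[of \<sigma> \<sigma>'] X.vertical Y.vertical unfolding K_def by simp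
   show "is_bi1 B (\<tau>' *[C1 (BI_IND B)] \<tau>)" using comp[of \<tau> \<tau>'] X.vertical Y.vertical unfolding K_def by simp
  qed
  have "F2 (VV B) composite \<in> Arr (C2 (IND B))"
   unfolding composite_VV by (rule two_category_HComp(1)[OF I]) (use d X.oplax_modification_VV Y.oplax_modification_VV in simp_all)
  then show ?thesis unfolding K_def using vm_loc.oplax_modification_VV[OF composite_frame] composite_VV by simp
 qed
qed

lemma double_modification_sides:
 assumes "double_modification A D \<Xi>"
 shows "vertical_transformation A D (VMSrc \<Xi>)" "vertical_transformation A D (VMTgt \<Xi>)" "VSrc (VMTgt \<Xi>) = VSrc (VMSrc \<Xi>)" "VTgt (VMTgt \<Xi>) = VTgt (VMSrc \<Xi>)"
 using assms unfolding double_modification_def by auto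

lemma BI_IND_cells:
 assumes B: "category B"
 shows "is_bi1 B \<tau> ==> is_bi B (VSrc \<tau>)"
  "is_bi1 B \<tau> ==> is_bi B (VTgt \<tau>)"
  "is_bi B \<Omega> ==> f \<in> Arr B ==> adjunction (DH \<Omega> f)"
  "is_bi B \<Omega> ==> pseudo_functor (op_cat B) (F0 (VV B) \<Omega>)"
  "is_bi B \<Omega> ==> pseudo_functor B (F0 (UU B) \<Omega>)"
  "is_bi1 B \<tau> ==> is_oplax B (F1 (VV B) \<tau>)"
  "is_bi1 B \<tau> ==> lax_transformation B (F1 (UU B) \<tau>)"
  "is_bi2 B \<Xi> ==> is_oplax2 B (F2 (VV B) \<Xi>)"
  "is_bi2 B \<Xi> ==> lax_modification B (F2 (UU B) \<Xi>)"
proof -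
 show "is_bi1 B \<tau> ==> is_bi B (VSrc \<tau>)"
  "is_bi1 B \<tau> ==> is_bi B (VTgt \<tau>)"
  unfolding vertical_transformation_def by blast+
 show "is_bi B \<Omega> ==> f \<in> Arr B ==> adjunction (DH \<Omega> f)"
  using pseudo_double_functor_iff[OF B, of \<Omega>] bi_frameD(4)[of B \<Omega> f] by blast
qed (use vt_loc.pseudo_functor_ends(1,3)[OF identity_frame(1)[OF B]] vt_loc.oplax_transformation_VV[OF vt_locI[OF B _ refl refl]]
  vt_loc.lax_transformation_UU[OF vt_locI[OF B _ refl refl]] vm_loc.oplax_modification_VV[OF vm_locI[OF B _ refl refl refl refl]]
  vm_loc.lax_modification_UU[OF vm_locI[OF B _ refl refl refl refl]] in blast)+

lemma locally_faithful_VV: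
 assumes B: "category B"
 shows "locally_faithful (BI_IND B) (VV B)"
 unfolding locally_faithful_def BI_IND_simps mem_Collect_eq
proof (intro conjI ballI impI)
 fix \<sigma> \<tau> :: "('a, 'b, 'c) bi_indexed1"
 assume h: "\<sigma> \<in> Collect (is_bi1 B)" "\<tau> \<in> Collect (is_bi1 B)"
  "VSrc \<sigma> = VSrc \<tau>" "VTgt \<sigma> = VTgt \<tau>" and eq: "F1 (VV B) \<sigma> = F1 (VV B) \<tau>"
 obtain \<Omega> \<Omega>' where e: "VSrc \<tau> = \<Omega>" "VTgt \<tau> = \<Omega>'" by blast
 interpret S: vt_loc B \<Omega> \<Omega>' \<sigma> by (rule vt_locI[OF B]) (use h e in simp_all)
 interpret T: vt_loc B \<Omega> \<Omega>' \<tau> by (rule vt_locI[OF B]) (use h e in simp_all)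
 have VO: "VO \<sigma> = VO \<tau>" using arg_cong[OF eq, of TO] by simp
 have "VH \<sigma> f = VH \<tau> f" if f [simp]: "f \<in> Arr B" for f
  by (rule square_eq_zeta) (use fun_cong[OF arg_cong[OF eq, of TM], of f] in "simp_all add: VO")
 then have "VH \<sigma> = VH \<tau>" by (intro extensionalityI[of _ "Arr B"]) simp_all
 then show "\<sigma> = \<tau>" using VO e h by simp
next
 fix \<Xi> \<Theta> :: "('a, 'b, 'c) bi_indexed2"
 assume h: "\<Xi> \<in> Collect (is_bi2 B)" "\<Theta> \<in> Collect (is_bi2 B)"
  "VMSrc \<Xi> = VMSrc \<Theta>" "VMTgt \<Xi> = VMTgt \<Theta>" and eq: "F2 (VV B) \<Xi> = F2 (VV B) \<Theta>"
 obtain \<Omega> \<Omega>' \<sigma> \<tau> where e: "VSrc (VMSrc \<Theta>) = \<Omega>" "VTgt (VMSrc \<Theta>) = \<Omega>'" "VMSrc \<Theta> = \<sigma>" "VMTgt \<Theta> = \<tau>" by blast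
 interpret S: vm_loc B \<Omega> \<Omega>' \<sigma> \<tau> \<Xi> by (rule vm_locI[OF B]) (use h e in simp_all)
 interpret T: vm_loc B \<Omega> \<Omega>' \<sigma> \<tau> \<Theta> by (rule vm_locI[OF B]) (use h e in simp_all)
 have "VMC \<Xi> a = VMC \<Theta> a" if a [simp]: "a \<in> Obj B" for a
  by (rule square_eq_zeta) (use fun_cong[OF arg_cong[OF eq, of MO], of a] in simp_all)
 then have "VMC \<Xi> = VMC \<Theta>" by (intro extensionalityI[of _ "Obj B"]) simp_all
 then show "\<Xi> = \<Theta>" using e h by simp
qed

lemma two_functor_VV:
 fixes B :: "('o, 'm) cat"
 assumes B: "category B"
 shows "two_functor (BI_IND B) (right_IND B) (VV B :: ('o, 'm, ('o, 'm, 'a) univ) forget_two_ftor)"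
proof -
 have I: "two_category (IND B :: ('o, 'm, ('o, 'm, 'a) univ) ps_two_cat)" by (rule two_functorD(1)[OF Groth_embedding(1)[OF B]])
 note cells = BI_IND_cells[OF B] double_modification_sides and closed = BI_IND_closed[OF B, where 'a = 'a, simplified]
 have right: "is_right_adjoint (ARight (DH \<Omega> f))" if "is_bi B \<Omega>" "f \<in> Arr B" for \<Omega> :: "('o, 'm, ('o, 'm, 'a) univ) bi_indexed" and f
  using cells(3)[OF that] unfolding is_right_adjoint_def by blast
 show ?thesis
  unfolding right_IND_def
 proof (rule two_category_reflect[OF two_category_full_sub[OF I]])
  show "closed_graph (C1 (BI_IND B :: (('o, 'm, ('o, 'm, 'a) univ) bi_indexed, _, _) two_cat))"
   by (rule closed_graphI) (simp_all add: hom_def closed(1) conjunct1[OF closed(2)] cells)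
  show "closed_graph (C2 (BI_IND B :: (('o, 'm, ('o, 'm, 'a) univ) bi_indexed, _, _) two_cat))"
   by (rule closed_graphI) (simp_all add: hom_def closed(3,4) cells)
  show "locally_faithful (BI_IND B) (VV B :: ('o, 'm, ('o, 'm, 'a) univ) forget_two_ftor)" by (rule locally_faithful_VV[OF B])
  show "preserves_cat (C1 (BI_IND B)) (C1 (full_sub (IND B) (\<lambda>\<Phi>. \<forall>f\<in>Arr B. is_right_adjoint (PM \<Phi> f))))
    (F0 (VV B :: ('o, 'm, ('o, 'm, 'a) univ) forget_two_ftor)) (F1 (VV B))"
   by (rule preserves_catI) (simp_all add: hom_def cells right closed(2) identity_frame(2)[OF B, simplified])
  show "preserves_cat (C2 (BI_IND B)) (C2 (full_sub (IND B) (\<lambda>\<Phi>. \<forall>f\<in>Arr B. is_right_adjoint (PM \<Phi> f))))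
    (F1 (VV B :: ('o, 'm, ('o, 'm, 'a) univ) forget_two_ftor)) (F2 (VV B))"
   by (rule preserves_catI) (simp_all add: hom_def cells right closed(3,4))
  fix u v :: "('o, 'm, ('o, 'm, 'a) univ) bi_indexed2"
  assume h: "u \<in> Arr (C2 (BI_IND B))" "v \<in> Arr (C2 (BI_IND B))" "src0 (BI_IND B) v = tgt0 (BI_IND B) u"
  note c = BI_IND_closed(5)[OF B h]
  show "v \<star>[BI_IND B] u \<in> hom (C2 (BI_IND B)) (Dom (C2 (BI_IND B)) v *[C1 (BI_IND B)] Dom (C2 (BI_IND B)) u)
    (Cod (C2 (BI_IND B)) v *[C1 (BI_IND B)] Cod (C2 (BI_IND B)) u)"
   by (rule homI[OF conjunct1[OF c]]) simp_all
  show "F2 (VV B) (v \<star>[BI_IND B] u) = F2 (VV B) v \<star>[full_sub (IND B) (\<lambda>\<Phi>. \<forall>f\<in>Arr B. is_right_adjoint (PM \<Phi> f))] F2 (VV B) u"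
   using conjunct2[OF c] by (simp only: full_sub_simps(3))
 qed (simp_all add: cells)
qed

text \<open>A square is determined by its boundary and one of its two members, which may be prescribed.\<close>

definition zeta_square :: "('o, 'm, 'o, 'm) adj => ('o, 'm, 'o, 'm) adj => ('o, 'm, 'o, 'm) ftor => ('o, 'm, 'o, 'm) ftor => ('o, 'm, 'o, 'm) nt => ('o, 'm) square" where
 "zeta_square a b H K \<zeta> = (let s = \<lparr>STop = a, SBot = b, SLeft = H, SRight = K, SXi = undefined, SZeta = \<zeta>\<rparr> in s\<lparr>SXi := comate s\<rparr>)"

definition xi_square :: "('o, 'm, 'o, 'm) adj => ('o, 'm, 'o, 'm) adj => ('o, 'm, 'o, 'm) ftor => ('o, 'm, 'o, 'm) ftor => ('o, 'm, 'o, 'm) nt => ('o, 'm) square" where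
 "xi_square a b H K \<xi> = (let s = \<lparr>STop = a, SBot = b, SLeft = H, SRight = K, SXi = \<xi>, SZeta = undefined\<rparr> in s\<lparr>SZeta := mate s\<rparr>)"

lemma prescribed_square_simps [simp]:
 "STop (zeta_square a b H K n) = a" "SBot (zeta_square a b H K n) = b" "SLeft (zeta_square a b H K n) = H" "SRight (zeta_square a b H K n) = K"
 "SZeta (zeta_square a b H K n) = n" "STop (xi_square a b H K n) = a" "SBot (xi_square a b H K n) = b" "SLeft (xi_square a b H K n) = H"
 "SRight (xi_square a b H K n) = K" "SXi (xi_square a b H K n) = n"
 by (simp_all add: zeta_square_def xi_square_def Let_def)

lemma is_square_prescribed [simp]:
 assumes "adjunction a" "adjunction b" "is_functor H" "is_functor K" "FDom H = ASrc a" "FCod H = ASrc b" "FDom K = ATgt a" "FCod K = ATgt b" "is_nt n"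
 shows "NSrc n = ftcomp H (ARight a) ==> NTgt n = ftcomp (ARight b) K ==> is_square (zeta_square a b H K n)"
  and "NSrc n = ftcomp (ALeft b) H ==> NTgt n = ftcomp K (ALeft a) ==> is_square (xi_square a b H K n)"
 unfolding zeta_square_def xi_square_def Let_def
 by (rule square_comate; use assms in "simp add: square_frame_def zeta_nt_def") (rule square_mate; use assms in "simp add: square_frame_def xi_nt_def")

lemma pseudo_functorD:
 assumes "pseudo_functor C \<Phi>"
 shows "a \<in> Obj C ==> category (PO \<Phi> a)"
  "f \<in> Arr C ==> is_functor (PM \<Phi> f)" "f \<in> Arr C ==> FDom (PM \<Phi> f) = PO \<Phi> (Dom C f)" "f \<in> Arr C ==> FCod (PM \<Phi> f) = PO \<Phi> (Cod C f)"
  "a \<in> Obj C ==> is_nt (Pdelta \<Phi> a)" "a \<in> Obj C ==> NSrc (Pdelta \<Phi> a) = ftid (PO \<Phi> a)" "a \<in> Obj C ==> NTgt (Pdelta \<Phi> a) = PM \<Phi> (Id C a)"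
  "a \<in> Obj C ==> x \<in> Obj (PO \<Phi> a) ==> iso_arrow (PO \<Phi> a) (NMap (Pdelta \<Phi> a) x)"
  "f \<in> Arr C ==> g \<in> Arr C ==> Dom C g = Cod C f ==> is_nt (Pgamma \<Phi> g f)"
  "f \<in> Arr C ==> g \<in> Arr C ==> Dom C g = Cod C f ==> NSrc (Pgamma \<Phi> g f) = ftcomp (PM \<Phi> g) (PM \<Phi> f)"
  "f \<in> Arr C ==> g \<in> Arr C ==> Dom C g = Cod C f ==> NTgt (Pgamma \<Phi> g f) = PM \<Phi> (g *[C] f)"
  "f \<in> Arr C ==> g \<in> Arr C ==> Dom C g = Cod C f ==> x \<in> Obj (PO \<Phi> (Dom C f)) ==> iso_arrow (PO \<Phi> (Cod C g)) (NMap (Pgamma \<Phi> g f) x)"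
 using assms unfolding pseudo_functor_def nat_iso_iff by auto

definition bi_of :: "('o, 'm, 'u) psftor => ('m => ('u, 'u, 'u, 'u) adj) => _ => _ => ('o, 'm, 'u) bi_indexed" where
 "bi_of \<Phi> h d c = \<lparr>DO = PO \<Phi>, DV = (\<lambda>a. ftid (PO \<Phi> a)), DH = h, DC = (\<lambda>f. vid (h f)), Ddelta = d, Dgamma = c\<rparr>"

lemma bi_of_simps [simp]:
 "DO (bi_of \<Phi> h d c) = PO \<Phi>" "DV (bi_of \<Phi> h d c) a = ftid (PO \<Phi> a)" "DH (bi_of \<Phi> h d c) = h" "DC (bi_of \<Phi> h d c) f = vid (h f)"
 "Ddelta (bi_of \<Phi> h d c) = d" "Dgamma (bi_of \<Phi> h d c) = c"
 by (simp_all add: bi_of_def)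

text \<open>
 The right adjoint member of \<open>h f\<close> is \<open>PM \<Phi> f\<close> also if \<open>f\<close> is not an arrow of \<open>B\<close>, so that \<open>V(\<Omega>)\<close> and \<open>\<Phi>\<close>
 are equal as records.
\<close>

lemma VV_surj:
 assumes B [simp]: "category B" and \<Phi>: "pseudo_functor (op_cat B) \<Phi>" and right: "\<And>f. f \<in> Arr B ==> is_right_adjoint (PM \<Phi> f)"
 obtains \<Omega> where "is_bi B \<Omega>" "F0 (VV B) \<Omega> = \<Phi>"
proof -
 define h where "h f = (if f \<in> Arr B then SOME a. adjunction a \<and> ARight a = PM \<Phi> f else \<lparr>ALeft = undefined, ARight = PM \<Phi> f, AUnit = undefined, ACounit = undefined\<rparr>)" for f
 note [simp] = pseudo_functorD[OF \<Phi>, simplified]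
 have h: "adjunction (h f) \<and> ARight (h f) = PM \<Phi> f" if "f \<in> Arr B" for f
  using someI_ex[of "\<lambda>a. adjunction a \<and> ARight a = PM \<Phi> f"] right[OF that] that unfolding is_right_adjoint_def h_def by simp
 have hR [simp]: "ARight (h f) = PM \<Phi> f" for f using h[of f] by (cases "f \<in> Arr B") (simp_all add: h_def)
 have [simp]: "adjunction (h f)" if "f \<in> Arr B" for f using h that by blast
 have [simp]: "ASrc (h f) = PO \<Phi> (Dom B f)" if "f \<in> Arr B" for f using adjunction_simps(4)[of "h f"] that by simp
 have [simp]: "ATgt (h f) = PO \<Phi> (Cod B f)" if "f \<in> Arr B" for f using adjunction_simps(3)[of "h f"] that by simp
 define \<Omega> where "\<Omega> = bi_of \<Phi> h (\<lambda>a. zeta_square (adj_id (PO \<Phi> a)) (h (Id B a)) (ftid (PO \<Phi> a)) (ftid (PO \<Phi> a)) (Pdelta \<Phi> a))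
  (\<lambda>f g. zeta_square (adj_comp (h g) (h f)) (h (g *[B] f)) (ftid (PO \<Phi> (Dom B f))) (ftid (PO \<Phi> (Cod B g))) (Pgamma \<Phi> f g))"
 have V: "F0 (VV B) \<Omega> = \<Phi>" by (intro psftor.equality ext) (simp_all add: \<Omega>_def)
 interpret bi_frame_loc B \<Omega>
  unfolding bi_frame_loc_def bi_frame_def globular_def \<Omega>_def by simp
 have "is_bi B \<Omega>"
  using pseudo_functor_VV \<Phi> bi_frame unfolding V pseudo_double_functor_iff[OF B] by blast
 with V show thesis using that by blast
qed

text \<open>
 The cells of the preimage have the given right adjoint members and their mates; coherence is that of
 the given transformation or modification.
\<close>

lemma VV_full:
 fixes B :: "('o, 'm) cat" and \<Omega> \<Omega>' :: "('o, 'm, ('o, 'm, 'a) univ) bi_indexed"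
 assumes B [simp]: "category B" and \<Omega>: "is_bi B \<Omega>" "is_bi B \<Omega>'"
 shows "is_oplax B g ==> TSrc g = F0 (VV B) \<Omega> ==> TTgt g = F0 (VV B) \<Omega>' ==>
   \<exists>\<tau>. is_bi1 B \<tau> \<and> VSrc \<tau> = \<Omega> \<and> VTgt \<tau> = \<Omega>' \<and> F1 (VV B) \<tau> = g"
  and "is_bi1 B \<sigma> ==> is_bi1 B \<tau> ==> VSrc \<sigma> = \<Omega> ==> VSrc \<tau> = \<Omega> ==> VTgt \<sigma> = \<Omega>' ==> VTgt \<tau> = \<Omega>' ==>
   is_oplax2 B \<Gamma> ==> MSrc \<Gamma> = F1 (VV B) \<sigma> ==> MTgt \<Gamma> = F1 (VV B) \<tau> ==>
   \<exists>\<Xi>. is_bi2 B \<Xi> \<and> VMSrc \<Xi> = \<sigma> \<and> VMTgt \<Xi> = \<tau> \<and> F2 (VV B) \<Xi> = \<Gamma>"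
proof -
 interpret S: bi_frame_loc B \<Omega> using \<Omega> pseudo_double_functor_iff[OF B] unfolding bi_frame_loc_def by blast
 interpret T: bi_frame_loc B \<Omega>' using \<Omega> pseudo_double_functor_iff[OF B] unfolding bi_frame_loc_def by blast
 show "\<exists>\<tau>. is_bi1 B \<tau> \<and> VSrc \<tau> = \<Omega> \<and> VTgt \<tau> = \<Omega>' \<and> F1 (VV B) \<tau> = g"
  if g: "is_oplax B g" and ends: "TSrc g = F0 (VV B) \<Omega>" "TTgt g = F0 (VV B) \<Omega>'"
 proof -
  interpret G: oplax_data B "F0 (VV B) \<Omega>" "F0 (VV B) \<Omega>'" g
   using oplax_dataI[OF B oplax_transformation_frame[OF g]] by (simp only: ends)
  define \<tau> where "\<tau> = \<lparr>VSrc = \<Omega>, VTgt = \<Omega>', VO = TO g,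
   VH = (\<lambda>f\<in>Arr B. zeta_square (DH \<Omega> f) (DH \<Omega>' f) (TO g (Dom B f)) (TO g (Cod B f)) (TM g f))\<rparr>"
  have "vt_loc B \<Omega> \<Omega>' \<tau>"
   unfolding vt_loc_def vt_frame_def using \<Omega> G.extensional by (simp add: \<tau>_def)
  moreover have "F1 (VV B) \<tau> = g"
   by (rule ptrans_eqI[where X = "Obj B" and M = "Arr B"]) (use G.extensional in "simp_all add: \<tau>_def")
  ultimately show ?thesis using g vt_loc.oplax_transformation_VV unfolding vt_loc_def by blast
 qed
 show "\<exists>\<Xi>. is_bi2 B \<Xi> \<and> VMSrc \<Xi> = \<sigma> \<and> VMTgt \<Xi> = \<tau> \<and> F2 (VV B) \<Xi> = \<Gamma>"
  if v: "is_bi1 B \<sigma>" "is_bi1 B \<tau>" and e: "VSrc \<sigma> = \<Omega>" "VSrc \<tau> = \<Omega>" "VTgt \<sigma> = \<Omega>'" "VTgt \<tau> = \<Omega>'"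
   and \<Gamma>: "is_oplax2 B \<Gamma>" and ends: "MSrc \<Gamma> = F1 (VV B) \<sigma>" "MTgt \<Gamma> = F1 (VV B) \<tau>"
 proof -
  interpret Sg: vt_loc B \<Omega> \<Omega>' \<sigma> by (rule vt_locI[OF B v(1) e(1,3)])
  interpret Ta: vt_loc B \<Omega> \<Omega>' \<tau> by (rule vt_locI[OF B v(2) e(2,4)])
  note m = pmod_frameD(3-6)[of "op_cat B" \<Gamma>, unfolded ends, simplified]
  have m0: "pmod_frame (op_cat B) \<Gamma>" using \<Gamma> unfolding oplax_modification_iff by blast
  note [simp] = m[OF m0]
  define \<Xi> where "\<Xi> = \<lparr>VMSrc = \<sigma>, VMTgt = \<tau>, VMC = (\<lambda>a\<in>Obj B. zeta_square (adj_id (DO \<Omega> a)) (adj_id (DO \<Omega>' a)) (VO \<sigma> a) (VO \<tau> a) (MO \<Gamma> a))\<rparr>"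
  interpret vm_loc B \<Omega> \<Omega>' \<sigma> \<tau> \<Xi> by unfold_locales (simp_all add: \<Xi>_def v)
  have "F2 (VV B) \<Xi> = \<Gamma>"
   by (intro pmod.equality extensionalityI[of _ "Obj B"]) (simp_all add: ends, simp add: \<Xi>_def)
  then show ?thesis using \<Gamma> oplax_modification_VV vm_ends by metis
 qed
qed

lemma VV_equivalence:
 fixes B :: "('o, 'm) cat"
 assumes B: "category B"
 shows "two_equivalence (BI_IND B) (right_IND B) (VV B :: ('o, 'm, ('o, 'm, 'a) univ) forget_two_ftor)"
proof (rule two_equivalence_criterion[OF two_functor_VV[OF B] locally_faithful_VV[OF B]])
 let ?V = "VV B :: ('o, 'm, ('o, 'm, 'a) univ) forget_two_ftor"
 note two_functorD(2)[OF two_functor_VV[OF B]]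
 show "locally_full (BI_IND B) (right_IND B) ?V"
  unfolding locally_full_def
 proof (intro conjI ballI impI)
  fix \<Omega> \<Omega>' g assume "\<Omega> \<in> Obj (C1 (BI_IND B))" "\<Omega>' \<in> Obj (C1 (BI_IND B))" "g \<in> hom (C1 (right_IND B)) (F0 ?V \<Omega>) (F0 ?V \<Omega>')"
  then show "\<exists>\<tau>\<in>hom (C1 (BI_IND B)) \<Omega> \<Omega>'. F1 ?V \<tau> = g"
   using VV_full(1)[OF B, of \<Omega> \<Omega>' g] by (auto simp: hom_def right_IND_def)
 next
  fix \<sigma> \<tau> \<Gamma> assume h: "\<sigma> \<in> Arr (C1 (BI_IND B))" "\<tau> \<in> Arr (C1 (BI_IND B))" "Dom (C1 (BI_IND B)) \<sigma> = Dom (C1 (BI_IND B)) \<tau>"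
   "Cod (C1 (BI_IND B)) \<sigma> = Cod (C1 (BI_IND B)) \<tau>" "\<Gamma> \<in> hom (C2 (right_IND B)) (F1 ?V \<sigma>) (F1 ?V \<tau>)"
  have "\<exists>\<Xi>. is_bi2 B \<Xi> \<and> VMSrc \<Xi> = \<sigma> \<and> VMTgt \<Xi> = \<tau> \<and> F2 ?V \<Xi> = \<Gamma>"
   by (rule VV_full(2)[OF B, of "VSrc \<tau>" "VTgt \<tau>"]) (use h BI_IND_cells(1,2)[OF B, of \<tau>] in "simp_all add: hom_def right_IND_def")
  then show "\<exists>\<Xi>\<in>hom (C2 (BI_IND B)) \<sigma> \<tau>. F2 ?V \<Xi> = \<Gamma>" by (auto simp: hom_def)
 qed
 fix \<Phi> :: "('o, 'm, ('o, 'm, 'a) univ) psftor"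
 assume h: "\<Phi> \<in> Obj (C1 (right_IND B))"
 then have "pseudo_functor (op_cat B) \<Phi>" "\<And>f. f \<in> Arr B ==> is_right_adjoint (PM \<Phi> f)" by (simp_all add: right_IND_def)
 then obtain \<Omega> where "is_bi B \<Omega>" "F0 ?V \<Omega> = \<Phi>" using VV_surj[OF B, of \<Phi>] by blast
 moreover have "category (C1 (right_IND B :: ('o, 'm, ('o, 'm, 'a) univ) ps_two_cat))"
  using two_category_cats(1)[OF two_functorD(2)[OF two_functor_VV[OF B]]] .
 ultimately show "\<exists>\<Omega>\<in>Obj (C1 (BI_IND B)). \<exists>i\<in>hom (C1 (right_IND B)) (F0 ?V \<Omega>) \<Phi>. iso_arrow (C1 (right_IND B)) i"
  using h by (intro bexI[of _ \<Omega>] bexI[of _ "Id (C1 (right_IND B)) \<Phi>"] homI) simp_all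
qed

section \<open>Left adjoint members\<close>

text \<open>
 Two families of functors and structure isomorphisms that coincide where they matter, that is, on
 objects, arrows and composable pairs of \<open>B\<close>, may still differ as records. Passing between them
 is an isomorphism of pseudo-functors all of whose members are identities.
\<close>

definition agree :: "('o, 'm) cat => ('o, 'm, 'u) psftor => ('o, 'm, 'u) psftor => bool" where
 "agree B \<Phi> \<Psi> \<longleftrightarrow> (\<forall>a\<in>Obj B. PO \<Phi> a = PO \<Psi> a \<and> Pdelta \<Phi> a = Pdelta \<Psi> a) \<and> (\<forall>f\<in>Arr B. PM \<Phi> f = PM \<Psi> f) \<and>
   (\<forall>f\<in>Arr B. \<forall>g\<in>Arr B. Dom B g = Cod B f --> Pgamma \<Phi> g f = Pgamma \<Psi> g f)"

lemma agreeD: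
 assumes "agree B \<Phi> \<Psi>"
 shows "a \<in> Obj B ==> PO \<Phi> a = PO \<Psi> a" "a \<in> Obj B ==> Pdelta \<Phi> a = Pdelta \<Psi> a" "f \<in> Arr B ==> PM \<Phi> f = PM \<Psi> f"
  "f \<in> Arr B ==> g \<in> Arr B ==> Dom B g = Cod B f ==> Pgamma \<Phi> g f = Pgamma \<Psi> g f"
 using assms unfolding agree_def by auto

lemma agree_refl [simp]: "agree B \<Phi> \<Phi>"
 by (simp add: agree_def)

lemma agree_sym: "agree B \<Phi> \<Psi> ==> agree B \<Psi> \<Phi>"
 unfolding agree_def by simp

lemma pseudo_functor_agree:
 assumes B [simp]: "category B" and a: "agree B \<Phi> \<Psi>" and "pseudo_functor B \<Phi>"
 shows "pseudo_functor B \<Psi>"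
 using assms(3) unfolding pseudo_functor_def by (simp add: agreeD[OF a] cong: ball_cong)

definition at_ends :: "('o, 'm, 'u) psftor => ('o, 'm, 'u) psftor => ('o, 'm, 'u) ptrans => ('o, 'm, 'u) ptrans" where
 "at_ends \<Phi> \<Psi> \<tau> = \<lparr>TSrc = \<Phi>, TTgt = \<Psi>, TO = TO \<tau>, TM = TM \<tau>\<rparr>"

definition at_ends2 :: "('o, 'm, 'u) psftor => ('o, 'm, 'u) psftor => ('o, 'm, 'u) pmod => ('o, 'm, 'u) pmod" where
 "at_ends2 \<Phi> \<Psi> \<Xi> = \<lparr>MSrc = at_ends \<Phi> \<Psi> (MSrc \<Xi>), MTgt = at_ends \<Phi> \<Psi> (MTgt \<Xi>), MO = MO \<Xi>\<rparr>"

lemma at_ends_simps [simp]: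
 "TSrc (at_ends \<Phi> \<Psi> \<tau>) = \<Phi>" "TTgt (at_ends \<Phi> \<Psi> \<tau>) = \<Psi>" "TO (at_ends \<Phi> \<Psi> \<tau>) = TO \<tau>" "TM (at_ends \<Phi> \<Psi> \<tau>) = TM \<tau>"
 "MSrc (at_ends2 \<Phi> \<Psi> \<Xi>) = at_ends \<Phi> \<Psi> (MSrc \<Xi>)" "MTgt (at_ends2 \<Phi> \<Psi> \<Xi>) = at_ends \<Phi> \<Psi> (MTgt \<Xi>)" "MO (at_ends2 \<Phi> \<Psi> \<Xi>) = MO \<Xi>"
 "at_ends \<Phi> \<Psi> (at_ends \<Phi>' \<Psi>' \<tau>) = at_ends \<Phi> \<Psi> \<tau>" "TSrc \<tau> = \<Phi> ==> TTgt \<tau> = \<Psi> ==> at_ends \<Phi> \<Psi> \<tau> = \<tau>"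
 by (simp_all add: at_ends_def at_ends2_def)

lemma lax_transformation_agree:
 assumes B [simp]: "category B" and a: "agree B (TSrc \<tau>) \<Phi>" "agree B (TTgt \<tau>) \<Psi>" and \<tau>: "lax_transformation B \<tau>"
 shows "lax_transformation B (at_ends \<Phi> \<Psi> \<tau>)"
proof -
 have "pseudo_functor B \<Phi>" "pseudo_functor B \<Psi>"
  using \<tau> pseudo_functor_agree[OF B a(1)] pseudo_functor_agree[OF B a(2)] unfolding lax_transformation_def ptrans_frame_def by blast+
 with \<tau> show ?thesis unfolding lax_transformation_def ptrans_frame_def by (simp add: agreeD[OF a(1)] agreeD[OF a(2)] cong: ball_cong)
qed

lemma lax_modification_agree:
 assumes B [simp]: "category B" and a: "agree B (TSrc (MSrc \<Xi>)) \<Phi>" "agree B (TTgt (MSrc \<Xi>)) \<Psi>" and \<Xi>: "lax_modification B \<Xi>"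
 shows "lax_modification B (at_ends2 \<Phi> \<Psi> \<Xi>)"
proof -
 have e: "TSrc (MSrc \<Xi>) = TSrc (MTgt \<Xi>)" "TTgt (MSrc \<Xi>) = TTgt (MTgt \<Xi>)" and l: "lax_transformation B (MSrc \<Xi>)" "lax_transformation B (MTgt \<Xi>)"
  using \<Xi> unfolding lax_modification_def pmod_frame_def by blast+
 have "lax_transformation B (at_ends \<Phi> \<Psi> (MSrc \<Xi>))" "lax_transformation B (at_ends \<Phi> \<Psi> (MTgt \<Xi>))"
  using lax_transformation_agree[OF B a l(1)] lax_transformation_agree[OF B a[unfolded e] l(2)] by blast+
 then show ?thesis
  using \<Xi> unfolding lax_modification_def pmod_frame_def by (simp add: agreeD[OF a(1)] agreeD[OF a(2)] cong: ball_cong)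
qed

lemma lax_transformationD:
 assumes "lax_transformation C \<tau>"
 shows "pseudo_functor C (TSrc \<tau>)" "pseudo_functor C (TTgt \<tau>)" "TO \<tau> \<in> extensional (Obj C)" "TM \<tau> \<in> extensional (Arr C)"
  "b \<in> Obj C ==> is_functor (TO \<tau> b)" "b \<in> Obj C ==> FDom (TO \<tau> b) = PO (TSrc \<tau>) b" "b \<in> Obj C ==> FCod (TO \<tau> b) = PO (TTgt \<tau>) b"
  "f \<in> Arr C ==> is_nt (TM \<tau> f)" "f \<in> Arr C ==> NSrc (TM \<tau> f) = ftcomp (PM (TTgt \<tau>) f) (TO \<tau> (Dom C f))"
  "f \<in> Arr C ==> NTgt (TM \<tau> f) = ftcomp (TO \<tau> (Cod C f)) (PM (TSrc \<tau>) f)"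
 using assms unfolding lax_transformation_def ptrans_frame_def is_nt_between_def by blast+

text \<open>
 The left adjoint members of the comparison cells are the inverses of the structure isomorphisms of
 \<open>\<Phi>\<close>. As inversion forgets the values outside the carriers, equality with \<open>\<Phi>\<close> cannot be achieved, only
 agreement.
\<close>

lemma UU_surj:
 assumes B [simp]: "category B" and \<Phi>: "pseudo_functor B \<Phi>" and left: "\<And>f. f \<in> Arr B ==> is_left_adjoint (PM \<Phi> f)"
 shows "\<exists>\<Omega>. is_bi B \<Omega> \<and> agree B (F0 (UU B) \<Omega>) \<Phi>"
proof -
 define h where "h f = (SOME a. adjunction a \<and> ALeft a = PM \<Phi> f)" for f
 note [simp] = pseudo_functorD[OF \<Phi>]
 have h: "adjunction (h f) \<and> ALeft (h f) = PM \<Phi> f" if "f \<in> Arr B" for f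
  using someI_ex[of "\<lambda>a. adjunction a \<and> ALeft a = PM \<Phi> f"] left[OF that] that unfolding is_left_adjoint_def h_def by simp
 have [simp]: "adjunction (h f)" "ALeft (h f) = PM \<Phi> f" if "f \<in> Arr B" for f using h[OF that] by blast+
 define \<Omega> where "\<Omega> = bi_of \<Phi> h (\<lambda>a. xi_square (adj_id (PO \<Phi> a)) (h (Id B a)) (ftid (PO \<Phi> a)) (ftid (PO \<Phi> a)) (ninv (Pdelta \<Phi> a)))
  (\<lambda>f g. xi_square (adj_comp (h g) (h f)) (h (g *[B] f)) (ftid (PO \<Phi> (Dom B f))) (ftid (PO \<Phi> (Cod B g))) (ninv (Pgamma \<Phi> g f)))"
 have n [simp]: "is_nt (ninv (Pdelta \<Phi> a)) \<and> ninv (ninv (Pdelta \<Phi> a)) = Pdelta \<Phi> a" if "a \<in> Obj B" for a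
  using that by (intro conjI is_nt_ninv ninv_ninv) simp_all
 have n' [simp]: "is_nt (ninv (Pgamma \<Phi> g f)) \<and> ninv (ninv (Pgamma \<Phi> g f)) = Pgamma \<Phi> g f" if "f \<in> Arr B" "g \<in> Arr B" "Dom B g = Cod B f" for f g
  using that by (intro conjI is_nt_ninv ninv_ninv) simp_all
 interpret bi_frame_loc B \<Omega>
  unfolding bi_frame_loc_def bi_frame_def globular_def \<Omega>_def by simp
 have "iso_arrow (PO \<Phi> a) (NMap (SXi (Ddelta \<Omega> a)) x)" if "a \<in> Obj B" "x \<in> Obj (PO \<Phi> a)" for a x using that by (simp add: \<Omega>_def)
 moreover have "iso_arrow (PO \<Phi> (Cod B g)) (NMap (SXi (Dgamma \<Omega> f g)) x)" if "f \<in> Arr B" "g \<in> Arr B" "Dom B g = Cod B f" "x \<in> Obj (PO \<Phi> (Dom B f))" for f g x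
  using that by (simp add: \<Omega>_def)
 ultimately have iso: "bi_iso B \<Omega>" unfolding bi_iso_xi by (simp add: \<Omega>_def)
 have U: "agree B (F0 (UU B) \<Omega>) \<Phi>" unfolding agree_def by (simp add: \<Omega>_def)
 have "is_bi B \<Omega>"
  using pseudo_functor_UU[OF iso] pseudo_functor_agree[OF B agree_sym[OF U] \<Phi>] bi_frame iso unfolding pseudo_double_functor_iff[OF B] by blast
 with U show ?thesis by blast
qed

text \<open>
 The cells with prescribed left adjoint members. The ends are given separately, since a pseudo-functor
 only agrees with the left adjoint members of a bi-indexed category.
\<close>

definition lift1 :: "('o, 'm) cat => ('o, 'm, 'u) bi_indexed => ('o, 'm, 'u) bi_indexed => ('o, 'm, 'u) ptrans => ('o, 'm, 'u) bi_indexed1" where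
 "lift1 B \<Omega> \<Omega>' \<tau> = \<lparr>VSrc = \<Omega>, VTgt = \<Omega>', VO = TO \<tau>,
   VH = (\<lambda>f\<in>Arr B. xi_square (DH \<Omega> f) (DH \<Omega>' f) (TO \<tau> (Dom B f)) (TO \<tau> (Cod B f)) (TM \<tau> f))\<rparr>"

definition lift2 :: "('o, 'm) cat => ('o, 'm, 'u) bi_indexed1 => ('o, 'm, 'u) bi_indexed1 => ('o, 'm, 'u) pmod => ('o, 'm, 'u) bi_indexed2" where
 "lift2 B \<sigma> \<tau> \<Xi> = \<lparr>VMSrc = \<sigma>, VMTgt = \<tau>,
   VMC = (\<lambda>a\<in>Obj B. xi_square (adj_id (DO (VSrc \<sigma>) a)) (adj_id (DO (VTgt \<sigma>) a)) (VO \<sigma> a) (VO \<tau> a) (MO \<Xi> a))\<rparr>"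

lemma UU_lift1:
 assumes B [simp]: "category B" and \<Omega>: "is_bi B \<Omega>" "is_bi B \<Omega>'"
  and \<tau>: "lax_transformation B \<tau>" and a: "agree B (F0 (UU B) \<Omega>) (TSrc \<tau>)" "agree B (F0 (UU B) \<Omega>') (TTgt \<tau>)"
 shows "is_bi1 B (lift1 B \<Omega> \<Omega>' \<tau>)" "F1 (UU B) (lift1 B \<Omega> \<Omega>' \<tau>) = at_ends (F0 (UU B) \<Omega>) (F0 (UU B) \<Omega>') \<tau>"
proof -
 interpret S: bi_frame_loc B \<Omega> using \<Omega> pseudo_double_functor_iff[OF B] unfolding bi_frame_loc_def by blast
 interpret T: bi_frame_loc B \<Omega>' using \<Omega> pseudo_double_functor_iff[OF B] unfolding bi_frame_loc_def by blast
 have \<tau>': "lax_transformation B (at_ends (F0 (UU B) \<Omega>) (F0 (UU B) \<Omega>') \<tau>)"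
  by (rule lax_transformation_agree[OF B agree_sym[OF a(1)] agree_sym[OF a(2)] \<tau>])
 note [simp] = lax_transformationD(3-)[OF \<tau>', simplified]
 show F1: "F1 (UU B) (lift1 B \<Omega> \<Omega>' \<tau>) = at_ends (F0 (UU B) \<Omega>) (F0 (UU B) \<Omega>') \<tau>"
  by (rule ptrans_eqI[where X = "Obj B" and M = "Arr B"]) (simp_all add: lift1_def)
 have "vt_loc B \<Omega> \<Omega>' (lift1 B \<Omega> \<Omega>' \<tau>)"
  unfolding vt_loc_def vt_frame_def using \<Omega> by (simp add: lift1_def)
 then show "is_bi1 B (lift1 B \<Omega> \<Omega>' \<tau>)" using F1 \<tau>' vt_loc.lax_transformation_UU by metis
qed

lemma UU_lift2:
 assumes B [simp]: "category B" and v: "is_bi1 B \<sigma>" "is_bi1 B \<tau>" and ends: "VSrc \<sigma> = VSrc \<tau>" "VTgt \<sigma> = VTgt \<tau>"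
  and \<Gamma>: "lax_modification B \<Gamma>" and M: "at_ends (F0 (UU B) (VSrc \<sigma>)) (F0 (UU B) (VTgt \<sigma>)) (MSrc \<Gamma>) = F1 (UU B) \<sigma>" "at_ends (F0 (UU B) (VSrc \<sigma>)) (F0 (UU B) (VTgt \<sigma>)) (MTgt \<Gamma>) = F1 (UU B) \<tau>"
  and a: "agree B (F0 (UU B) (VSrc \<sigma>)) (TSrc (MSrc \<Gamma>))" "agree B (F0 (UU B) (VTgt \<sigma>)) (TTgt (MSrc \<Gamma>))"
 shows "is_bi2 B (lift2 B \<sigma> \<tau> \<Gamma>)" "F2 (UU B) (lift2 B \<sigma> \<tau> \<Gamma>) = at_ends2 (F0 (UU B) (VSrc \<sigma>)) (F0 (UU B) (VTgt \<sigma>)) \<Gamma>"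
proof -
 obtain \<Omega> \<Omega>' where e: "VSrc \<tau> = \<Omega>" "VTgt \<tau> = \<Omega>'" by blast
 note e' = ends[unfolded e]
 note M = M[unfolded e']
 interpret Sg: vt_loc B \<Omega> \<Omega>' \<sigma> by (rule vt_locI[OF B v(1) e'])
 interpret Ta: vt_loc B \<Omega> \<Omega>' \<tau> by (rule vt_locI[OF B v(2) e])
 let ?G = "at_ends2 (F0 (UU B) \<Omega>) (F0 (UU B) \<Omega>') \<Gamma>"
 have \<Gamma>': "lax_modification B ?G" by (rule lax_modification_agree[OF B agree_sym[OF a(1), unfolded e'] agree_sym[OF a(2), unfolded e'] \<Gamma>])
 then have m: "pmod_frame B ?G" unfolding lax_modification_def by blast
 have MM: "MSrc ?G = F1 (UU B) \<sigma>" "MTgt ?G = F1 (UU B) \<tau>" using M by simp_all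
 note [simp] = pmod_frameD(3-6)[OF m, unfolded MM, simplified]
 interpret vm_loc B \<Omega> \<Omega>' \<sigma> \<tau> "lift2 B \<sigma> \<tau> \<Gamma>" by unfold_locales (simp_all add: lift2_def v)
 show F2: "F2 (UU B) (lift2 B \<sigma> \<tau> \<Gamma>) = at_ends2 (F0 (UU B) (VSrc \<sigma>)) (F0 (UU B) (VTgt \<sigma>)) \<Gamma>"
  by (intro pmod.equality extensionalityI[of _ "Obj B"]) (simp_all add: M del: members2, simp add: lift2_def)
 then show "is_bi2 B (lift2 B \<sigma> \<tau> \<Gamma>)" using \<Gamma>' lax_modification_UU by (simp add: e')
qed

lemma locally_faithful_UU:
 assumes B: "category B"
 shows "locally_faithful (BI_IND B) (UU B)"
 unfolding locally_faithful_def BI_IND_simps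
proof (intro conjI ballI impI)
 fix \<sigma> \<tau> :: "('a, 'b, 'c) bi_indexed1"
 assume h: "\<sigma> \<in> Collect (is_bi1 B)" "\<tau> \<in> Collect (is_bi1 B)"
  "VSrc \<sigma> = VSrc \<tau>" "VTgt \<sigma> = VTgt \<tau>" and eq: "F1 (UU B) \<sigma> = F1 (UU B) \<tau>"
 obtain \<Omega> \<Omega>' where e: "VSrc \<tau> = \<Omega>" "VTgt \<tau> = \<Omega>'" by blast
 interpret S: vt_loc B \<Omega> \<Omega>' \<sigma> by (rule vt_locI[OF B]) (use h e in simp_all)
 interpret T: vt_loc B \<Omega> \<Omega>' \<tau> by (rule vt_locI[OF B]) (use h e in simp_all)
 have VO: "VO \<sigma> = VO \<tau>" using arg_cong[OF eq, of TO] by simp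
 have "VH \<sigma> f = VH \<tau> f" if f [simp]: "f \<in> Arr B" for f
  by (rule square_eq_xi) (use fun_cong[OF arg_cong[OF eq, of TM], of f] in "simp_all add: VO")
 then have "VH \<sigma> = VH \<tau>" by (intro extensionalityI[of _ "Arr B"]) simp_all
 then show "\<sigma> = \<tau>" using VO e h by simp
next
 fix \<Xi> \<Theta> :: "('a, 'b, 'c) bi_indexed2"
 assume h: "\<Xi> \<in> Collect (is_bi2 B)" "\<Theta> \<in> Collect (is_bi2 B)"
  "VMSrc \<Xi> = VMSrc \<Theta>" "VMTgt \<Xi> = VMTgt \<Theta>" and eq: "F2 (UU B) \<Xi> = F2 (UU B) \<Theta>"
 obtain \<Omega> \<Omega>' \<sigma> \<tau> where e: "VSrc (VMSrc \<Theta>) = \<Omega>" "VTgt (VMSrc \<Theta>) = \<Omega>'" "VMSrc \<Theta> = \<sigma>" "VMTgt \<Theta> = \<tau>" by blast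
 interpret S: vm_loc B \<Omega> \<Omega>' \<sigma> \<tau> \<Xi> by (rule vm_locI[OF B]) (use h e in simp_all)
 interpret T: vm_loc B \<Omega> \<Omega>' \<sigma> \<tau> \<Theta> by (rule vm_locI[OF B]) (use h e in simp_all)
 have "F2 (VV B) \<Xi> = F2 (VV B) \<Theta>"
  using fun_cong[OF arg_cong[OF eq, of MO]] h by (intro pmod.equality extensionalityI[of _ "Obj B"]) (simp_all, metis S.members2(1) T.members2(1) UU_simps(12))
 then show "\<Xi> = \<Theta>" by (rule locally_faithfulD(2)[OF locally_faithful_VV[OF B]]) (use h in simp_all)
qed

lemma OPIND_simps [simp]:
 "Obj (C1 (OPIND B)) = {\<Phi>. pseudo_functor B \<Phi>}" "Arr (C1 (OPIND B)) = {\<tau>. lax_transformation B \<tau>}"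
 "Dom (C1 (OPIND B)) = TSrc" "Cod (C1 (OPIND B)) = TTgt" "Id (C1 (OPIND B)) = lax_id B" "Comp (C1 (OPIND B)) = lax_comp B"
 "Obj (C2 (OPIND B)) = {\<tau>. lax_transformation B \<tau>}" "Arr (C2 (OPIND B)) = {\<Xi>. lax_modification B \<Xi>}"
 "Dom (C2 (OPIND B)) = MSrc" "Cod (C2 (OPIND B)) = MTgt" "Id (C2 (OPIND B)) = pmod_id B" "Comp (C2 (OPIND B)) = pmod_comp B"
 "HComp (OPIND B) \<Theta> \<Xi> = \<lparr>MSrc = lax_comp B (MSrc \<Theta>) (MSrc \<Xi>), MTgt = lax_comp B (MTgt \<Theta>) (MTgt \<Xi>), MO = (\<lambda>a\<in>Obj B. hcomp (MO \<Theta> a) (MO \<Xi> a))\<rparr>"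
 "src0 (OPIND B) \<Xi> = TSrc (MSrc \<Xi>)" "tgt0 (OPIND B) \<Xi> = TTgt (MSrc \<Xi>)"
 by (simp_all add: OPIND_def src0_def tgt0_def)

lemma UU_preserves:
 assumes B: "category B"
 shows "is_bi1 B \<tau> ==> is_bi1 B \<sigma> ==> VSrc \<sigma> = VTgt \<tau> ==>
   F1 (UU B) (\<sigma> *[C1 (BI_IND B)] \<tau>) = lax_comp B (F1 (UU B) \<sigma>) (F1 (UU B) \<tau>)"
  and "is_bi1 B \<tau> ==> F2 (UU B) (Id (C2 (BI_IND B)) \<tau>) = pmod_id B (F1 (UU B) \<tau>)"
  and "is_bi2 B \<Xi> ==> is_bi2 B \<Theta> ==> VMSrc \<Theta> = VMTgt \<Xi> ==>
   F2 (UU B) (\<Theta> *[C2 (BI_IND B)] \<Xi>) = pmod_comp B (F2 (UU B) \<Theta>) (F2 (UU B) \<Xi>)"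
proof -
 show "F1 (UU B) (\<sigma> *[C1 (BI_IND B)] \<tau>) = lax_comp B (F1 (UU B) \<sigma>) (F1 (UU B) \<tau>)"
  if v: "is_bi1 B \<tau>" "is_bi1 B \<sigma>" and eq: "VSrc \<sigma> = VTgt \<tau>"
 proof -
  obtain \<Omega> \<Omega>' \<Omega>'' where e: "VSrc \<tau> = \<Omega>" "VTgt \<tau> = \<Omega>'" "VTgt \<sigma> = \<Omega>''" by blast
  interpret T: vt_loc B \<Omega> \<Omega>' \<tau> by (rule vt_locI[OF B v(1) e(1,2)])
  interpret S: vt_loc B \<Omega>' \<Omega>'' \<sigma> by (rule vt_locI[OF B v(2) eq[unfolded e] e(3)])
  interpret vt_pair B \<Omega> \<Omega>' \<Omega>'' \<sigma> \<tau> ..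
  show ?thesis by (rule composite_UU)
 qed
 show "F2 (UU B) (Id (C2 (BI_IND B)) \<tau>) = pmod_id B (F1 (UU B) \<tau>)" if v: "is_bi1 B \<tau>"
  by (intro pmod.equality extensionalityI[of _ "Obj B"]) simp_all
 show "F2 (UU B) (\<Theta> *[C2 (BI_IND B)] \<Xi>) = pmod_comp B (F2 (UU B) \<Theta>) (F2 (UU B) \<Xi>)"
  if d: "is_bi2 B \<Xi>" "is_bi2 B \<Theta>" and eq: "VMSrc \<Theta> = VMTgt \<Xi>"
 proof -
  obtain \<Omega> \<Omega>' \<rho> \<sigma> \<tau> where e: "VSrc (VMSrc \<Xi>) = \<Omega>" "VTgt (VMSrc \<Xi>) = \<Omega>'" "VMSrc \<Xi> = \<rho>" "VMTgt \<Xi> = \<sigma>" "VMTgt \<Theta> = \<tau>" by blast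
  interpret X: vm_loc B \<Omega> \<Omega>' \<rho> \<sigma> \<Xi> by (rule vm_locI[OF B d(1) e(1-4)])
  interpret Y: vm_loc B \<Omega> \<Omega>' \<sigma> \<tau> \<Theta> by (rule vm_locI[OF B d(2)]) (use e eq in simp_all)
  interpret vm_comp B \<Omega> \<Omega>' \<rho> \<sigma> \<tau> \<Theta> \<Xi> ..
  show ?thesis by (rule composite_UU)
 qed
qed

lemma UU_preserves_HComp:
 fixes B :: "('o, 'm) cat" and \<Xi> \<Theta> :: "('o, 'm, ('o, 'm, 'a) univ) bi_indexed2"
 assumes B: "category B" and d: "is_bi2 B \<Xi>" "is_bi2 B \<Theta>" and eq: "VSrc (VMSrc \<Theta>) = VTgt (VMSrc \<Xi>)"
 shows "F2 (UU B) (\<Theta> \<star>[BI_IND B] \<Xi>) = F2 (UU B) \<Theta> \<star>[OPIND B] F2 (UU B) \<Xi>"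
proof -
 obtain \<Omega> \<Omega>' \<Omega>'' \<sigma> \<tau> \<sigma>' \<tau>' where e: "VSrc (VMSrc \<Xi>) = \<Omega>" "VTgt (VMSrc \<Xi>) = \<Omega>'" "VMSrc \<Xi> = \<sigma>" "VMTgt \<Xi> = \<tau>"
  "VTgt (VMSrc \<Theta>) = \<Omega>''" "VMSrc \<Theta> = \<sigma>'" "VMTgt \<Theta> = \<tau>'" by blast
 interpret X: vm_loc B \<Omega> \<Omega>' \<sigma> \<tau> \<Xi> by (rule vm_locI[OF B d(1) e(1-4)])
 interpret Y: vm_loc B \<Omega>' \<Omega>'' \<sigma>' \<tau>' \<Theta> by (rule vm_locI[OF B d(2) eq[unfolded e(2)] e(5-7)])
 have "\<sigma>' *[C1 (BI_IND B)] \<sigma> \<in> Arr (C1 (BI_IND B))" "\<tau>' *[C1 (BI_IND B)] \<tau> \<in> Arr (C1 (BI_IND B))"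
  using BI_IND_closed(2)[OF B, of \<sigma> \<sigma>'] BI_IND_closed(2)[OF B, of \<tau> \<tau>'] X.vertical Y.vertical by simp_all
 then interpret vm_hcomp B \<Omega> \<Omega>' \<Omega>'' \<sigma> \<tau> \<sigma>' \<tau>' \<Theta> \<Xi> by unfold_locales simp_all
 show ?thesis using composite_UU by simp
qed

text \<open>
 A bi-indexed category with prescribed left adjoint members is chosen for each pseudo-functor; on
 1-cells and 2-cells there is no choice left.
\<close>

definition completion :: "('o, 'm) cat => (('o, 'm, 'u) psftor, ('o, 'm, 'u) ptrans, ('o, 'm, 'u) pmod,
  ('o, 'm, 'u) bi_indexed, ('o, 'm, 'u) bi_indexed1, ('o, 'm, 'u) bi_indexed2) two_ftor" where
 "completion B =
   (let s0 = \<lambda>\<Phi>. SOME \<Omega>. is_bi B \<Omega> \<and> agree B (F0 (UU B) \<Omega>) \<Phi>;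
     s1 = \<lambda>\<tau>. lift1 B (s0 (TSrc \<tau>)) (s0 (TTgt \<tau>)) \<tau>
   in \<lparr>F0 = s0, F1 = s1, F2 = \<lambda>\<Xi>. lift2 B (s1 (MSrc \<Xi>)) (s1 (MTgt \<Xi>)) \<Xi>\<rparr>)"

lemma left_OPIND_simps [simp]:
 "\<Phi> \<in> Obj (C1 (left_OPIND B)) \<longleftrightarrow> pseudo_functor B \<Phi> \<and> (\<forall>f\<in>Arr B. is_left_adjoint (PM \<Phi> f))"
 "\<tau> \<in> Arr (C1 (left_OPIND B)) \<longleftrightarrow> lax_transformation B \<tau> \<and> TSrc \<tau> \<in> Obj (C1 (left_OPIND B)) \<and> TTgt \<tau> \<in> Obj (C1 (left_OPIND B))"
 "Dom (C1 (left_OPIND B)) = TSrc" "Cod (C1 (left_OPIND B)) = TTgt" "Id (C1 (left_OPIND B)) = lax_id B" "Comp (C1 (left_OPIND B)) = lax_comp B"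
 "Obj (C2 (left_OPIND B)) = Arr (C1 (left_OPIND B))"
 "\<Xi> \<in> Arr (C2 (left_OPIND B)) \<longleftrightarrow> lax_modification B \<Xi> \<and> MSrc \<Xi> \<in> Arr (C1 (left_OPIND B))"
 "Dom (C2 (left_OPIND B)) = MSrc" "Cod (C2 (left_OPIND B)) = MTgt" "Id (C2 (left_OPIND B)) = pmod_id B" "Comp (C2 (left_OPIND B)) = pmod_comp B"
 "HComp (left_OPIND B) = HComp (OPIND B)" "src0 (left_OPIND B) \<Xi> = TSrc (MSrc \<Xi>)" "tgt0 (left_OPIND B) \<Xi> = TTgt (MSrc \<Xi>)"
 by (auto simp: left_OPIND_def lax_modification_def lax_transformation_def ptrans_frame_def)

lemma lax_modification_sides:
 assumes "lax_modification B \<Xi>"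
 shows "lax_transformation B (MSrc \<Xi>)" "lax_transformation B (MTgt \<Xi>)" "TSrc (MTgt \<Xi>) = TSrc (MSrc \<Xi>)" "TTgt (MTgt \<Xi>) = TTgt (MSrc \<Xi>)"
 using assms unfolding lax_modification_def pmod_frame_def by auto

text \<open>
 The second parameter only fixes the type of the fibres. \<open>N \<Phi>\<close> is the copy of \<open>\<Phi>\<close> that is the image of
 a bi-indexed category; it agrees with \<open>\<Phi>\<close>.
\<close>

locale completed =
 fixes B :: "('o, 'm) cat" and univ :: "('o, 'm, 'a) univ itself"
 assumes B: "category B"
begin

abbreviation "M \<equiv> left_OPIND B :: ('o, 'm, ('o, 'm, 'a) univ) ps_two_cat"
abbreviation "K \<equiv> BI_IND B :: (('o, 'm, ('o, 'm, 'a) univ) bi_indexed, _, _) two_cat"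
abbreviation "U \<equiv> UU B :: ('o, 'm, ('o, 'm, 'a) univ) forget_two_ftor"
abbreviation "S \<equiv> completion B"
abbreviation "N \<Phi> \<equiv> F0 U (F0 S \<Phi>)"

lemma F0_S:
 assumes "\<Phi> \<in> Obj (C1 M)"
 shows "is_bi B (F0 S \<Phi>)" "agree B (N \<Phi>) \<Phi>"
proof -
 let ?P = "\<lambda>\<Omega>. is_bi B \<Omega> \<and> agree B (F0 (UU B) \<Omega>) \<Phi>"
 have "\<exists>\<Omega>. ?P \<Omega>" using assms UU_surj[OF B, of \<Phi>] by simp
 then have "?P (F0 S \<Phi>)" unfolding completion_def Let_def two_ftor.simps by (rule someI_ex)
 then show "is_bi B (F0 S \<Phi>)" "agree B (N \<Phi>) \<Phi>" by blast+
qed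

lemma F12_S: "F1 S \<tau> = lift1 B (F0 S (TSrc \<tau>)) (F0 S (TTgt \<tau>)) \<tau>" "F2 S \<Xi> = lift2 B (F1 S (MSrc \<Xi>)) (F1 S (MTgt \<Xi>)) \<Xi>"
 by (simp_all add: completion_def Let_def)

lemma F1_S:
 assumes "\<tau> \<in> Arr (C1 M)"
 shows "is_bi1 B (F1 S \<tau>)" "F1 U (F1 S \<tau>) = at_ends (N (TSrc \<tau>)) (N (TTgt \<tau>)) \<tau>"
proof -
 have \<tau>: "lax_transformation B \<tau>" "TSrc \<tau> \<in> Obj (C1 M)" "TTgt \<tau> \<in> Obj (C1 M)" using assms by simp_all
 note l = UU_lift1[OF B F0_S(1)[OF \<tau>(2)] F0_S(1)[OF \<tau>(3)] \<tau>(1) F0_S(2)[OF \<tau>(2)] F0_S(2)[OF \<tau>(3)]]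
 show "is_bi1 B (F1 S \<tau>)" "F1 U (F1 S \<tau>) = at_ends (N (TSrc \<tau>)) (N (TTgt \<tau>)) \<tau>"
  unfolding F12_S by (rule l)+
qed

lemma F1_S_ends [simp]: "VSrc (F1 S \<tau>) = F0 S (TSrc \<tau>)" "VTgt (F1 S \<tau>) = F0 S (TTgt \<tau>)"
 by (simp_all add: F12_S lift1_def)

lemma F2_S:
 assumes "\<Xi> \<in> Arr (C2 M)"
 shows "is_bi2 B (F2 S \<Xi>)" "F2 U (F2 S \<Xi>) = at_ends2 (N (TSrc (MSrc \<Xi>))) (N (TTgt (MSrc \<Xi>))) \<Xi>"
proof -
 have \<Xi>: "lax_modification B \<Xi>" "MSrc \<Xi> \<in> Arr (C1 M)" "MTgt \<Xi> \<in> Arr (C1 M)" and o: "TSrc (MSrc \<Xi>) \<in> Obj (C1 M)" "TTgt (MSrc \<Xi>) \<in> Obj (C1 M)"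
  using assms lax_modification_sides[of B \<Xi>] by simp_all
 note s = lax_modification_sides[OF \<Xi>(1)]
 show "is_bi2 B (F2 S \<Xi>)" "F2 U (F2 S \<Xi>) = at_ends2 (N (TSrc (MSrc \<Xi>))) (N (TTgt (MSrc \<Xi>))) \<Xi>"
  unfolding F12_S(2) using UU_lift2[OF B F1_S(1)[OF \<Xi>(2)] F1_S(1)[OF \<Xi>(3)] _ _ \<Xi>(1)] s F1_S(2)[OF \<Xi>(2)] F1_S(2)[OF \<Xi>(3)] F0_S(2)[OF o(1)] F0_S(2)[OF o(2)]
  by simp_all
qed

lemma F2_S_ends [simp]: "VMSrc (F2 S \<Xi>) = F1 S (MSrc \<Xi>)" "VMTgt (F2 S \<Xi>) = F1 S (MTgt \<Xi>)"
 by (simp_all add: F12_S(2) lift2_def)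

text \<open>
 The laws of \<open>completion\<close> hold because a vertical transformation with given ends is determined by its
 left adjoint members; moreover, data that have a completion are coherent.
\<close>

lemma F1_S_unique:
 assumes o: "TSrc \<tau> \<in> Obj (C1 M)" "TTgt \<tau> \<in> Obj (C1 M)"
  and t: "is_bi1 B t" "VSrc t = F0 S (TSrc \<tau>)" "VTgt t = F0 S (TTgt \<tau>)" "F1 U t = at_ends (N (TSrc \<tau>)) (N (TTgt \<tau>)) \<tau>"
 shows "\<tau> \<in> Arr (C1 M) \<and> F1 S \<tau> = t"
proof -
 have "lax_transformation B (at_ends (N (TSrc \<tau>)) (N (TTgt \<tau>)) \<tau>)" using BI_IND_cells(7)[OF B t(1)] unfolding t(4) .
 then have "lax_transformation B (at_ends (TSrc \<tau>) (TTgt \<tau>) (at_ends (N (TSrc \<tau>)) (N (TTgt \<tau>)) \<tau>))"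
  by - (rule lax_transformation_agree[OF B], simp_all only: at_ends_simps F0_S(2)[OF o(1)] F0_S(2)[OF o(2)])
 then have \<tau>: "\<tau> \<in> Arr (C1 M)" using o by simp
 moreover have "F1 S \<tau> = t"
  by (rule locally_faithfulD(1)[OF locally_faithful_UU[OF B]]) (simp_all only: F1_S[OF \<tau>] t BI_IND_simps mem_Collect_eq F1_S_ends)
 ultimately show ?thesis ..
qed

lemma F2_S_unique:
 assumes o: "MSrc \<Xi> \<in> Arr (C1 M)" "MTgt \<Xi> \<in> Arr (C1 M)" "TSrc (MTgt \<Xi>) = TSrc (MSrc \<Xi>)" "TTgt (MTgt \<Xi>) = TTgt (MSrc \<Xi>)"
  and t: "is_bi2 B t" "VMSrc t = F1 S (MSrc \<Xi>)" "VMTgt t = F1 S (MTgt \<Xi>)" "F2 U t = at_ends2 (N (TSrc (MSrc \<Xi>))) (N (TTgt (MSrc \<Xi>))) \<Xi>"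
 shows "\<Xi> \<in> Arr (C2 M) \<and> F2 S \<Xi> = t"
proof -
 have o': "TSrc (MSrc \<Xi>) \<in> Obj (C1 M)" "TTgt (MSrc \<Xi>) \<in> Obj (C1 M)" using o by simp_all
 have "lax_modification B (at_ends2 (N (TSrc (MSrc \<Xi>))) (N (TTgt (MSrc \<Xi>))) \<Xi>)" using BI_IND_cells(9)[OF B t(1)] unfolding t(4) .
 then have "lax_modification B (at_ends2 (TSrc (MSrc \<Xi>)) (TTgt (MSrc \<Xi>)) (at_ends2 (N (TSrc (MSrc \<Xi>))) (N (TTgt (MSrc \<Xi>))) \<Xi>))"
  by - (rule lax_modification_agree[OF B], simp_all only: at_ends_simps F0_S(2)[OF o'(1)] F0_S(2)[OF o'(2)])
 also have "at_ends2 (TSrc (MSrc \<Xi>)) (TTgt (MSrc \<Xi>)) (at_ends2 (N (TSrc (MSrc \<Xi>))) (N (TTgt (MSrc \<Xi>))) \<Xi>) = \<Xi>"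
  by (intro pmod.equality) (simp_all add: o)
 finally have \<Xi>: "\<Xi> \<in> Arr (C2 M)" using o by simp
 moreover have "F2 S \<Xi> = t"
  by (rule locally_faithfulD(2)[OF locally_faithful_UU[OF B]]) (simp_all only: F2_S[OF \<Xi>] t BI_IND_simps mem_Collect_eq F2_S_ends)
 ultimately show ?thesis ..
qed

end

context completed
begin

lemma two_category_K: "two_category K"
 using two_functorD(1)[OF two_functor_VV[OF B]] .

lemma completion_closed:
 shows "\<Phi> \<in> Obj (C1 M) ==> lax_id B \<Phi> \<in> Arr (C1 M) \<and> F1 S (lax_id B \<Phi>) = Id (C1 K) (F0 S \<Phi>)"
  and "\<tau> \<in> Arr (C1 M) ==> \<sigma> \<in> Arr (C1 M) ==> TSrc \<sigma> = TTgt \<tau> ==> lax_comp B \<sigma> \<tau> \<in> Arr (C1 M) \<and> F1 S (lax_comp B \<sigma> \<tau>) = F1 S \<sigma> *[C1 K] F1 S \<tau>"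
  and "\<tau> \<in> Arr (C1 M) ==> pmod_id B \<tau> \<in> Arr (C2 M) \<and> F2 S (pmod_id B \<tau>) = Id (C2 K) (F1 S \<tau>)"
  and "\<Xi> \<in> Arr (C2 M) ==> \<Theta> \<in> Arr (C2 M) ==> MSrc \<Theta> = MTgt \<Xi> ==> pmod_comp B \<Theta> \<Xi> \<in> Arr (C2 M) \<and> F2 S (pmod_comp B \<Theta> \<Xi>) = F2 S \<Theta> *[C2 K] F2 S \<Xi>"
  and "\<Xi> \<in> Arr (C2 M) ==> \<Theta> \<in> Arr (C2 M) ==> src0 M \<Theta> = tgt0 M \<Xi> ==> \<Theta> \<star>[M] \<Xi> \<in> Arr (C2 M) \<and> F2 S (\<Theta> \<star>[M] \<Xi>) = F2 S \<Theta> \<star>[K] F2 S \<Xi>"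
proof -
 note K1 = two_category_cats(1)[OF two_category_K] and K2 = two_category_cats(2)[OF two_category_K]
 show "lax_id B \<Phi> \<in> Arr (C1 M) \<and> F1 S (lax_id B \<Phi>) = Id (C1 K) (F0 S \<Phi>)" if \<Phi>: "\<Phi> \<in> Obj (C1 M)"
 proof -
  note p = F0_S[OF \<Phi>]
  have "F1 U (Id (C1 K) (F0 S \<Phi>)) = lax_id B (N \<Phi>)" by (rule identity_frame(3)[OF B p(1)])
  also have "\<dots> = at_ends (N \<Phi>) (N \<Phi>) (lax_id B \<Phi>)"
   unfolding lax_id_def at_ends_def using agreeD[OF p(2)] by (auto intro!: restrict_ext)
  finally have "F1 U (Id (C1 K) (F0 S \<Phi>)) = at_ends (N \<Phi>) (N \<Phi>) (lax_id B \<Phi>)" .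
  then show ?thesis
   using F1_S_unique[of "lax_id B \<Phi>" "Id (C1 K) (F0 S \<Phi>)"] category_Id(1)[OF K1, of "F0 S \<Phi>"] p(1) \<Phi>
   by (simp del: left_OPIND_simps)
 qed
 show comp: "lax_comp B \<sigma> \<tau> \<in> Arr (C1 M) \<and> F1 S (lax_comp B \<sigma> \<tau>) = F1 S \<sigma> *[C1 K] F1 S \<tau>"
  if t: "\<tau> \<in> Arr (C1 M)" "\<sigma> \<in> Arr (C1 M)" and e: "TSrc \<sigma> = TTgt \<tau>" for \<sigma> \<tau>
 proof -
  note v = F1_S[OF t(1)] F1_S[OF t(2)]
  have "F1 U (F1 S \<sigma> *[C1 K] F1 S \<tau>) = lax_comp B (F1 U (F1 S \<sigma>)) (F1 U (F1 S \<tau>))"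
   by (rule UU_preserves(1)[OF B v(1,3)]) (simp add: e)
  also have "\<dots> = at_ends (N (TSrc \<tau>)) (N (TTgt \<sigma>)) (lax_comp B \<sigma> \<tau>)"
   unfolding v(2,4) by (simp add: lax_comp_def at_ends_def)
  finally have "F1 U (F1 S \<sigma> *[C1 K] F1 S \<tau>) = at_ends (N (TSrc \<tau>)) (N (TTgt \<sigma>)) (lax_comp B \<sigma> \<tau>)" .
  moreover have "is_bi1 B (F1 S \<sigma> *[C1 K] F1 S \<tau>)"
   using category_Comp(1)[OF K1, of "F1 S \<tau>" "F1 S \<sigma>"] v(1,3) e by simp
  ultimately show ?thesis
   using F1_S_unique[of "lax_comp B \<sigma> \<tau>" "F1 S \<sigma> *[C1 K] F1 S \<tau>"] t by (simp del: left_OPIND_simps(1))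
 qed
 show "pmod_id B \<tau> \<in> Arr (C2 M) \<and> F2 S (pmod_id B \<tau>) = Id (C2 K) (F1 S \<tau>)" if t: "\<tau> \<in> Arr (C1 M)" for \<tau>
 proof -
  note v = F1_S[OF t]
  have "F2 U (Id (C2 K) (F1 S \<tau>)) = pmod_id B (F1 U (F1 S \<tau>))" by (rule UU_preserves(2)[OF B v(1)])
  also have "\<dots> = at_ends2 (N (TSrc \<tau>)) (N (TTgt \<tau>)) (pmod_id B \<tau>)"
   unfolding v(2) by (simp add: pmod_id_def at_ends2_def)
  finally have "F2 U (Id (C2 K) (F1 S \<tau>)) = at_ends2 (N (TSrc \<tau>)) (N (TTgt \<tau>)) (pmod_id B \<tau>)" .
  then show ?thesis using F2_S_unique[of "pmod_id B \<tau>" "Id (C2 K) (F1 S \<tau>)"] category_Id(1)[OF K2, of "F1 S \<tau>"] v(1) t by (simp del: left_OPIND_simps(2))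
 qed
 show "pmod_comp B \<Theta> \<Xi> \<in> Arr (C2 M) \<and> F2 S (pmod_comp B \<Theta> \<Xi>) = F2 S \<Theta> *[C2 K] F2 S \<Xi>"
  if t: "\<Xi> \<in> Arr (C2 M)" "\<Theta> \<in> Arr (C2 M)" and e: "MSrc \<Theta> = MTgt \<Xi>" for \<Theta> \<Xi>
 proof -
  note v = F2_S[OF t(1)] F2_S[OF t(2)]
  have l: "lax_modification B \<Xi>" "lax_modification B \<Theta>" "MSrc \<Xi> \<in> Arr (C1 M)" using t by simp_all
  note s = lax_modification_sides[OF l(1)] lax_modification_sides[OF l(2)]
  have "F2 U (F2 S \<Theta> *[C2 K] F2 S \<Xi>) = pmod_comp B (F2 U (F2 S \<Theta>)) (F2 U (F2 S \<Xi>))"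
   by (rule UU_preserves(3)[OF B v(1,3)]) (simp add: e)
  also have "\<dots> = at_ends2 (N (TSrc (MSrc \<Xi>))) (N (TTgt (MSrc \<Xi>))) (pmod_comp B \<Theta> \<Xi>)"
   unfolding v(2,4) by (simp add: pmod_comp_def at_ends2_def e s)
  finally have "F2 U (F2 S \<Theta> *[C2 K] F2 S \<Xi>) = at_ends2 (N (TSrc (MSrc \<Xi>))) (N (TTgt (MSrc \<Xi>))) (pmod_comp B \<Theta> \<Xi>)" .
  moreover have "is_bi2 B (F2 S \<Theta> *[C2 K] F2 S \<Xi>)"
   using category_Comp(1)[OF K2, of "F2 S \<Xi>" "F2 S \<Theta>"] v(1,3) e by simp
  moreover have "MTgt \<Theta> \<in> Arr (C1 M)" "TSrc (MTgt \<Theta>) = TSrc (MSrc \<Xi>)" "TTgt (MTgt \<Theta>) = TTgt (MSrc \<Xi>)" using t l s e by simp_all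
  ultimately show ?thesis
   using F2_S_unique[of "pmod_comp B \<Theta> \<Xi>" "F2 S \<Theta> *[C2 K] F2 S \<Xi>"] l(3) by (simp del: left_OPIND_simps(2))
 qed
 show "\<Theta> \<star>[M] \<Xi> \<in> Arr (C2 M) \<and> F2 S (\<Theta> \<star>[M] \<Xi>) = F2 S \<Theta> \<star>[K] F2 S \<Xi>"
  if t: "\<Xi> \<in> Arr (C2 M)" "\<Theta> \<in> Arr (C2 M)" and e: "src0 M \<Theta> = tgt0 M \<Xi>" for \<Theta> \<Xi>
 proof -
  note v = F2_S[OF t(1)] F2_S[OF t(2)]
  have e': "TSrc (MSrc \<Theta>) = TTgt (MSrc \<Xi>)" using e by simp
  have l: "lax_modification B \<Xi>" "lax_modification B \<Theta>" and a: "MSrc \<Xi> \<in> Arr (C1 M)" "MSrc \<Theta> \<in> Arr (C1 M)" using t by simp_all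
  note s = lax_modification_sides[OF l(1)] lax_modification_sides[OF l(2)]
  have b: "MTgt \<Xi> \<in> Arr (C1 M)" "MTgt \<Theta> \<in> Arr (C1 M)" using a s by simp_all
  have c: "lax_comp B (MSrc \<Theta>) (MSrc \<Xi>) \<in> Arr (C1 M)" "lax_comp B (MTgt \<Theta>) (MTgt \<Xi>) \<in> Arr (C1 M)"
   "F1 S (lax_comp B (MSrc \<Theta>) (MSrc \<Xi>)) = F1 S (MSrc \<Theta>) *[C1 K] F1 S (MSrc \<Xi>)" "F1 S (lax_comp B (MTgt \<Theta>) (MTgt \<Xi>)) = F1 S (MTgt \<Theta>) *[C1 K] F1 S (MTgt \<Xi>)"
   using comp[OF a e'] comp[OF b] e' s by simp_all
  have "F2 U (F2 S \<Theta> \<star>[K] F2 S \<Xi>) = F2 U (F2 S \<Theta>) \<star>[OPIND B] F2 U (F2 S \<Xi>)"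
   by (rule UU_preserves_HComp[OF B v(1,3)]) (simp add: e')
  also have "\<dots> = at_ends2 (N (TSrc (MSrc \<Xi>))) (N (TTgt (MSrc \<Theta>))) (\<Theta> \<star>[M] \<Xi>)"
   unfolding v(2,4) by (simp add: at_ends2_def at_ends_def lax_comp_def e' s)
  finally have "F2 U (F2 S \<Theta> \<star>[K] F2 S \<Xi>) = at_ends2 (N (TSrc (MSrc \<Xi>))) (N (TTgt (MSrc \<Theta>))) (\<Theta> \<star>[M] \<Xi>)" .
  moreover have "is_bi2 B (F2 S \<Theta> \<star>[K] F2 S \<Xi>)"
   using two_category_HComp(1)[OF two_category_K, of "F2 S \<Xi>" "F2 S \<Theta>"] v(1,3) e' by simp
  moreover have "VMSrc (F2 S \<Theta> \<star>[K] F2 S \<Xi>) = F1 S (lax_comp B (MSrc \<Theta>) (MSrc \<Xi>))" "VMTgt (F2 S \<Theta> \<star>[K] F2 S \<Xi>) = F1 S (lax_comp B (MTgt \<Theta>) (MTgt \<Xi>))"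
   unfolding c by simp_all
  ultimately show ?thesis
   using F2_S_unique[of "\<Theta> \<star>[M] \<Xi>" "F2 S \<Theta> \<star>[K] F2 S \<Xi>"] c(1,2) s by (simp del: left_OPIND_simps(2,8) BI_IND_simps)
 qed
qed

text \<open>
 The 2-category of opindexed categories with left adjoint members inherits its laws from bi-indexed
 categories, to which it is mapped injectively.
\<close>

lemma two_functor_S: "two_functor M K S"
proof (rule two_category_reflect[OF two_category_K])
 note c = completion_closed
 have sides: "MTgt \<Xi> \<in> Arr (C1 M)" if "\<Xi> \<in> Arr (C2 M)" for \<Xi> using that lax_modification_sides[of B \<Xi>] by simp
 show "closed_graph (C1 M)"
  by (rule closed_graphI) (use c(1,2) in "simp_all add: hom_def del: left_OPIND_simps(1)")
 show "closed_graph (C2 M)"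
  by (rule closed_graphI) (use c(3,4) sides in "simp_all add: hom_def del: left_OPIND_simps(2)")
 show "preserves_cat (C1 M) (C1 K) (F0 S) (F1 S)"
  by (rule preserves_catI) (use F0_S(1) F1_S(1) c(1,2) in "simp_all add: hom_def del: left_OPIND_simps(1,2) BI_IND_simps(5,6)")
 show "preserves_cat (C2 M) (C2 K) (F1 S) (F2 S)"
  by (rule preserves_catI) (use F1_S(1) F2_S(1) c(3,4) in "simp_all add: hom_def del: left_OPIND_simps(1,2,8) BI_IND_simps(5,6,11,12)")
 fix \<Xi> \<Theta> assume h: "\<Xi> \<in> Arr (C2 M)" "\<Theta> \<in> Arr (C2 M)" "src0 M \<Theta> = tgt0 M \<Xi>"
 show "F2 S (\<Theta> \<star>[M] \<Xi>) = F2 S \<Theta> \<star>[K] F2 S \<Xi>" using c(5)[OF h] by blast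
 show "\<Theta> \<star>[M] \<Xi> \<in> hom (C2 M) (Dom (C2 M) \<Theta> *[C1 M] Dom (C2 M) \<Xi>) (Cod (C2 M) \<Theta> *[C1 M] Cod (C2 M) \<Xi>)"
  by (rule homI[OF conjunct1[OF c(5)[OF h]]]) simp_all
next
 show "locally_faithful M S"
  unfolding locally_faithful_def
 proof (intro conjI ballI impI)
  fix \<sigma> \<tau> assume h: "\<sigma> \<in> Arr (C1 M)" "\<tau> \<in> Arr (C1 M)" "Dom (C1 M) \<sigma> = Dom (C1 M) \<tau>" "Cod (C1 M) \<sigma> = Cod (C1 M) \<tau>" "F1 S \<sigma> = F1 S \<tau>"
  then have "at_ends (N (TSrc \<sigma>)) (N (TTgt \<sigma>)) \<sigma> = at_ends (N (TSrc \<tau>)) (N (TTgt \<tau>)) \<tau>" using F1_S(2)[OF h(1)] F1_S(2)[OF h(2)] by simp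
  then show "\<sigma> = \<tau>" using h(3,4) by (intro ptrans.equality) (simp_all add: at_ends_def)
 next
  fix \<Xi> \<Theta> assume h: "\<Xi> \<in> Arr (C2 M)" "\<Theta> \<in> Arr (C2 M)" "Dom (C2 M) \<Xi> = Dom (C2 M) \<Theta>" "Cod (C2 M) \<Xi> = Cod (C2 M) \<Theta>" "F2 S \<Xi> = F2 S \<Theta>"
  then have "MO (F2 U (F2 S \<Xi>)) = MO (F2 U (F2 S \<Theta>))" by simp
  then show "\<Xi> = \<Theta>" unfolding F2_S(2)[OF h(1)] F2_S(2)[OF h(2)] using h(3,4) by (intro pmod.equality) simp_all
 qed
qed (simp_all add: lax_modification_sides[of B])

lemma two_functor_U: "two_functor K M U"
proof (rule two_functorI[OF two_category_K two_functorD(1)[OF two_functor_S]])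
 note cells = BI_IND_cells[OF B] double_modification_sides and p = UU_preserves[OF B, simplified]
 have left: "is_left_adjoint (ALeft (DH \<Omega> f))" if "is_bi B \<Omega>" "f \<in> Arr B" for \<Omega> :: "('o, 'm, ('o, 'm, 'a) univ) bi_indexed" and f
  using cells(3)[OF that] unfolding is_left_adjoint_def by blast
 show "preserves_cat (C1 K) (C1 M) (F0 U) (F1 U)"
  by (rule preserves_catI) (simp_all add: hom_def cells left p identity_frame(3)[OF B, simplified])
 show "preserves_cat (C2 K) (C2 M) (F1 U) (F2 U)"
  by (rule preserves_catI) (simp_all add: hom_def cells left p)
 fix \<Xi> \<Theta> assume "\<Xi> \<in> Arr (C2 K)" "\<Theta> \<in> Arr (C2 K)" "src0 K \<Theta> = tgt0 K \<Xi>"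
 then show "F2 U (\<Theta> \<star>[K] \<Xi>) = F2 U \<Theta> \<star>[M] F2 U \<Xi>" using UU_preserves_HComp[OF B, of \<Xi> \<Theta>] by (simp del: BI_IND_simps(13) OPIND_simps)
qed

text \<open>
 The identity of \<open>\<Phi>\<close>, with one end replaced by \<open>N \<Phi>\<close>, is an isomorphism between \<open>\<Phi>\<close> and the image of its
 completion.
\<close>

lemma U_equivalence: "two_equivalence K M U"
proof (rule two_equivalence_criterion[OF two_functor_U locally_faithful_UU[OF B]])
 show "locally_full K M U"
  unfolding locally_full_def
 proof (intro conjI ballI impI)
  fix \<Omega> \<Omega>' g assume h: "\<Omega> \<in> Obj (C1 K)" "\<Omega>' \<in> Obj (C1 K)" "g \<in> hom (C1 M) (F0 U \<Omega>) (F0 U \<Omega>')"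
  then have g: "lax_transformation B g" "TSrc g = F0 U \<Omega>" "TTgt g = F0 U \<Omega>'" by (simp_all add: hom_def)
  have "is_bi1 B (lift1 B \<Omega> \<Omega>' g)" "F1 U (lift1 B \<Omega> \<Omega>' g) = at_ends (F0 U \<Omega>) (F0 U \<Omega>') g"
   using UU_lift1[OF B _ _ g(1), of \<Omega> \<Omega>'] h g by simp_all
  then show "\<exists>\<tau>\<in>hom (C1 K) \<Omega> \<Omega>'. F1 U \<tau> = g"
   using g by (intro bexI[of _ "lift1 B \<Omega> \<Omega>' g"]) (simp_all add: hom_def lift1_def)
 next
  fix \<sigma> \<tau> \<Gamma> assume h: "\<sigma> \<in> Arr (C1 K)" "\<tau> \<in> Arr (C1 K)" "Dom (C1 K) \<sigma> = Dom (C1 K) \<tau>" "Cod (C1 K) \<sigma> = Cod (C1 K) \<tau>" "\<Gamma> \<in> hom (C2 M) (F1 U \<sigma>) (F1 U \<tau>)"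
  have \<Gamma>: "lax_modification B \<Gamma>" "MSrc \<Gamma> = F1 U \<sigma>" "MTgt \<Gamma> = F1 U \<tau>" using h(5) by (simp_all add: hom_def)
  have "is_bi2 B (lift2 B \<sigma> \<tau> \<Gamma>)" "F2 U (lift2 B \<sigma> \<tau> \<Gamma>) = at_ends2 (F0 U (VSrc \<sigma>)) (F0 U (VTgt \<sigma>)) \<Gamma>"
   using UU_lift2[OF B _ _ _ _ \<Gamma>(1), of \<sigma> \<tau>] h \<Gamma> by simp_all
  moreover have "at_ends2 (F0 U (VSrc \<sigma>)) (F0 U (VTgt \<sigma>)) \<Gamma> = \<Gamma>" using \<Gamma> h by (intro pmod.equality) simp_all
  ultimately show "\<exists>\<Xi>\<in>hom (C2 K) \<sigma> \<tau>. F2 U \<Xi> = \<Gamma>" by (intro bexI[of _ "lift2 B \<sigma> \<tau> \<Gamma>"]) (simp_all add: hom_def lift2_def)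
 qed
 fix \<Phi> assume \<Phi>: "\<Phi> \<in> Obj (C1 M)"
 note p = F0_S[OF \<Phi>]
 have N: "N \<Phi> \<in> Obj (C1 M)" using two_functor1(1)[OF two_functor_U, of "F0 S \<Phi>"] p(1) by simp
 let ?I = "\<lambda>\<Phi>\<^sub>1 \<Phi>\<^sub>2. at_ends \<Phi>\<^sub>1 \<Phi>\<^sub>2 (lax_id B \<Phi>)"
 have id: "lax_transformation B (lax_id B \<Phi>)" using completion_closed(1)[OF \<Phi>] by simp
 have I: "?I \<Phi>\<^sub>1 \<Phi>\<^sub>2 \<in> Arr (C1 M)" if "\<Phi>\<^sub>1 \<in> {\<Phi>, N \<Phi>}" "\<Phi>\<^sub>2 \<in> {\<Phi>, N \<Phi>}" for \<Phi>\<^sub>1 \<Phi>\<^sub>2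
  using lax_transformation_agree[OF B _ _ id, of \<Phi>\<^sub>1 \<Phi>\<^sub>2] that agree_sym[OF p(2)] \<Phi> N by (auto simp del: left_OPIND_simps(1))
 have "lax_comp B (lax_id B \<Phi>) (lax_id B \<Phi>) = lax_id B \<Phi>"
  using category_Id_left[OF two_category_cats(1)[OF two_functorD(2)[OF two_functor_U]], of "lax_id B \<Phi>" \<Phi>] id \<Phi> by simp
 then have II: "lax_comp B (?I \<Phi>\<^sub>2 \<Phi>\<^sub>3) (?I \<Phi>\<^sub>1 \<Phi>\<^sub>2') = ?I \<Phi>\<^sub>1 \<Phi>\<^sub>3" for \<Phi>\<^sub>1 \<Phi>\<^sub>2 \<Phi>\<^sub>2' \<Phi>\<^sub>3
  by (simp add: lax_comp_def at_ends_def lax_id_def)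
 have "lax_id B (N \<Phi>) = ?I (N \<Phi>) (N \<Phi>)" unfolding lax_id_def at_ends_def using agreeD[OF p(2)] by (auto intro!: restrict_ext)
 then have "inverse_arrows (C1 M) (?I (N \<Phi>) \<Phi>) (?I \<Phi> (N \<Phi>))"
  by (intro inverse_arrowsI) (simp_all add: II I del: left_OPIND_simps(1,2))
 then show "\<exists>\<Omega>\<in>Obj (C1 K). \<exists>i\<in>hom (C1 M) (F0 U \<Omega>) \<Phi>. iso_arrow (C1 M) i"
  using p(1) I[of "N \<Phi>" \<Phi>] by (intro bexI[of _ "F0 S \<Phi>"] bexI[of _ "?I (N \<Phi>) \<Phi>"] homI) (auto simp: iso_arrow_def simp del: left_OPIND_simps(1,2))
qed

end

section \<open>The op-construction\<close>

definition gop1 where "gop1 B \<tau> = fst (snd (F1 (Groth_op B) \<tau>))"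
definition gop2 where "gop2 B \<Xi> = fst (snd (F2 (Groth_op B) \<Xi>))"

lemma Groth_op_simps [simp]:
 "F0 (Groth_op B) \<Phi> = total_proj B (total_cat_op B \<Phi>)"
 "F1 (Groth_op B) \<tau> = (total_proj B (total_cat_op B (TSrc \<tau>)), gop1 B \<tau>, total_proj B (total_cat_op B (TTgt \<tau>)))"
 "F2 (Groth_op B) \<Xi> = (total_proj B (total_cat_op B (TSrc (MSrc \<Xi>))), gop2 B \<Xi>, total_proj B (total_cat_op B (TTgt (MSrc \<Xi>))))"
 by (simp_all add: gop1_def gop2_def Groth_op_def Let_def)

lemma total_cat_op_simps [simp]:
 "GO b e \<in> Obj (total_cat_op B \<Phi>) \<longleftrightarrow> b \<in> Obj B \<and> e \<in> Obj (PO \<Phi> b)"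
 "GA d f h e \<in> Arr (total_cat_op B \<Phi>) \<longleftrightarrow> f \<in> Arr B \<and> d \<in> Obj (PO \<Phi> (Dom B f)) \<and> e \<in> Obj (PO \<Phi> (Cod B f)) \<and>
   h \<in> Arr (PO \<Phi> (Cod B f)) \<and> Dom (PO \<Phi> (Cod B f)) h = FO (PM \<Phi> f) d \<and> Cod (PO \<Phi> (Cod B f)) h = e"
 "Dom (total_cat_op B \<Phi>) (GA d f h e) = GO (Dom B f) d" "Cod (total_cat_op B \<Phi>) (GA d f h e) = GO (Cod B f) e"
 "Id (total_cat_op B \<Phi>) (GO b e) = GA e (Id B b) (inv_arrow (PO \<Phi> b) (NMap (Pdelta \<Phi> b) e)) e"
 "GA e' g k w *[total_cat_op B \<Phi>] GA d f h e = GA d (g *[B] f)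
   (k *[PO \<Phi> (Cod B g)] (FM (PM \<Phi> g) h *[PO \<Phi> (Cod B g)] inv_arrow (PO \<Phi> (Cod B g)) (NMap (Pgamma \<Phi> g f) d))) w"
 by (auto simp: total_cat_op_def Let_def hom_def)

lemma total_cat_op_ObjE:
 assumes "x \<in> Obj (total_cat_op B \<Phi>)"
 obtains b e where "x = GO b e" "b \<in> Obj B" "e \<in> Obj (PO \<Phi> b)"
 using assms by (auto simp: total_cat_op_def)

lemma total_cat_op_ArrE:
 assumes "x \<in> Arr (total_cat_op B \<Phi>)"
 obtains d f h e where "x = GA d f h e" "f \<in> Arr B" "d \<in> Obj (PO \<Phi> (Dom B f))" "e \<in> Obj (PO \<Phi> (Cod B f))"
  "h \<in> Arr (PO \<Phi> (Cod B f))" "Dom (PO \<Phi> (Cod B f)) h = FO (PM \<Phi> f) d" "Cod (PO \<Phi> (Cod B f)) h = e"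
 using assms by (auto simp: total_cat_op_def hom_def)

lemma gop1_simps [simp]:
 "FDom (gop1 B \<tau>) = total_cat_op B (TSrc \<tau>)" "FCod (gop1 B \<tau>) = total_cat_op B (TTgt \<tau>)"
 "b \<in> Obj B ==> e \<in> Obj (PO (TSrc \<tau>) b) ==> FO (gop1 B \<tau>) (GO b e) = GO b (FO (TO \<tau> b) e)"
 "GA d f h e \<in> Arr (total_cat_op B (TSrc \<tau>)) ==> FM (gop1 B \<tau>) (GA d f h e) = GA (FO (TO \<tau> (Dom B f)) d) f
   (FM (TO \<tau> (Cod B f)) h *[PO (TTgt \<tau>) (Cod B f)] NMap (TM \<tau> f) d) (FO (TO \<tau> (Cod B f)) e)"
 "FO (gop1 B \<tau>) \<in> extensional (Obj (total_cat_op B (TSrc \<tau>)))" "FM (gop1 B \<tau>) \<in> extensional (Arr (total_cat_op B (TSrc \<tau>)))"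
 by (simp_all add: gop1_def Groth_op_def Let_def)

lemma gop2_simps [simp]:
 "NSrc (gop2 B \<Xi>) = gop1 B (MSrc \<Xi>)" "NTgt (gop2 B \<Xi>) = gop1 B (MTgt \<Xi>)"
 "NMap (gop2 B \<Xi>) \<in> extensional (Obj (total_cat_op B (TSrc (MSrc \<Xi>))))"
 "b \<in> Obj B ==> e \<in> Obj (PO (TSrc (MSrc \<Xi>)) b) ==> NMap (gop2 B \<Xi>) (GO b e) = GA (FO (TO (MSrc \<Xi>) b) e) (Id B b)
   (NMap (MO \<Xi> b) e *[PO (TTgt (MSrc \<Xi>)) b] inv_arrow (PO (TTgt (MSrc \<Xi>)) b) (NMap (Pdelta (TTgt (MSrc \<Xi>)) b) (FO (TO (MSrc \<Xi>) b) e)))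
   (FO (TO (MTgt \<Xi>) b) e)"
 by (simp_all add: gop1_def gop2_def Groth_op_def Let_def)

text \<open>
 Agreement instead of equality of \<open>\<Phi>\<close> with \<open>U(\<Omega>)\<close> covers two cases at once: \<open>\<Phi> = U(\<Omega>)\<close>, which gives the
 2-natural isomorphism of the theorem, and an arbitrary \<open>\<Phi>\<close> with its completion, from which the
 op-construction acquires its functoriality.
\<close>

locale left_members = bi_frame_loc B \<Omega> for B :: "('o, 'm) cat" and \<Omega> :: "('o, 'm, ('o, 'm, 'a) univ) bi_indexed" +
 fixes \<Phi> :: "('o, 'm, ('o, 'm, 'a) univ) psftor"
 assumes pseudo: "is_bi B \<Omega>" and agree: "agree B (F0 (UU B) \<Omega>) \<Phi>"
begin

lemma bi: "bi_iso B \<Omega>" "bi_coherent B \<Omega>"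
 using pseudo pseudo_double_functor_iff[OF frame(1)] by blast+

sublocale V: indexed B "F0 (VV B) \<Omega>"
 by unfold_locales (use pseudo_functor_VV bi in simp_all)

lemma members [simp]:
 "b \<in> Obj B ==> PO \<Phi> b = DO \<Omega> b" "f \<in> Arr B ==> PM \<Phi> f = ALeft (DH \<Omega> f)"
 "b \<in> Obj B ==> e \<in> Obj (DO \<Omega> b) ==> inv_arrow (DO \<Omega> b) (NMap (Pdelta \<Phi> b) e) = NMap (SXi (Ddelta \<Omega> b)) e"
 "f \<in> Arr B ==> g \<in> Arr B ==> Dom B g = Cod B f ==> e \<in> Obj (DO \<Omega> (Dom B f)) ==>
  inv_arrow (DO \<Omega> (Cod B g)) (NMap (Pgamma \<Phi> g f) e) = NMap (SXi (Dgamma \<Omega> f g)) e"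
 using agreeD[OF agree_sym[OF agree]] iso_members[OF bi(1)] by (simp_all add: inv_arrow_inv_arrow)

lemma transpose_type [simp]:
 assumes "f \<in> Arr B" "d \<in> Obj (DO \<Omega> (Dom B f))" "h \<in> Arr (DO \<Omega> (Cod B f))" "Dom (DO \<Omega> (Cod B f)) h = FO (ALeft (DH \<Omega> f)) d"
 shows "adj_transpose (DH \<Omega> f) d h \<in> Arr (DO \<Omega> (Dom B f))" "Dom (DO \<Omega> (Dom B f)) (adj_transpose (DH \<Omega> f) d h) = d"
  "Cod (DO \<Omega> (Dom B f)) (adj_transpose (DH \<Omega> f) d h) = FO (ARight (DH \<Omega> f)) (Cod (DO \<Omega> (Cod B f)) h)"
 using adj_transpose_simps[of "DH \<Omega> f" d h] assms by simp_all

abbreviation "E \<equiv> total_cat B (F0 (VV B) \<Omega>)"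
abbreviation "E' \<equiv> total_cat_op B \<Phi>"

definition transposition where
 "transposition = \<lparr>FDom = E', FCod = E, FO = (\<lambda>x\<in>Obj E'. x),
   FM = (\<lambda>x\<in>Arr E'. GA (ar_src x) (ar_base x) (adj_transpose (DH \<Omega> (ar_base x)) (ar_src x) (ar_fibre x)) (ar_tgt x))\<rparr>"

lemma transposition_simps [simp]:
 "FDom transposition = E'" "FCod transposition = E" "x \<in> Obj E' ==> FO transposition x = x"
 "GA d f h e \<in> Arr E' ==> FM transposition (GA d f h e) = GA d f (adj_transpose (DH \<Omega> f) d h) e"
 by (simp_all add: transposition_def del: total_cat_op_simps(2))

lemma E'_ArrE:
 assumes "x \<in> Arr E'"
 obtains d f h e where "x = GA d f h e" "f \<in> Arr B" "d \<in> Obj (DO \<Omega> (Dom B f))" "e \<in> Obj (DO \<Omega> (Cod B f))"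
  "h \<in> Arr (DO \<Omega> (Cod B f))" "Dom (DO \<Omega> (Cod B f)) h = FO (ALeft (DH \<Omega> f)) d" "Cod (DO \<Omega> (Cod B f)) h = e"
 using total_cat_op_ArrE[OF assms] that by (smt (verit) category_Arr frame(1) members(1,2))

lemma closed_E': "closed_graph E'"
proof (rule closed_graphI)
 fix x y assume "x \<in> Arr E'" "y \<in> Arr E'" and c: "Dom E' y = Cod E' x"
 then obtain d f h e e' g k w where e: "x = GA d f h e" "y = GA e' g k w" and [simp]: "f \<in> Arr B" "d \<in> Obj (DO \<Omega> (Dom B f))"
  "h \<in> Arr (DO \<Omega> (Cod B f))" "Dom (DO \<Omega> (Cod B f)) h = FO (ALeft (DH \<Omega> f)) d" and g [simp]: "g \<in> Arr B"
  "k \<in> Arr (DO \<Omega> (Cod B g))" "Dom (DO \<Omega> (Cod B g)) k = FO (ALeft (DH \<Omega> g)) e'" and h: "Cod (DO \<Omega> (Cod B f)) h = e" "Cod (DO \<Omega> (Cod B g)) k = w"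
  by (elim E'_ArrE) blast
 have [simp]: "e' = e" "Dom B g = Cod B f" "w \<in> Obj (DO \<Omega> (Cod B g))" using c h unfolding e by auto
 show "y *[E'] x \<in> hom E' (Dom E' x) (Cod E' y)" unfolding e by (simp add: hom_def h)
qed (auto elim!: E'_ArrE total_cat_op_ObjE simp: hom_def)

text \<open>
 The composite of \<open>(f, h)\<close> and \<open>(g, k)\<close> contains the left adjoint member of the comparison cell at \<open>f\<close> and
 \<open>g\<close>. By the mate condition it is transposed into the right adjoint member after the transpose along
 the composite adjunction, which is computed in two steps. Identities are treated with \<open>\<delta>\<close>.
\<close>

lemma transposition_preserves: "preserves_cat E' E (FO transposition) (FM transposition)"
proof (rule preserves_catI)
 fix x assume "x \<in> Obj E'"
 then obtain b e where x: "x = GO b e" and [simp]: "b \<in> Obj B" "e \<in> Obj (DO \<Omega> b)" by (auto elim: total_cat_op_ObjE)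
 show "FO transposition x \<in> Obj E" by (simp add: x)
 have "adj_transpose (DH \<Omega> (Id B b)) (FO (ftid (DO \<Omega> b)) e) (NMap (SXi (Ddelta \<Omega> b)) e) = NMap (SZeta (Ddelta \<Omega> b)) e"
  by (subst square_unit[where a = "adj_id (DO \<Omega> b)" and H = "ftid (DO \<Omega> b)" and C = "DO \<Omega> b" and s = "Ddelta \<Omega> b"]) simp_all
 then show "FM transposition (Id E' x) = Id E (FO transposition x)" by (simp add: x)
next
 fix x assume "x \<in> Arr E'"
 then obtain d f h e where x: "x = GA d f h e" and [simp]: "f \<in> Arr B" "d \<in> Obj (DO \<Omega> (Dom B f))" "e \<in> Obj (DO \<Omega> (Cod B f))"
  "h \<in> Arr (DO \<Omega> (Cod B f))" "Dom (DO \<Omega> (Cod B f)) h = FO (ALeft (DH \<Omega> f)) d" "Cod (DO \<Omega> (Cod B f)) h = e"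
  by (elim E'_ArrE) blast
 show "FM transposition x \<in> hom E (FO transposition (Dom E' x)) (FO transposition (Cod E' x))" by (simp add: x hom_def)
 fix y assume "y \<in> Arr E'" and c: "Dom E' y = Cod E' x"
 then obtain e' g k w where y: "y = GA e' g k w" and [simp]: "g \<in> Arr B" "w \<in> Obj (DO \<Omega> (Cod B g))"
  "k \<in> Arr (DO \<Omega> (Cod B g))" and k: "Dom (DO \<Omega> (Cod B g)) k = FO (ALeft (DH \<Omega> g)) e'" and w [simp]: "Cod (DO \<Omega> (Cod B g)) k = w"
  by (elim E'_ArrE) blast
 have [simp]: "e' = e" "Dom B g = Cod B f" using c unfolding x y by auto
 note [simp] = k[simplified]
 let ?u = "k *[DO \<Omega> (Cod B g)] FM (ALeft (DH \<Omega> g)) h"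
 have "adj_transpose (DH \<Omega> g) (FO (ALeft (DH \<Omega> f)) d) ?u = adj_transpose (DH \<Omega> g) e k *[DO \<Omega> (Cod B f)] h"
  using adj_transpose_Comp_right[of "DH \<Omega> g" h k] by simp
 then have u: "adj_transpose (adj_comp (DH \<Omega> g) (DH \<Omega> f)) d ?u =
   FM (ARight (DH \<Omega> f)) (adj_transpose (DH \<Omega> g) e k) *[DO \<Omega> (Dom B f)] adj_transpose (DH \<Omega> f) d h"
  using adj_transpose_Comp_left[of "DH \<Omega> f" d h "adj_transpose (DH \<Omega> g) e k"] by (simp add: adj_transpose_adj_comp)
 have "adj_transpose (DH \<Omega> (g *[B] f)) d (?u *[DO \<Omega> (Cod B g)] NMap (SXi (Dgamma \<Omega> f g)) d) =
  NMap (SZeta (Dgamma \<Omega> f g)) w *[DO \<Omega> (Dom B f)] adj_transpose (adj_comp (DH \<Omega> g) (DH \<Omega> f)) d ?u"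
  using mates_transpose[of "Dgamma \<Omega> f g" d ?u w] adj_transpose_simps[of "adj_comp (DH \<Omega> g) (DH \<Omega> f)" d ?u] by simp
 then show "FM transposition (y *[E'] x) = FM transposition y *[E] FM transposition x"
  unfolding u by (simp add: x y)
qed

lemma transposition_inj:
 assumes "FM transposition x = FM transposition y" "x \<in> Arr E'" "y \<in> Arr E'"
 shows "x = y"
proof -
 obtain d f h e where x: "x = GA d f h e" and [simp]: "f \<in> Arr B" "d \<in> Obj (DO \<Omega> (Dom B f))" "e \<in> Obj (DO \<Omega> (Cod B f))"
  "h \<in> Arr (DO \<Omega> (Cod B f))" "Dom (DO \<Omega> (Cod B f)) h = FO (ALeft (DH \<Omega> f)) d" "Cod (DO \<Omega> (Cod B f)) h = e"
  using assms(2) by (elim E'_ArrE) blast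
 obtain d' f' k e' where y: "y = GA d' f' k e'" and k: "f' \<in> Arr B" "d' \<in> Obj (DO \<Omega> (Dom B f'))" "e' \<in> Obj (DO \<Omega> (Cod B f'))"
  "k \<in> Arr (DO \<Omega> (Cod B f'))" "Dom (DO \<Omega> (Cod B f')) k = FO (ALeft (DH \<Omega> f')) d'" "Cod (DO \<Omega> (Cod B f')) k = e'"
  using assms(3) by (elim E'_ArrE) blast
 have [simp]: "d' = d" "f' = f" "e' = e" and eq: "adj_transpose (DH \<Omega> f) d h = adj_transpose (DH \<Omega> f) d k"
  using assms(1) k unfolding x y by auto
 have "h = k" by (rule adj_transpose_inject[OF eq]) (use k in simp_all)
 then show ?thesis by (simp add: x y)
qed

text \<open>
 The op-construction needs no separate verification of associativity: it is mapped injectively into the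
 total category.
\<close>

lemma category_E': "category E'"
 by (rule category_reflect[OF closed_E' V.category_total transposition_preserves]) (rule transposition_inj)

lemma functor_transposition [simp]: "is_functor transposition"
 unfolding is_functor_def transposition_simps using category_E' V.category_total transposition_preserves by (simp add: transposition_def)

lemma object_over_E': "object_over B (total_proj B E')"
 unfolding object_over_def
 by (intro conjI is_functorI) (auto simp: category_E' total_proj_def hom_def elim!: E'_ArrE total_cat_op_ObjE)

abbreviation "over \<equiv> (total_proj B E', transposition, total_proj B E)"

lemma functor_over_transposition: "functor_over B over"
 by (rule functor_overI[OF object_over_E' V.object_over_total_proj]) (auto elim!: E'_ArrE total_cat_op_ObjE)

lemma bifibration_E: "bifibration (total_proj B E)"
proof -
 have "is_right_adjoint (ARight (DH \<Omega> f))" if "f \<in> Arr B" for f using frame(4)[OF that] unfolding is_right_adjoint_def by blast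
 then show ?thesis using V.bifibration_total_iff by simp
qed

lemma transposition_iso:
 obtains K where "functor_over B (total_proj B E, K, total_proj B E')" "ftcomp K transposition = ftid E'"
  "inverse_arrows (C1 (BIFIB B)) over (total_proj B E, K, total_proj B E')" "bifibration (total_proj B E')"
proof -
 have "FO transposition ` Obj E' = Obj E"
  by (auto elim!: total_cat_op_ObjE total_cat_ObjE intro!: image_eqI[of "GO b e" for b e])
 then have 1: "bij_betw (FO transposition) (Obj E') (Obj E)" by (auto simp: bij_betw_def inj_on_def)
 have "x \<in> FM transposition ` Arr E'" if xE: "x \<in> Arr E" for x
 proof -
  obtain d f h e where x: "x = GA d f h e" and h: "f \<in> Arr B" "d \<in> Obj (DO \<Omega> (Dom B f))" "e \<in> Obj (DO \<Omega> (Cod B f))"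
   "h \<in> Arr (DO \<Omega> (Dom B f))" "Dom (DO \<Omega> (Dom B f)) h = d" "Cod (DO \<Omega> (Dom B f)) h = FO (ARight (DH \<Omega> f)) e"
   using xE by (elim total_cat_ArrE) simp
  note c = adj_cotranspose_simps[of "DH \<Omega> f" e h] transpose_cotranspose[of "DH \<Omega> f" e h]
  show ?thesis
   by (rule image_eqI[of _ _ "GA d f (adj_cotranspose (DH \<Omega> f) e h) e"]) (use h c in "simp_all add: x")
 qed
 moreover have "FM transposition ` Arr E' \<subseteq> Arr E" using functor_simps[OF functor_transposition] by auto
 ultimately have 2: "bij_betw (FM transposition) (Arr E') (Arr E)"
  using transposition_inj unfolding bij_betw_def inj_on_def by blast
 obtain K where K: "functor_over B (total_proj B E, K, total_proj B E')" "ftcomp K transposition = ftid E'" "ftcomp transposition K = ftid E"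
   "inverse_arrows (C1 (CAT_over B)) over (total_proj B E, K, total_proj B E')"
  using functor_over_iso[OF functor_over_transposition] 1 2 by auto
 have bif: "bifibration (total_proj B E')"
  by (rule bifibration_transfer[OF functor_over_transposition K(1)]) (simp_all add: K bifibration_E)
 then have "inverse_arrows (C1 (BIFIB B)) over (total_proj B E, K, total_proj B E')"
  using inverse_arrowsD[OF K(4)] bifibration_E unfolding BIFIB_def by (intro inverse_arrowsI) simp_all
 then show thesis using K(1,2) bif that by blast
qed

definition inverse where
 "inverse = (SOME K. functor_over B (total_proj B E, K, total_proj B E') \<and> ftcomp K transposition = ftid E' \<and>
  inverse_arrows (C1 (BIFIB B)) over (total_proj B E, K, total_proj B E') \<and> bifibration (total_proj B E'))"

lemma inverse: "functor_over B (total_proj B E, inverse, total_proj B E')" "ftcomp inverse transposition = ftid E'"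
  "inverse_arrows (C1 (BIFIB B)) over (total_proj B E, inverse, total_proj B E')" "bifibration (total_proj B E')"
 using someI_ex[of "\<lambda>K. functor_over B (total_proj B E, K, total_proj B E') \<and> ftcomp K transposition = ftid E' \<and>
  inverse_arrows (C1 (BIFIB B)) over (total_proj B E, K, total_proj B E') \<and> bifibration (total_proj B E')"] transposition_iso
 unfolding inverse_def by blast+

lemma inverse_simps [simp]:
 "is_functor inverse" "FDom inverse = E" "FCod inverse = E'"
 "x \<in> Obj E' ==> FO inverse x = x" "x \<in> Arr E' ==> FM inverse (FM transposition x) = x"
 using functor_overD(3-5)[OF inverse(1)] ftcomp_simps(3)[of x transposition inverse] ftcomp_simps(4)[of x transposition inverse]
 unfolding inverse(2) by simp_all

end

text \<open>
 Naturality of transposition with respect to a transformation is the mate condition for its cells.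
\<close>

lemma gop1_conjugate:
 fixes \<tau> :: "('o, 'm, ('o, 'm, 'a) univ) ptrans"
 assumes S: "left_members B \<Omega> \<Phi>" and T: "left_members B \<Omega>' \<Phi>'"
  and t: "is_bi1 B t" "VSrc t = \<Omega>" "VTgt t = \<Omega>'"
  and \<tau>: "TSrc \<tau> = \<Phi>" "TTgt \<tau> = \<Phi>'" "\<And>b. b \<in> Obj B ==> TO \<tau> b = VO t b" "\<And>f. f \<in> Arr B ==> TM \<tau> f = SXi (VH t f)"
 shows "gop1 B \<tau> = ftcomp (left_members.inverse B \<Omega>' \<Phi>') (ftcomp (groth1 B (F1 (VV B) t)) (left_members.transposition B \<Omega> \<Phi>))"
proof -
 interpret S: left_members B \<Omega> \<Phi> by (rule S)
 interpret T: left_members B \<Omega>' \<Phi>' by (rule T)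
 interpret t: vt_loc B \<Omega> \<Omega>' t by (rule vt_locI[OF S.frame(1) t])
 have o: "is_oplax B (F1 (VV B) t)" using t.oplax_transformation_VV t(1) by blast
 interpret G: oplax_data B "F0 (VV B) \<Omega>" "F0 (VV B) \<Omega>'" "F1 (VV B) t"
  using oplax_dataI[OF S.frame(1) oplax_transformation_frame[OF o]] by (simp only: VV_simps t.vt_ends)
 note [simp] = \<tau>
 let ?G = "groth1 B (F1 (VV B) t)"
 have G [simp]: "is_functor ?G" "FDom ?G = S.E" "FCod ?G = T.E" using functor_overD(3-5)[OF G.functor_over_groth1[OF o]] by simp_all
 have "FM (gop1 B \<tau>) x = FM T.inverse (FM ?G (FM S.transposition x))" if xE: "x \<in> Arr S.E'" for x
 proof -
  obtain d f h e where x: "x = GA d f h e" and [simp]: "f \<in> Arr B" "d \<in> Obj (DO \<Omega> (Dom B f))" "e \<in> Obj (DO \<Omega> (Cod B f))"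
   "h \<in> Arr (DO \<Omega> (Cod B f))" "Dom (DO \<Omega> (Cod B f)) h = FO (ALeft (DH \<Omega> f)) d" "Cod (DO \<Omega> (Cod B f)) h = e"
   using xE by (elim S.E'_ArrE) blast
  have "adj_transpose (DH \<Omega>' f) (FO (VO t (Dom B f)) d) (FM (VO t (Cod B f)) h *[DO \<Omega>' (Cod B f)] NMap (SXi (VH t f)) d) =
   NMap (SZeta (VH t f)) e *[DO \<Omega>' (Dom B f)] FM (VO t (Dom B f)) (adj_transpose (DH \<Omega> f) d h)"
   using mates_transpose[of "VH t f" d h e] by simp
  then have "FM T.transposition (FM (gop1 B \<tau>) x) = FM ?G (FM S.transposition x)" by (simp add: x)
  moreover have "FM (gop1 B \<tau>) x \<in> Arr T.E'" by (simp add: x)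
  ultimately show ?thesis using T.inverse_simps(5) by metis
 qed
 moreover have "FO (gop1 B \<tau>) x = FO T.inverse (FO ?G (FO S.transposition x))" if "x \<in> Obj S.E'" for x
  using that by (auto elim!: total_cat_op_ObjE)
 ultimately show ?thesis
  by (intro ftor.equality extensionalityI[of _ "Obj S.E'"] extensionalityI[of _ "Arr S.E'"])
   (use gop1_simps(5,6)[of B \<tau>] in "simp_all add: ftcomp_def compose_def")
qed

lemma gop2_conjugate:
 fixes \<Xi> :: "('o, 'm, ('o, 'm, 'a) univ) pmod"
 assumes S: "left_members B \<Omega> \<Phi>" and T: "left_members B \<Omega>' \<Phi>'"
  and m: "is_bi2 B m" "VSrc (VMSrc m) = \<Omega>" "VTgt (VMSrc m) = \<Omega>'"
  and \<Xi>: "TSrc (MSrc \<Xi>) = \<Phi>" "TTgt (MSrc \<Xi>) = \<Phi>'" "\<And>b. b \<in> Obj B ==> TO (MSrc \<Xi>) b = VO (VMSrc m) b"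
   "\<And>b. b \<in> Obj B ==> TO (MTgt \<Xi>) b = VO (VMTgt m) b" "\<And>b. b \<in> Obj B ==> MO \<Xi> b = SXi (VMC m b)"
  and c: "gop1 B (MSrc \<Xi>) = ftcomp (left_members.inverse B \<Omega>' \<Phi>') (ftcomp (groth1 B (F1 (VV B) (VMSrc m))) (left_members.transposition B \<Omega> \<Phi>))"
   "gop1 B (MTgt \<Xi>) = ftcomp (left_members.inverse B \<Omega>' \<Phi>') (ftcomp (groth1 B (F1 (VV B) (VMTgt m))) (left_members.transposition B \<Omega> \<Phi>))"
 shows "gop2 B \<Xi> = hcomp (nid (left_members.inverse B \<Omega>' \<Phi>')) (hcomp (groth2 B (F2 (VV B) m)) (nid (left_members.transposition B \<Omega> \<Phi>)))"
proof -
 interpret S: left_members B \<Omega> \<Phi> by (rule S)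
 interpret T: left_members B \<Omega>' \<Phi>' by (rule T)
 obtain s t where e: "VMSrc m = s" "VMTgt m = t" by blast
 interpret m: vm_loc B \<Omega> \<Omega>' s t m by (rule vm_locI[OF S.frame(1) m e])
 note [simp] = \<Xi>[unfolded e]
 let ?G = "groth2 B (F2 (VV B) m)"
 have o: "is_oplax2 B (F2 (VV B) m)" using m.oplax_modification_VV m(1) by blast
 have "transformation_over B (total_proj B S.E, ?G, total_proj B T.E)"
  using oplax_modificationD(5)[OF S.frame(1) o] by (simp add: e)
 then have G [simp]: "is_nt ?G" "FDom (groth1 B (F1 (VV B) s)) = S.E" "FCod (groth1 B (F1 (VV B) s)) = T.E" "is_functor (groth1 B (F1 (VV B) s))" "is_functor (groth1 B (F1 (VV B) t))"
  using transformation_overD(1-3) functor_overD(3) by (fastforce simp: e)+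
 let ?H = "hcomp (nid T.inverse) (hcomp ?G (nid S.transposition))"
 have "NMap (gop2 B \<Xi>) x = NMap ?H x" if xE: "x \<in> Obj S.E'" for x
 proof -
  obtain b e where x: "x = GO b e" and [simp]: "b \<in> Obj B" "e \<in> Obj (DO \<Omega> b)" using xE by (auto elim: total_cat_op_ObjE)
  let ?m = "NMap (SZeta (VMC m b)) e"
  have "adj_transpose (DH \<Omega>' (Id B b)) (FO (VO s b) e) (?m *[DO \<Omega>' b] NMap (SXi (Ddelta \<Omega>' b)) (FO (VO s b) e)) =
   NMap (SZeta (Ddelta \<Omega>' b)) (FO (VO t b) e) *[DO \<Omega>' b] ?m"
   using mates_transpose[of "Ddelta \<Omega>' b" "FO (VO s b) e" ?m "FO (VO t b) e"] by (simp add: adj_transpose_adj_id)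
  then have "FM T.transposition (NMap (gop2 B \<Xi>) x) = NMap ?G x"
   by (simp add: x groth2_vertical vertical_def)
  moreover have "NMap (gop2 B \<Xi>) x \<in> Arr T.E'" by (simp add: x)
  ultimately have "NMap (gop2 B \<Xi>) x = FM T.inverse (NMap ?G x)" using T.inverse_simps(5) by metis
  moreover have "x \<in> Obj S.E" by (simp add: x)
  then have "NMap ?H x = FM T.inverse (NMap ?G x)" using xE by (simp add: T.V.category_total T.category_E')
  ultimately show ?thesis by simp
 qed
 then show ?thesis
  by (intro nt.equality extensionalityI[of _ "Obj S.E'"])
   (use gop2_simps(3)[of B \<Xi>] nt_extensional[of ?H] in "simp_all add: c[unfolded e]")
qed

lemma BIFIB_simps [simp]:
 "Comp (C1 (BIFIB B)) = Comp (C1 (CAT_over B))" "Dom (C1 (BIFIB B)) = Dom (C1 (CAT_over B))" "Cod (C1 (BIFIB B)) = Cod (C1 (CAT_over B))"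
 "HComp (BIFIB B) = HComp (CAT_over B)" "Id (C2 (BIFIB B)) = Id (C2 (CAT_over B))"
 by (simp_all add: BIFIB_def)

text \<open>
 The op-construction after \<open>R\<close> is the conjugate, by the transposition isomorphisms, of a composite of
 2-functors. This proves at the same time that it is a 2-functor.
\<close>

lemma Groth_op_conjugate:
 fixes B :: "('o, 'm) cat" and T :: "(_, _, _, ('o, 'm, ('o, 'm, 'a) univ) bi_indexed, _, _) two_ftor"
 assumes B: "category B" and T: "two_functor M (BI_IND B) T"
  and R0: "\<And>x. x \<in> Obj (C1 M) ==> agree B (F0 (UU B) (F0 T x)) (F0 R x)"
  and R1: "\<And>f. f \<in> Arr (C1 M) ==> TSrc (F1 R f) = F0 R (Dom (C1 M) f) \<and> TTgt (F1 R f) = F0 R (Cod (C1 M) f)"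
   "\<And>f b. f \<in> Arr (C1 M) ==> b \<in> Obj B ==> TO (F1 R f) b = VO (F1 T f) b"
   "\<And>f k. f \<in> Arr (C1 M) ==> k \<in> Arr B ==> TM (F1 R f) k = SXi (VH (F1 T f) k)"
  and R2: "\<And>u. u \<in> Arr (C2 M) ==> MSrc (F2 R u) = F1 R (Dom (C2 M) u) \<and> MTgt (F2 R u) = F1 R (Cod (C2 M) u)"
   "\<And>u b. u \<in> Arr (C2 M) ==> b \<in> Obj B ==> MO (F2 R u) b = SXi (VMC (F2 T u) b)"
 shows "two_naturally_isomorphic M (BIFIB B) (two_comp (Groth_op B) R) (two_comp (Groth B) (two_comp (VV B) T))"
proof -
 note t = two_functor_simps[OF T, simplified]
 note M = two_functorD(1)[OF T]
 have L: "left_members B (F0 T x) (F0 R x)" if "x \<in> Obj (C1 M)" for x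
  using t(1)[OF that] R0[OF that] pseudo_double_functor_iff[OF B] by unfold_locales blast+
 let ?p = "\<lambda>x. total_proj B (total_cat_op B (F0 R x))" and ?q = "\<lambda>x. total_proj B (total_cat B (F0 (VV B) (F0 T x)))"
 define s where "s x = (?p x, left_members.transposition B (F0 T x) (F0 R x), ?q x)" for x
 define s' where "s' x = (?q x, left_members.inverse B (F0 T x) (F0 R x), ?p x)" for x
 have c1: "gop1 B (F1 R f) = ftcomp (left_members.inverse B (F0 T (Cod (C1 M) f)) (F0 R (Cod (C1 M) f)))
   (ftcomp (groth1 B (F1 (VV B) (F1 T f))) (left_members.transposition B (F0 T (Dom (C1 M) f)) (F0 R (Dom (C1 M) f))))" if f: "f \<in> Arr (C1 M)" for f
  using gop1_conjugate[OF L L t(2)[OF f] t(3)[OF f] t(4)[OF f], of "F1 R f"] category_Arr[OF two_category_cats(1)[OF M] f] R1(1)[OF f] R1(2,3)[OF f] by blast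
 show ?thesis
 proof (rule two_functor_conjugate[where s = s and s' = s'])
  show "two_functor M (BIFIB B) (two_comp (Groth B) (two_comp (VV B) T))"
   by (intro two_functor_comp[OF two_functor_comp[OF T two_functor_VV[OF B]]] two_equivalence_functor[OF Groth_equivalence[OF B]])
  show "inverse_arrows (C1 (BIFIB B)) (s x) (s' x)" if "x \<in> Obj (C1 M)" for x
   unfolding s_def s'_def by (rule left_members.inverse(3)[OF L[OF that]])
  show "s x \<in> hom (C1 (BIFIB B)) (F0 (two_comp (Groth_op B) R) x) (F0 (two_comp (Groth B) (two_comp (VV B) T)) x)" if "x \<in> Obj (C1 M)" for x
   using inverse_arrowsD(1)[OF left_members.inverse(3)[OF L[OF that]]] by (simp add: s_def hom_def two_comp_def)
  show "F1 (two_comp (Groth_op B) R) f = s' (Cod (C1 M) f) *[C1 (BIFIB B)] (F1 (two_comp (Groth B) (two_comp (VV B) T)) f *[C1 (BIFIB B)] s (Dom (C1 M) f))"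
   if f: "f \<in> Arr (C1 M)" for f
   using R1(1)[OF f] c1[OF f] by (simp add: two_comp_def s_def s'_def)
  show "F2 (two_comp (Groth_op B) R) u = Id (C2 (BIFIB B)) (s' (tgt0 M u)) \<star>[BIFIB B] (F2 (two_comp (Groth B) (two_comp (VV B) T)) u \<star>[BIFIB B] Id (C2 (BIFIB B)) (s (src0 M u)))"
   if u: "u \<in> Arr (C2 M)" for u
  proof -
   note a [simp] = u two_category_sides[OF M u] R2(1)[OF u] R1(1)[OF two_category_sides(1)[OF M u]]
   have "gop2 B (F2 R u) = hcomp (nid (left_members.inverse B (F0 T (tgt0 M u)) (F0 R (tgt0 M u))))
    (hcomp (groth2 B (F2 (VV B) (F2 T u))) (nid (left_members.transposition B (F0 T (src0 M u)) (F0 R (src0 M u)))))"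
    by (rule gop2_conjugate[OF L L]) (simp_all add: t R1 R2 c1)
   then show ?thesis by (simp add: two_comp_def s_def s'_def)
  qed
 qed
qed

text \<open>
 Conjugation is applied twice: to the completion, for functoriality of the op-construction, and to \<open>U\<close>,
 for the comparison with the Grothendieck construction after \<open>V\<close>.
\<close>

lemma (in completed) Groth_op_results:
 "two_equivalence M (BIFIB B) (Groth_op B :: ('o, 'm, ('o, 'm, 'a) univ) groth_two_ftor)"
 "two_naturally_isomorphic K (BIFIB B) (two_comp (Groth B :: ('o, 'm, ('o, 'm, 'a) univ) groth_two_ftor) (VV B)) (two_comp (Groth_op B) U)"
proof -
 let ?P = "Groth_op B :: ('o, 'm, ('o, 'm, 'a) univ) groth_two_ftor"
 have "two_naturally_isomorphic M (BIFIB B) (two_comp ?P two_id) (two_comp (Groth B) (two_comp (VV B) S))"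
 proof (rule Groth_op_conjugate[OF B two_functor_S])
  show "agree B (N x) (F0 two_id x)" if "x \<in> Obj (C1 M)" for x using F0_S(2)[OF that] by (simp add: two_id_def)
  fix f assume f: "f \<in> Arr (C1 M)"
  note u = F1_S(2)[OF f]
  show "TO (F1 two_id f) b = VO (F1 S f) b" for b using arg_cong[OF u, of TO] by (simp add: two_id_def)
  show "TM (F1 two_id f) k = SXi (VH (F1 S f) k)" if "k \<in> Arr B" for k using fun_cong[OF arg_cong[OF u, of TM], of k] that by (simp add: two_id_def)
 next
  fix u assume a: "u \<in> Arr (C2 M)"
  show "MO (F2 two_id u) b = SXi (VMC (F2 S u) b)" if "b \<in> Obj B" for b
   using fun_cong[OF arg_cong[OF F2_S(2)[OF a], of MO], of b] that by (simp add: two_id_def)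
 qed (simp_all add: two_id_def)
 then have P: "two_functor M (BIFIB B) ?P" unfolding two_naturally_isomorphic_def by simp
 have "two_naturally_isomorphic K (BIFIB B) (two_comp ?P U) (two_comp (Groth B) (two_comp (VV B) two_id))"
  by (rule Groth_op_conjugate[OF B two_functor_id[OF two_category_K]]) (simp_all add: two_id_def)
 then show *: "two_naturally_isomorphic K (BIFIB B) (two_comp (Groth B :: ('o, 'm, ('o, 'm, 'a) univ) groth_two_ftor) (VV B)) (two_comp ?P U)"
  by (simp add: two_naturally_isomorphic_sym)
 show "two_equivalence M (BIFIB B) ?P"
  by (rule two_equivalence_cancel[OF U_equivalence two_equivalence_comp[OF VV_equivalence[OF B] Groth_equivalence[OF B]] P *])
qed

theorem theorem2p1p37:
 fixes B :: "('o, 'm) cat"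
 assumes "category B"
 shows
  "two_equivalence (BI_IND B) (left_OPIND B)
    (UU B :: ('o, 'm, ('o, 'm, 'a) univ) forget_two_ftor) \<and>
   two_equivalence (BI_IND B) (right_IND B)
    (VV B :: ('o, 'm, ('o, 'm, 'a) univ) forget_two_ftor) \<and>
   two_equivalence (right_IND B) (BIFIB B)
    (Groth B :: ('o, 'm, ('o, 'm, 'a) univ) groth_two_ftor) \<and>
   two_equivalence (left_OPIND B) (BIFIB B)
    (Groth_op B :: ('o, 'm, ('o, 'm, 'a) univ) groth_two_ftor) \<and>
   two_naturally_isomorphic (BI_IND B) (BIFIB B)
    (two_comp (Groth B :: ('o, 'm, ('o, 'm, 'a) univ) groth_two_ftor) (VV B))
    (two_comp (Groth_op B) (UU B))"
proof -
 interpret completed B "TYPE(('o, 'm, 'a) univ)" by unfold_locales (rule assms)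
 show ?thesis
  using U_equivalence VV_equivalence[OF assms] Groth_equivalence[OF assms] Groth_op_results by blast
qed

end
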